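(* Let $1\le p<\infty$. Let $X=\mathbf{R}^2\setminus A$, where $A=\bigcup_{j=1}^\infty(q_j+C)$, $\{q_j\}_{j=1}^\infty$ is an enumeration of $\mathbf{Q}^2$ and $C\subset[0,1]\times[0,1]$ is the four corners Cantor set defined in the context. Also let $\Omega'$ be a nonempty open subset of $\mathbf{R}^2$ and $\Omega=\Omega'\cap X$, all sets being equipped with the Lebesgue measure $\mathcal L^2$. Then the following are true: (a) $A\cap\Omega'$ is isometrically removable for $\widehat N^{1,p}(\Omega)$; (b) $X$ supports a global $1$-Poincaré inequality; (c) $\Omega$ is not $p$-path almost open in $\mathbf{R}^2$.
   Context: The set $C$: let $H_0=[0,1]$ and, for $k=0,1,\ldots$, let $H_{k+1}$ be obtained by removing from the centre of every interval in $H_k$ the open interval of length $2^{-2k-1}$. Then $C=\bigcap_{k=1}^\infty(H_k\times H_k)$. For $Z\subset\mathbf{R}^2$ measurable, regarded as a metric space with Euclidean distance and Lebesgue measure: balls are relative open balls $B(x,r)=\{y\in Z:|x-y|<r\}$, $\lambda B(x,r)=B(x,\lambda r)$. Curves are nonconstant, compact (defined on compact intervals), rectifiable and parameterized by arc length, $\gamma:[0,l_\gamma]\to Z$. The $p$-modulus of a curve family $\Gamma$ is $\inf_\rho\int_Z\rho^p\,d\mathcal L^2$ over all Borel $\rho\ge0$ with $\int_\gamma\rho\,ds\ge1$ for all $\gamma\in\Gamma$; a property holds for $p$-almost every curve if it fails only for a family of zero $p$-modulus. A Borel $g:Z\to[0,\infty]$ is an upper gradient of $u:Z\to[-\infty,\infty]$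 if $|u(\gamma(0))-u(\gamma(l_\gamma))|\le\int_\gamma g\,ds$ for all curves (left-hand side $=\infty$ if at least one of its terms is infinite); a measurable $g$ is a $p$-weak upper gradient if this holds for $p$-almost every curve. The minimal $p$-weak upper gradient $g_{u,Z}$ is the a.e. smallest $p$-weak upper gradient in $L^p_{\rm loc}(Z)$. $N^{1,p}(Z)$ is the set of measurable $u$ with $\int_Z|u|^p+\inf_g\int_Zg^p<\infty$ (infimum over upper gradients), and $\widehat N^{1,p}(Z)=\{u:u=v\text{ a.e. for some }v\in N^{1,p}(Z)\}$ with $g_{u,Z}:=g_{v,Z}$. $A\cap\Omega'=\Omega'\setminus\Omega$ is isometrically removable for $\widehat N^{1,p}(\Omega)$ if $\widehat N^{1,p}(\Omega)=\{u|_\Omega:u\in\widehat N^{1,p}(\Omega')\}$ and $g_{u,\Omega}=g_{u,\Omega'}$ a.e. in $\Omega$ for every $u\in\widehat N^{1,p}(\Omega')$. $Z$ supports a global $1$-Poincaré inequality if there are $C>0$, $\lambda\ge1$ such that for all balls $B\subset Z$ with radius $r_B$, all integrable $u$ on $\lambda B$ and all upper gradients $g$ of $u$ in $\lambda B$, $\frac1{\mathcal L^2(B)}\int_B|u-u_B|\,d\mathcal L^2\le \frac{C r_B}{\mathcal L^2(\lambda B)}\int_{\lambda B}g\,d\mathcal L^2$, where $u_B$ is the average of $u$ over $B$. $\Omega$ is $p$-path almost open in $\mathbf{R}^2$ if for $p$-almost every curve $\gamma:[0,l_\gamma]\to\mathbf{R}^2$, $\gamma^{-1}(\Omega)$ is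 the union of a relatively open subset of $[0,l_\gamma]$ and a set of zero 1-dimensional Lebesgue measure. *)

theory Defs
  imports "HOL-Analysis.Analysis"
begin

type_synonym plane = "real \<times> real"

text \<open>The closed intervals \<open>[a, b]\<close> constituting \<open>H\<^sub>k\<close>, encoded by their end points \<open>(a, b)\<close>.
  Removing from \<open>[a, b]\<close> the open centred interval of length \<open>2 powi (- 2 * k - 1)\<close> leaves two
  closed intervals.\<close>

primrec cantor_intervals :: "nat \<Rightarrow> (real \<times> real) set" where
  "cantor_intervals 0 = {(0, 1)}"
| "cantor_intervals (Suc k) =
     (\<Union>(a, b) \<in> cantor_intervals k.
        {(a, (a + b) / 2 - 2 powi (- 2 * int k - 1) / 2),
         ((a + b) / 2 + 2 powi (- 2 * int k - 1) / 2, b)})"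

definition cantor_stage :: "nat \<Rightarrow> real set" where
  "cantor_stage k = (\<Union>(a, b) \<in> cantor_intervals k. {a..b})"

definition four_corners_cantor_set :: "plane set" where
  "four_corners_cantor_set = (\<Inter>k \<in> {1..}. cantor_stage k \<times> cantor_stage k)"

text \<open>The product metric on \<^typ>\<open>real \<times> real\<close> is the Euclidean one.\<close>

definition curve_length :: "(real \<Rightarrow> plane) \<Rightarrow> real \<Rightarrow> real \<Rightarrow> ennreal" where
  "curve_length \<gamma> a b =
     (SUP (n, t) \<in> {(n :: nat, t :: nat \<Rightarrow> real). t 0 = a \<and> t n = b \<and> mono_on {..n} t}.
        \<Sum>i<n. ennreal (dist (\<gamma> (t i)) (\<gamma> (t (Suc i)))))"

text \<open>A curve is a pair \<open>(l, \<gamma>)\<close> of which only the values of \<open>\<gamma>\<close> on \<open>[0, l]\<close> are relevant.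
  A curve parameterized by arc length is nonconstant if and only if \<open>l > 0\<close>.\<close>

definition curves :: "plane set \<Rightarrow> (real \<times> (real \<Rightarrow> plane)) set" where
  "curves Z = {(l, \<gamma>). 0 < l \<and> continuous_on {0..l} \<gamma> \<and> \<gamma> ` {0..l} \<subseteq> Z \<and>
     (\<forall>s t. 0 \<le> s \<and> s \<le> t \<and> t \<le> l \<longrightarrow> curve_length \<gamma> s t = ennreal (t - s))}"

text \<open>With respect to the complete measure \<^term>\<open>lebesgue\<close>, if \<open>g\<close> is Lebesgue measurable on
  \<open>Z\<close>, then \<open>g \<circ> \<gamma>\<close> is measurable for \<open>p\<close>-almost every curve in \<open>Z\<close>, as \<open>g\<close> agrees with a
  Borel function off a null set.\<close>

definition curve_integral :: "real \<Rightarrow> (real \<Rightarrow> plane) \<Rightarrow> (plane \<Rightarrow> ennreal) \<Rightarrow> ennreal" where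
  "curve_integral l \<gamma> g = (\<integral>\<^sup>+t. g (\<gamma> t) \<partial>lebesgue_on {0..l})"

definition ennreal_powr :: "ennreal \<Rightarrow> real \<Rightarrow> ennreal" where
  "ennreal_powr x p = (if x = \<infinity> then \<infinity> else ennreal (enn2real x powr p))"

definition modulus :: "real \<Rightarrow> plane set \<Rightarrow> (real \<times> (real \<Rightarrow> plane)) set \<Rightarrow> ennreal" where
  "modulus p Z \<Gamma> =
     (INF \<rho> \<in> {\<rho> \<in> borel_measurable (restrict_space borel Z).
                 \<forall>(l, \<gamma>) \<in> \<Gamma>. 1 \<le> curve_integral l \<gamma> \<rho>}.
        \<integral>\<^sup>+x. ennreal_powr (\<rho> x) p \<partial>lebesgue_on Z)"

definition almost_every_curve ::
    "real \<Rightarrow> plane set \<Rightarrow> (real \<Rightarrow> (real \<Rightarrow> plane) \<Rightarrow> bool) \<Rightarrow> bool" where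
  "almost_every_curve p Z P \<longleftrightarrow> modulus p Z {(l, \<gamma>) \<in> curves Z. \<not> P l \<gamma>} = 0"

definition upper_gradient_ineq ::
    "(plane \<Rightarrow> ereal) \<Rightarrow> (plane \<Rightarrow> ennreal) \<Rightarrow> real \<Rightarrow> (real \<Rightarrow> plane) \<Rightarrow> bool" where
  "upper_gradient_ineq u g l \<gamma> \<longleftrightarrow>
     (if \<bar>u (\<gamma> 0)\<bar> = \<infinity> \<or> \<bar>u (\<gamma> l)\<bar> = \<infinity> then \<infinity> else e2ennreal \<bar>u (\<gamma> 0) - u (\<gamma> l)\<bar>)
       \<le> curve_integral l \<gamma> g"

definition upper_gradient :: "plane set \<Rightarrow> (plane \<Rightarrow> ereal) \<Rightarrow> (plane \<Rightarrow> ennreal) \<Rightarrow> bool" where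
  "upper_gradient Z u g \<longleftrightarrow> g \<in> borel_measurable (restrict_space borel Z) \<and>
     (\<forall>(l, \<gamma>) \<in> curves Z. upper_gradient_ineq u g l \<gamma>)"

definition weak_upper_gradient ::
    "real \<Rightarrow> plane set \<Rightarrow> (plane \<Rightarrow> ereal) \<Rightarrow> (plane \<Rightarrow> ennreal) \<Rightarrow> bool" where
  "weak_upper_gradient p Z u g \<longleftrightarrow> g \<in> borel_measurable (lebesgue_on Z) \<and>
     almost_every_curve p Z (upper_gradient_ineq u g)"

definition Lp_loc :: "real \<Rightarrow> plane set \<Rightarrow> (plane \<Rightarrow> ennreal) set" where
  "Lp_loc p Z = {g \<in> borel_measurable (lebesgue_on Z).
     \<forall>x\<in>Z. \<exists>r>0. (\<integral>\<^sup>+y. ennreal_powr (g y) p \<partial>lebesgue_on (Z \<inter> ball x r)) < \<infinity>}"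

definition is_minimal_weak_upper_gradient ::
    "real \<Rightarrow> plane set \<Rightarrow> (plane \<Rightarrow> ereal) \<Rightarrow> (plane \<Rightarrow> ennreal) \<Rightarrow> bool" where
  "is_minimal_weak_upper_gradient p Z u g \<longleftrightarrow>
     g \<in> Lp_loc p Z \<and> weak_upper_gradient p Z u g \<and>
     (\<forall>h \<in> Lp_loc p Z. weak_upper_gradient p Z u h \<longrightarrow> (AE x in lebesgue_on Z. g x \<le> h x))"

text \<open>Functions on \<open>Z\<close> are represented by their extensional representatives, so that
  \<open>restrict u W\<close> is the restriction of \<open>u\<close> to \<open>W\<close>.\<close>

definition newtonian :: "real \<Rightarrow> plane set \<Rightarrow> (plane \<Rightarrow> ereal) set" where
  "newtonian p Z = {u \<in> extensional Z. u \<in> borel_measurable (lebesgue_on Z) \<and>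
     (\<integral>\<^sup>+x. ennreal_powr (e2ennreal \<bar>u x\<bar>) p \<partial>lebesgue_on Z) +
     (INF g \<in> {g. upper_gradient Z u g}. \<integral>\<^sup>+x. ennreal_powr (g x) p \<partial>lebesgue_on Z) < \<infinity>}"

definition newtonian_hat :: "real \<Rightarrow> plane set \<Rightarrow> (plane \<Rightarrow> ereal) set" where
  "newtonian_hat p Z =
     {u \<in> extensional Z. \<exists>v \<in> newtonian p Z. AE x in lebesgue_on Z. u x = v x}"

text \<open>The function \<open>g\<^bsub>u,Z\<^esub>\<close> for \<open>u\<close> in \<^term>\<open>newtonian_hat p Z\<close>; it exists and is
  determined only up to a.e. equality.\<close>

definition minimal_weak_upper_gradient ::
    "real \<Rightarrow> plane set \<Rightarrow> (plane \<Rightarrow> ereal) \<Rightarrow> plane \<Rightarrow> ennreal" where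
  "minimal_weak_upper_gradient p Z u =
     (SOME g. \<exists>v \<in> newtonian p Z. (AE x in lebesgue_on Z. u x = v x) \<and>
        is_minimal_weak_upper_gradient p Z v g)"

text \<open>\<open>E\<close> is isometrically removable for the space on \<open>W\<close>, the larger set being \<open>W \<union> E\<close>.\<close>

definition isometrically_removable :: "real \<Rightarrow> plane set \<Rightarrow> plane set \<Rightarrow> bool" where
  "isometrically_removable p E W \<longleftrightarrow> E \<inter> W = {} \<and>
     newtonian_hat p W = (\<lambda>u. restrict u W) ` newtonian_hat p (W \<union> E) \<and>
     (\<forall>u \<in> newtonian_hat p (W \<union> E). AE x in lebesgue_on W.
        minimal_weak_upper_gradient p W (restrict u W) x =
        minimal_weak_upper_gradient p (W \<union> E) u x)"

text \<open>Integrable functions may take the values \<open>\<plusminus>\<infinity>\<close>, but only on a null set, which does not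
  affect the average.\<close>

definition integrable_ereal_on :: "plane set \<Rightarrow> (plane \<Rightarrow> ereal) \<Rightarrow> bool" where
  "integrable_ereal_on B u \<longleftrightarrow> u \<in> borel_measurable (lebesgue_on B) \<and>
     (\<integral>\<^sup>+x. e2ennreal \<bar>u x\<bar> \<partial>lebesgue_on B) < \<infinity>"

definition average :: "plane set \<Rightarrow> (plane \<Rightarrow> ereal) \<Rightarrow> real" where
  "average B u = (\<integral>x. real_of_ereal (u x) \<partial>lebesgue_on B) / measure lebesgue B"

definition supports_global_1_Poincare :: "plane set \<Rightarrow> bool" where
  "supports_global_1_Poincare Z \<longleftrightarrow>
     (\<exists>C>0. \<exists>\<Lambda>\<ge>1. \<forall>x\<in>Z. \<forall>r>0. \<forall>u g.
        let B = Z \<inter> ball x r; B' = Z \<inter> ball x (\<Lambda> * r) in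
        integrable_ereal_on B' u \<and> upper_gradient B' u g \<longrightarrow>
          (\<integral>\<^sup>+y. e2ennreal \<bar>u y - ereal (average B u)\<bar> \<partial>lebesgue_on B) / emeasure lebesgue B
          \<le> ennreal (C * r) / emeasure lebesgue B' * (\<integral>\<^sup>+y. g y \<partial>lebesgue_on B'))"

definition path_almost_open :: "real \<Rightarrow> plane set \<Rightarrow> plane set \<Rightarrow> bool" where
  "path_almost_open p Z W \<longleftrightarrow> almost_every_curve p Z (\<lambda>l \<gamma>.
     \<exists>G N. openin (top_of_set {0..l}) G \<and> N \<in> null_sets lebesgue \<and>
       {t \<in> {0..l}. \<gamma> t \<in> W} = G \<union> N)"

end

theory Submission
  imports Defs
begin

text \<open>Everything rests on the projections of the four corners Cantor set \<open>C\<close>. If two of the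
  \<open>4 ^ k\<close> squares of some stage have the same projection along a direction \<open>v\<close>, then the projection
  of \<open>C\<close> is covered by fewer than \<open>4 ^ k\<close> copies of itself, each smaller by the factor \<open>4 ^ k\<close>, and so
  it is null (\<open>null_projection\<close>). Such directions are dense, as differences of corners have dense
  slopes (\<open>good_directions_dense\<close>), and the axes are among them. Since \<open>A\<close> is a countable union of
  translates of \<open>C\<close>, almost every line in such a direction misses \<open>A\<close> (\<open>thin_translates\<close>); in
  particular \<open>A\<close> is null. On the other hand, \<open>x + 2 * y\<close> maps \<open>C\<close> onto an interval, and likewise every
  small corner of \<open>C\<close>. As the translations are dense, \<open>A\<close> is dense on every line in the
  direction \<open>(2, -1)\<close> (\<open>removed_set_dense_on_line\<close>).

  Because of the last fact \<open>\<Omega>\<close> is not path almost open: almost every segment in \<open>\<Omega>'\<close> in the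
  direction \<open>(2, -1)\<close> meets \<open>A\<close> in a dense set of length zero, so that its part in \<open>\<Omega>\<close> has empty
  interior and full length, and these segments are too many to have zero modulus.

  For the Poincare inequality, almost every two points of a square can be joined in \<open>X\<close> by a horizontal and a vertical
  segment. Integrating the upper gradient along them and averaging over the points gives the
  inequality as in the plane (\<open>thin_supports_Poincare\<close>).

  For the removability, let \<open>V = \<Omega>'\<close>. A weak upper gradient \<open>h\<close> of \<open>u\<close> in a set between \<open>V - A\<close> and \<open>V\<close> controls \<open>u\<close>
  on almost every segment in each good direction \<open>v\<close>. By Fubini this bounds the distributional
  derivative of \<open>u\<close> in the direction \<open>v\<close> by \<open>h\<close> (\<open>slope_bound_of_weak_upper_gradient\<close>), a statement about
  functions on an open set in which \<open>A\<close>, being null, has disappeared. Such bounds are closed under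
  minima and decreasing limits, and therefore there is a least one \<open>m\<close> of finite energy
  (\<open>minimal_slope_bound\<close>). Conversely, mollifying \<open>u\<close> and \<open>m\<close> turns the bounds in a dense set of
  directions into a bound of the local Lipschitz constant, which can be integrated along every
  curve. In the limit, by Fuglede's lemma, \<open>m\<close> is a weak upper gradient in \<open>V\<close> of a representative of
  \<open>u\<close> (\<open>good_representative\<close>). Newtonian functions that agree almost everywhere agree along almost
  every curve (\<open>weak_upper_gradient_transfer\<close>), so \<open>m\<close> is the minimal weak upper gradient both on \<open>V\<close>
  and on \<open>V - A\<close>, and functions on \<open>V - A\<close> extend to \<open>V\<close> (\<open>common_minimal_gradient\<close>).\<close>

section \<open>The four corners Cantor set\<close>

lemma removed_length: "(2::real) powi (- 2 * int k - 1) = (1/4) ^ k / 2"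
proof -
  have "- 2 * int k - 1 = - (int (2 * k + 1))" by simp
  then have "(2::real) powi (- 2 * int k - 1) = 2 powi (- (int (2 * k + 1)))" by (simp only:)
  also have "\<dots> = 1 / 2 ^ (2 * k + 1)"
    by (simp only: power_int_minus power_int_of_nat inverse_eq_divide)
  also have "\<dots> = (1/4) ^ k / 2" by (simp add: power_mult power_one_over)
  finally show ?thesis .
qed

lemma cantor_intervals_length: "(a, b) \<in> cantor_intervals k \<Longrightarrow> b = a + (1/4) ^ k"
proof (induction k arbitrary: a b)
  case (Suc k)
  from Suc.prems obtain z where z: "z \<in> cantor_intervals k"
    and ab: "(a, b) \<in> (case z of (c, d) \<Rightarrow> {(c, (c + d) / 2 - (1/4) ^ k / 2 / 2),
         ((c + d) / 2 + (1/4) ^ k / 2 / 2, d)})"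
    unfolding cantor_intervals.simps removed_length by blast
  obtain c d where cd: "z = (c, d)" by (cases z)
  have "d = c + (1/4) ^ k" using Suc.IH z cd by blast
  with ab show ?case
    unfolding cd power_Suc by (auto simp: add_divide_distrib)
qed auto

text \<open>The recursion in the definition subdivides the intervals of the last stage; for
  self-similarity it is turned into one that scales the whole previous stage.\<close>

lemma cantor_intervals_Suc:
  "cantor_intervals (Suc k) = (\<lambda>(a, b). (a / 4, b / 4)) ` cantor_intervals k \<union>
     (\<lambda>(a, b). (3 / 4 + a / 4, 3 / 4 + b / 4)) ` cantor_intervals k"
proof (induction k)
  case 0
  show ?case by (auto simp: power_int_minus)
next
  case (Suc k)
  have split: "cantor_intervals (Suc j) = (\<Union>(a, b) \<in> cantor_intervals j.
      {(a, a + (1/4) ^ Suc j), (b - (1/4) ^ Suc j, b)})" for j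
  proof -
    note pw = removed_length[of j]
    show ?thesis
      unfolding cantor_intervals.simps pw
      by (intro SUP_cong refl) (auto dest!: cantor_intervals_length simp: field_simps)
  qed
  define G where "G = (\<lambda>j (a :: real, b :: real). {(a, a + (1/4) ^ Suc j), (b - (1/4) ^ Suc j, b)})"
  define f where "f = (\<lambda>(a :: real, b :: real). (a / 4, b / 4))"
  define g where "g = (\<lambda>(a :: real, b :: real). (3 / 4 + a / 4, 3 / 4 + b / 4))"
  have split': "cantor_intervals (Suc j) = (\<Union>z \<in> cantor_intervals j. G j z)" for j
    unfolding split G_def ..
  have fg: "G (Suc k) (f z) = f ` G k z" "G (Suc k) (g z) = g ` G k z" for z
  proof -
    obtain a b where z: "z = (a, b)" by (cases z)
    define q :: real where "q = (1/4) ^ Suc k"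
    have q: "(1/4) ^ Suc (Suc k) = q / 4" "(1/4) ^ Suc k = q" by (simp_all add: q_def)
    show "G (Suc k) (f z) = f ` G k z" "G (Suc k) (g z) = g ` G k z"
      unfolding z G_def f_def g_def prod.case q
      by (simp_all add: add_divide_distrib diff_divide_distrib algebra_simps)
  qed
  have "cantor_intervals (Suc (Suc k)) =
      (\<Union>z \<in> f ` cantor_intervals k \<union> g ` cantor_intervals k. G (Suc k) z)"
    unfolding split'[of "Suc k"] Suc.IH f_def g_def ..
  also have "\<dots> = f ` (\<Union>z \<in> cantor_intervals k. G k z) \<union> g ` (\<Union>z \<in> cantor_intervals k. G k z)"
    unfolding UN_Un image_UN UN_simps(10) by (simp only: fg)
  also have "\<dots> = f ` cantor_intervals (Suc k) \<union> g ` cantor_intervals (Suc k)"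
    unfolding split'[of k] ..
  finally have "cantor_intervals (Suc (Suc k)) = f ` cantor_intervals (Suc k) \<union> g ` cantor_intervals (Suc k)" .
  then show ?case unfolding f_def g_def .
qed

lemma cantor_stage_0: "cantor_stage 0 = {0..1}"
  by (simp add: cantor_stage_def)

lemma cantor_stage_Suc:
  "x \<in> cantor_stage (Suc k) \<longleftrightarrow> 4 * x \<in> cantor_stage k \<or> 4 * x - 3 \<in> cantor_stage k"
proof -
  have "x \<in> cantor_stage (Suc k) \<longleftrightarrow>
      (\<exists>z\<in>cantor_intervals k. x \<in> {fst z / 4..snd z / 4} \<or> x \<in> {3 / 4 + fst z / 4..3 / 4 + snd z / 4})"
    unfolding cantor_stage_def cantor_intervals_Suc by (simp only: UN_iff case_prod_beta bex_Un bex_simps(7) fst_conv snd_conv) blast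
  also have "\<dots> \<longleftrightarrow> (\<exists>z\<in>cantor_intervals k. 4 * x \<in> {fst z..snd z} \<or> 4 * x - 3 \<in> {fst z..snd z})"
    by (intro bex_cong refl) auto
  also have "\<dots> \<longleftrightarrow> 4 * x \<in> cantor_stage k \<or> 4 * x - 3 \<in> cantor_stage k"
    unfolding cantor_stage_def UN_iff case_prod_beta by blast
  finally show ?thesis .
qed

lemma cantor_stage_subset: "cantor_stage k \<subseteq> {0..1}"
proof (induction k)
  case (Suc k)
  show ?case
  proof
    fix x assume "x \<in> cantor_stage (Suc k)"
    then have "4 * x \<in> {0..1} \<or> 4 * x - 3 \<in> {0..1}" using Suc cantor_stage_Suc by blast
    then show "x \<in> {0..1}" by auto
  qed
qed (simp add: cantor_stage_0)

lemma cantor_stage_decreasing: "cantor_stage (Suc k) \<subseteq> cantor_stage k"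
proof (induction k)
  case 0
  then show ?case using cantor_stage_subset[of 1] by (simp add: cantor_stage_0)
next
  case (Suc k)
  then show ?case unfolding subset_iff cantor_stage_Suc[of _ "Suc k"] cantor_stage_Suc[of _ k] by blast
qed

lemma compact_cantor_stage: "compact (cantor_stage k)"
proof -
  have "finite (cantor_intervals k)" by (induction k) auto
  then show ?thesis unfolding cantor_stage_def by (intro compact_UN) auto
qed

abbreviation cantor_half :: "real set" where "cantor_half \<equiv> (\<Inter>k. cantor_stage k)"

text \<open>At most one of \<open>4 * x\<close> and \<open>4 * x - 3\<close> lies in \<open>[0, 1]\<close>, so the same alternative of the
  recursion for the stages holds at all of them.\<close>

lemma cantor_half_iff: "x \<in> cantor_half \<longleftrightarrow> 4 * x \<in> cantor_half \<or> 4 * x - 3 \<in> cantor_half"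
proof
  assume x: "x \<in> cantor_half"
  then have s: "4 * x \<in> cantor_stage k \<or> 4 * x - 3 \<in> cantor_stage k" for k
    using cantor_stage_Suc by blast
  show "4 * x \<in> cantor_half \<or> 4 * x - 3 \<in> cantor_half"
  proof (cases "4 * x \<le> 1")
    case True
    then have "4 * x - 3 \<notin> cantor_stage k" for k
      using cantor_stage_subset[of k] by force
    then show ?thesis using s by blast
  next
    case False
    then have "4 * x \<notin> cantor_stage k" for k
      using cantor_stage_subset[of k] by force
    then show ?thesis using s by blast
  qed
next
  assume *: "4 * x \<in> cantor_half \<or> 4 * x - 3 \<in> cantor_half"
  have "x \<in> cantor_stage k" for k
  proof (cases k)
    case 0
    have "4 * x \<in> {0..1} \<or> 4 * x - 3 \<in> {0..1}"
      using * cantor_stage_subset by blast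
    then show ?thesis by (auto simp: 0 cantor_stage_0)
  next
    case (Suc j)
    then show ?thesis using * by (auto simp: cantor_stage_Suc)
  qed
  then show "x \<in> cantor_half" by blast
qed

lemma four_corners_eq: "four_corners_cantor_set = cantor_half \<times> cantor_half"
proof -
  have all: "x \<in> cantor_half \<longleftrightarrow> (\<forall>k\<in>{1..}. x \<in> cantor_stage k)" for x
  proof
    assume *: "\<forall>k\<in>{1..}. x \<in> cantor_stage k"
    have "x \<in> cantor_stage k" for k
    proof (cases k)
      case 0
      have "x \<in> cantor_stage (Suc 0)" using * by simp
      then show ?thesis using cantor_stage_decreasing[of 0] unfolding 0 by blast
    next
      case (Suc j)
      then show ?thesis using * by simp
    qed
    then show "x \<in> cantor_half" by blast
  qed blast
  show ?thesis
  proof (rule set_eqI)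
    fix z :: "real \<times> real"
    have "z \<in> four_corners_cantor_set \<longleftrightarrow> (\<forall>k\<in>{1..}. fst z \<in> cantor_stage k \<and> snd z \<in> cantor_stage k)"
      unfolding four_corners_cantor_set_def by (simp only: INT_iff mem_Times_iff)
    also have "\<dots> \<longleftrightarrow> fst z \<in> cantor_half \<and> snd z \<in> cantor_half"
      unfolding all by blast
    finally show "z \<in> four_corners_cantor_set \<longleftrightarrow> z \<in> cantor_half \<times> cantor_half"
      by (simp only: mem_Times_iff)
  qed
qed

lemma compact_four_corners: "compact four_corners_cantor_set"
proof -
  have "closed cantor_half"
    by (intro closed_INT ballI compact_imp_closed compact_cantor_stage)
  then have "compact (cantor_stage 0 \<inter> cantor_half)"
    by (intro compact_Int_closed compact_cantor_stage)
  also have "cantor_stage 0 \<inter> cantor_half = cantor_half" by blast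
  finally show ?thesis unfolding four_corners_eq by (intro compact_Times)
qed

text \<open>The origin is the fixed point of one of the four similarities of ratio \<open>1/4\<close> that map the
  Cantor set into itself.\<close>

lemma four_corners_scale_corner:
  assumes "(x, y) \<in> four_corners_cantor_set"
  shows "(x / 4 ^ k, y / 4 ^ k) \<in> four_corners_cantor_set"
  using assms
proof (induction k)
  case (Suc k)
  then have "(4 * (x / 4 ^ Suc k)) \<in> cantor_half" "(4 * (y / 4 ^ Suc k)) \<in> cantor_half"
    by (simp_all add: four_corners_eq)
  then show ?case unfolding four_corners_eq using cantor_half_iff by blast
qed simp

text \<open>The corners of the \<open>4 ^ k\<close> squares of side \<open>4 ^ (-k)\<close> of stage \<open>k\<close>, in one coordinate.\<close>

fun corner_coords :: "nat \<Rightarrow> real set" where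
  "corner_coords 0 = {0}"
| "corner_coords (Suc k) = (\<lambda>x. x / 4) ` corner_coords k \<union> (\<lambda>x. 3 / 4 + x / 4) ` corner_coords k"

lemma corner_coords_card: "finite (corner_coords k) \<and> card (corner_coords k) \<le> 2 ^ k"
proof (induction k)
  case (Suc k)
  have "card (corner_coords (Suc k)) \<le> card (corner_coords k) + card (corner_coords k)"
    using Suc by (auto intro!: order_trans[OF card_Un_le] add_mono card_image_le)
  then show ?case using Suc by simp
qed simp

lemma cantor_half_decomp:
  "x \<in> cantor_half \<Longrightarrow> \<exists>c \<in> corner_coords k. \<exists>y \<in> cantor_half. x = c + y / 4 ^ k"
proof (induction k arbitrary: x)
  case (Suc k)
  from Suc.prems consider "4 * x \<in> cantor_half" | "4 * x - 3 \<in> cantor_half"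
    using cantor_half_iff by blast
  then show ?case
  proof cases
    case 1
    from Suc.IH[OF this] obtain c y where "c \<in> corner_coords k" "y \<in> cantor_half" "4 * x = c + y / 4 ^ k" by blast
    then show ?thesis by (intro bexI[of _ "c / 4"] bexI[of _ y]) (auto simp: field_simps)
  next
    case 2
    from Suc.IH[OF this] obtain c y where "c \<in> corner_coords k" "y \<in> cantor_half" "4 * x - 3 = c + y / 4 ^ k" by blast
    then show ?thesis by (intro bexI[of _ "3/4 + c / 4"] bexI[of _ y]) (auto simp: field_simps)
  qed
qed (auto)

text \<open>The numbers \<open>\<Sum>i<k. d\<^sub>i * 4 ^ i\<close> with digits \<open>d\<^sub>i\<close> in \<open>{-1, 0, 1}\<close>, which are the
  differences of corner coordinates of stage \<open>k\<close> up to the factor \<open>3 / 4 ^ k\<close>.\<close>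

inductive balanced :: "nat \<Rightarrow> int \<Rightarrow> bool" where
  balanced_0: "balanced 0 0"
| balanced_Suc: "balanced k n \<Longrightarrow> d \<in> {-1, 0, 1} \<Longrightarrow> balanced (Suc k) (4 * n + d)"

lemma corner_coords_shift:
  "c \<in> corner_coords k \<Longrightarrow> {c, c + 3 / 4 ^ Suc k} \<subseteq> corner_coords (Suc k)"
proof (induction k arbitrary: c)
  case (Suc k)
  then obtain e where e: "e \<in> corner_coords k" "c = e / 4 \<or> c = 3 / 4 + e / 4" by auto
  from Suc.IH[OF e(1)] have m: "e \<in> corner_coords (Suc k)" "e + 3 / 4 ^ Suc k \<in> corner_coords (Suc k)" by auto
  have "x / 4 \<in> corner_coords (Suc (Suc k)) \<and> 3 / 4 + x / 4 \<in> corner_coords (Suc (Suc k))"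
    if "x \<in> corner_coords (Suc k)" for x
    using that by (simp only: corner_coords.simps(2)[of "Suc k"]) blast
  note m' = this[OF m(1)] this[OF m(2)]
  from e(2) show ?case
  proof
    assume c: "c = e / 4"
    have eq: "e / 4 + 3 / 4 ^ Suc (Suc k) = (e + 3 / 4 ^ Suc k) / 4" by (simp add: add_divide_distrib)
    show ?thesis unfolding c eq using m' by (simp only: insert_subset empty_subsetI simp_thms)
  next
    assume c: "c = 3 / 4 + e / 4"
    have eq: "3 / 4 + e / 4 + 3 / 4 ^ Suc (Suc k) = 3 / 4 + (e + 3 / 4 ^ Suc k) / 4" by (simp add: add_divide_distrib)
    show ?thesis unfolding c eq using m' by (simp only: insert_subset empty_subsetI simp_thms)
  qed
qed simp

text \<open>Digits \<open>1\<close> and \<open>-1\<close> are realized by moving one of the two corners to the right half of the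
  last subdivision.\<close>

lemma corner_coords_diff:
  "balanced k n \<Longrightarrow> \<exists>c \<in> corner_coords k. \<exists>d \<in> corner_coords k. c - d = 3 * of_int n / 4 ^ k"
proof (induction rule: balanced.induct)
  case (balanced_Suc k n e)
  then obtain c d where cd: "c \<in> corner_coords k" "d \<in> corner_coords k" "c - d = 3 * of_int n / 4 ^ k" by blast
  let ?s = "3 / 4 ^ Suc k :: real"
  have m: "c \<in> corner_coords (Suc k)" "d \<in> corner_coords (Suc k)"
     "c + ?s \<in> corner_coords (Suc k)" "d + ?s \<in> corner_coords (Suc k)"
    using corner_coords_shift[OF cd(1)] corner_coords_shift[OF cd(2)] by auto
  from balanced_Suc(2) consider "e = -1" | "e = 0" | "e = 1" by auto
  then show ?case
  proof cases
    case 1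
    then show ?thesis using cd(3)
      by (intro bexI[OF _ m(1)] bexI[OF _ m(4)]) (auto simp: field_simps)
  next
    case 2
    then show ?thesis using cd(3)
      by (intro bexI[OF _ m(1)] bexI[OF _ m(2)]) (auto simp: field_simps)
  next
    case 3
    then show ?thesis using cd(3)
      by (intro bexI[OF _ m(3)] bexI[OF _ m(2)]) (auto simp: field_simps)
  qed
qed simp

text \<open>If two of the \<open>4 ^ k\<close> corners of stage \<open>k\<close> have the same image under a linear functional,
  then the image of the Cantor set is covered by fewer than \<open>4 ^ k\<close> copies of itself, scaled by
  \<open>4 ^ (-k)\<close>. Comparing measures, it is null.\<close>

lemma null_projection:
  fixes m n :: int
  assumes "balanced k m" "balanced k n" "(m, n) \<noteq> (0, 0)"
  shows "(\<lambda>(x, y). of_int n * x - of_int m * y) ` four_corners_cantor_set \<in> null_sets (lborel :: real measure)"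
proof -
  define L where "L = (\<lambda>z::real \<times> real. of_int n * fst z - of_int m * snd z)"
  define T where "T = L ` four_corners_cantor_set"
  define P where "P = corner_coords k \<times> corner_coords k"
  have Leq: "(\<lambda>(x, y). of_int n * x - of_int m * y) = L" by (auto simp: L_def)
  have cT: "compact T" unfolding T_def L_def
    by (intro compact_continuous_image compact_four_corners continuous_intros)
  then have Ts: "T \<in> sets lborel" using compact_imp_closed by force
  have finP: "finite P" using corner_coords_card by (simp add: P_def)
  have cardP: "card P \<le> 4 ^ k"
  proof -
    have "card P \<le> 2 ^ k * 2 ^ k" unfolding P_def card_cartesian_product
      using corner_coords_card by (intro mult_mono) auto
    then show ?thesis by (simp add: power_mult_distrib[symmetric])
  qed
  obtain c c' where c: "c \<in> corner_coords k" "c' \<in> corner_coords k" "c - c' = 3 * of_int m / 4 ^ k"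
    using corner_coords_diff[OF assms(1)] by blast
  obtain d d' where d: "d \<in> corner_coords k" "d' \<in> corner_coords k" "d - d' = 3 * of_int n / 4 ^ k"
    using corner_coords_diff[OF assms(2)] by blast
  have "L (c, d) - L (c', d') = of_int n * (c - c') - of_int m * (d - d')"
    by (simp add: L_def algebra_simps)
  (* The difference of the two corners is a multiple of (m, n), which spans the kernel of L. *)
  then have Lsame: "L (c, d) = L (c', d')" by (simp add: c d)
  have diff: "(c, d) \<noteq> (c', d')"
    using c(3) d(3) assms(3) by auto
  have "\<not> inj_on L P"
    using Lsame diff c d unfolding P_def by (auto simp: inj_on_def)
  then have "card (L ` P) < card P"
    using card_image_le[OF finP, of L] eq_card_imp_inj_on[OF finP] by (metis nat_less_le)
  with cardP have cardLP: "real (card (L ` P)) \<le> 4 ^ k - 1"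
    by (metis (no_types, lifting) Suc_leI le_diff_conv2 add.commute of_nat_Suc of_nat_le_iff of_nat_numeral of_nat_power order_less_le_trans le_diff_eq)
  (* Copies over corners with the same image coincide, so the image of the set of corners suffices
     as an index set. *)
  have cover: "T \<subseteq> (\<Union>a\<in>L ` P. (\<lambda>t. a + (1 / 4 ^ k) *\<^sub>R t) ` T)"
  proof
    fix t assume "t \<in> T"
    then obtain x y where xy: "x \<in> cantor_half" "y \<in> cantor_half" "t = L (x, y)"
      by (auto simp: T_def four_corners_eq)
    obtain a x' where a: "a \<in> corner_coords k" "x' \<in> cantor_half" "x = a + x' / 4 ^ k"
      using cantor_half_decomp[OF xy(1)] by blast
    obtain b y' where b: "b \<in> corner_coords k" "y' \<in> cantor_half" "y = b + y' / 4 ^ k"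
      using cantor_half_decomp[OF xy(2)] by blast
    have "t = L (a, b) + (1 / 4 ^ k) *\<^sub>R L (x', y')"
      by (simp add: xy(3) a(3) b(3) L_def field_simps)
    moreover have "L (x', y') \<in> T" using a b by (auto simp: T_def four_corners_eq)
    moreover have "L (a, b) \<in> L ` P" using a b by (auto simp: P_def)
    ultimately show "t \<in> (\<Union>a\<in>L ` P. (\<lambda>t. a + (1 / 4 ^ k) *\<^sub>R t) ` T)" by blast
  qed
  have Tm: "T \<in> lmeasurable" using lmeasurable_compact[OF cT] .
  have im: "(\<lambda>t. a + (1 / 4 ^ k) *\<^sub>R t) ` T \<in> lmeasurable \<and>
      measure lebesgue ((\<lambda>t. a + (1 / 4 ^ k) *\<^sub>R t) ` T) = measure lebesgue T / 4 ^ k" for a :: real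
  proof -
    have "compact ((\<lambda>t. a + (1 / 4 ^ k) *\<^sub>R t) ` T)"
      by (intro compact_continuous_image cT continuous_intros)
    moreover have "measure lebesgue ((\<lambda>t. (1 / 4 ^ k) *\<^sub>R t + a) ` T) = measure lebesgue T / 4 ^ k"
      by (subst measure_lebesgue_affine) simp
    ultimately show ?thesis by (simp add: lmeasurable_compact add.commute)
  qed
  have "measure lebesgue T \<le> measure lebesgue (\<Union>a\<in>L ` P. (\<lambda>t. a + (1 / 4 ^ k) *\<^sub>R t) ` T)"
    using finP im by (intro measure_mono_fmeasurable cover fmeasurable.finite_UN) (auto intro: fmeasurableD Tm)
  also have "\<dots> \<le> (\<Sum>a\<in>L ` P. measure lebesgue ((\<lambda>t. a + (1 / 4 ^ k) *\<^sub>R t) ` T))"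
    using finP im by (intro measure_UNION_le) (auto intro: fmeasurableD)
  also have "\<dots> = real (card (L ` P)) * (measure lebesgue T / 4 ^ k)"
    using im by simp
  also have "\<dots> \<le> (4 ^ k - 1) * (measure lebesgue T / 4 ^ k)"
    using cardLP by (intro mult_right_mono) auto
  finally have "measure lebesgue T \<le> measure lebesgue T - measure lebesgue T / 4 ^ k"
    by (simp add: field_simps)
  then have "measure lebesgue T \<le> 0" by (simp add: field_simps)
  then have "measure lebesgue T = 0" using measure_nonneg[of lebesgue T] by linarith
  then have "emeasure lborel T = 0"
    using Ts emeasure_eq_measure2[OF Tm] by simp
  then show ?thesis using Ts unfolding Leq T_def[symmetric] by (auto intro: null_setsI)
qed

subsection \<open>Directions of null projection\<close>

text \<open>The unit vectors \<open>v\<close> for which almost every line parallel to \<open>v\<close> misses the Cantor set. Such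
  a line is a level set of the linear functional in the definition.\<close>

definition good_directions :: "plane set" where
  "good_directions = {v. norm v = 1 \<and>
     (\<lambda>(x, y). snd v * x - fst v * y) ` four_corners_cantor_set \<in> null_sets (lborel :: real measure)}"

lemma good_direction_balanced:
  assumes "balanced k m" "balanced k n" "(m, n) \<noteq> (0, 0)"
  shows "(1 / norm (of_int m :: real, of_int n :: real)) *\<^sub>R (of_int m, of_int n) \<in> good_directions"
proof -
  define v :: plane where "v = (of_int m, of_int n)"
  define c where "c = 1 / norm v"
  have "v \<noteq> 0" using assms(3) by (auto simp: v_def zero_prod_def)
  then have c: "c \<noteq> 0" and nv: "norm (c *\<^sub>R v) = 1" by (auto simp: c_def)
  let ?T = "(\<lambda>(x, y). of_int n * x - of_int m * y) ` four_corners_cantor_set"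
  have T: "?T \<in> null_sets lborel" by (rule null_projection[OF assms])
  have "compact ?T" unfolding case_prod_beta
    by (intro compact_continuous_image compact_four_corners continuous_intros)
  have im: "(\<lambda>(x, y). snd (c *\<^sub>R v) * x - fst (c *\<^sub>R v) * y) ` four_corners_cantor_set = (\<lambda>t. c *\<^sub>R t + 0) ` ?T"
    unfolding image_image by (rule image_cong) (auto simp: v_def algebra_simps)
  have "closed ((\<lambda>t. c *\<^sub>R t + 0) ` ?T)"
    by (intro compact_imp_closed compact_continuous_image continuous_intros \<open>compact ?T\<close>)
  moreover have "emeasure lebesgue ((\<lambda>t. c *\<^sub>R t + 0) ` ?T) = 0"
    unfolding emeasure_lebesgue_affine null_setsD1[OF null_sets_completionI[OF T]] by simp
  ultimately have "(\<lambda>t. c *\<^sub>R t + 0) ` ?T \<in> null_sets lborel"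
    by (intro null_setsI) auto
  then show ?thesis using nv unfolding good_directions_def im[symmetric] by (simp add: c_def v_def)
qed

lemma balanced_0': "balanced k 0"
  by (induction k) (auto intro: balanced.intros dest: balanced_Suc[where d=0])

lemma balanced_uminus: "balanced k n \<Longrightarrow> balanced k (- n)"
proof (induction rule: balanced.induct)
  case (balanced_Suc k n d)
  have "balanced (Suc k) (4 * (- n) + (- d))"
    by (rule balanced.balanced_Suc) (use balanced_Suc in auto)
  then show ?case by simp
qed (simp add: balanced_0)

lemma balanced_mult4: "balanced k n \<Longrightarrow> balanced (Suc k) (4 * n)"
  using balanced_Suc[of k n 0] by simp

lemma balanced_pad: "balanced k n \<Longrightarrow> balanced (Suc k) n"
proof (induction rule: balanced.induct)
  case (balanced_Suc k n d)
  then show ?case using balanced.balanced_Suc[of "Suc k" n d] by simp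
qed (use balanced_0' in simp)

text \<open>A digit pair that continues the approximation of the slope \<open>s\<close> exists because the numbers
  \<open>1 + s, s, s - 1, - 1, - 1 - s\<close>, all of the form \<open>s * d - e\<close> with \<open>d, e\<close> in
  \<open>{-1, 0, 1}\<close>, descend in steps of \<open>1\<close> and \<open>s\<close>, and these are at most \<open>2 * (1 + s) / 3\<close>
  when \<open>1/2 \<le> s \<le> 2\<close>.\<close>

lemma balanced_slope_digit:
  fixes s r :: real
  assumes s: "1 / 2 \<le> s" "s \<le> 2" and r: "\<bar>r\<bar> \<le> (1 + s) / 3"
  shows "\<exists>d\<in>{-1, 0, 1}. \<exists>e\<in>{-1, 0, 1}. \<bar>4 * r + s * of_int d - of_int e\<bar> \<le> (1 + s) / 3"
proof (rule ccontr)
  assume "\<not> ?thesis"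
  then have n: "\<not> \<bar>4 * r + s * of_int d - of_int e\<bar> \<le> (1 + s) / 3"
    if "d \<in> {-1, 0, 1}" "e \<in> {-1, 0, 1}" for d e using that by blast
  define c where "c = (1 + s) / 3"
  have step: "c < 4 * r + q" if "c < 4 * r + p" "p - 2 * c \<le> q" "\<not> \<bar>4 * r + q\<bar> \<le> c" for p q
    using that by linarith
  have r': "- 4 * c \<le> 4 * r" "4 * r \<le> 4 * c" using r by (auto simp: c_def)
  have n': "\<not> \<bar>4 * r + q\<bar> \<le> c" if "d \<in> {-1, 0, 1}" "e \<in> {-1, 0, 1}" "q = s * of_int d - of_int e" for d e q
    using n[OF that(1,2)] unfolding that(3) c_def add_diff_eq .
  have c3: "3 * c = 1 + s" by (simp add: c_def)
  have "c < 4 * r + (s + 1)"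
    using n'[of 1 "-1" "s + 1"] r' c3 by (simp del: abs_le_iff)
  then have "c < 4 * r + s"
    by (rule step[OF _ _ n'[of 1 0]]) (use s c3 in auto)
  then have "c < 4 * r + (s - 1)"
    by (rule step[OF _ _ n'[of 1 1]]) (use s c3 in auto)
  then have "c < 4 * r + (- 1)"
    by (rule step[OF _ _ n'[of 0 1]]) (use s c3 in auto)
  then have "c < 4 * r + (- 1 - s)"
    by (rule step[OF _ _ n'[of "-1" 1]]) (use s c3 in auto)
  with r' show False by (auto simp: c_def)
qed

text \<open>Appending one digit to \<open>m\<close> and \<open>n\<close> multiplies the defect \<open>s * m - n\<close> by \<open>4\<close> and shifts it;
  with the right digits it stays bounded while \<open>m\<close> grows.\<close>

lemma balanced_slope:
  fixes s :: real
  assumes s: "1 / 2 \<le> s" "s \<le> 2"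
  shows "\<exists>m n. balanced (Suc k) m \<and> balanced (Suc k) n \<and> 3 ^ k \<le> m \<and>
           \<bar>s * of_int m - of_int n\<bar> \<le> (1 + s) / 3"
proof (induction k)
  case 0
  have "balanced (Suc 0) 1" using balanced_Suc[OF balanced_0, of 1] by simp
  then show ?case using s by (intro exI[of _ 1]) (auto simp: abs_if)
next
  case (Suc k)
  then obtain m n where mn: "balanced (Suc k) m" "balanced (Suc k) n" "3 ^ k \<le> m"
     "\<bar>s * of_int m - of_int n\<bar> \<le> (1 + s) / 3" by blast
  obtain d e :: int where de: "d \<in> {-1, 0, 1}" "e \<in> {-1, 0, 1}"
     "\<bar>4 * (s * of_int m - of_int n) + s * of_int d - of_int e\<bar> \<le> (1 + s) / 3"
    using balanced_slope_digit[OF s mn(4)] by blast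
  have "balanced (Suc (Suc k)) (4 * m + d)" "balanced (Suc (Suc k)) (4 * n + e)"
    using mn de by (auto intro: balanced_Suc simp del: insert_iff)
  moreover have "3 ^ Suc k \<le> 4 * m + d"
  proof -
    have "(1::int) \<le> 3 ^ k" by simp
    moreover have "- 1 \<le> d" using de(1) by auto
    ultimately have "3 * 3 ^ k \<le> 4 * m + d" using mn(3) by linarith
    then show ?thesis by simp
  qed
  moreover have "\<bar>s * of_int (4 * m + d) - of_int (4 * n + e)\<bar> \<le> (1 + s) / 3"
    using de(3) by (simp add: algebra_simps)
  ultimately show ?case by blast
qed

text \<open>Bounded defect and growing \<open>m\<close> give the slopes in \<open>[1/2, 2]\<close>. Balanced numbers are closed
  under multiplication by \<open>4\<close> and under negation, which gives all others.\<close>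

lemma balanced_slope_approx:
  fixes s :: real
  assumes s: "s \<noteq> 0" and e: "0 < e"
  shows "\<exists>k m n. balanced k m \<and> balanced k n \<and> 0 < m \<and> \<bar>s - of_int n / of_int m\<bar> < e"
proof -
  have base: "\<exists>k m n. balanced k m \<and> balanced k n \<and> 0 < m \<and> \<bar>s - of_int n / of_int m\<bar> < e"
    if s: "1 / 2 \<le> s" "s \<le> 2" and e: "0 < e" for s e :: real
  proof -
    obtain k where k: "1 / e < 3 ^ k" using real_arch_pow[of 3 "1 / e"] by auto
    obtain m n where mn: "balanced (Suc k) m" "balanced (Suc k) n" "3 ^ k \<le> m"
       "\<bar>s * of_int m - of_int n\<bar> \<le> (1 + s) / 3"
      using balanced_slope[OF s] by blast
    have "(1::int) \<le> 3 ^ k" by simp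
    with mn(3) have m0: "0 < m" by linarith
    have "(3::real) ^ k \<le> of_int m" using mn(3) by (metis of_int_le_iff of_int_numeral of_int_power)
    then have "e * 3 ^ k \<le> e * of_int m" using e by (intro mult_left_mono) auto
    moreover have "1 < e * 3 ^ k" using k e by (simp add: pos_divide_less_eq mult.commute)
    ultimately have me: "1 < e * of_int m" by linarith
    have "\<bar>s - of_int n / of_int m\<bar> = \<bar>s * of_int m - of_int n\<bar> / of_int m"
    proof -
      have "s - of_int n / of_int m = (s * of_int m - of_int n) / of_int m" using m0 by (simp add: diff_divide_distrib)
      then show ?thesis using m0 by (simp only: abs_divide abs_of_pos of_int_0_less_iff)
    qed
    also have "\<dots> \<le> 1 / of_int m" using mn(4) s m0 by (intro divide_right_mono) auto
    also have "\<dots> < e" using me m0 by (simp add: field_simps)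
    finally show ?thesis using mn m0 by blast
  qed
  have pos: "\<exists>k m n. balanced k m \<and> balanced k n \<and> 0 < m \<and> \<bar>s - of_int n / of_int m\<bar> < e"
    if s: "0 < s" and e: "0 < e" for s e :: real
  proof -
    have up: "\<exists>k m n. balanced k m \<and> balanced k n \<and> 0 < m \<and> \<bar>4 ^ j * s - of_int n / of_int m\<bar> < e"
      if "1 / 2 \<le> s" "s \<le> 2" "0 < e" for s e :: real and j :: nat
      using that(3)
    proof (induction j arbitrary: e)
      case 0
      then show ?case using base[OF that(1,2)] by simp
    next
      case (Suc j)
      from Suc.IH[of "e / 4"] Suc.prems obtain k m n where
        *: "balanced k m" "balanced k n" "0 < m" "\<bar>4 ^ j * s - of_int n / of_int m\<bar> < e / 4" by auto
      have "4 ^ Suc j * s - of_int (4 * n) / of_int m = 4 * (4 ^ j * s - of_int n / of_int m)"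
        by (simp add: right_diff_distrib)
      then have "\<bar>4 ^ Suc j * s - of_int (4 * n) / of_int m\<bar> = 4 * \<bar>4 ^ j * s - of_int n / of_int m\<bar>"
        by (simp only: abs_mult abs_numeral)
      moreover have "4 * \<bar>4 ^ j * s - of_int n / of_int m\<bar> < e" using *(4) by simp
      ultimately have "\<bar>4 ^ Suc j * s - of_int (4 * n) / of_int m\<bar> < e" by (simp only:)
      then show ?case using * balanced_pad[of k m] balanced_mult4[of k n]
        by (intro exI[of _ "Suc k"] exI[of _ m] exI[of _ "4 * n"]) auto
    qed
    have down: "\<exists>k m n. balanced k m \<and> balanced k n \<and> 0 < m \<and> \<bar>s / 4 ^ j - of_int n / of_int m\<bar> < e"
      if "1 / 2 \<le> s" "s \<le> 2" "0 < e" for s e :: real and j :: nat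
      using that(3)
    proof (induction j arbitrary: e)
      case 0
      then show ?case using base[OF that(1,2)] by simp
    next
      case (Suc j)
      from Suc.IH[of "4 * e"] Suc.prems obtain k m n where
        *: "balanced k m" "balanced k n" "0 < m" "\<bar>s / 4 ^ j - of_int n / of_int m\<bar> < 4 * e" by auto
      have "s / 4 ^ Suc j - of_int n / of_int (4 * m) = (s / 4 ^ j - of_int n / of_int m) / 4"
        by (simp add: diff_divide_distrib)
      then have "\<bar>s / 4 ^ Suc j - of_int n / of_int (4 * m)\<bar> = \<bar>s / 4 ^ j - of_int n / of_int m\<bar> / 4"
        by (simp only: abs_divide abs_numeral)
      moreover have "\<bar>s / 4 ^ j - of_int n / of_int m\<bar> / 4 < e" using *(4) by simp
      ultimately have "\<bar>s / 4 ^ Suc j - of_int n / of_int (4 * m)\<bar> < e" by (simp only:)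
      then show ?case using * balanced_pad[of k n] balanced_mult4[of k m]
        by (intro exI[of _ "Suc k"] exI[of _ "4 * m"] exI[of _ n]) auto
    qed
    define j where "j = \<lfloor>log 4 (2 * s)\<rfloor>"
    have j: "of_int j \<le> log 4 (2 * s)" "log 4 (2 * s) < of_int j + 1" by (auto simp: j_def)
    have l: "4 powr of_int j \<le> 2 * s" "2 * s < 4 powr (of_int j + 1)"
      using j s by (auto simp: le_log_iff log_less_iff)
    define t where "t = s / 4 powr of_int j"
    have t: "1 / 2 \<le> t" "t \<le> 2" using l by (auto simp: t_def field_simps powr_add)
    show ?thesis
    proof (cases "0 \<le> j")
      case True
      then have "4 powr real_of_int j = 4 ^ nat j" by (simp add: powr_real_of_int)
      then have "s = 4 ^ nat j * t" by (simp add: t_def)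
      then show ?thesis using up[OF t e, of "nat j"] by simp
    next
      case False
      then have "4 powr real_of_int j = 1 / 4 ^ nat (- j)" by (simp add: powr_real_of_int divide_inverse)
      then have "s = t / 4 ^ nat (- j)" by (simp add: t_def)
      then show ?thesis using down[OF t e, of "nat (- j)"] by simp
    qed
  qed
  show ?thesis
  proof (cases "0 < s")
    case True
    then show ?thesis using pos e by blast
  next
    case False
    with s have "0 < - s" by simp
    from pos[OF this e] obtain k m n where *: "balanced k m" "balanced k n" "0 < m" "\<bar>- s - of_int n / of_int m\<bar> < e" by blast
    have "\<bar>s - of_int (- n) / of_int m\<bar> = \<bar>- s - of_int n / of_int m\<bar>" by (simp add: abs_if)
    then show ?thesis using * balanced_uminus[OF *(2)]
      by (intro exI[of _ k] exI[of _ m] exI[of _ "- n"]) auto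
  qed
qed

lemma good_directions_uminus: "v \<in> good_directions \<Longrightarrow> - v \<in> good_directions"
proof -
  assume v: "v \<in> good_directions"
  let ?T = "(\<lambda>(x, y). snd v * x - fst v * y) ` four_corners_cantor_set"
  have im: "(\<lambda>(x, y). snd (- v) * x - fst (- v) * y) ` four_corners_cantor_set = (\<lambda>t. (-1) *\<^sub>R t + 0) ` ?T"
    unfolding image_image by (rule image_cong) auto
  have T: "?T \<in> null_sets lborel" using v by (simp add: good_directions_def)
  have "compact ?T" unfolding case_prod_beta
    by (intro compact_continuous_image compact_four_corners continuous_intros)
  have "closed ((\<lambda>t. (-1) *\<^sub>R t + 0) ` ?T)"
    by (intro compact_imp_closed compact_continuous_image continuous_intros \<open>compact ?T\<close>)
  moreover have "emeasure lebesgue ((\<lambda>t. (-1) *\<^sub>R t + 0) ` ?T) = 0"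
    unfolding emeasure_lebesgue_affine null_setsD1[OF null_sets_completionI[OF T]] by simp
  ultimately have "(\<lambda>t. (-1) *\<^sub>R t + 0) ` ?T \<in> null_sets lborel"
    by (intro null_setsI) auto
  then show ?thesis using v unfolding good_directions_def mem_Collect_eq im by simp
qed

lemma axis_directions: "(1, 0) \<in> good_directions" "(0, 1) \<in> good_directions"
proof -
  have "balanced (Suc 0) 1" "balanced (Suc 0) 0" using balanced_Suc[OF balanced_0, of 1] balanced_0' by auto
  from good_direction_balanced[OF this] good_direction_balanced[OF this(2,1)]
  show "(1, 0) \<in> good_directions" "(0, 1) \<in> good_directions" by (auto simp: norm_prod_def)
qed

lemma good_directions_dense:
  fixes w :: plane
  assumes w: "norm w = 1" and e: "0 < e"
  shows "\<exists>v\<in>good_directions. dist v w < e"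
proof -
  consider "fst w = 0" | "snd w = 0" | "fst w \<noteq> 0" "snd w \<noteq> 0" by blast
  then show ?thesis
  proof cases
    case 1
    then have "w = (0, 1) \<or> w = - (0, 1)" using w by (cases w) (auto simp: norm_prod_def abs_if split: if_splits)
    then have "w \<in> good_directions" using axis_directions good_directions_uminus by metis
    then show ?thesis using e by (intro bexI[of _ w]) auto
  next
    case 2
    then have "w = (1, 0) \<or> w = - (1, 0)" using w by (cases w) (auto simp: norm_prod_def abs_if split: if_splits)
    then have "w \<in> good_directions" using axis_directions good_directions_uminus by metis
    then show ?thesis using e by (intro bexI[of _ w]) auto
  next
    case 3
    define s where "s = snd w / fst w"
    define F where "F = (\<lambda>t::real. (sgn (fst w) / norm (1::real, t)) *\<^sub>R (1::real, t))"
    have nz: "norm (1::real, t) \<noteq> 0" for t :: real by (simp add: zero_prod_def)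
    have "isCont F s" unfolding F_def by (intro continuous_intros nz)
    then obtain d where d: "0 < d" "\<And>t. dist t s < d \<Longrightarrow> dist (F t) (F s) < e"
      using e unfolding continuous_at_eps_delta by blast
    have "w = fst w *\<^sub>R (1, s)" using 3 by (cases w) (simp add: s_def)
    then have "1 = \<bar>fst w\<bar> * norm (1::real, s)" using w by (metis norm_scaleR)
    then have "norm (1::real, s) = 1 / \<bar>fst w\<bar>" using 3 by (simp add: field_simps)
    then have Fs: "F s = w" using 3 unfolding F_def
      by (subst \<open>w = fst w *\<^sub>R (1, s)\<close>) (auto simp: sgn_if abs_if s_def prod_eq_iff)
    have "s \<noteq> 0" using 3 by (simp add: s_def)
    then obtain k m n where mn: "balanced k m" "balanced k n" "0 < m" "\<bar>s - of_int n / of_int m\<bar> < d"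
      using balanced_slope_approx d(1) by blast
    define t where "t = real_of_int n / real_of_int m"
    have G: "(1 / norm (real_of_int m, real_of_int n)) *\<^sub>R (real_of_int m, real_of_int n) \<in> good_directions"
      using good_direction_balanced[OF mn(1,2)] mn(3) by auto
    have mt: "(real_of_int m, real_of_int n) = of_int m *\<^sub>R (1, t)" using mn(3) by (simp add: t_def)
    have "(1 / norm (real_of_int m, real_of_int n)) *\<^sub>R (real_of_int m, real_of_int n) = (1 / norm (1::real, t)) *\<^sub>R (1, t)"
      unfolding mt norm_scaleR using mn(3) by simp
    with G have G': "(1 / norm (1::real, t)) *\<^sub>R (1, t) \<in> good_directions" by simp
    have "F t \<in> good_directions"
    proof (cases "0 < fst w")
      case True
      then show ?thesis using G' by (simp add: F_def)
    next
      case False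
      then have "F t = - ((1 / norm (1::real, t)) *\<^sub>R (1, t))" using 3 by (simp add: F_def)
      then show ?thesis using good_directions_uminus[OF G'] by simp
    qed
    moreover have "dist (F t) w < e"
      using d(2)[of t] mn(4) by (simp add: Fs t_def dist_real_def abs_minus_commute)
    ultimately show ?thesis by blast
  qed
qed

section \<open>Powers of extended nonnegative numbers\<close>

lemma ennreal_powr_ennreal: "0 \<le> x \<Longrightarrow> ennreal_powr (ennreal x) p = ennreal (x powr p)"
  by (simp add: ennreal_powr_def)

lemma ennreal_powr_top [simp]: "ennreal_powr top p = top"
  by (simp add: ennreal_powr_def)

lemma ennreal_powr_zero [simp]: "ennreal_powr 0 p = 0"
  by (simp add: ennreal_powr_def)

lemma ennreal_powr_mono: "0 \<le> p \<Longrightarrow> x \<le> y \<Longrightarrow> ennreal_powr x p \<le> ennreal_powr y p"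
  by (cases x rule: ennreal_cases; cases y rule: ennreal_cases)
     (auto simp: ennreal_powr_ennreal ennreal_leI powr_mono2 top_unique)

lemma ennreal_powr_measurable [measurable]: "(\<lambda>x. ennreal_powr x p) \<in> borel_measurable borel"
  unfolding ennreal_powr_def by measurable

lemma le_one_plus_ennreal_powr: "1 \<le> p \<Longrightarrow> x \<le> 1 + ennreal_powr x p"
proof (cases x rule: ennreal_cases)
  case (real r)
  assume p: "1 \<le> p"
  have "r \<le> 1 + r powr p"
  proof (cases "r \<le> 1")
    case True
    then show ?thesis using powr_ge_zero[of r p] by linarith
  next
    case False
    then have "r powr 1 \<le> r powr p" using p by (intro powr_mono) auto
    then show ?thesis using False by simp
  qed
  then have "ennreal r \<le> ennreal (1 + r powr p)" by (rule ennreal_leI)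
  then show ?thesis using real by (simp add: ennreal_powr_ennreal)
qed simp

lemma ennreal_powr_less_top_iff: "ennreal_powr x p < top \<longleftrightarrow> x < top"
  by (cases x rule: ennreal_cases) (auto simp: ennreal_powr_ennreal)

lemma ennreal_powr_cmult: "0 \<le> c \<Longrightarrow> ennreal_powr (ennreal c * x) p = ennreal (c powr p) * ennreal_powr x p"
  by (cases x rule: ennreal_cases)
     (auto simp: ennreal_powr_ennreal ennreal_mult[symmetric] powr_mult ennreal_mult_top)

text \<open>A weighted triangle inequality: the \<open>n\<close>-th term is at most a fraction \<open>2 ^ (-n - 1)\<close> of the
  \<open>p\<close>-th root of the right-hand side, and these fractions add up to \<open>1\<close>.\<close>

lemma ennreal_powr_suminf_le:
  assumes p: "1 \<le> p"
  shows "ennreal_powr (\<Sum>n. x n) p \<le> (\<Sum>n. ennreal ((2 ^ Suc n) powr p) * ennreal_powr (x n) p)"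
    (is "_ \<le> ?S")
proof (cases ?S rule: ennreal_cases)
  case (real s)
  have "x n \<le> ennreal (s powr (1 / p) * (1/2) ^ Suc n)" for n
  proof -
    define y where "y = ennreal (2 ^ Suc n) * x n"
    have "ennreal_powr y p = ennreal ((2 ^ Suc n) powr p) * ennreal_powr (x n) p"
      unfolding y_def by (rule ennreal_powr_cmult) simp
    also have "\<dots> \<le> ?S"
      using sum_le_suminf[of "\<lambda>n. ennreal ((2 ^ Suc n) powr p) * ennreal_powr (x n) p" "{n}"] by simp
    finally have y: "ennreal_powr y p \<le> ennreal s" using real by simp
    then have "y < top" using ennreal_powr_less_top_iff[of y p] by (metis ennreal_less_top order_le_less_trans)
    then obtain z where z: "y = ennreal z" "0 \<le> z" by (cases y rule: ennreal_cases) auto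
    with y real have "z powr p \<le> s" by (simp add: ennreal_powr_ennreal)
    then have "(z powr p) powr (1 / p) \<le> s powr (1 / p)" using p by (intro powr_mono2) auto
    then have zs: "z \<le> s powr (1 / p)" using z p by (simp add: powr_powr)
    have "x n = ennreal ((1/2) ^ Suc n) * y"
    proof -
      have "ennreal ((1/2) ^ Suc n) * ennreal (2 ^ Suc n) = 1"
        by (subst ennreal_mult[symmetric]) (auto simp: power_mult_distrib[symmetric])
      then show ?thesis unfolding y_def by (simp only: mult.assoc[symmetric] mult_1)
    qed
    also have "\<dots> = ennreal (z * (1/2) ^ Suc n)"
      unfolding z by (subst ennreal_mult[symmetric]) (auto simp: z mult.commute)
    also have "\<dots> \<le> ennreal (s powr (1 / p) * (1/2) ^ Suc n)"
      using zs by (intro ennreal_leI mult_right_mono) auto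
    finally show ?thesis .
  qed
  then have "(\<Sum>n. x n) \<le> (\<Sum>n. ennreal (s powr (1 / p) * (1/2) ^ Suc n))"
    by (intro suminf_le) auto
  also have "\<dots> = ennreal (s powr (1 / p) * 1)"
    by (intro suminf_ennreal_eq sums_mult power_half_series) auto
  finally have "ennreal_powr (\<Sum>n. x n) p \<le> ennreal_powr (ennreal (s powr (1 / p))) p"
    using p by (intro ennreal_powr_mono) auto
  also have "\<dots> = ennreal s" using p real by (simp add: ennreal_powr_ennreal powr_powr)
  finally show ?thesis using real by simp
qed simp

lemma ennreal_powr_add_le:
  assumes p: "1 \<le> p"
  shows "ennreal_powr (x + y) p \<le> ennreal (2 powr p) * (ennreal_powr x p + ennreal_powr y p)"
proof -
  have le: "ennreal_powr (x + y) p \<le> ennreal (2 powr p) * (ennreal_powr x p + ennreal_powr y p)"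
    if "x \<le> y" for x y
  proof -
    have "ennreal_powr (x + y) p \<le> ennreal_powr (ennreal 2 * y) p"
      using that p by (intro ennreal_powr_mono) (auto simp: mult_2 intro!: add_mono)
    also have "\<dots> = ennreal (2 powr p) * ennreal_powr y p" by (rule ennreal_powr_cmult) simp
    also have "\<dots> \<le> ennreal (2 powr p) * (ennreal_powr x p + ennreal_powr y p)"
      by (intro mult_left_mono) auto
    finally show ?thesis .
  qed
  show ?thesis
    using le[of x y] le[of y x] by (cases "x \<le> y") (auto simp: add.commute)
qed

section \<open>Curves\<close>

lemma curve_measurable:
  assumes "(l, \<gamma>) \<in> curves Z" "g \<in> borel_measurable (restrict_space borel Z)"
  shows "(\<lambda>t. g (\<gamma> t)) \<in> borel_measurable (lebesgue_on {0..l})"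
proof -
  have "\<gamma> \<in> borel_measurable (lebesgue_on {0..l})"
    using assms(1) by (intro continuous_imp_measurable_on_sets_lebesgue) (auto simp: curves_def)
  then have "\<gamma> \<in> lebesgue_on {0..l} \<rightarrow>\<^sub>M restrict_space borel Z"
    using assms(1) by (intro measurable_restrict_space2) (auto simp: curves_def)
  then show ?thesis using assms(2) by (rule measurable_compose)
qed

lemma borel_on_imp_lebesgue_on:
  assumes "g \<in> borel_measurable (restrict_space borel Z)"
  shows "g \<in> borel_measurable (lebesgue_on Z)"
proof -
  have "(\<lambda>x. x) \<in> lebesgue_on Z \<rightarrow>\<^sub>M restrict_space borel Z"
    by (intro measurable_restrict_space2 measurable_restrict_space1 measurable_completion) auto
  then show ?thesis using assms by (rule measurable_compose)
qed

lemma curve_length_shift: "curve_length (\<lambda>t. \<gamma> (a + t)) s t = curve_length \<gamma> (a + s) (a + t)"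
proof -
  let ?P = "\<lambda>s t. {(n :: nat, \<tau> :: nat \<Rightarrow> real). \<tau> 0 = s \<and> \<tau> n = t \<and> mono_on {..n} \<tau>}"
  have "?P (a + s) (a + t) = (\<lambda>(n, \<tau>). (n, \<lambda>i. a + \<tau> i)) ` ?P s t"
  proof (intro set_eqI iffI)
    fix x assume "x \<in> ?P (a + s) (a + t)"
    then show "x \<in> (\<lambda>(n, \<tau>). (n, \<lambda>i. a + \<tau> i)) ` ?P s t"
      by (cases x) (auto simp: mono_on_def image_iff intro!: exI[of _ "\<lambda>i. snd x i - a"])
  qed (auto simp: mono_on_def)
  then show ?thesis
    unfolding curve_length_def by (simp add: image_image case_prod_beta)
qed

lemma subcurve:
  assumes "(l, \<gamma>) \<in> curves Z" "0 \<le> a" "a < b" "b \<le> l"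
  shows "(b - a, \<lambda>t. \<gamma> (a + t)) \<in> curves Z"
proof -
  have c: "continuous_on {0..l} \<gamma>" "\<gamma> ` {0..l} \<subseteq> Z"
    "\<And>s t. 0 \<le> s \<Longrightarrow> s \<le> t \<Longrightarrow> t \<le> l \<Longrightarrow> curve_length \<gamma> s t = ennreal (t - s)"
    using assms(1) by (auto simp: curves_def)
  have "continuous_on {0..b - a} (\<lambda>t. \<gamma> (a + t))"
    by (intro continuous_on_compose2[OF c(1)] continuous_intros) (use assms in auto)
  moreover have "(\<lambda>t. \<gamma> (a + t)) ` {0..b - a} \<subseteq> Z" using c(2) assms by auto
  ultimately show ?thesis
    using assms c(3) by (auto simp: curves_def curve_length_shift)
qed

lemma curve_lipschitz:
  assumes "(l, \<gamma>) \<in> curves Z" "0 \<le> s" "s \<le> t" "t \<le> l"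
  shows "dist (\<gamma> s) (\<gamma> t) \<le> t - s"
proof -
  let ?P = "{(n :: nat, \<tau> :: nat \<Rightarrow> real). \<tau> 0 = s \<and> \<tau> n = t \<and> mono_on {..n} \<tau>}"
  have "(1, \<lambda>i. if i = 0 then s else t) \<in> ?P" using assms by (auto simp: mono_on_def)
  then have "(\<Sum>i<1. ennreal (dist (\<gamma> (if i = 0 then s else t)) (\<gamma> (if Suc i = 0 then s else t)))) \<le> curve_length \<gamma> s t"
    unfolding curve_length_def by (intro SUP_upper2[where i="(1, \<lambda>i. if i = 0 then s else t)"]) auto
  then have "ennreal (dist (\<gamma> s) (\<gamma> t)) \<le> curve_length \<gamma> s t" by simp
  also have "\<dots> = ennreal (t - s)" using assms by (auto simp: curves_def)
  finally show ?thesis using assms by simp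
qed

lemma segment_curve:
  fixes v :: plane
  assumes v: "norm v = 1" and l: "0 < l" and Z: "\<And>t. 0 \<le> t \<Longrightarrow> t \<le> l \<Longrightarrow> z + t *\<^sub>R v \<in> Z"
  shows "(l, \<lambda>t. z + t *\<^sub>R v) \<in> curves Z"
proof -
  have "curve_length (\<lambda>t. z + t *\<^sub>R v) s t = ennreal (t - s)" if st: "s \<le> t" for s t
  proof -
    let ?P = "{(n :: nat, \<tau> :: nat \<Rightarrow> real). \<tau> 0 = s \<and> \<tau> n = t \<and> mono_on {..n} \<tau>}"
    have "(\<Sum>i<n. ennreal (dist (z + \<tau> i *\<^sub>R v) (z + \<tau> (Suc i) *\<^sub>R v))) = ennreal (t - s)"
      if *: "(n, \<tau>) \<in> ?P" for n \<tau>
    proof -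
      have m: "\<tau> i \<le> \<tau> (Suc i)" if "i < n" for i
        using * that by (auto simp: mono_on_def)
      have "dist (z + \<tau> i *\<^sub>R v) (z + \<tau> (Suc i) *\<^sub>R v) = \<tau> (Suc i) - \<tau> i" if "i < n" for i
        using m[OF that] v by (simp add: dist_norm scaleR_left_diff_distrib[symmetric])
      then have "(\<Sum>i<n. ennreal (dist (z + \<tau> i *\<^sub>R v) (z + \<tau> (Suc i) *\<^sub>R v))) = (\<Sum>i<n. ennreal (\<tau> (Suc i) - \<tau> i))"
        by (intro sum.cong) auto
      also have "\<dots> = ennreal (\<Sum>i<n. \<tau> (Suc i) - \<tau> i)"
        using m by (intro sum_ennreal) auto
      also have "(\<Sum>i<n. \<tau> (Suc i) - \<tau> i) = t - s"
        using * by (subst sum_lessThan_telescope) auto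
      finally show ?thesis .
    qed
    then have "curve_length (\<lambda>t. z + t *\<^sub>R v) s t = (SUP x\<in>?P. ennreal (t - s))"
      unfolding curve_length_def by (intro SUP_cong refl) auto
    moreover have "(1, \<lambda>i. if i = 0 then s else t) \<in> ?P" using st by (auto simp: mono_on_def)
    then have "?P \<noteq> {}" by blast
    ultimately show ?thesis by (simp only: SUP_constant if_False)
  qed
  then show ?thesis using l Z
    by (auto simp: curves_def intro!: continuous_intros)
qed

lemma curve_integral_subcurve:
  assumes c: "(l, \<gamma>) \<in> curves Z" "0 \<le> a" "a < b" "b \<le> l"
    and g: "g \<in> borel_measurable (restrict_space borel Z)"
  shows "curve_integral (b - a) (\<lambda>t. \<gamma> (a + t)) g = (\<integral>\<^sup>+t\<in>{a..b}. g (\<gamma> t) \<partial>lebesgue)"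
proof -
  have m: "(\<lambda>t. g (\<gamma> t) * indicator {a..b} t) \<in> borel_measurable lebesgue"
  proof -
    have "(\<lambda>t. g (\<gamma> t) * indicator {0..l} t) \<in> borel_measurable lebesgue"
      by (rule borel_measurable_restrict_space_iff_ennreal[THEN iffD1, OF _ curve_measurable[OF c(1) g]]) auto
    then have "(\<lambda>t. g (\<gamma> t) * indicator {0..l} t * indicator {a..b} t) \<in> borel_measurable lebesgue"
      by (rule borel_measurable_times_ennreal[OF _ borel_measurable_indicator]) auto
    also have "(\<lambda>t. g (\<gamma> t) * indicator {0..l} t * indicator {a..b} t) = (\<lambda>t. g (\<gamma> t) * indicator {a..b} t)"
      using c by (auto simp: indicator_def fun_eq_iff)
    finally show ?thesis .
  qed
  have "curve_integral (b - a) (\<lambda>t. \<gamma> (a + t)) g = (\<integral>\<^sup>+t. g (\<gamma> (a + t)) * indicator {0..b - a} t \<partial>lebesgue)"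
    unfolding curve_integral_def by (intro nn_integral_restrict_space) auto
  also have "\<dots> = (\<integral>\<^sup>+t. g (\<gamma> (a + 1 * t)) * indicator {a..b} (a + 1 * t) \<partial>lebesgue)"
    by (intro nn_integral_cong) (auto simp: indicator_def)
  also have "\<dots> = (\<integral>\<^sup>+t. g (\<gamma> t) * indicator {a..b} t \<partial>lebesgue)"
    using nn_integral_real_affine_lebesgue[OF m, of 1 a] by simp
  finally show ?thesis .
qed

lemma curve_integral_eq: "curve_integral l \<gamma> g = (\<integral>\<^sup>+t\<in>{0..l}. g (\<gamma> t) \<partial>lebesgue)"
  unfolding curve_integral_def by (intro nn_integral_restrict_space) auto

section \<open>Exceptional families of curves\<close>

text \<open>Fuglede's description of families of zero modulus, which is how they are used below: a
  single function of finite energy has infinite integral along all their curves.\<close>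

lemma modulus_eq_0_iff:
  assumes p: "1 \<le> p" and \<Gamma>: "\<Gamma> \<subseteq> curves Z"
  shows "modulus p Z \<Gamma> = 0 \<longleftrightarrow> (\<exists>\<rho>\<in>borel_measurable (restrict_space borel Z).
     (\<integral>\<^sup>+x. ennreal_powr (\<rho> x) p \<partial>lebesgue_on Z) < top \<and> (\<forall>(l, \<gamma>)\<in>\<Gamma>. curve_integral l \<gamma> \<rho> = top))"
proof
  let ?A = "{\<rho> \<in> borel_measurable (restrict_space borel Z). \<forall>(l, \<gamma>) \<in> \<Gamma>. 1 \<le> curve_integral l \<gamma> \<rho>}"
  assume 0: "modulus p Z \<Gamma> = 0"
  (* Admissible functions of energy at most e n are summed. The weights c n are those of the
     triangle inequality for series, and e n makes the total energy at most 1. *)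
  define c where "c n = (2 ^ Suc n :: real) powr p" for n :: nat
  have c: "0 < c n" for n by (simp add: c_def)
  define e where "e n = (1/2 :: real) ^ Suc n / c n" for n
  have e: "0 < e n" for n using c[of n] by (simp add: e_def)
  have ce: "c n * e n = (1/2) ^ Suc n" for n using c[of n] by (simp add: e_def)
  have "\<exists>\<rho>. \<rho> \<in> ?A \<and> (\<integral>\<^sup>+x. ennreal_powr (\<rho> x) p \<partial>lebesgue_on Z) < ennreal (e n)" for n
  proof -
    have "modulus p Z \<Gamma> < ennreal (e n)" unfolding 0 using e by simp
    then show ?thesis unfolding modulus_def INF_less_iff by blast
  qed
  then have "\<exists>\<rho>. \<forall>n. \<rho> n \<in> ?A \<and> (\<integral>\<^sup>+x. ennreal_powr (\<rho> n x) p \<partial>lebesgue_on Z) < ennreal (e n)"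
    by (intro choice allI)
  then obtain \<rho> where \<rho>: "\<And>n. \<rho> n \<in> ?A"
      "\<And>n. (\<integral>\<^sup>+x. ennreal_powr (\<rho> n x) p \<partial>lebesgue_on Z) < ennreal (e n)"
    by blast
  have m: "\<rho> n \<in> borel_measurable (restrict_space borel Z)" for n using \<rho>(1) by blast
  have ml: "\<rho> n \<in> borel_measurable (lebesgue_on Z)" for n using m by (rule borel_on_imp_lebesgue_on)
  show "\<exists>\<rho>\<in>borel_measurable (restrict_space borel Z).
     (\<integral>\<^sup>+x. ennreal_powr (\<rho> x) p \<partial>lebesgue_on Z) < top \<and> (\<forall>(l, \<gamma>)\<in>\<Gamma>. curve_integral l \<gamma> \<rho> = top)"
  proof (intro bexI conjI)
    show "(\<lambda>x. \<Sum>n. \<rho> n x) \<in> borel_measurable (restrict_space borel Z)" using m by measurable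
    have "(\<integral>\<^sup>+x. ennreal_powr (\<Sum>n. \<rho> n x) p \<partial>lebesgue_on Z)
        \<le> (\<integral>\<^sup>+x. (\<Sum>n. ennreal (c n) * ennreal_powr (\<rho> n x) p) \<partial>lebesgue_on Z)"
      unfolding c_def by (intro nn_integral_mono ennreal_powr_suminf_le p)
    also have "\<dots> = (\<Sum>n. \<integral>\<^sup>+x. ennreal (c n) * ennreal_powr (\<rho> n x) p \<partial>lebesgue_on Z)"
      by (intro nn_integral_suminf borel_measurable_times_ennreal borel_measurable_const
          measurable_compose[OF ml ennreal_powr_measurable])
    also have "\<dots> = (\<Sum>n. ennreal (c n) * (\<integral>\<^sup>+x. ennreal_powr (\<rho> n x) p \<partial>lebesgue_on Z))"
      by (intro arg_cong[where f=suminf] ext nn_integral_cmult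
          measurable_compose[OF ml ennreal_powr_measurable])
    also have "\<dots> \<le> (\<Sum>n. ennreal (c n) * ennreal (e n))"
      by (intro suminf_le mult_left_mono less_imp_le[OF \<rho>(2)]) auto
    also have "\<dots> = (\<Sum>n. ennreal ((1/2) ^ Suc n))"
      by (subst ennreal_mult[symmetric]) (simp_all only: less_imp_le[OF c] less_imp_le[OF e] ce)
    also have "\<dots> = ennreal 1"
      by (intro suminf_ennreal_eq power_half_series) auto
    also have "\<dots> < top" by simp
    finally show "(\<integral>\<^sup>+x. ennreal_powr (\<Sum>n. \<rho> n x) p \<partial>lebesgue_on Z) < top" .
    have "curve_integral l \<gamma> (\<lambda>x. \<Sum>n. \<rho> n x) = top" if "(l, \<gamma>) \<in> \<Gamma>" for l \<gamma>
    proof -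
      have "curve_integral l \<gamma> (\<lambda>x. \<Sum>n. \<rho> n x) = (\<Sum>n. curve_integral l \<gamma> (\<rho> n))"
        unfolding curve_integral_def using that \<Gamma> by (intro nn_integral_suminf curve_measurable[OF _ m]) auto
      also have "\<dots> \<ge> (\<Sum>n. 1)" using \<rho>(1) that by (intro suminf_le) auto
      also have "(\<Sum>n. (1::ennreal)) = top"
      proof -
        have "of_nat N \<le> (\<Sum>n. (1::ennreal))" for N
          using sum_le_suminf[of "\<lambda>_. 1::ennreal" "{..<N}"] by simp
        note le = this
        show ?thesis
        proof (cases "\<Sum>n. (1::ennreal)" rule: ennreal_cases)
          case (real r)
          obtain N where "r < real N" using reals_Archimedean2 by blast
          then have "ennreal r < ennreal (real N)" using real by (simp add: ennreal_lessI)
          also have "\<dots> = of_nat N" by (simp add: ennreal_of_nat_eq_real_of_nat)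
          also have "\<dots> \<le> ennreal r" using le[of N] unfolding real(2) .
          finally show ?thesis by simp
        qed simp
      qed
      finally show ?thesis by (simp add: top_unique)
    qed
    then show "\<forall>(l, \<gamma>)\<in>\<Gamma>. curve_integral l \<gamma> (\<lambda>x. \<Sum>n. \<rho> n x) = top" by blast
  qed
next
  let ?A = "{\<rho> \<in> borel_measurable (restrict_space borel Z). \<forall>(l, \<gamma>) \<in> \<Gamma>. 1 \<le> curve_integral l \<gamma> \<rho>}"
  assume "\<exists>\<rho>\<in>borel_measurable (restrict_space borel Z).
     (\<integral>\<^sup>+x. ennreal_powr (\<rho> x) p \<partial>lebesgue_on Z) < top \<and> (\<forall>(l, \<gamma>)\<in>\<Gamma>. curve_integral l \<gamma> \<rho> = top)"
  then obtain \<rho> where \<rho>: "\<rho> \<in> borel_measurable (restrict_space borel Z)"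
     "(\<integral>\<^sup>+x. ennreal_powr (\<rho> x) p \<partial>lebesgue_on Z) < top" "\<And>l \<gamma>. (l, \<gamma>) \<in> \<Gamma> \<Longrightarrow> curve_integral l \<gamma> \<rho> = top"
    by blast
  obtain c where c: "(\<integral>\<^sup>+x. ennreal_powr (\<rho> x) p \<partial>lebesgue_on Z) = ennreal c" "0 \<le> c"
    using \<rho>(2) by (cases "\<integral>\<^sup>+x. ennreal_powr (\<rho> x) p \<partial>lebesgue_on Z" rule: ennreal_cases) auto
  (* All positive multiples of a function with infinite integrals are admissible. *)
  have le: "modulus p Z \<Gamma> \<le> ennreal ((1 / real (Suc n)) powr p * c)" for n
  proof -
    have "(\<lambda>x. ennreal (1 / real (Suc n)) * \<rho> x) \<in> ?A"
    proof (intro CollectI conjI)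
      show "(\<lambda>x. ennreal (1 / real (Suc n)) * \<rho> x) \<in> borel_measurable (restrict_space borel Z)"
        using \<rho>(1) by measurable
      have "curve_integral l \<gamma> (\<lambda>x. ennreal (1 / real (Suc n)) * \<rho> x) = top" if "(l, \<gamma>) \<in> \<Gamma>" for l \<gamma>
      proof -
        have "curve_integral l \<gamma> (\<lambda>x. ennreal (1 / real (Suc n)) * \<rho> x) = ennreal (1 / real (Suc n)) * curve_integral l \<gamma> \<rho>"
          unfolding curve_integral_def using that \<Gamma> by (intro nn_integral_cmult curve_measurable[OF _ \<rho>(1)]) auto
        then show ?thesis using \<rho>(3)[OF that] by (simp add: ennreal_mult_top)
      qed
      then show "\<forall>(l, \<gamma>)\<in>\<Gamma>. 1 \<le> curve_integral l \<gamma> (\<lambda>x. ennreal (1 / real (Suc n)) * \<rho> x)" by auto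
    qed
    then have "modulus p Z \<Gamma> \<le> (\<integral>\<^sup>+x. ennreal_powr (ennreal (1 / real (Suc n)) * \<rho> x) p \<partial>lebesgue_on Z)"
      unfolding modulus_def by (rule INF_lower)
    also have "\<dots> = (\<integral>\<^sup>+x. ennreal ((1 / real (Suc n)) powr p) * ennreal_powr (\<rho> x) p \<partial>lebesgue_on Z)"
      by (intro nn_integral_cong ennreal_powr_cmult) simp
    also have "\<dots> = ennreal ((1 / real (Suc n)) powr p) * ennreal c"
      unfolding c(1)[symmetric] using borel_on_imp_lebesgue_on[OF \<rho>(1)] by (intro nn_integral_cmult) measurable
    also have "\<dots> = ennreal ((1 / real (Suc n)) powr p * c)"
      using c(2) by (subst ennreal_mult) auto
    finally show ?thesis .
  qed
  have "(\<lambda>n. (1 / real (Suc n)) powr p * c) \<longlonglongrightarrow> 0 powr p * c"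
    using p LIMSEQ_inverse_real_of_nat
    by (intro tendsto_mult_right tendsto_powr') (auto simp: divide_inverse)
  then have "(\<lambda>n. ennreal ((1 / real (Suc n)) powr p * c)) \<longlonglongrightarrow> 0"
    using tendsto_ennrealI by fastforce
  then have "modulus p Z \<Gamma> \<le> 0" using le by (intro LIMSEQ_le_const[of _ 0 "modulus p Z \<Gamma>"]) auto
  then show "modulus p Z \<Gamma> = 0" by simp
qed

lemma almost_every_curve_iff:
  assumes "1 \<le> p"
  shows "almost_every_curve p Z P \<longleftrightarrow> (\<exists>\<rho>\<in>borel_measurable (restrict_space borel Z).
     (\<integral>\<^sup>+x. ennreal_powr (\<rho> x) p \<partial>lebesgue_on Z) < top \<and>
     (\<forall>(l, \<gamma>)\<in>curves Z. curve_integral l \<gamma> \<rho> < top \<longrightarrow> P l \<gamma>))"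
proof -
  have sub: "{(l, \<gamma>) \<in> curves Z. \<not> P l \<gamma>} \<subseteq> curves Z" by blast
  have "(\<forall>(l, \<gamma>)\<in>{(l, \<gamma>) \<in> curves Z. \<not> P l \<gamma>}. curve_integral l \<gamma> \<rho> = top) \<longleftrightarrow>
      (\<forall>(l, \<gamma>)\<in>curves Z. curve_integral l \<gamma> \<rho> < top \<longrightarrow> P l \<gamma>)" for \<rho>
    by (auto simp: less_top[symmetric])
  then show ?thesis
    unfolding almost_every_curve_def modulus_eq_0_iff[OF assms sub] by (simp only:)
qed

lemma almost_every_curve_mono:
  assumes "1 \<le> p" "almost_every_curve p Z P" "\<And>l \<gamma>. (l, \<gamma>) \<in> curves Z \<Longrightarrow> P l \<gamma> \<Longrightarrow> Q l \<gamma>"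
  shows "almost_every_curve p Z Q"
  using assms(2,3) unfolding almost_every_curve_iff[OF assms(1)] by blast

lemma energy_add_finite:
  assumes p: "1 \<le> p" and f: "f \<in> borel_measurable M" "(\<integral>\<^sup>+x. ennreal_powr (f x) p \<partial>M) < top"
    and g: "g \<in> borel_measurable M" "(\<integral>\<^sup>+x. ennreal_powr (g x) p \<partial>M) < top"
  shows "(\<integral>\<^sup>+x. ennreal_powr (f x + g x) p \<partial>M) < top"
proof -
  have "(\<integral>\<^sup>+x. ennreal_powr (f x + g x) p \<partial>M)
      \<le> (\<integral>\<^sup>+x. ennreal (2 powr p) * (ennreal_powr (f x) p + ennreal_powr (g x) p) \<partial>M)"
    by (intro nn_integral_mono ennreal_powr_add_le p)
  also have "\<dots> = ennreal (2 powr p) * ((\<integral>\<^sup>+x. ennreal_powr (f x) p \<partial>M) + (\<integral>\<^sup>+x. ennreal_powr (g x) p \<partial>M))"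
    using measurable_compose[OF f(1) ennreal_powr_measurable] measurable_compose[OF g(1) ennreal_powr_measurable]
    by (simp add: nn_integral_cmult nn_integral_add)
  also have "\<dots> < top" using f g by (simp add: ennreal_mult_less_top)
  finally show ?thesis .
qed

lemma almost_every_curve_conj:
  assumes p: "1 \<le> p" and P: "almost_every_curve p Z P" and Q: "almost_every_curve p Z Q"
  shows "almost_every_curve p Z (\<lambda>l \<gamma>. P l \<gamma> \<and> Q l \<gamma>)"
proof -
  obtain \<rho> where \<rho>: "\<rho> \<in> borel_measurable (restrict_space borel Z)"
     "(\<integral>\<^sup>+x. ennreal_powr (\<rho> x) p \<partial>lebesgue_on Z) < top"
     "\<And>l \<gamma>. (l, \<gamma>)\<in>curves Z \<Longrightarrow> curve_integral l \<gamma> \<rho> < top \<Longrightarrow> P l \<gamma>"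
    using P unfolding almost_every_curve_iff[OF p] by blast
  obtain \<sigma> where \<sigma>: "\<sigma> \<in> borel_measurable (restrict_space borel Z)"
     "(\<integral>\<^sup>+x. ennreal_powr (\<sigma> x) p \<partial>lebesgue_on Z) < top"
     "\<And>l \<gamma>. (l, \<gamma>)\<in>curves Z \<Longrightarrow> curve_integral l \<gamma> \<sigma> < top \<Longrightarrow> Q l \<gamma>"
    using Q unfolding almost_every_curve_iff[OF p] by blast
  have le: "curve_integral l \<gamma> \<rho> \<le> curve_integral l \<gamma> (\<lambda>x. \<rho> x + \<sigma> x)"
    "curve_integral l \<gamma> \<sigma> \<le> curve_integral l \<gamma> (\<lambda>x. \<rho> x + \<sigma> x)" for l \<gamma>
    unfolding curve_integral_def by (auto intro!: nn_integral_mono)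
  show ?thesis unfolding almost_every_curve_iff[OF p]
  proof (intro bexI[of _ "\<lambda>x. \<rho> x + \<sigma> x"] conjI)
    show "(\<integral>\<^sup>+x. ennreal_powr (\<rho> x + \<sigma> x) p \<partial>lebesgue_on Z) < top"
      using \<rho> \<sigma> by (intro energy_add_finite p borel_on_imp_lebesgue_on)
    show "\<forall>(l, \<gamma>)\<in>curves Z. curve_integral l \<gamma> (\<lambda>x. \<rho> x + \<sigma> x) < top \<longrightarrow> P l \<gamma> \<and> Q l \<gamma>"
    proof clarify
      fix l \<gamma> assume c: "(l, \<gamma>) \<in> curves Z" and f: "curve_integral l \<gamma> (\<lambda>x. \<rho> x + \<sigma> x) < top"
      show "P l \<gamma> \<and> Q l \<gamma>"
        using \<rho>(3)[OF c] \<sigma>(3)[OF c] order_le_less_trans[OF le(1) f] order_le_less_trans[OF le(2) f] by blast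
    qed
    show "(\<lambda>x. \<rho> x + \<sigma> x) \<in> borel_measurable (restrict_space borel Z)" using \<rho> \<sigma> by measurable
  qed
qed

text \<open>The function that is infinite on a Borel null set containing \<open>N\<close> has zero energy, and its
  integral is infinite along the curves that spend positive length there.\<close>

lemma almost_every_curve_avoids_null:
  assumes p: "1 \<le> p" and Z: "Z \<in> sets lebesgue" and N: "N \<in> null_sets lebesgue"
  shows "almost_every_curve p Z (\<lambda>l \<gamma>. AE t in lebesgue_on {0..l}. \<gamma> t \<notin> N)"
proof -
  obtain N' where N': "N' \<in> null_sets lborel" "N \<subseteq> N'"
    using N by (auto simp: null_sets_completion_iff2)
  have [measurable]: "N' \<in> sets borel" using N' by auto
  define \<rho> where "\<rho> = (\<lambda>x::plane. top * indicator N' x :: ennreal)"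
  have [measurable]: "\<rho> \<in> borel_measurable borel" unfolding \<rho>_def by measurable
  have m: "\<rho> \<in> borel_measurable (restrict_space borel Z)" by (intro measurable_restrict_space1) measurable
  show ?thesis unfolding almost_every_curve_iff[OF p]
  proof (rule bexI[OF _ m], rule conjI)
    have "AE x in lebesgue. x \<notin> N'" by (rule AE_not_in[OF null_sets_completionI[OF N'(1)]])
    then have "AE x in lebesgue_on Z. ennreal_powr (\<rho> x) p = 0"
      using Z by (subst AE_restrict_space_iff) (auto simp: \<rho>_def elim!: eventually_mono)
    then have "(\<integral>\<^sup>+x. ennreal_powr (\<rho> x) p \<partial>lebesgue_on Z) = (\<integral>\<^sup>+x. 0 \<partial>lebesgue_on Z)"
      by (rule nn_integral_cong_AE)
    then show "(\<integral>\<^sup>+x. ennreal_powr (\<rho> x) p \<partial>lebesgue_on Z) < top" by simp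
    show "\<forall>(l, \<gamma>)\<in>curves Z. curve_integral l \<gamma> \<rho> < top \<longrightarrow> (AE t in lebesgue_on {0..l}. \<gamma> t \<notin> N)"
    proof clarify
    fix l \<gamma> assume c: "(l, \<gamma>) \<in> curves Z" and f: "curve_integral l \<gamma> \<rho> < top"
    have "AE t in lebesgue_on {0..l}. \<rho> (\<gamma> t) \<noteq> top"
      using f unfolding curve_integral_def
      by (intro nn_integral_PInf_AE[unfolded infinity_ennreal_def] curve_measurable[OF c m]) auto
    then show "AE t in lebesgue_on {0..l}. \<gamma> t \<notin> N"
      by eventually_elim (use N' in \<open>auto simp: \<rho>_def indicator_def split: if_splits\<close>)
    qed
  qed
qed

lemma null_sets_of_AE_lebesgue:
  assumes "AE x in lebesgue. P x"
  shows "{x. \<not> P x} \<in> null_sets lebesgue"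
proof -
  obtain N where "N \<in> null_sets lebesgue" "{x \<in> space lebesgue. \<not> P x} \<subseteq> N"
    using assms unfolding eventually_ae_filter by blast
  then show ?thesis by (intro null_sets_completion_subset[of "{x. \<not> P x}" N]) auto
qed

lemma lebesgue_on_borel_version:
  fixes g :: "plane \<Rightarrow> ennreal"
  assumes Z: "Z \<in> sets lebesgue" and g: "g \<in> borel_measurable (lebesgue_on Z)"
  obtains g' where "g' \<in> borel_measurable borel" "AE x in lebesgue_on Z. g x = g' x"
     "{x \<in> Z. g x \<noteq> g' x} \<in> null_sets lebesgue"
proof -
  have "(\<lambda>x. g x * indicator Z x) \<in> borel_measurable lebesgue"
    by (rule borel_measurable_restrict_space_iff_ennreal[THEN iffD1, OF _ g]) (use Z in auto)
  then obtain g' where g': "g' \<in> borel_measurable lborel" "AE x in lborel. g x * indicator Z x = g' x"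
    using completion_ex_borel_measurable by blast
  then have ae: "AE x in lebesgue. g x * indicator Z x = g' x" by (simp add: AE_completion_iff)
  then have n: "{x. g x * indicator Z x \<noteq> g' x} \<in> null_sets lebesgue"
    by (rule null_sets_of_AE_lebesgue)
  show ?thesis
  proof (rule that[of g'])
    show "g' \<in> borel_measurable borel" using g' by simp
    show "AE x in lebesgue_on Z. g x = g' x"
      using ae Z by (subst AE_restrict_space_iff) (auto elim!: eventually_mono)
    show "{x \<in> Z. g x \<noteq> g' x} \<in> null_sets lebesgue"
      by (rule null_sets_completion_subset[OF _ n]) (auto simp: indicator_def)
  qed
qed

section \<open>Directional slope bounds\<close>

subsection \<open>Translations and test functions\<close>

lemma nn_integral_translate:
  fixes f :: "'a::euclidean_space \<Rightarrow> ennreal"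
  assumes [measurable]: "f \<in> borel_measurable borel"
  shows "(\<integral>\<^sup>+z. f (z + a) \<partial>lborel) = (\<integral>\<^sup>+z. f z \<partial>lborel)"
proof -
  have "(\<integral>\<^sup>+z. f z \<partial>lborel) = (\<integral>\<^sup>+z. f z \<partial>distr lborel borel ((+) a))" by (simp only: lborel_distr_plus)
  also have "\<dots> = (\<integral>\<^sup>+z. f (a + z) \<partial>lborel)" by (intro nn_integral_distr) auto
  finally show ?thesis by (simp add: add.commute)
qed

lemma integral_translate:
  fixes f :: "'a::euclidean_space \<Rightarrow> real"
  assumes [measurable]: "f \<in> borel_measurable borel"
  shows "(\<integral>z. f (z + a) \<partial>lborel) = (\<integral>z. f z \<partial>lborel)"
proof -
  have "(\<integral>z. f z \<partial>lborel) = (\<integral>z. f z \<partial>distr lborel borel ((+) a))" by (simp only: lborel_distr_plus)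
  also have "\<dots> = (\<integral>z. f (a + z) \<partial>lborel)" by (intro integral_distr) auto
  finally show ?thesis by (simp add: add.commute)
qed

lemma AE_translate:
  fixes P :: "'a::euclidean_space \<Rightarrow> bool"
  assumes "AE z in lborel. P z"
  shows "AE z in lborel. P (z + a)"
proof -
  obtain N where N: "N \<in> null_sets lborel" "{z. \<not> P z} \<subseteq> N"
    using assms by (auto simp: eventually_ae_filter)
  have [measurable]: "N \<in> sets borel" using N by auto
  have "(\<integral>\<^sup>+z. indicator N (z + a) \<partial>lborel) = (\<integral>\<^sup>+z. indicator N z \<partial>lborel)"
    by (rule nn_integral_translate) measurable
  also have "\<dots> = 0" using N by (subst nn_integral_indicator) auto
  finally have "AE z in lborel. indicator N (z + a) = (0::ennreal)"
    by (subst (asm) nn_integral_0_iff_AE) auto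
  then show ?thesis by eventually_elim (use N in \<open>auto simp: indicator_def split: if_splits\<close>)
qed

definition test_function :: "plane set \<Rightarrow> (plane \<Rightarrow> real) \<Rightarrow> bool" where
  "test_function U \<phi> \<longleftrightarrow> (\<forall>z. 0 \<le> \<phi> z) \<and> (\<exists>L. L-lipschitz_on UNIV \<phi>) \<and>
     (\<exists>K. compact K \<and> K \<subseteq> U \<and> (\<forall>z. z \<notin> K \<longrightarrow> \<phi> z = 0))"

lemma test_functionD:
  assumes "test_function U \<phi>"
  shows "\<exists>L K. 0 < L \<and> (\<forall>x y. \<bar>\<phi> x - \<phi> y\<bar> \<le> L * dist x y) \<and> compact K \<and> K \<subseteq> U \<and>
    (\<forall>z. z \<notin> K \<longrightarrow> \<phi> z = 0) \<and> (\<forall>z. 0 \<le> \<phi> z) \<and> (\<forall>z. \<phi> z \<le> L)"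
proof -
  obtain L K where L: "L-lipschitz_on UNIV \<phi>" and K: "compact K" "K \<subseteq> U" "\<And>z. z \<notin> K \<Longrightarrow> \<phi> z = 0" and p: "\<And>z. 0 \<le> \<phi> z"
    using assms unfolding test_function_def by blast
  have "continuous_on K \<phi>"
    using lipschitz_on_continuous_on[OF L] continuous_on_subset by blast
  then have "bounded (\<phi> ` K)" using K(1) compact_continuous_image compact_imp_bounded by blast
  then obtain M where M: "\<And>z. z \<in> K \<Longrightarrow> norm (\<phi> z) \<le> M" unfolding bounded_iff by blast
  define B where "B = \<bar>L\<bar> + \<bar>M\<bar> + 1"
  have "\<bar>\<phi> x - \<phi> y\<bar> \<le> B * dist x y" for x y
  proof -
    have "\<bar>\<phi> x - \<phi> y\<bar> \<le> L * dist x y" using lipschitz_onD[OF L, of x y] by (simp add: dist_real_def)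
    also have "\<dots> \<le> B * dist x y" by (intro mult_right_mono) (auto simp: B_def)
    finally show ?thesis .
  qed
  moreover have "\<phi> z \<le> B" for z
    using M[of z] K(3)[of z] by (cases "z \<in> K") (auto simp: B_def)
  moreover have "0 < B" by (auto simp: B_def)
  ultimately show ?thesis using K p by (intro exI[of _ B] exI[of _ K]) blast
qed

lemma test_function_measurable [measurable_dest]: "test_function U \<phi> \<Longrightarrow> \<phi> \<in> borel_measurable borel"
  unfolding test_function_def
  using borel_measurable_continuous_onI lipschitz_on_continuous_on by blast

definition locally_integrable :: "(plane \<Rightarrow> real) \<Rightarrow> bool" where
  "locally_integrable u \<longleftrightarrow> u \<in> borel_measurable borel \<and>
     (\<forall>K. compact K \<longrightarrow> (\<integral>\<^sup>+z\<in>K. ennreal \<bar>u z\<bar> \<partial>lborel) < top)"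

lemma integrable_mult_test:
  assumes u: "locally_integrable u" and \<phi>: "test_function U \<phi>"
  shows "integrable lborel (\<lambda>z. u z * \<phi> (z + a))"
proof -
  obtain L K where L: "0 < L" "\<And>x y. \<bar>\<phi> x - \<phi> y\<bar> \<le> L * dist x y" "compact K" "K \<subseteq> U"
    "\<And>z. z \<notin> K \<Longrightarrow> \<phi> z = 0" "\<And>z. 0 \<le> \<phi> z" "\<And>z. \<phi> z \<le> L"
    using test_functionD[OF \<phi>] by blast
  note [measurable] = test_function_measurable[OF \<phi>]
  have [measurable]: "u \<in> borel_measurable borel" using u by (auto simp: locally_integrable_def)
  define K' where "K' = (\<lambda>z. z - a) ` K"
  have K': "compact K'" unfolding K'_def by (intro compact_continuous_image continuous_intros L)
  have [measurable]: "K' \<in> sets borel" using K' by (simp add: borel_closed compact_imp_closed)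
  show ?thesis
  proof (rule integrableI_bounded)
    show "(\<lambda>z. u z * \<phi> (z + a)) \<in> borel_measurable lborel" by measurable
    have "(\<integral>\<^sup>+z. ennreal (norm (u z * \<phi> (z + a))) \<partial>lborel) \<le> (\<integral>\<^sup>+z. ennreal L * (ennreal \<bar>u z\<bar> * indicator K' z) \<partial>lborel)"
    proof (rule nn_integral_mono)
      fix z
      have "z + a \<notin> K" if "z \<notin> K'" using that unfolding K'_def by (auto simp: image_iff)
      then show "ennreal (norm (u z * \<phi> (z + a))) \<le> ennreal L * (ennreal \<bar>u z\<bar> * indicator K' z)"
        using L(1) L(5,6,7)[of "z + a"]
        by (cases "z \<in> K'") (auto simp: abs_mult ennreal_mult[symmetric] mult.commute[of "\<bar>u z\<bar>"] intro!: ennreal_leI mult_right_mono)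
    qed
    also have "\<dots> = ennreal L * (\<integral>\<^sup>+z\<in>K'. ennreal \<bar>u z\<bar> \<partial>lborel)"
      by (intro nn_integral_cmult) measurable
    also have "\<dots> < \<infinity>" using u K' by (auto simp: locally_integrable_def ennreal_mult_less_top)
    finally show "(\<integral>\<^sup>+z. ennreal (norm (u z * \<phi> (z + a))) \<partial>lborel) < \<infinity>" .
  qed
qed

subsection \<open>Slope bounds\<close>

text \<open>Tested against nonnegative \<open>\<phi>\<close>, this says that the distributional derivative of \<open>u\<close> in the
  direction \<open>v\<close> is bounded by \<open>h\<close> in \<open>U\<close>. Difference quotients of \<open>\<phi>\<close> take the place of its
  derivative, so that Lipschitz test functions suffice and no limit has to exist.\<close>

definition slope_bound :: "plane set \<Rightarrow> (plane \<Rightarrow> real) \<Rightarrow> (plane \<Rightarrow> ennreal) \<Rightarrow> plane \<Rightarrow> bool" where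
  "slope_bound U u h v \<longleftrightarrow> (\<forall>\<phi>. test_function U \<phi> \<longrightarrow> (\<forall>e>0. \<forall>\<^sub>F \<delta> in at_right 0.
     ennreal \<bar>\<integral>z. u z * (\<phi> (z + \<delta> *\<^sub>R v) - \<phi> z) \<partial>lborel\<bar>
       \<le> ennreal \<delta> * ((\<integral>\<^sup>+z. h z * ennreal (\<phi> z) \<partial>lborel) + ennreal e)))"

definition integrable_on_compacts :: "plane set \<Rightarrow> (plane \<Rightarrow> ennreal) \<Rightarrow> bool" where
  "integrable_on_compacts U h \<longleftrightarrow> h \<in> borel_measurable borel \<and>
     (\<forall>K. compact K \<longrightarrow> K \<subseteq> U \<longrightarrow> (\<integral>\<^sup>+z\<in>K. h z \<partial>lborel) < top)"

lemma slope_bound_cong: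
  assumes "slope_bound U u h v" "AE z in lborel. z \<in> U \<longrightarrow> h z = h' z"
  shows "slope_bound U u h' v"
proof -
  have "(\<integral>\<^sup>+z. h z * ennreal (\<phi> z) \<partial>lborel) = (\<integral>\<^sup>+z. h' z * ennreal (\<phi> z) \<partial>lborel)" if "test_function U \<phi>" for \<phi>
  proof (rule nn_integral_cong_AE)
    have "\<phi> z = 0" if "z \<notin> U" for z using \<open>test_function U \<phi>\<close> that unfolding test_function_def by blast
    then show "AE z in lborel. h z * ennreal (\<phi> z) = h' z * ennreal (\<phi> z)"
      using assms(2) by (auto elim!: eventually_mono)
  qed
  then show ?thesis using assms(1) unfolding slope_bound_def by simp
qed

lemma finite_test_integral:
  assumes h: "integrable_on_compacts U h" and \<phi>: "test_function U \<phi>"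
  shows "(\<integral>\<^sup>+z. h z * ennreal (\<phi> z) \<partial>lborel) < top"
proof -
  obtain L K where L: "0 < L" "\<And>x y. \<bar>\<phi> x - \<phi> y\<bar> \<le> L * dist x y" "compact K" "K \<subseteq> U"
    "\<And>z. z \<notin> K \<Longrightarrow> \<phi> z = 0" "\<And>z. 0 \<le> \<phi> z" "\<And>z. \<phi> z \<le> L"
    using test_functionD[OF \<phi>] by blast
  have [measurable]: "K \<in> sets borel" using L(3) by (simp add: borel_closed compact_imp_closed)
  have [measurable]: "h \<in> borel_measurable borel" using h by (simp add: integrable_on_compacts_def)
  have "(\<integral>\<^sup>+z. h z * ennreal (\<phi> z) \<partial>lborel) \<le> (\<integral>\<^sup>+z. ennreal L * (h z * indicator K z) \<partial>lborel)"
  proof (rule nn_integral_mono)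
    fix z
    show "h z * ennreal (\<phi> z) \<le> ennreal L * (h z * indicator K z)"
      using L(5,7)[of z] by (cases "z \<in> K") (auto simp: mult.commute[of "h z"] intro!: mult_right_mono ennreal_leI)
  qed
  also have "\<dots> = ennreal L * (\<integral>\<^sup>+z\<in>K. h z \<partial>lborel)" by (intro nn_integral_cmult) measurable
  also have "\<dots> < top" using h L(3,4) by (auto simp: integrable_on_compacts_def ennreal_mult_less_top)
  finally show ?thesis .
qed

text \<open>Integrating the estimate along segments against \<open>\<phi>\<close> and translating the difference quotient
  from \<open>u\<close> to \<open>\<phi>\<close> gives the slope bound.\<close>

lemma slope_bound_of_segments:
  fixes w :: plane
  assumes u: "locally_integrable u" and U: "open U" and h: "integrable_on_compacts U h" and w: "norm w = 1"
    and seg: "\<And>\<delta>. 0 < \<delta> \<Longrightarrow> AE z in lborel. (\<forall>s\<in>{0..\<delta>}. z + s *\<^sub>R w \<in> U) \<longrightarrow>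
        ennreal \<bar>u (z + \<delta> *\<^sub>R w) - u z\<bar> \<le> (\<integral>\<^sup>+s\<in>{0..\<delta>}. h (z + s *\<^sub>R w) \<partial>lborel)"
  shows "slope_bound U u h (- w)"
  unfolding slope_bound_def
proof (intro allI impI)
  fix \<phi> and e :: real assume \<phi>: "test_function U \<phi>" and e: "0 < e"
  obtain L K where L: "0 < L" "\<And>x y. \<bar>\<phi> x - \<phi> y\<bar> \<le> L * dist x y" "compact K" "K \<subseteq> U"
    "\<And>z. z \<notin> K \<Longrightarrow> \<phi> z = 0" "\<And>z. 0 \<le> \<phi> z" "\<And>z. \<phi> z \<le> L"
    using test_functionD[OF \<phi>] by blast
  note [measurable] = test_function_measurable[OF \<phi>]
  have [measurable]: "u \<in> borel_measurable borel" using u by (auto simp: locally_integrable_def)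
  have [measurable]: "h \<in> borel_measurable borel" using h by (simp add: integrable_on_compacts_def)
  obtain r where r: "0 < r" "(\<Union>x\<in>K. cball x r) \<subseteq> U"
    using compact_subset_open_imp_cball_epsilon_subset[OF L(3) U L(4)] by blast
  define K1 where "K1 = (\<Union>x\<in>K. cball x r)"
  have K1: "compact K1" "K1 \<subseteq> U" using compact_minkowski_sum_cball[OF L(3)] r by (auto simp: K1_def)
  have [measurable]: "K1 \<in> sets borel" using K1(1) by (simp add: borel_closed compact_imp_closed)
  have "(\<integral>\<^sup>+z\<in>K1. h z \<partial>lborel) < top" using h K1 by (auto simp: integrable_on_compacts_def)
  then obtain m where m: "(\<integral>\<^sup>+z\<in>K1. h z \<partial>lborel) = ennreal m" "0 \<le> m"
    by (cases "\<integral>\<^sup>+z\<in>K1. h z \<partial>lborel" rule: ennreal_cases) auto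
  (* Translating \<phi> by at most \<delta> changes it by at most L * \<delta> on K1, so the integral of h against
     it changes by at most L * \<delta> * m. The second term of the minimum makes this at most e. *)
  define d where "d = min r (e / (L * m + 1))"
  have Lm: "0 < L * m + 1" using L(1) m(2) by (simp add: add_nonneg_pos)
  have d: "0 < d" using r e Lm by (simp add: d_def)
  have "ennreal \<bar>\<integral>z. u z * (\<phi> (z + \<delta> *\<^sub>R - w) - \<phi> z) \<partial>lborel\<bar>
       \<le> ennreal \<delta> * ((\<integral>\<^sup>+z. h z * ennreal (\<phi> z) \<partial>lborel) + ennreal e)"
    if \<delta>: "0 < \<delta>" "\<delta> < d" for \<delta>
  proof -
    have \<delta>r: "\<delta> \<le> r" using \<delta> by (simp add: d_def)
    have Lme: "L * \<delta> * m \<le> e"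
    proof -
      have "\<delta> * (L * m + 1) \<le> e" using \<delta> Lm by (simp add: d_def pos_less_divide_eq)
      then show ?thesis using \<delta> by (simp add: algebra_simps)
    qed
    have int1: "integrable lborel (\<lambda>z. u z * \<phi> (z + a))" for a
      by (rule integrable_mult_test[OF u \<phi>])
    have int2: "integrable lborel (\<lambda>z. u (z + \<delta> *\<^sub>R w) * \<phi> z)"
    proof -
      have "integrable (distr lborel borel ((+) (\<delta> *\<^sub>R w))) (\<lambda>z. u z * \<phi> (z + (- \<delta> *\<^sub>R w)))"
        unfolding lborel_distr_plus by (rule int1)
      then have "integrable lborel (\<lambda>z. u (\<delta> *\<^sub>R w + z) * \<phi> (\<delta> *\<^sub>R w + z + (- \<delta> *\<^sub>R w)))"
        by (subst (asm) integrable_distr_eq) (auto simp: comp_def)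
      then show ?thesis by (simp add: add.commute)
    qed
    have "(\<integral>z. u z * (\<phi> (z + \<delta> *\<^sub>R - w) - \<phi> z) \<partial>lborel) =
        (\<integral>z. u z * \<phi> (z + (- \<delta> *\<^sub>R w)) \<partial>lborel) - (\<integral>z. u z * \<phi> z \<partial>lborel)"
      using int1[of "- \<delta> *\<^sub>R w"] int1[of 0]
      by (subst Bochner_Integration.integral_diff[symmetric]) (auto simp: right_diff_distrib)
    also have "(\<integral>z. u z * \<phi> (z + (- \<delta> *\<^sub>R w)) \<partial>lborel) = (\<integral>z. u (z + \<delta> *\<^sub>R w) * \<phi> (z + \<delta> *\<^sub>R w + (- \<delta> *\<^sub>R w)) \<partial>lborel)"
      by (rule integral_translate[symmetric]) measurable
    also have "\<dots> = (\<integral>z. u (z + \<delta> *\<^sub>R w) * \<phi> z \<partial>lborel)" by simp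
    also have "\<dots> - (\<integral>z. u z * \<phi> z \<partial>lborel) = (\<integral>z. (u (z + \<delta> *\<^sub>R w) - u z) * \<phi> z \<partial>lborel)"
      using int2 int1[of 0]
      by (subst Bochner_Integration.integral_diff[symmetric]) (auto simp: left_diff_distrib)
    finally have eq: "(\<integral>z. u z * (\<phi> (z + \<delta> *\<^sub>R - w) - \<phi> z) \<partial>lborel) = (\<integral>z. (u (z + \<delta> *\<^sub>R w) - u z) * \<phi> z \<partial>lborel)" .
    have int3: "integrable lborel (\<lambda>z. (u (z + \<delta> *\<^sub>R w) - u z) * \<phi> z)"
      using Bochner_Integration.integrable_diff[OF int2 int1[of 0]] by (simp add: left_diff_distrib)
    have "ennreal \<bar>\<integral>z. (u (z + \<delta> *\<^sub>R w) - u z) * \<phi> z \<partial>lborel\<bar> \<le> (\<integral>\<^sup>+z. ennreal \<bar>(u (z + \<delta> *\<^sub>R w) - u z) * \<phi> z\<bar> \<partial>lborel)"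
      using integral_norm_bound_ennreal[OF int3] by simp
    also have "\<dots> \<le> (\<integral>\<^sup>+z. (\<integral>\<^sup>+s\<in>{0..\<delta>}. h (z + s *\<^sub>R w) \<partial>lborel) * ennreal (\<phi> z) \<partial>lborel)"
    proof (rule nn_integral_mono_AE)
      show "AE z in lborel. ennreal \<bar>(u (z + \<delta> *\<^sub>R w) - u z) * \<phi> z\<bar> \<le> (\<integral>\<^sup>+s\<in>{0..\<delta>}. h (z + s *\<^sub>R w) \<partial>lborel) * ennreal (\<phi> z)"
        using seg[OF \<delta>(1)]
      proof eventually_elim
        case (elim z)
        show ?case
        proof (cases "z \<in> K")
          case True
          have "z + s *\<^sub>R w \<in> U" if "s \<in> {0..\<delta>}" for s
          proof -
            have "z + s *\<^sub>R w \<in> cball z r" using that \<delta>r w by (simp add: dist_norm)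
            then show ?thesis using r(2) True by blast
          qed
          then have "ennreal \<bar>u (z + \<delta> *\<^sub>R w) - u z\<bar> \<le> (\<integral>\<^sup>+s\<in>{0..\<delta>}. h (z + s *\<^sub>R w) \<partial>lborel)" using elim by blast
          then show ?thesis using L(6)[of z] by (auto simp: abs_mult ennreal_mult intro!: mult_right_mono)
        next
          case False
          then show ?thesis using L(5) by simp
        qed
      qed
    qed
    also have "\<dots> = (\<integral>\<^sup>+z. (\<integral>\<^sup>+s. h (z + s *\<^sub>R w) * indicator {0..\<delta>} s * ennreal (\<phi> z) \<partial>lborel) \<partial>lborel)"
      by (intro nn_integral_cong nn_integral_multc[symmetric]) measurable
    also have "\<dots> = (\<integral>\<^sup>+s. (\<integral>\<^sup>+z. h (z + s *\<^sub>R w) * indicator {0..\<delta>} s * ennreal (\<phi> z) \<partial>lborel) \<partial>lborel)"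
      by (intro lborel_pair.Fubini'[symmetric]) measurable
    also have "\<dots> \<le> (\<integral>\<^sup>+s. ((\<integral>\<^sup>+z. h z * ennreal (\<phi> z) \<partial>lborel) + ennreal e) * indicator {0..\<delta>} s \<partial>lborel)"
    proof (rule nn_integral_mono)
      fix s :: real
      show "(\<integral>\<^sup>+z. h (z + s *\<^sub>R w) * indicator {0..\<delta>} s * ennreal (\<phi> z) \<partial>lborel)
         \<le> ((\<integral>\<^sup>+z. h z * ennreal (\<phi> z) \<partial>lborel) + ennreal e) * indicator {0..\<delta>} s"
      proof (cases "s \<in> {0..\<delta>}")
        case True
        have "(\<integral>\<^sup>+z. h (z + s *\<^sub>R w) * indicator {0..\<delta>} s * ennreal (\<phi> z) \<partial>lborel)
            = (\<integral>\<^sup>+z. h (z + s *\<^sub>R w) * ennreal (\<phi> (z + s *\<^sub>R w - s *\<^sub>R w)) \<partial>lborel)"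
          using True by simp
        also have "\<dots> = (\<integral>\<^sup>+z. h z * ennreal (\<phi> (z - s *\<^sub>R w)) \<partial>lborel)"
          by (rule nn_integral_translate) measurable
        also have "\<dots> \<le> (\<integral>\<^sup>+z. h z * ennreal (\<phi> z) + ennreal (L * \<delta>) * (h z * indicator K1 z) \<partial>lborel)"
        proof (rule nn_integral_mono)
          fix z
          have "\<phi> (z - s *\<^sub>R w) \<le> \<phi> z + L * \<delta> * indicator K1 z"
          proof (cases "z \<in> K1")
            case in1: True
            have "\<phi> (z - s *\<^sub>R w) - \<phi> z \<le> L * dist (z - s *\<^sub>R w) z" using L(2) abs_le_D1 by blast
            also have "dist (z - s *\<^sub>R w) z = s" using True w by (simp add: dist_norm)
            also have "L * s \<le> L * \<delta>" using L(1) True by (intro mult_left_mono) auto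
            finally show ?thesis using in1 by simp
          next
            case False
            have "z - s *\<^sub>R w \<notin> K"
            proof
              assume "z - s *\<^sub>R w \<in> K"
              moreover have "z \<in> cball (z - s *\<^sub>R w) r" using True \<delta>r w by (simp add: dist_norm)
              ultimately show False using False unfolding K1_def by blast
            qed
            then show ?thesis using L(5,6) False by simp
          qed
          then have "h z * ennreal (\<phi> (z - s *\<^sub>R w)) \<le> h z * ennreal (\<phi> z + L * \<delta> * indicator K1 z)"
            by (intro mult_left_mono ennreal_leI) auto
          also have "\<dots> = h z * ennreal (\<phi> z) + ennreal (L * \<delta>) * (h z * indicator K1 z)"
            using L(1,6) \<delta>(1) by (cases "z \<in> K1") (auto simp: distrib_left mult.commute)
          finally show "h z * ennreal (\<phi> (z - s *\<^sub>R w)) \<le> h z * ennreal (\<phi> z) + ennreal (L * \<delta>) * (h z * indicator K1 z)" .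
        qed
        also have "\<dots> = (\<integral>\<^sup>+z. h z * ennreal (\<phi> z) \<partial>lborel) + ennreal (L * \<delta>) * ennreal m"
          unfolding m(1)[symmetric] by (subst nn_integral_add) (auto simp: nn_integral_cmult)
        also have "\<dots> \<le> (\<integral>\<^sup>+z. h z * ennreal (\<phi> z) \<partial>lborel) + ennreal e"
          using Lme L(1) \<delta>(1) m(2) by (intro add_left_mono) (auto simp: ennreal_mult[symmetric] intro!: ennreal_leI)
        finally show ?thesis using True by simp
      qed simp
    qed
    also have "\<dots> = ((\<integral>\<^sup>+z. h z * ennreal (\<phi> z) \<partial>lborel) + ennreal e) * ennreal \<delta>"
      using \<delta>(1) by (subst nn_integral_cmult_indicator) auto
    finally show ?thesis unfolding eq by (simp only: mult.commute)
  qed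
  then show "\<forall>\<^sub>F \<delta> in at_right 0. ennreal \<bar>\<integral>z. u z * (\<phi> (z + \<delta> *\<^sub>R - w) - \<phi> z) \<partial>lborel\<bar>
       \<le> ennreal \<delta> * ((\<integral>\<^sup>+z. h z * ennreal (\<phi> z) \<partial>lborel) + ennreal e)"
    unfolding eventually_at_right_field using d by blast
qed

subsection \<open>Lattice operations on slope bounds\<close>

lemma test_function_mult:
  assumes \<phi>: "test_function V \<phi>" and \<psi>: "L-lipschitz_on UNIV \<psi>" "\<And>z. 0 \<le> \<psi> z" "\<And>z. \<psi> z \<le> 1"
  shows "test_function V (\<lambda>z. \<phi> z * \<psi> z)"
proof -
  obtain M K where M: "0 < M" "\<And>x y. \<bar>\<phi> x - \<phi> y\<bar> \<le> M * dist x y" "compact K" "K \<subseteq> V"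
    "\<And>z. z \<notin> K \<Longrightarrow> \<phi> z = 0" "\<And>z. 0 \<le> \<phi> z" "\<And>z. \<phi> z \<le> M"
    using test_functionD[OF \<phi>] by blast
  have L0: "0 \<le> L" using \<psi>(1) lipschitz_on_nonneg by blast
  have "(M * L + M)-lipschitz_on UNIV (\<lambda>z. \<phi> z * \<psi> z)"
  proof (rule lipschitz_onI)
    fix x y :: plane
    have c: "\<bar>\<psi> x - \<psi> y\<bar> \<le> L * dist x y" using lipschitz_onD[OF \<psi>(1), of x y] by (simp add: dist_real_def)
    have "\<phi> x * \<psi> x - \<phi> y * \<psi> y = \<phi> x * (\<psi> x - \<psi> y) + \<psi> y * (\<phi> x - \<phi> y)" by (simp add: algebra_simps)
    then have "\<bar>\<phi> x * \<psi> x - \<phi> y * \<psi> y\<bar> \<le> \<bar>\<phi> x\<bar> * \<bar>\<psi> x - \<psi> y\<bar> + \<bar>\<psi> y\<bar> * \<bar>\<phi> x - \<phi> y\<bar>"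
      by (metis abs_mult abs_triangle_ineq)
    also have "\<dots> \<le> M * (L * dist x y) + 1 * (M * dist x y)"
      using c M(1,2,6,7) \<psi>(2,3) by (intro add_mono mult_mono) auto
    finally show "dist (\<phi> x * \<psi> x) (\<phi> y * \<psi> y) \<le> (M * L + M) * dist x y"
      by (simp add: dist_real_def algebra_simps)
  qed (use M(1) L0 in auto)
  then show ?thesis
    unfolding test_function_def using M \<psi>(2) by (intro conjI allI exI[of _ K]) auto
qed

text \<open>A cutoff between a compact set and an open neighbourhood, so steep that the mass it adds to
  the compact set is small.\<close>

lemma cutoff_small_mass:
  assumes K: "compact K" "K \<subseteq> U" and U: "open U" and h: "integrable_on_compacts U h" and e: "0 < (e::real)"
  shows "\<exists>\<psi> L K2. L-lipschitz_on UNIV \<psi> \<and> (\<forall>z. 0 \<le> \<psi> z) \<and> (\<forall>z. \<psi> z \<le> 1) \<and> (\<forall>z\<in>K. \<psi> z = 1) \<and>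
     compact K2 \<and> K2 \<subseteq> U \<and> (\<forall>z. z \<notin> K2 \<longrightarrow> \<psi> z = (0::real)) \<and>
     (\<integral>\<^sup>+z. h z * ennreal (\<psi> z) \<partial>lborel) \<le> (\<integral>\<^sup>+z\<in>K. h z \<partial>lborel) + ennreal e"
proof (cases "K = {}")
  case True
  show ?thesis
    by (rule exI[of _ "\<lambda>_. 0"], rule exI[of _ 0], rule exI[of _ "{}"]) (auto simp: True intro: lipschitz_on_constant)
next
  case False
  have [measurable]: "h \<in> borel_measurable borel" using h by (simp add: integrable_on_compacts_def)
  obtain r where r: "0 < r" "(\<Union>x\<in>K. cball x r) \<subseteq> U"
    using compact_subset_open_imp_cball_epsilon_subset[OF K(1) U K(2)] by blast
  define K2 where "K2 = (\<Union>x\<in>K. cball x r)"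
  have K2: "compact K2" "K2 \<subseteq> U" using compact_minkowski_sum_cball[OF K(1)] r by (auto simp: K2_def)
  have [measurable]: "K2 \<in> sets borel" "K \<in> sets borel" using K2(1) K(1) by (simp_all add: borel_closed compact_imp_closed)
  define \<psi> where "\<psi> n z = max 0 (1 - real n * infdist z K)" for n z
  have [measurable]: "\<psi> n \<in> borel_measurable borel" for n
    unfolding \<psi>_def by (intro borel_measurable_continuous_onI continuous_intros)
  obtain n0 :: nat where n0: "1 / r < real n0" using reals_Archimedean2 by blast
  have out: "\<psi> n z = 0" if "z \<notin> K2" "n0 \<le> n" for n z
  proof -
    have "r \<le> infdist z K"
    proof (rule ccontr)
      assume "\<not> r \<le> infdist z K"
      then have "(INF a\<in>K. dist z a) < r" using False by (simp add: infdist_notempty)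
      then obtain a where "a \<in> K" "dist z a < r"
        using False by (subst (asm) cINF_less_iff) auto
      then have "z \<in> K2" unfolding K2_def by (auto simp: dist_commute intro!: bexI[of _ a] less_imp_le)
      with that(1) show False by simp
    qed
    moreover have "1 / r \<le> real n" using n0 that(2) by (meson le_less_trans less_imp_le of_nat_le_iff order_less_le_trans)
    then have "1 \<le> real n * r" using r(1) by (simp add: divide_le_eq)
    ultimately have "1 \<le> real n * infdist z K" by (meson mult_left_mono of_nat_0_le_iff order_trans)
    then show ?thesis by (simp add: \<psi>_def)
  qed
  have lim: "(\<lambda>n. \<integral>\<^sup>+z. h z * ennreal (\<psi> (n + n0) z) \<partial>lborel) \<longlonglongrightarrow> (\<integral>\<^sup>+z\<in>K. h z \<partial>lborel)"
  proof (rule nn_integral_dominated_convergence)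
    show "AE z in lborel. h z * ennreal (\<psi> (n + n0) z) \<le> h z * indicator K2 z" for n
    proof (rule AE_I2)
      fix z
      show "h z * ennreal (\<psi> (n + n0) z) \<le> h z * indicator K2 z"
      proof (cases "z \<in> K2")
        case True
        have "\<psi> (n + n0) z \<le> 1" by (simp add: \<psi>_def infdist_nonneg)
        then have "ennreal (\<psi> (n + n0) z) \<le> 1" by (metis ennreal_1 ennreal_leI)
        then have "h z * ennreal (\<psi> (n + n0) z) \<le> h z * 1" by (intro mult_left_mono) auto
        then show ?thesis using True by simp
      qed (use out[of z "n + n0"] in simp)
    qed
    show "(\<integral>\<^sup>+z. h z * indicator K2 z \<partial>lborel) < \<infinity>"
      using h K2 by (auto simp: integrable_on_compacts_def)
    show "AE z in lborel. (\<lambda>n. h z * ennreal (\<psi> (n + n0) z)) \<longlonglongrightarrow> h z * indicator K z"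
    proof (rule AE_I2)
      fix z
      show "(\<lambda>n. h z * ennreal (\<psi> (n + n0) z)) \<longlonglongrightarrow> h z * indicator K z"
      proof (cases "z \<in> K")
        case True
        then show ?thesis by (simp add: \<psi>_def)
      next
        case nz: False
        then have "0 < infdist z K"
          using infdist_pos_not_in_closed[of K z] False K(1) compact_imp_closed by blast
        then obtain N :: nat where N: "1 / infdist z K < real N" using reals_Archimedean2 by blast
        have "\<psi> (n + n0) z = 0" if "N \<le> n" for n
        proof -
          have "1 \<le> real N * infdist z K" using N \<open>0 < infdist z K\<close> by (simp add: divide_less_eq)
          also have "\<dots> \<le> real (n + n0) * infdist z K" using that by (intro mult_right_mono) (auto simp: infdist_nonneg)
          finally show ?thesis by (simp add: \<psi>_def)
        qed
        then have "eventually (\<lambda>n. h z * ennreal (\<psi> (n + n0) z) = h z * indicator K z) sequentially"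
          using nz unfolding eventually_sequentially by (intro exI[of _ N]) auto
        then show ?thesis by (rule tendsto_eventually)
      qed
    qed
  qed measurable
  have "(\<integral>\<^sup>+z\<in>K. h z \<partial>lborel) < top" using h K by (auto simp: integrable_on_compacts_def)
  then have "(\<integral>\<^sup>+z\<in>K. h z \<partial>lborel) < (\<integral>\<^sup>+z\<in>K. h z \<partial>lborel) + ennreal e"
    using e by (cases "\<integral>\<^sup>+z\<in>K. h z \<partial>lborel" rule: ennreal_cases) (auto simp flip: ennreal_plus simp: ennreal_less_iff)
  from order_tendstoD(2)[OF lim this] obtain n where n: "(\<integral>\<^sup>+z. h z * ennreal (\<psi> (n + n0) z) \<partial>lborel) < (\<integral>\<^sup>+z\<in>K. h z \<partial>lborel) + ennreal e"
    unfolding eventually_sequentially by blast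
  have "(real (n + n0))-lipschitz_on UNIV (\<psi> (n + n0))"
  proof (rule lipschitz_onI)
    fix x y
    have "\<bar>\<psi> (n + n0) x - \<psi> (n + n0) y\<bar> \<le> \<bar>real (n + n0) * infdist x K - real (n + n0) * infdist y K\<bar>"
    proof -
      have "\<bar>max 0 (1 - a) - max 0 (1 - b)\<bar> \<le> \<bar>a - b\<bar>" for a b :: real
        by (auto simp: max_def abs_if)
      then show ?thesis unfolding \<psi>_def .
    qed
    also have "\<dots> = real (n + n0) * \<bar>infdist x K - infdist y K\<bar>"
      by (simp only: right_diff_distrib[symmetric] abs_mult abs_of_nat)
    also have "\<dots> \<le> real (n + n0) * dist x y"
      by (intro mult_left_mono infdist_triangle_abs) auto
    finally show "dist (\<psi> (n + n0) x) (\<psi> (n + n0) y) \<le> real (n + n0) * dist x y" by (simp add: dist_real_def)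
  qed simp
  then show ?thesis
    using n K2 out[of _ "n + n0"]
    by (intro exI[of _ "\<psi> (n + n0)"] exI[of _ "real (n + n0)"] exI[of _ K2]) (auto simp: \<psi>_def infdist_nonneg)
qed

lemma at_right_add_bounds:
  fixes I J :: "real \<Rightarrow> real"
  assumes "\<forall>\<^sub>F \<delta> in at_right 0. ennreal \<bar>I \<delta>\<bar> \<le> ennreal \<delta> * a" "\<forall>\<^sub>F \<delta> in at_right 0. ennreal \<bar>J \<delta>\<bar> \<le> ennreal \<delta> * b"
    "a + b \<le> c" "\<And>\<delta>. K \<delta> = I \<delta> + J \<delta>"
  shows "\<forall>\<^sub>F \<delta> in at_right 0. ennreal \<bar>K \<delta>\<bar> \<le> ennreal \<delta> * c"
  using assms(1,2)
proof eventually_elim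
  case (elim \<delta>)
  have "ennreal \<bar>K \<delta>\<bar> \<le> ennreal (\<bar>I \<delta>\<bar> + \<bar>J \<delta>\<bar>)" unfolding assms(4) by (intro ennreal_leI abs_triangle_ineq)
  also have "\<dots> = ennreal \<bar>I \<delta>\<bar> + ennreal \<bar>J \<delta>\<bar>" by simp
  also have "\<dots> \<le> ennreal \<delta> * a + ennreal \<delta> * b" using elim by (rule add_mono)
  also have "\<dots> = ennreal \<delta> * (a + b)" by (simp add: distrib_left)
  also have "\<dots> \<le> ennreal \<delta> * c" using assms(3) by (rule mult_left_mono) simp
  finally show ?case .
qed

text \<open>Splitting a test function \<open>\<phi>\<close> into \<open>\<phi> * \<psi>\<close> and \<open>\<phi> * (1 - \<psi>)\<close>, where \<open>\<psi>\<close> approximates the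
  indicator of the set on which \<open>h < g\<close>, lets \<open>h\<close> and \<open>g\<close> take over where they are smaller. That
  \<open>h\<close> need be a bound only in a smaller open set \<open>U\<close> will allow competitors that are integrable
  near the points of a dense set only.\<close>

lemma slope_bound_min:
  assumes u: "locally_integrable u" and V: "open V" and U: "open U" "U \<subseteq> V"
    and g: "integrable_on_compacts V g" "slope_bound V u g v"
    and h: "integrable_on_compacts U h" "slope_bound U u h v"
  shows "slope_bound V u (\<lambda>z. if z \<in> U then min (g z) (h z) else g z) v"
  unfolding slope_bound_def
proof (intro allI impI)
  fix \<phi> and e :: real assume \<phi>: "test_function V \<phi>" and e: "0 < e"
  define m where "m = (\<lambda>z. if z \<in> U then min (g z) (h z) else g z)"
  note [measurable] = test_function_measurable[OF \<phi>]
  have [measurable]: "g \<in> borel_measurable borel" "h \<in> borel_measurable borel" "U \<in> sets borel"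
    using g h U by (auto simp: integrable_on_compacts_def)
  obtain M K where M: "0 < M" "\<And>x y. \<bar>\<phi> x - \<phi> y\<bar> \<le> M * dist x y" "compact K" "K \<subseteq> V"
    "\<And>z. z \<notin> K \<Longrightarrow> \<phi> z = 0" "\<And>z. 0 \<le> \<phi> z" "\<And>z. \<phi> z \<le> M"
    using test_functionD[OF \<phi>] by blast
  define E where "E = {z \<in> U. h z < g z}"
  have [measurable]: "E \<in> sets borel" unfolding E_def by measurable
  have [measurable]: "m \<in> borel_measurable borel" unfolding m_def by measurable
  define \<mu> where "\<mu> = density lborel (\<lambda>z. g z * ennreal (\<phi> z))"
  have \<mu>: "emeasure \<mu> S = (\<integral>\<^sup>+z\<in>S. g z * ennreal (\<phi> z) \<partial>lborel)" if "S \<in> sets borel" for S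
    unfolding \<mu>_def using that by (subst emeasure_density) auto
  have gf: "(\<integral>\<^sup>+z. g z * ennreal (\<phi> z) \<partial>lborel) < top" by (rule finite_test_integral[OF g(1) \<phi>])
  have fin: "emeasure \<mu> (space \<mu>) \<noteq> \<infinity>" using gf \<mu>[of UNIV] by (simp add: \<mu>_def)
  have sets\<mu>: "sets \<mu> = sets borel" by (simp add: \<mu>_def)
  (* By inner regularity the set E where h wins can be replaced by a compact subset, at a small
     cost in the integral of g against \<phi>. *)
  have reg: "emeasure \<mu> E = (SUP K\<in>{K. K \<subseteq> E \<and> compact K}. emeasure \<mu> K)"
    by (rule inner_regular[OF sets\<mu> fin]) measurable
  have "emeasure \<mu> E < top" using \<mu>[of UNIV] gf
    by (intro le_less_trans[OF emeasure_mono[of E UNIV \<mu>]]) (auto simp: sets\<mu>)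
  then have "\<exists>K'\<in>{K. K \<subseteq> E \<and> compact K}. emeasure \<mu> E < emeasure \<mu> K' + ennreal (e / 4)"
    using e compact_empty by (intro SUP_approx_ennreal[OF _ _ reg]) auto
  then obtain K' where K': "K' \<subseteq> E" "compact K'" "emeasure \<mu> E < emeasure \<mu> K' + ennreal (e / 4)"
    by blast
  have [measurable]: "K' \<in> sets borel" using K'(2) by (simp add: borel_closed compact_imp_closed)
  have K'U: "K' \<subseteq> U" using K'(1) by (auto simp: E_def)
  have diff: "(\<integral>\<^sup>+z\<in>E - K'. g z * ennreal (\<phi> z) \<partial>lborel) \<le> ennreal (e / 4)"
  proof -
    have "emeasure \<mu> (E - K') = emeasure \<mu> E - emeasure \<mu> K'"
      using K'(1) \<open>emeasure \<mu> E < top\<close> emeasure_mono[OF K'(1), of \<mu>] by (intro emeasure_Diff) (auto simp: sets\<mu> top_unique)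
    also have "\<dots> \<le> ennreal (e / 4)"
      using K'(3) less_imp_neq[OF \<open>emeasure \<mu> E < top\<close>] by (simp add: ennreal_minus_le_iff less_imp_le add.commute)
    finally show ?thesis by (subst (asm) \<mu>) auto
  qed
  have hM: "integrable_on_compacts U (\<lambda>z. h z * ennreal (\<phi> z))"
    unfolding integrable_on_compacts_def
  proof (intro conjI allI impI)
    fix K assume K: "compact K" "K \<subseteq> U"
    have [measurable]: "K \<in> sets borel" using K(1) by (simp add: borel_closed compact_imp_closed)
    have "(\<integral>\<^sup>+z\<in>K. h z * ennreal (\<phi> z) \<partial>lborel) \<le> (\<integral>\<^sup>+z. ennreal M * (h z * indicator K z) \<partial>lborel)"
    proof (rule nn_integral_mono)
      fix z
      show "h z * ennreal (\<phi> z) * indicator K z \<le> ennreal M * (h z * indicator K z)"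
        using M(7)[of z] by (cases "z \<in> K") (auto simp: mult.commute[of "h z"] intro!: mult_right_mono ennreal_leI)
    qed
    also have "\<dots> = ennreal M * (\<integral>\<^sup>+z\<in>K. h z \<partial>lborel)" by (intro nn_integral_cmult) measurable
    also have "\<dots> < top" using h K by (auto simp: integrable_on_compacts_def ennreal_mult_less_top)
    finally show "(\<integral>\<^sup>+z\<in>K. h z * ennreal (\<phi> z) \<partial>lborel) < top" .
  qed measurable
  have e4: "0 < e / 4" using e by simp
  obtain \<psi> L K2 where \<psi>: "L-lipschitz_on UNIV \<psi>" "\<And>z. 0 \<le> \<psi> z" "\<And>z. \<psi> z \<le> 1" "\<And>z. z \<in> K' \<Longrightarrow> \<psi> z = 1"
     "compact K2" "K2 \<subseteq> U" "\<And>z. z \<notin> K2 \<Longrightarrow> \<psi> z = (0::real)"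
     and \<psi>m: "(\<integral>\<^sup>+z. h z * ennreal (\<phi> z) * ennreal (\<psi> z) \<partial>lborel) \<le> (\<integral>\<^sup>+z\<in>K'. h z * ennreal (\<phi> z) \<partial>lborel) + ennreal (e / 4)"
    using cutoff_small_mass[OF K'(2) K'U U(1) hM e4] by blast
  have [measurable]: "\<psi> \<in> borel_measurable borel"
    using \<psi>(1) borel_measurable_continuous_onI lipschitz_on_continuous_on by blast
  have t1V: "test_function V (\<lambda>z. \<phi> z * \<psi> z)" by (rule test_function_mult[OF \<phi> \<psi>(1-3)])
  have t1: "test_function U (\<lambda>z. \<phi> z * \<psi> z)"
    using t1V \<psi>(5,6,7) unfolding test_function_def by (metis mult_zero_right)
  have l2: "L-lipschitz_on UNIV (\<lambda>z. 1 - \<psi> z)"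
    using lipschitz_on_diff[OF lipschitz_on_constant \<psi>(1), of 1] by simp
  have t2: "test_function V (\<lambda>z. \<phi> z * (1 - \<psi> z))" 
    by (rule test_function_mult[OF \<phi> l2]) (use \<psi> in auto)
  have split: "(\<integral>z. u z * (\<phi> (z + \<delta> *\<^sub>R v) - \<phi> z) \<partial>lborel) =
      (\<integral>z. u z * (\<phi> (z + \<delta> *\<^sub>R v) * \<psi> (z + \<delta> *\<^sub>R v) - \<phi> z * \<psi> z) \<partial>lborel) +
      (\<integral>z. u z * (\<phi> (z + \<delta> *\<^sub>R v) * (1 - \<psi> (z + \<delta> *\<^sub>R v)) - \<phi> z * (1 - \<psi> z)) \<partial>lborel)" for \<delta>
  proof -
    have i1: "integrable lborel (\<lambda>z. u z * (\<phi> (z + \<delta> *\<^sub>R v) * \<psi> (z + \<delta> *\<^sub>R v) - \<phi> z * \<psi> z))"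
      using Bochner_Integration.integrable_diff[OF integrable_mult_test[OF u t1, of "\<delta> *\<^sub>R v"] integrable_mult_test[OF u t1, of 0]]
      by (simp add: right_diff_distrib)
    have i2: "integrable lborel (\<lambda>z. u z * (\<phi> (z + \<delta> *\<^sub>R v) * (1 - \<psi> (z + \<delta> *\<^sub>R v)) - \<phi> z * (1 - \<psi> z)))"
      using Bochner_Integration.integrable_diff[OF integrable_mult_test[OF u t2, of "\<delta> *\<^sub>R v"] integrable_mult_test[OF u t2, of 0]]
      by (simp add: right_diff_distrib)
    show ?thesis
      unfolding Bochner_Integration.integral_add[OF i1 i2, symmetric]
      by (intro Bochner_Integration.integral_cong refl) (simp add: algebra_simps)
  qed
  (* The four errors of e / 4 are: one for each slope bound, one for the cutoff and one for the
     part of E outside K'. *)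
  have mass: "((\<integral>\<^sup>+z. h z * ennreal (\<phi> z * \<psi> z) \<partial>lborel) + ennreal (e / 4)) +
      ((\<integral>\<^sup>+z. g z * ennreal (\<phi> z * (1 - \<psi> z)) \<partial>lborel) + ennreal (e / 4))
      \<le> (\<integral>\<^sup>+z. m z * ennreal (\<phi> z) \<partial>lborel) + ennreal e"
  proof -
    have a: "(\<integral>\<^sup>+z. h z * ennreal (\<phi> z * \<psi> z) \<partial>lborel) \<le> (\<integral>\<^sup>+z\<in>K'. h z * ennreal (\<phi> z) \<partial>lborel) + ennreal (e / 4)"
      using \<psi>m M(6) \<psi>(2) by (simp add: ennreal_mult mult.assoc)
    have "(\<integral>\<^sup>+z. g z * ennreal (\<phi> z * (1 - \<psi> z)) \<partial>lborel)
        \<le> (\<integral>\<^sup>+z. g z * ennreal (\<phi> z) * indicator (- E) z + g z * ennreal (\<phi> z) * indicator (E - K') z \<partial>lborel)"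
    proof (rule nn_integral_mono)
      fix z
      have "\<phi> z * (1 - \<psi> z) \<le> \<phi> z" using M(6)[of z] \<psi>(2)[of z] by (simp add: mult_left_le)
      then have le: "g z * ennreal (\<phi> z * (1 - \<psi> z)) \<le> g z * ennreal (\<phi> z)" by (intro mult_left_mono ennreal_leI) auto
      show "g z * ennreal (\<phi> z * (1 - \<psi> z)) \<le> g z * ennreal (\<phi> z) * indicator (- E) z + g z * ennreal (\<phi> z) * indicator (E - K') z"
        using le \<psi>(4)[of z] by (cases "z \<in> E"; cases "z \<in> K'") (use K'(1) in auto)
    qed
    also have "\<dots> = (\<integral>\<^sup>+z\<in>- E. g z * ennreal (\<phi> z) \<partial>lborel) + (\<integral>\<^sup>+z\<in>E - K'. g z * ennreal (\<phi> z) \<partial>lborel)"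
      by (intro nn_integral_add) measurable
    also have "\<dots> \<le> (\<integral>\<^sup>+z\<in>- E. g z * ennreal (\<phi> z) \<partial>lborel) + ennreal (e / 4)"
      by (intro add_left_mono diff)
    finally have b: "(\<integral>\<^sup>+z. g z * ennreal (\<phi> z * (1 - \<psi> z)) \<partial>lborel) \<le> (\<integral>\<^sup>+z\<in>- E. g z * ennreal (\<phi> z) \<partial>lborel) + ennreal (e / 4)" .
    have c: "(\<integral>\<^sup>+z\<in>K'. h z * ennreal (\<phi> z) \<partial>lborel) + (\<integral>\<^sup>+z\<in>- E. g z * ennreal (\<phi> z) \<partial>lborel) \<le> (\<integral>\<^sup>+z. m z * ennreal (\<phi> z) \<partial>lborel)"
    proof -
      have "(\<integral>\<^sup>+z\<in>K'. h z * ennreal (\<phi> z) \<partial>lborel) + (\<integral>\<^sup>+z\<in>- E. g z * ennreal (\<phi> z) \<partial>lborel)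
          = (\<integral>\<^sup>+z. h z * ennreal (\<phi> z) * indicator K' z + g z * ennreal (\<phi> z) * indicator (- E) z \<partial>lborel)"
        by (intro nn_integral_add[symmetric]) measurable
      also have "\<dots> \<le> (\<integral>\<^sup>+z. m z * ennreal (\<phi> z) \<partial>lborel)"
      proof (rule nn_integral_mono)
        fix z
        show "h z * ennreal (\<phi> z) * indicator K' z + g z * ennreal (\<phi> z) * indicator (- E) z \<le> m z * ennreal (\<phi> z)"
        proof (cases "z \<in> E")
          case True
          then have "m z = h z" by (simp add: m_def E_def)
          then show ?thesis using True by (simp add: indicator_def)
        next
          case False
          then have "m z = g z" by (auto simp: m_def E_def min_def)
          then show ?thesis using False K'(1) by (auto simp: indicator_def)
        qed
      qed
      finally show ?thesis .
    qed
    have "((\<integral>\<^sup>+z. h z * ennreal (\<phi> z * \<psi> z) \<partial>lborel) + ennreal (e / 4)) +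
      ((\<integral>\<^sup>+z. g z * ennreal (\<phi> z * (1 - \<psi> z)) \<partial>lborel) + ennreal (e / 4))
      \<le> (((\<integral>\<^sup>+z\<in>K'. h z * ennreal (\<phi> z) \<partial>lborel) + ennreal (e / 4)) + ennreal (e / 4)) +
        (((\<integral>\<^sup>+z\<in>- E. g z * ennreal (\<phi> z) \<partial>lborel) + ennreal (e / 4)) + ennreal (e / 4))"
      by (intro add_mono a b order_refl)
    also have "\<dots> = ((\<integral>\<^sup>+z\<in>K'. h z * ennreal (\<phi> z) \<partial>lborel) + (\<integral>\<^sup>+z\<in>- E. g z * ennreal (\<phi> z) \<partial>lborel)) +
        (ennreal (e / 4) + ennreal (e / 4) + (ennreal (e / 4) + ennreal (e / 4)))"
      by (simp only: ac_simps)
    also have "ennreal (e / 4) + ennreal (e / 4) + (ennreal (e / 4) + ennreal (e / 4)) = ennreal e"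
      using e by (simp flip: ennreal_plus)
    finally show ?thesis using c by (meson add_right_mono order_trans)
  qed
  have "\<forall>\<^sub>F \<delta> in at_right 0. ennreal \<bar>\<integral>z. u z * (\<phi> (z + \<delta> *\<^sub>R v) - \<phi> z) \<partial>lborel\<bar>
       \<le> ennreal \<delta> * ((\<integral>\<^sup>+z. m z * ennreal (\<phi> z) \<partial>lborel) + ennreal e)"
    using h(2)[unfolded slope_bound_def, rule_format, OF t1 e4] g(2)[unfolded slope_bound_def, rule_format, OF t2 e4]
    by (rule at_right_add_bounds[OF _ _ mass split])
  then show "\<forall>\<^sub>F \<delta> in at_right 0. ennreal \<bar>\<integral>z. u z * (\<phi> (z + \<delta> *\<^sub>R v) - \<phi> z) \<partial>lborel\<bar>
       \<le> ennreal \<delta> * ((\<integral>\<^sup>+z. (if z \<in> U then min (g z) (h z) else g z) * ennreal (\<phi> z) \<partial>lborel) + ennreal e)"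
    by (simp only: m_def)
qed

text \<open>The integrals against a test function converge by monotone convergence, and so each of them
  that is close to the limit can be used for the estimate.\<close>

lemma slope_bound_INF:
  fixes h :: "nat \<Rightarrow> plane \<Rightarrow> ennreal"
  assumes h: "\<And>n. integrable_on_compacts U (h n)" "\<And>n. slope_bound U u (h n) v" and dec: "decseq h"
  shows "slope_bound U u (\<lambda>z. INF n. h n z) v"
  unfolding slope_bound_def
proof (intro allI impI)
  fix \<phi> and e :: real assume \<phi>: "test_function U \<phi>" and e: "0 < e"
  note [measurable] = test_function_measurable[OF \<phi>]
  have [measurable]: "h n \<in> borel_measurable borel" for n using h(1) by (simp add: integrable_on_compacts_def)
  have fin: "(\<integral>\<^sup>+z. h n z * ennreal (\<phi> z) \<partial>lborel) < top" for n by (rule finite_test_integral[OF h(1) \<phi>])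
  have le: "h j z \<le> h i z" if "i \<le> j" for i j z by (rule le_funD[OF decseqD[OF dec that]])
  have "(\<integral>\<^sup>+z. (INF n. h n z) * ennreal (\<phi> z) \<partial>lborel) = (\<integral>\<^sup>+z. (INF n. h n z * ennreal (\<phi> z)) \<partial>lborel)"
  proof (rule nn_integral_cong)
    fix z
    have "decseq (\<lambda>n. h n z)" by (rule decseq_SucI) (simp add: le)
    then have "(\<lambda>n. ennreal (\<phi> z) * h n z) \<longlonglongrightarrow> ennreal (\<phi> z) * (INF n. h n z)"
      by (intro ennreal_tendsto_cmult LIMSEQ_INF) auto
    moreover have "(\<lambda>n. ennreal (\<phi> z) * h n z) \<longlonglongrightarrow> (INF n. ennreal (\<phi> z) * h n z)"
      by (intro LIMSEQ_INF decseq_SucI mult_left_mono le) auto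
    ultimately show "(INF n. h n z) * ennreal (\<phi> z) = (INF n. h n z * ennreal (\<phi> z))"
      by (simp only: mult.commute[of _ "ennreal (\<phi> z)"]) (rule LIMSEQ_unique)
  qed
  also have "\<dots> = (INF n. \<integral>\<^sup>+z. h n z * ennreal (\<phi> z) \<partial>lborel)"
  proof (rule nn_integral_monotone_convergence_INF_decseq)
    show "decseq (\<lambda>n z. h n z * ennreal (\<phi> z))"
      by (intro decseq_SucI le_funI mult_right_mono le) auto
    show "(\<integral>\<^sup>+z. h 0 z * ennreal (\<phi> z) \<partial>lborel) < \<infinity>" using fin[of 0] by simp
  qed measurable
  finally have eq: "(\<integral>\<^sup>+z. (INF n. h n z) * ennreal (\<phi> z) \<partial>lborel) = (INF n. \<integral>\<^sup>+z. h n z * ennreal (\<phi> z) \<partial>lborel)" .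
  have e2: "0 < e / 2" using e by simp
  have "(INF n. \<integral>\<^sup>+z. h n z * ennreal (\<phi> z) \<partial>lborel) < top" using fin by (meson INF_lower UNIV_I le_less_trans)
  then have "(INF n. \<integral>\<^sup>+z. h n z * ennreal (\<phi> z) \<partial>lborel) < (INF n. \<integral>\<^sup>+z. h n z * ennreal (\<phi> z) \<partial>lborel) + ennreal (e / 2)"
    using e2 by (cases "INF n. \<integral>\<^sup>+z. h n z * ennreal (\<phi> z) \<partial>lborel" rule: ennreal_cases)
      (auto simp flip: ennreal_plus simp: ennreal_less_iff)
  then obtain n where n: "(\<integral>\<^sup>+z. h n z * ennreal (\<phi> z) \<partial>lborel) < (INF n. \<integral>\<^sup>+z. h n z * ennreal (\<phi> z) \<partial>lborel) + ennreal (e / 2)"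
    unfolding INF_less_iff by blast
  have "(\<integral>\<^sup>+z. h n z * ennreal (\<phi> z) \<partial>lborel) + ennreal (e / 2) \<le> (INF n. \<integral>\<^sup>+z. h n z * ennreal (\<phi> z) \<partial>lborel) + ennreal (e / 2) + ennreal (e / 2)"
    using n by (intro add_right_mono) simp
  also have "\<dots> = (\<integral>\<^sup>+z. (INF n. h n z) * ennreal (\<phi> z) \<partial>lborel) + ennreal e"
    unfolding eq add.assoc using e by (simp flip: ennreal_plus)
  finally have mass: "(\<integral>\<^sup>+z. h n z * ennreal (\<phi> z) \<partial>lborel) + ennreal (e / 2) \<le> (\<integral>\<^sup>+z. (INF n. h n z) * ennreal (\<phi> z) \<partial>lborel) + ennreal e" .
  show "\<forall>\<^sub>F \<delta> in at_right 0. ennreal \<bar>\<integral>z. u z * (\<phi> (z + \<delta> *\<^sub>R v) - \<phi> z) \<partial>lborel\<bar>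
       \<le> ennreal \<delta> * ((\<integral>\<^sup>+z. (INF n. h n z) * ennreal (\<phi> z) \<partial>lborel) + ennreal e)"
    using h(2)[unfolded slope_bound_def, rule_format, OF \<phi> e2]
    by eventually_elim (use mass in \<open>blast intro: order_trans mult_left_mono zero_le\<close>)
qed

subsection \<open>The least slope bound\<close>

lemma integrable_on_compacts_of_energy:
  assumes p: "1 \<le> p" and h: "h \<in> borel_measurable borel" "(\<integral>\<^sup>+z. ennreal_powr (h z) p \<partial>lborel) < top"
  shows "integrable_on_compacts U h"
  unfolding integrable_on_compacts_def
proof (intro conjI allI impI h(1))
  fix K :: "plane set" assume K: "compact K"
  have [measurable]: "K \<in> sets borel" "h \<in> borel_measurable borel"
    using K h by (simp_all add: borel_closed compact_imp_closed)
  have "(\<integral>\<^sup>+z\<in>K. h z \<partial>lborel) \<le> (\<integral>\<^sup>+z. indicator K z + ennreal_powr (h z) p \<partial>lborel)"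
  proof (rule nn_integral_mono)
    fix z show "h z * indicator K z \<le> indicator K z + ennreal_powr (h z) p"
      using le_one_plus_ennreal_powr[OF p, of "h z"] by (cases "z \<in> K") auto
  qed
  also have "\<dots> = emeasure lborel K + (\<integral>\<^sup>+z. ennreal_powr (h z) p \<partial>lborel)"
    by (subst nn_integral_add) auto
  also have "\<dots> < top" using h(2) emeasure_compact_finite[OF K] by simp
  finally show "(\<integral>\<^sup>+z\<in>K. h z \<partial>lborel) < top" .
qed

lemma ennreal_powr_le_imp_le:
  assumes p: "1 \<le> p" and le: "ennreal_powr x p \<le> ennreal_powr y p"
  shows "x \<le> y"
proof (rule ccontr)
  assume "\<not> x \<le> y"
  then have yx: "y < x" by simp
  then obtain r where r: "y = ennreal r" "0 \<le> r" by (cases y rule: ennreal_cases) auto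
  show False
  proof (cases x rule: ennreal_cases)
    case (real s)
    have "r < s" using yx r real by (simp add: ennreal_less_iff)
    then have "r powr p < s powr p" using r p by (intro powr_less_mono2) auto
    then show False using le r real by (simp add: ennreal_powr_ennreal)
  next
    case top
    then show False using le r by (simp add: ennreal_powr_ennreal top_unique)
  qed
qed

text \<open>Slope bounds of finite energy form a family closed under minima and decreasing limits, so
  minimizing the energy yields one below all others, including those given only in a smaller
  open set.\<close>

lemma minimal_slope_bound:
  fixes u :: "plane \<Rightarrow> real"
  assumes p: "1 \<le> p" and V: "open V" and u: "locally_integrable u"
    and h0: "h0 \<in> borel_measurable borel" "(\<integral>\<^sup>+z. ennreal_powr (h0 z) p \<partial>lborel) < top"
      "\<And>v. v \<in> D \<Longrightarrow> slope_bound V u h0 v"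
  shows "\<exists>m. m \<in> borel_measurable borel \<and> (\<integral>\<^sup>+z. ennreal_powr (m z) p \<partial>lborel) < top \<and> (\<forall>z. z \<notin> V \<longrightarrow> m z = 0) \<and>
      (\<forall>v\<in>D. slope_bound V u m v) \<and>
      (\<forall>U h. open U \<longrightarrow> U \<subseteq> V \<longrightarrow> integrable_on_compacts U h \<longrightarrow> (\<forall>v\<in>D. slope_bound U u h v) \<longrightarrow>
         (AE z in lborel. z \<in> U \<longrightarrow> m z \<le> h z))"
proof -
  define I where "I h = (\<integral>\<^sup>+z. ennreal_powr (h z) p \<partial>lborel)" for h :: "plane \<Rightarrow> ennreal"
  define F where "F h \<longleftrightarrow> h \<in> borel_measurable borel \<and> I h < top \<and> (\<forall>z. z \<notin> V \<longrightarrow> h z = 0) \<and>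
      (\<forall>v\<in>D. slope_bound V u h v)" for h
  define mn where "mn U g h = (\<lambda>z::plane. if z \<in> U then min (g z) (h z) else g z :: ennreal)" for U g h
  have Fm: "F h \<Longrightarrow> h \<in> borel_measurable borel" and Fi: "F h \<Longrightarrow> integrable_on_compacts V h" for h
    using integrable_on_compacts_of_energy[OF p] by (auto simp: F_def I_def)
  have I_mono: "I g \<le> I h" if "\<And>z. g z \<le> h z" for g h
    unfolding I_def using p that by (intro nn_integral_mono ennreal_powr_mono) auto
  have [measurable]: "V \<in> sets borel" using V by simp
  have F_mn: "F (mn U g h)" if g: "F g" and U: "open U" "U \<subseteq> V"
    and h: "integrable_on_compacts U h" "\<And>v. v \<in> D \<Longrightarrow> slope_bound U u h v" for U g h
  proof -
    have [measurable]: "g \<in> borel_measurable borel" "h \<in> borel_measurable borel" "U \<in> sets borel"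
      using g h U by (auto simp: Fm integrable_on_compacts_def)
    have "mn U g h \<in> borel_measurable borel" unfolding mn_def by measurable
    moreover have "I (mn U g h) \<le> I g" by (rule I_mono) (simp add: mn_def)
    then have "I (mn U g h) < top" using g by (auto simp: F_def)
    moreover have "\<forall>v\<in>D. slope_bound V u (mn U g h) v"
      unfolding mn_def using g h by (intro ballI slope_bound_min[OF u V U Fi[OF g]]) (auto simp: F_def)
    moreover have "\<forall>z. z \<notin> V \<longrightarrow> mn U g h z = 0" using g U by (auto simp: F_def mn_def)
    ultimately show ?thesis by (simp add: F_def)
  qed
  have F_INF: "F (\<lambda>z. INF n. k n z)" if k: "\<And>n. F (k n)" "decseq k" for k :: "nat \<Rightarrow> plane \<Rightarrow> ennreal"
  proof -
    have [measurable]: "k n \<in> borel_measurable borel" for n using k Fm by blast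
    have "(\<lambda>z. INF n. k n z) \<in> borel_measurable borel" by measurable
    moreover have "I (\<lambda>z. INF n. k n z) \<le> I (k 0)" by (rule I_mono) (auto intro: INF_lower)
    then have "I (\<lambda>z. INF n. k n z) < top" using k(1)[of 0] by (auto simp: F_def)
    moreover have "\<forall>v\<in>D. slope_bound V u (\<lambda>z. INF n. k n z) v"
      using k by (intro ballI slope_bound_INF Fi) (auto simp: F_def)
    moreover have "\<forall>z. z \<notin> V \<longrightarrow> (INF n. k n z) = 0" using k(1) by (auto simp: F_def)
    ultimately show ?thesis by (simp add: F_def)
  qed
  define h1 where "h1 = (\<lambda>z. h0 z * indicator V z)"
  have "F h1"
  proof -
    have [measurable]: "h0 \<in> borel_measurable borel" by (rule h0)
    have "h1 \<in> borel_measurable borel" unfolding h1_def by measurable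
    moreover have "I h1 \<le> I h0" by (rule I_mono) (auto simp: h1_def indicator_def)
    then have "I h1 < top" using h0(2) by (auto simp: I_def)
    moreover have "slope_bound V u h1 v" if "v \<in> D" for v
      using h0(3)[OF that] by (rule slope_bound_cong) (auto simp: h1_def)
    ultimately show ?thesis by (auto simp: F_def h1_def)
  qed
  define i0 where "i0 = (INF h\<in>Collect F. I h)"
  have "i0 \<le> I h1" unfolding i0_def using \<open>F h1\<close> by (intro INF_lower) auto
  then have i0: "i0 < top" using \<open>F h1\<close> by (auto simp: F_def)
  have "\<exists>h. F h \<and> I h < i0 + ennreal (1 / real (Suc n))" for n
  proof -
    have "i0 < i0 + ennreal (1 / real (Suc n))"
      using i0 by (cases i0 rule: ennreal_cases) (auto simp flip: ennreal_plus simp: ennreal_less_iff)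
    then show ?thesis unfolding i0_def INF_less_iff by auto
  qed
  then have "\<exists>h. \<forall>n. F (h n) \<and> I (h n) < i0 + ennreal (1 / real (Suc n))" by (intro choice allI)
  then obtain h where h: "\<And>n. F (h n)" "\<And>n. I (h n) < i0 + ennreal (1 / real (Suc n))" by blast
  (* Running minima of a minimizing sequence. *)
  define k where "k = rec_nat (h 0) (\<lambda>n g. mn V g (h (Suc n)))"
  have k0: "k 0 = h 0" and kS: "k (Suc n) = mn V (k n) (h (Suc n))" for n by (simp_all add: k_def)
  have Fk: "F (k n)" for n
  proof (induction n)
    case (Suc n)
    show ?case unfolding kS
      by (rule F_mn[OF Suc V order_refl Fi[OF h(1)]]) (use h(1) in \<open>auto simp: F_def\<close>)
  qed (simp add: k0 h)
  have dec: "decseq k" by (rule decseq_SucI) (auto simp: kS mn_def le_fun_def)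
  have kh: "k n z \<le> h n z" for n z
  proof (cases n)
    case (Suc j)
    have "z \<notin> V \<Longrightarrow> k j z = 0" using Fk[of j] unfolding F_def by blast
    then show ?thesis by (auto simp: Suc kS mn_def)
  qed (simp add: k0)
  define m where "m = (\<lambda>z. INF n. k n z)"
  have Fm': "F m" unfolding m_def by (rule F_INF[OF Fk dec])
  have Im: "I m \<le> i0"
  proof (rule ennreal_le_epsilon)
    fix e :: real assume "0 < e"
    then obtain n where n: "1 / real (Suc n) < e" using nat_approx_posE by blast
    have "I m \<le> I (k n)" by (rule I_mono) (auto simp: m_def intro: INF_lower)
    also have "\<dots> \<le> I (h n)" by (rule I_mono) (rule kh)
    also have "\<dots> \<le> i0 + ennreal (1 / real (Suc n))" using h(2) less_imp_le by blast
    also have "\<dots> \<le> i0 + ennreal e" using n by (intro add_left_mono ennreal_leI) simp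
    finally show "I m \<le> i0 + ennreal e" .
  qed
  have [measurable]: "m \<in> borel_measurable borel" using Fm' Fm by blast
  (* Replacing m by its minimum with g on U cannot lower the energy any further, so it changes m
     only on a null set. *)
  have min: "AE z in lborel. z \<in> U \<longrightarrow> m z \<le> g z"
    if U: "open U" "U \<subseteq> V" "integrable_on_compacts U g" "\<forall>v\<in>D. slope_bound U u g v" for U g
  proof -
    have Fn: "F (mn U m g)" using U by (intro F_mn Fm') auto
    have [measurable]: "mn U m g \<in> borel_measurable borel" using Fn Fm by blast
    have "i0 \<le> I (mn U m g)" unfolding i0_def using Fn by (intro INF_lower) auto
    with Im have le: "I m \<le> I (mn U m g)" by (rule order_trans)
    have ptw: "ennreal_powr (mn U m g z) p \<le> ennreal_powr (m z) p" for z
      using p by (intro ennreal_powr_mono) (auto simp: mn_def)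
    have "(\<integral>\<^sup>+z. ennreal_powr (m z) p - ennreal_powr (mn U m g z) p \<partial>lborel) = I m - I (mn U m g)"
      unfolding I_def using Fn ptw by (intro nn_integral_diff) (auto simp: F_def I_def)
    also have "\<dots> = 0" using le Fm' by (simp add: F_def diff_eq_0_iff_ennreal)
    finally have "AE z in lborel. ennreal_powr (m z) p - ennreal_powr (mn U m g z) p = 0"
      by (subst (asm) nn_integral_0_iff_AE) auto
    moreover have "AE z in lborel. ennreal_powr (m z) p < top"
    proof -
      have "AE z in lborel. ennreal_powr (m z) p \<noteq> top"
        using Fm' by (intro nn_integral_PInf_AE[unfolded infinity_ennreal_def]) (auto simp: F_def I_def)
      then show ?thesis by (simp add: less_top)
    qed
    ultimately show ?thesis
    proof eventually_elim
      case (elim z)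
      then have "ennreal_powr (m z) p \<le> ennreal_powr (mn U m g z) p"
        by (simp add: diff_eq_0_iff_ennreal)
      then have "m z \<le> mn U m g z" by (rule ennreal_powr_le_imp_le[OF p])
      then show ?case by (auto simp: mn_def)
    qed
  qed
  show ?thesis
  proof (intro exI[of _ m] conjI)
    show "\<forall>U h. open U \<longrightarrow> U \<subseteq> V \<longrightarrow> integrable_on_compacts U h \<longrightarrow> (\<forall>v\<in>D. slope_bound U u h v) \<longrightarrow>
         (AE z in lborel. z \<in> U \<longrightarrow> m z \<le> h z)"
      by (intro allI impI min)
  qed (use Fm'[unfolded F_def I_def] in blast)+
qed

section \<open>Mollification\<close>

subsection \<open>Continuity of translations in the mean\<close>

definition mean_continuous :: "(plane \<Rightarrow> real) \<Rightarrow> bool" where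
  "mean_continuous f \<longleftrightarrow> (\<forall>e>0. \<exists>d>0. \<forall>a. norm a < d \<longrightarrow> (\<integral>\<^sup>+z. ennreal \<bar>f (z + a) - f z\<bar> \<partial>lborel) < ennreal e)"

lemma mean_continuous_approx:
  assumes [measurable]: "f \<in> borel_measurable borel"
    and ap: "\<And>e. 0 < e \<Longrightarrow> \<exists>g\<in>borel_measurable borel. mean_continuous g \<and> (\<integral>\<^sup>+z. ennreal \<bar>f z - g z\<bar> \<partial>lborel) < ennreal e"
  shows "mean_continuous f"
  unfolding mean_continuous_def
proof (intro allI impI)
  fix e :: real assume e: "0 < e"
  then obtain g where g: "g \<in> borel_measurable borel" "mean_continuous g" "(\<integral>\<^sup>+z. ennreal \<bar>f z - g z\<bar> \<partial>lborel) < ennreal (e / 3)"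
    using ap[of "e / 3"] by auto
  note [measurable] = g(1)
  have "0 < e / 3" using e by simp
  then obtain d where d: "0 < d" "\<And>a. norm a < d \<Longrightarrow> (\<integral>\<^sup>+z. ennreal \<bar>g (z + a) - g z\<bar> \<partial>lborel) < ennreal (e / 3)"
    using g(2) unfolding mean_continuous_def by blast
  have "(\<integral>\<^sup>+z. ennreal \<bar>f (z + a) - f z\<bar> \<partial>lborel) < ennreal e" if a: "norm a < d" for a
  proof -
    have tr: "(\<integral>\<^sup>+z. ennreal \<bar>f (z + a) - g (z + a)\<bar> \<partial>lborel) = (\<integral>\<^sup>+z. ennreal \<bar>f z - g z\<bar> \<partial>lborel)"
      by (rule nn_integral_translate[of "\<lambda>z. ennreal \<bar>f z - g z\<bar>"]) measurable
    have "(\<integral>\<^sup>+z. ennreal \<bar>f (z + a) - f z\<bar> \<partial>lborel)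
      \<le> (\<integral>\<^sup>+z. ennreal \<bar>f (z + a) - g (z + a)\<bar> + (ennreal \<bar>g (z + a) - g z\<bar> + ennreal \<bar>f z - g z\<bar>) \<partial>lborel)"
    proof (rule nn_integral_mono)
      fix z
      have "\<bar>f (z + a) - f z\<bar> \<le> \<bar>f (z + a) - g (z + a)\<bar> + (\<bar>g (z + a) - g z\<bar> + \<bar>f z - g z\<bar>)" by linarith
      then show "ennreal \<bar>f (z + a) - f z\<bar> \<le> ennreal \<bar>f (z + a) - g (z + a)\<bar> + (ennreal \<bar>g (z + a) - g z\<bar> + ennreal \<bar>f z - g z\<bar>)"
        by (simp flip: ennreal_plus)
    qed
    also have "\<dots> = (\<integral>\<^sup>+z. ennreal \<bar>f z - g z\<bar> \<partial>lborel) + ((\<integral>\<^sup>+z. ennreal \<bar>g (z + a) - g z\<bar> \<partial>lborel) + (\<integral>\<^sup>+z. ennreal \<bar>f z - g z\<bar> \<partial>lborel))"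
      by (simp add: nn_integral_add tr)
    also have "\<dots> < ennreal (e / 3) + (ennreal (e / 3) + ennreal (e / 3))"
      using g(3) d(2)[OF a] by (intro add_strict_mono)
    also have "\<dots> = ennreal e" using e by (simp flip: ennreal_plus)
    finally show ?thesis .
  qed
  then show "\<exists>d>0. \<forall>a. norm a < d \<longrightarrow> (\<integral>\<^sup>+z. ennreal \<bar>f (z + a) - f z\<bar> \<partial>lborel) < ennreal e"
    using d(1) by blast
qed

lemma mean_continuous_lipschitz:
  assumes L: "L-lipschitz_on UNIV f" and K: "compact K" "\<And>z. z \<notin> K \<Longrightarrow> f z = 0"
  shows "mean_continuous f"
  unfolding mean_continuous_def
proof (intro allI impI)
  fix e :: real assume e: "0 < e"
  have L0: "0 \<le> L" using L lipschitz_on_nonneg by blast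
  define K1 where "K1 = (\<Union>x\<in>K. cball x 1)"
  have K1: "compact K1" using compact_minkowski_sum_cball[OF K(1)] by (simp add: K1_def)
  have [measurable]: "K1 \<in> sets borel" using K1 by (simp add: borel_closed compact_imp_closed)
  obtain m where m: "emeasure lborel K1 = ennreal m" "0 \<le> m"
    using emeasure_compact_finite[OF K1] by (cases "emeasure lborel K1" rule: ennreal_cases) auto
  define d where "d = min 1 (e / (2 * (L * m + 1)))"
  have Lm: "0 < L * m + 1" using L0 m by (simp add: add_nonneg_pos)
  have "0 < d" using e Lm by (simp add: d_def)
  moreover have "(\<integral>\<^sup>+z. ennreal \<bar>f (z + a) - f z\<bar> \<partial>lborel) < ennreal e" if a: "norm a < d" for a
  proof -
    have a1: "norm a \<le> 1" using a by (simp add: d_def)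
    have "(\<integral>\<^sup>+z. ennreal \<bar>f (z + a) - f z\<bar> \<partial>lborel) \<le> (\<integral>\<^sup>+z. ennreal (L * norm a) * indicator K1 z \<partial>lborel)"
    proof (rule nn_integral_mono)
      fix z
      show "ennreal \<bar>f (z + a) - f z\<bar> \<le> ennreal (L * norm a) * indicator K1 z"
      proof (cases "z \<in> K1")
        case True
        have "\<bar>f (z + a) - f z\<bar> \<le> L * norm a" using lipschitz_onD[OF L, of "z + a" z] by (simp add: dist_real_def dist_norm)
        then show ?thesis using True by (simp add: ennreal_leI)
      next
        case False
        have "z \<notin> K" using False by (auto simp: K1_def)
        moreover have "z + a \<notin> K"
        proof
          assume "z + a \<in> K"
          moreover have "z \<in> cball (z + a) 1" using a1 by (simp add: dist_norm)
          ultimately show False using False unfolding K1_def by blast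
        qed
        ultimately show ?thesis using K(2) by simp
      qed
    qed
    also have "\<dots> = ennreal (L * norm a) * ennreal m" by (simp add: nn_integral_cmult_indicator m)
    also have "\<dots> = ennreal (L * norm a * m)" using L0 m by (simp add: ennreal_mult)
    also have "\<dots> < ennreal e"
    proof -
      have "norm a * (2 * (L * m + 1)) < e" using a Lm by (simp add: d_def pos_less_divide_eq)
      moreover have "L * norm a * m \<le> norm a * (2 * (L * m + 1))"
      proof -
        have "L * norm a * m = norm a * (L * m)" by simp
        also have "\<dots> \<le> norm a * (2 * (L * m + 1))" using L0 m by (intro mult_left_mono) (auto simp: mult_nonneg_nonneg)
        finally show ?thesis .
      qed
      ultimately have "L * norm a * m < e" by linarith
      then show ?thesis using e by (intro ennreal_lessI) auto
    qed
    finally show ?thesis .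
  qed
  ultimately show "\<exists>d>0. \<forall>a. norm a < d \<longrightarrow> (\<integral>\<^sup>+z. ennreal \<bar>f (z + a) - f z\<bar> \<partial>lborel) < ennreal e" by blast
qed

lemma mean_continuous_compact:
  assumes K: "compact K"
  shows "mean_continuous (indicator K)"
proof (rule mean_continuous_approx)
  have [measurable]: "K \<in> sets borel" using K by (simp add: borel_closed compact_imp_closed)
  show "indicator K \<in> borel_measurable borel" by measurable
  fix e :: real assume e: "0 < e"
  then have e2: "0 < e / 2" by simp
  have "integrable_on_compacts UNIV (\<lambda>_. 1)"
    unfolding integrable_on_compacts_def
    using emeasure_compact_finite by (auto simp: borel_closed compact_imp_closed)
  from cutoff_small_mass[OF K subset_UNIV open_UNIV this e2]
  obtain \<psi> L K2 where \<psi>: "L-lipschitz_on UNIV \<psi>" "\<And>z. 0 \<le> \<psi> z" "\<And>z. \<psi> z \<le> 1" "\<And>z. z \<in> K \<Longrightarrow> \<psi> z = 1"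
     "compact K2" "\<And>z. z \<notin> K2 \<Longrightarrow> \<psi> z = (0::real)"
     "(\<integral>\<^sup>+z. 1 * ennreal (\<psi> z) \<partial>lborel) \<le> (\<integral>\<^sup>+z\<in>K. 1 \<partial>lborel) + ennreal (e / 2)" by blast
  have [measurable]: "\<psi> \<in> borel_measurable borel"
    using \<psi>(1) borel_measurable_continuous_onI lipschitz_on_continuous_on by blast
  have "mean_continuous \<psi>" using \<psi> by (intro mean_continuous_lipschitz)
  moreover have "(\<integral>\<^sup>+z. ennreal \<bar>indicator K z - \<psi> z\<bar> \<partial>lborel) < ennreal e"
  proof -
    have fin: "(\<integral>\<^sup>+z. indicator K z \<partial>lborel) < top"
      using emeasure_compact_finite[OF K] by simp
    have "(\<integral>\<^sup>+z. ennreal \<bar>indicator K z - \<psi> z\<bar> \<partial>lborel) = (\<integral>\<^sup>+z. ennreal (\<psi> z) - indicator K z \<partial>lborel)"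
    proof (rule nn_integral_cong)
      fix z
      show "ennreal \<bar>indicator K z - \<psi> z\<bar> = ennreal (\<psi> z) - indicator K z"
        using \<psi>(2,4)[of z] by (cases "z \<in> K") auto
    qed
    also have "\<dots> = (\<integral>\<^sup>+z. ennreal (\<psi> z) \<partial>lborel) - (\<integral>\<^sup>+z. indicator K z \<partial>lborel)"
      using fin \<psi>(4) by (intro nn_integral_diff) (auto simp: indicator_def)
    also have "\<dots> \<le> ennreal (e / 2)"
      using \<psi>(7) less_imp_neq[OF fin] by (simp add: ennreal_minus_le_iff add.commute)
    also have "\<dots> < ennreal e" using e by (simp add: ennreal_lessI)
    finally show ?thesis .
  qed
  ultimately show "\<exists>g\<in>borel_measurable borel. mean_continuous g \<and> (\<integral>\<^sup>+z. ennreal \<bar>indicator K z - g z\<bar> \<partial>lborel) < ennreal e"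
    by (intro bexI[of _ \<psi>]) auto
qed

lemma mean_continuous_indicator:
  assumes A: "A \<in> sets borel" "emeasure lborel A < \<infinity>"
  shows "mean_continuous (indicator A)"
proof (rule mean_continuous_approx)
  note [measurable] = A(1)
  show "indicator A \<in> borel_measurable borel" by measurable
  fix e :: real assume e: "0 < e"
  define \<mu> where "\<mu> = density lborel (indicator A)"
  have \<mu>: "emeasure \<mu> S = emeasure lborel (A \<inter> S)" if "S \<in> sets borel" for S
    unfolding \<mu>_def using that A by (subst emeasure_density) (auto simp: nn_integral_indicator[symmetric] indicator_inter_arith simp del: nn_integral_indicator)
  have sets\<mu>: "sets \<mu> = sets borel" by (simp add: \<mu>_def)
  have fin: "emeasure \<mu> (space \<mu>) \<noteq> \<infinity>" using \<mu>[of UNIV] A by (simp add: \<mu>_def)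
  have reg: "emeasure \<mu> A = (SUP K\<in>{K. K \<subseteq> A \<and> compact K}. emeasure \<mu> K)"
    by (rule inner_regular[OF sets\<mu> fin]) measurable
  have "\<exists>K\<in>{K. K \<subseteq> A \<and> compact K}. emeasure \<mu> A < emeasure \<mu> K + ennreal e"
    using e compact_empty A \<mu>[of A] by (intro SUP_approx_ennreal[OF _ _ reg]) auto
  then obtain K where K: "K \<subseteq> A" "compact K" "emeasure \<mu> A < emeasure \<mu> K + ennreal e" by blast
  have [measurable]: "K \<in> sets borel" using K by (simp add: borel_closed compact_imp_closed)
  have AK: "A \<inter> K = K" using K by blast
  have "(\<integral>\<^sup>+z. ennreal \<bar>indicator A z - indicator K z\<bar> \<partial>lborel) = (\<integral>\<^sup>+z. indicator (A - K) z \<partial>lborel)"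
    using K(1) by (intro nn_integral_cong) (auto simp: indicator_def)
  also have "\<dots> = emeasure lborel (A - K)" by (rule nn_integral_indicator) measurable
  also have "\<dots> = emeasure lborel A - emeasure lborel K"
    using K A emeasure_compact_finite[OF K(2)] by (intro emeasure_Diff) auto
  also have "\<dots> < ennreal e"
  proof -
    have less: "a - k < ennreal e" if "a < k + ennreal e" "k \<noteq> top" "k \<le> a" "a \<noteq> top" for a k :: ennreal
      using that e by (cases a rule: ennreal_cases; cases k rule: ennreal_cases)
        (auto simp: ennreal_minus ennreal_less_iff simp flip: ennreal_plus)
    show ?thesis
      using K(3) less_imp_neq[OF emeasure_compact_finite[OF K(2)]] less_imp_neq[OF A(2)] emeasure_mono[OF K(1), of lborel]
      by (intro less) (auto simp: \<mu> AK)
  qed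
  finally show "\<exists>g\<in>borel_measurable borel. mean_continuous g \<and> (\<integral>\<^sup>+z. ennreal \<bar>indicator A z - g z\<bar> \<partial>lborel) < ennreal e"
    by (intro bexI[of _ "indicator K"] conjI mean_continuous_compact K(2)) auto
qed

text \<open>Translations preserve the \<open>L\<^sup>1\<close> norm, so the property is inherited by limits in the mean. It
  passes from Lipschitz functions of compact support to indicators of compact sets, then of
  sets of finite measure, and finally to integrable functions.\<close>

lemma mean_continuous_integrable:
  fixes f :: "plane \<Rightarrow> real"
  assumes "integrable lborel f"
  shows "mean_continuous f"
  using assms
proof (induction rule: integrable_induct)
  case (base A c)
  have A: "mean_continuous (indicator A)" using base by (intro mean_continuous_indicator) auto
  show ?case unfolding mean_continuous_def
  proof (intro allI impI)
    fix e :: real assume e: "0 < e"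
    have "0 < e / (\<bar>c\<bar> + 1)" using e by simp
    then obtain d where d: "0 < d" "\<And>a. norm a < d \<Longrightarrow> (\<integral>\<^sup>+z. ennreal \<bar>indicator A (z + a) - indicator A z\<bar> \<partial>lborel) < ennreal (e / (\<bar>c\<bar> + 1))"
      using A unfolding mean_continuous_def by blast
    have [measurable]: "A \<in> sets borel" using base by simp
    have "(\<integral>\<^sup>+z. ennreal \<bar>indicat_real A (z + a) *\<^sub>R c - indicat_real A z *\<^sub>R c\<bar> \<partial>lborel) < ennreal e" if a: "norm a < d" for a
    proof -
      have "(\<integral>\<^sup>+z. ennreal \<bar>indicat_real A (z + a) *\<^sub>R c - indicat_real A z *\<^sub>R c\<bar> \<partial>lborel)
          \<le> (\<integral>\<^sup>+z. ennreal (\<bar>c\<bar> + 1) * ennreal \<bar>indicator A (z + a) - indicator A z\<bar> \<partial>lborel)"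
        by (intro nn_integral_mono) (auto simp: indicator_def ennreal_leI)
      also have "\<dots> = ennreal (\<bar>c\<bar> + 1) * (\<integral>\<^sup>+z. ennreal \<bar>indicator A (z + a) - indicator A z\<bar> \<partial>lborel)"
        by (intro nn_integral_cmult) measurable
      also have "\<dots> < ennreal (\<bar>c\<bar> + 1) * ennreal (e / (\<bar>c\<bar> + 1))"
      proof (rule ennreal_mult_strict_left_mono[OF d(2)[OF a]])
        show "0 < ennreal (\<bar>c\<bar> + 1)" by (subst ennreal_less_zero_iff) simp
      qed simp
      also have "\<dots> = ennreal e" using e by (subst ennreal_mult[symmetric]) auto
      finally show ?thesis .
    qed
    then show "\<exists>d>0. \<forall>a. norm a < d \<longrightarrow> (\<integral>\<^sup>+z. ennreal \<bar>indicat_real A (z + a) *\<^sub>R c - indicat_real A z *\<^sub>R c\<bar> \<partial>lborel) < ennreal e"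
      using d(1) by blast
  qed
next
  case (add f g)
  have [measurable]: "f \<in> borel_measurable borel" "g \<in> borel_measurable borel" using add by (auto dest: borel_measurable_integrable)
  show ?case unfolding mean_continuous_def
  proof (intro allI impI)
    fix e :: real assume e: "0 < e"
    then have e2: "0 < e / 2" by simp
    obtain d where d: "0 < d" "\<And>a. norm a < d \<Longrightarrow> (\<integral>\<^sup>+z. ennreal \<bar>f (z + a) - f z\<bar> \<partial>lborel) < ennreal (e / 2)"
      using add e2 unfolding mean_continuous_def by blast
    obtain d' where d': "0 < d'" "\<And>a. norm a < d' \<Longrightarrow> (\<integral>\<^sup>+z. ennreal \<bar>g (z + a) - g z\<bar> \<partial>lborel) < ennreal (e / 2)"
      using add e2 unfolding mean_continuous_def by blast
    have "(\<integral>\<^sup>+z. ennreal \<bar>(f (z + a) + g (z + a)) - (f z + g z)\<bar> \<partial>lborel) < ennreal e" if a: "norm a < min d d'" for a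
    proof -
      have "(\<integral>\<^sup>+z. ennreal \<bar>(f (z + a) + g (z + a)) - (f z + g z)\<bar> \<partial>lborel)
        \<le> (\<integral>\<^sup>+z. ennreal \<bar>f (z + a) - f z\<bar> + ennreal \<bar>g (z + a) - g z\<bar> \<partial>lborel)"
        by (intro nn_integral_mono) (simp flip: ennreal_plus)
      also have "\<dots> = (\<integral>\<^sup>+z. ennreal \<bar>f (z + a) - f z\<bar> \<partial>lborel) + (\<integral>\<^sup>+z. ennreal \<bar>g (z + a) - g z\<bar> \<partial>lborel)"
        by (intro nn_integral_add) measurable
      also have "\<dots> < ennreal (e / 2) + ennreal (e / 2)" using d d' a by (intro add_strict_mono) auto
      also have "\<dots> = ennreal e" using e by (simp flip: ennreal_plus)
      finally show ?thesis .
    qed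
    then show "\<exists>d>0. \<forall>a. norm a < d \<longrightarrow> (\<integral>\<^sup>+z. ennreal \<bar>(f (z + a) + g (z + a)) - (f z + g z)\<bar> \<partial>lborel) < ennreal e"
      using d(1) d'(1) by (intro exI[of _ "min d d'"]) auto
  qed
next
  case (lim f s)
  have [measurable]: "f \<in> borel_measurable borel" "s i \<in> borel_measurable borel" for i
    using lim.hyps by (auto dest: borel_measurable_integrable)
  show ?case
  proof (rule mean_continuous_approx)
    fix e :: real assume e: "0 < e"
    have "(\<lambda>i. \<integral>\<^sup>+z. ennreal \<bar>f z - s i z\<bar> \<partial>lborel) \<longlonglongrightarrow> (\<integral>\<^sup>+z. 0 \<partial>(lborel::plane measure))"
    proof (rule nn_integral_dominated_convergence)
      show "AE z in lborel. ennreal \<bar>f z - s i z\<bar> \<le> ennreal (3 * \<bar>f z\<bar>)" for i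
      proof (rule AE_I2)
        fix z :: plane
        have "\<bar>s i z\<bar> \<le> 2 * \<bar>f z\<bar>" using lim.hyps(3)[of z i] by simp
        then show "ennreal \<bar>f z - s i z\<bar> \<le> ennreal (3 * \<bar>f z\<bar>)" by (intro ennreal_leI) linarith
      qed
      have "(\<integral>\<^sup>+z. ennreal (3 * \<bar>f z\<bar>) \<partial>lborel) = 3 * (\<integral>\<^sup>+z. ennreal \<bar>f z\<bar> \<partial>lborel)"
        by (simp add: ennreal_mult nn_integral_cmult)
      also have "\<dots> < \<infinity>" using lim.hyps(4) by (auto simp: integrable_iff_bounded ennreal_mult_less_top)
      finally show "(\<integral>\<^sup>+z. ennreal (3 * \<bar>f z\<bar>) \<partial>lborel) < \<infinity>" .
      show "AE z in lborel. (\<lambda>i. ennreal \<bar>f z - s i z\<bar>) \<longlonglongrightarrow> 0"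
      proof (rule AE_I2)
        fix z :: plane
        have "(\<lambda>i. \<bar>f z - s i z\<bar>) \<longlonglongrightarrow> \<bar>f z - f z\<bar>"
          using lim.hyps(2)[of z] by (intro tendsto_intros) auto
        then show "(\<lambda>i. ennreal \<bar>f z - s i z\<bar>) \<longlonglongrightarrow> 0"
          using tendsto_ennrealI by fastforce
      qed
    qed measurable
    then have "\<forall>\<^sub>F i in sequentially. (\<integral>\<^sup>+z. ennreal \<bar>f z - s i z\<bar> \<partial>lborel) < ennreal e"
      using e by (intro order_tendstoD(2)) auto
    then obtain i where "(\<integral>\<^sup>+z. ennreal \<bar>f z - s i z\<bar> \<partial>lborel) < ennreal e"
      unfolding eventually_sequentially by blast
    then show "\<exists>g\<in>borel_measurable borel. mean_continuous g \<and> (\<integral>\<^sup>+z. ennreal \<bar>f z - g z\<bar> \<partial>lborel) < ennreal e"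
      using lim.IH by (intro bexI[of _ "s i"]) auto
  qed measurable
qed

subsection \<open>Mollifiers\<close>

definition bump_mass :: "real \<Rightarrow> real" where
  "bump_mass e = (\<integral>z. max 0 (e - norm (z :: plane)) \<partial>lborel)"

definition mollifier :: "real \<Rightarrow> plane \<Rightarrow> real" where
  "mollifier e z = max 0 (e - norm z) / bump_mass e"

definition mollify :: "real \<Rightarrow> (plane \<Rightarrow> real) \<Rightarrow> plane \<Rightarrow> real" where
  "mollify e f z = (\<integral>w. f w * mollifier e (w - z) \<partial>lborel)"

lemma bump_integrable: "integrable lborel (\<lambda>z :: plane. max 0 (e - norm z))"
proof (rule integrableI_bounded)
  have "(\<integral>\<^sup>+z. ennreal (norm (max 0 (e - norm (z :: plane)))) \<partial>lborel) \<le> (\<integral>\<^sup>+z. ennreal \<bar>e\<bar> * indicator (cball 0 e) z \<partial>(lborel :: plane measure))"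
  proof (rule nn_integral_mono)
    fix z :: plane
    show "ennreal (norm (max 0 (e - norm z))) \<le> ennreal \<bar>e\<bar> * indicator (cball 0 e) z"
      using norm_ge_zero[of z] by (cases "norm z \<le> e") (auto simp: max_def simp del: norm_ge_zero intro!: ennreal_leI)
  qed
  also have "\<dots> = ennreal \<bar>e\<bar> * emeasure lborel (cball (0::plane) e)" by (simp add: nn_integral_cmult_indicator)
  also have "\<dots> < \<infinity>" using emeasure_lborel_cball_finite[of "0::plane" e] by (auto simp: ennreal_mult_less_top)
  finally show "(\<integral>\<^sup>+z. ennreal (norm (max 0 (e - norm (z :: plane)))) \<partial>lborel) < \<infinity>" .
qed measurable

lemma bump_mass_pos: "0 < e \<Longrightarrow> 0 < bump_mass e"
proof -
  assume e: "0 < e"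
  have "0 \<le> bump_mass e" unfolding bump_mass_def by (intro Bochner_Integration.integral_nonneg) auto
  moreover have "bump_mass e \<noteq> 0"
  proof
    assume "bump_mass e = 0"
    then have "AE z in lborel. max 0 (e - norm (z :: plane)) = 0"
      unfolding bump_mass_def by (subst (asm) integral_nonneg_eq_0_iff_AE[OF bump_integrable]) auto
    then have "AE z in lborel. z \<notin> ball (0::plane) e" by eventually_elim (auto simp: max_def split: if_splits)
    then have "ball (0::plane) e \<in> null_sets lborel" by (subst AE_iff_null_sets) auto
    then have "negligible (ball (0::plane) e)" by (simp add: negligible_iff_null_sets null_sets_completionI)
    then show False using open_not_negligible[of "ball (0::plane) e"] e by simp
  qed
  ultimately show ?thesis by linarith
qed

lemma mollifier_nonneg: "0 < e \<Longrightarrow> 0 \<le> mollifier e z"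
  using bump_mass_pos[of e] by (simp add: mollifier_def)

lemma mollifier_zero: "e \<le> norm z \<Longrightarrow> mollifier e z = 0"
  by (simp add: mollifier_def)

lemma mollifier_measurable [measurable]: "mollifier e \<in> borel_measurable borel"
  unfolding mollifier_def by measurable

lemma mollifier_nn_integral: "0 < e \<Longrightarrow> (\<integral>\<^sup>+z. ennreal (mollifier e z) \<partial>lborel) = 1"
proof -
  assume e: "0 < e"
  have i: "integrable lborel (mollifier e)" unfolding mollifier_def by (intro integrable_divide_zero bump_integrable) 
  have "(\<integral>z. mollifier e z \<partial>lborel) = bump_mass e / bump_mass e"
    unfolding mollifier_def by (subst integral_divide_zero) (simp add: bump_mass_def)
  then have "(\<integral>z. mollifier e z \<partial>lborel) = 1" using bump_mass_pos[OF e] by simp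
  then show ?thesis
    using nn_integral_eq_integral[OF i] mollifier_nonneg[OF e] by simp
qed

lemma mollifier_lipschitz: "0 < e \<Longrightarrow> \<bar>mollifier e x - mollifier e y\<bar> \<le> dist x y / bump_mass e"
proof -
  assume e: "0 < e"
  have "\<bar>max 0 (e - norm x) - max 0 (e - norm y)\<bar> \<le> \<bar>norm x - norm y\<bar>" by (auto simp: max_def)
  also have "\<dots> \<le> dist x y" by (simp add: dist_norm norm_triangle_ineq3)
  finally have "\<bar>max 0 (e - norm x) - max 0 (e - norm y)\<bar> / bump_mass e \<le> dist x y / bump_mass e"
    using bump_mass_pos[OF e] by (intro divide_right_mono) auto
  then show ?thesis
    using bump_mass_pos[OF e] by (simp add: mollifier_def diff_divide_distrib[symmetric])
qed

lemma test_function_mollifier: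
  assumes e: "0 < e" and z: "cball z e \<subseteq> U"
  shows "test_function U (\<lambda>w. mollifier e (w - z))"
  unfolding test_function_def
proof (intro conjI exI[of _ "1 / bump_mass e"] exI[of _ "cball z e"] allI impI)
  show "(1 / bump_mass e)-lipschitz_on UNIV (\<lambda>w. mollifier e (w - z))"
  proof (rule lipschitz_onI)
    fix x y
    show "dist (mollifier e (x - z)) (mollifier e (y - z)) \<le> 1 / bump_mass e * dist x y"
      using mollifier_lipschitz[OF e, of "x - z" "y - z"] by (simp add: dist_real_def dist_norm)
  qed (use bump_mass_pos[OF e] in simp)
qed (use z mollifier_nonneg[OF e] in \<open>auto intro: mollifier_zero simp: dist_norm norm_minus_commute\<close>)

lemma locally_integrable_mult_mollifier:
  assumes u: "locally_integrable u" and e: "0 < e"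
  shows "integrable lborel (\<lambda>w. u w * mollifier e (w - z))"
  using integrable_mult_test[OF u test_function_mollifier[OF e, of z UNIV], of 0] by simp

lemma continuous_mollify:
  assumes u: "locally_integrable u" and e: "0 < e"
  shows "continuous_on UNIV (mollify e u)"
  unfolding continuous_on_iff
proof (intro ballI allI impI)
  fix z :: plane and \<eta> :: real assume \<eta>: "0 < \<eta>"
  define K where "K = cball z (1 + e)"
  have [measurable]: "u \<in> borel_measurable borel" using u by (simp add: locally_integrable_def)
  have [measurable]: "K \<in> sets borel" by (simp add: K_def)
  have "(\<integral>\<^sup>+w\<in>K. ennreal \<bar>u w\<bar> \<partial>lborel) < top" using u by (simp add: locally_integrable_def K_def)
  then obtain m where m: "(\<integral>\<^sup>+w\<in>K. ennreal \<bar>u w\<bar> \<partial>lborel) = ennreal m" "0 \<le> m"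
    by (cases "\<integral>\<^sup>+w\<in>K. ennreal \<bar>u w\<bar> \<partial>lborel" rule: ennreal_cases) auto
  define c where "c = 1 / bump_mass e"
  have c: "0 < c" using bump_mass_pos[OF e] by (simp add: c_def)
  have le: "\<bar>mollify e u z' - mollify e u z\<bar> \<le> c * m * dist z' z" if z': "dist z' z < 1" for z'
  proof -
    have i: "integrable lborel (\<lambda>w. u w * (mollifier e (w - z') - mollifier e (w - z)))"
      using Bochner_Integration.integrable_diff[OF locally_integrable_mult_mollifier[OF u e, of z'] locally_integrable_mult_mollifier[OF u e, of z]]
      by (simp add: right_diff_distrib)
    have "mollify e u z' - mollify e u z = (\<integral>w. u w * (mollifier e (w - z') - mollifier e (w - z)) \<partial>lborel)"
      unfolding mollify_def
      by (subst Bochner_Integration.integral_diff[symmetric]) (auto intro: locally_integrable_mult_mollifier u e simp: right_diff_distrib)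
    then have "ennreal \<bar>mollify e u z' - mollify e u z\<bar> \<le> (\<integral>\<^sup>+w. ennreal \<bar>u w * (mollifier e (w - z') - mollifier e (w - z))\<bar> \<partial>lborel)"
      using integral_norm_bound_ennreal[OF i] by simp
    also have "\<dots> \<le> (\<integral>\<^sup>+w. ennreal (c * dist z' z) * (ennreal \<bar>u w\<bar> * indicator K w) \<partial>lborel)"
    proof (rule nn_integral_mono)
      fix w
      show "ennreal \<bar>u w * (mollifier e (w - z') - mollifier e (w - z))\<bar> \<le> ennreal (c * dist z' z) * (ennreal \<bar>u w\<bar> * indicator K w)"
      proof (cases "w \<in> K")
        case True
        have "\<bar>mollifier e (w - z') - mollifier e (w - z)\<bar> \<le> c * dist z' z"
          using mollifier_lipschitz[OF e, of "w - z'" "w - z"] by (simp add: c_def dist_norm norm_minus_commute)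
        then have "\<bar>u w * (mollifier e (w - z') - mollifier e (w - z))\<bar> \<le> c * dist z' z * \<bar>u w\<bar>"
          by (simp add: abs_mult mult.commute[of "\<bar>u w\<bar>"] mult_right_mono)
        then show ?thesis using True c by (simp add: ennreal_mult[symmetric] ennreal_leI)
      next
        case False
        then have far: "1 + e < dist w z" by (simp add: K_def dist_commute)
        have "dist w z \<le> dist w z' + dist z' z" by (rule dist_triangle)
        then have "e \<le> norm (w - z')" "e \<le> norm (w - z)" using far z' e by (auto simp: dist_norm)
        then show ?thesis by (simp add: mollifier_zero)
      qed
    qed
    also have "\<dots> = ennreal (c * dist z' z) * ennreal m" unfolding m(1)[symmetric]
      by (intro nn_integral_cmult) measurable
    also have "\<dots> = ennreal (c * m * dist z' z)" using c m by (simp add: ennreal_mult[symmetric] mult.assoc mult.left_commute mult.commute)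
    finally show ?thesis using c m by (simp add: ennreal_le_iff)
  qed
  define d where "d = min 1 (\<eta> / (c * m + 1))"
  have cm: "0 < c * m + 1" using c m by (simp add: add_nonneg_pos)
  have "dist (mollify e u z') (mollify e u z) < \<eta>" if "dist z' z < d" for z'
  proof -
    have "dist z' z * (c * m + 1) < \<eta>" using that cm by (simp add: d_def pos_less_divide_eq)
    moreover have "c * m * dist z' z \<le> dist z' z * (c * m + 1)" by (simp add: algebra_simps)
    ultimately show ?thesis using le[of z'] that by (simp add: d_def dist_real_def)
  qed
  moreover have "0 < d" using \<eta> cm by (simp add: d_def)
  ultimately show "\<exists>d>0. \<forall>x'\<in>UNIV. dist x' z < d \<longrightarrow> dist (mollify e u x') (mollify e u z) < \<eta>" by blast
qed

text \<open>The translated mollifier \<open>w \<mapsto> mollifier e (w - z)\<close> is itself a test function, and for it the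
  slope bound speaks of mollifications of \<open>u\<close> and \<open>h\<close>.\<close>

lemma mollify_slope:
  assumes u: "locally_integrable u" and h: "locally_integrable h" "\<And>z. 0 \<le> h z"
    and sb: "slope_bound U u (\<lambda>z. ennreal (h z)) v" and e: "0 < e" and z: "cball z e \<subseteq> U" and \<eta>: "0 < \<eta>"
  shows "\<forall>\<^sub>F \<delta> in at_right 0. \<bar>mollify e u (z - \<delta> *\<^sub>R v) - mollify e u z\<bar> \<le> \<delta> * (mollify e h z + \<eta>)"
proof -
  have t: "test_function U (\<lambda>w. mollifier e (w - z))" by (rule test_function_mollifier[OF e z])
  have mh: "0 \<le> mollify e h z" unfolding mollify_def using h mollifier_nonneg[OF e] by (intro Bochner_Integration.integral_nonneg) auto
  have eq: "(\<integral>w. u w * (mollifier e (w + \<delta> *\<^sub>R v - z) - mollifier e (w - z)) \<partial>lborel) = mollify e u (z - \<delta> *\<^sub>R v) - mollify e u z" for \<delta>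
  proof -
    have eq1: "w + \<delta> *\<^sub>R v - z = w - (z - \<delta> *\<^sub>R v)" for w by simp
    show ?thesis unfolding mollify_def eq1
      by (subst Bochner_Integration.integral_diff[symmetric]) (auto intro: locally_integrable_mult_mollifier u e simp: right_diff_distrib)
  qed
  have eqh: "(\<integral>\<^sup>+w. ennreal (h w) * ennreal (mollifier e (w - z)) \<partial>lborel) = ennreal (mollify e h z)"
    unfolding mollify_def using h mollifier_nonneg[OF e] locally_integrable_mult_mollifier[OF h(1) e, of z]
    by (subst nn_integral_eq_integral[symmetric]) (auto simp: ennreal_mult)
  show ?thesis
    using sb[unfolded slope_bound_def, rule_format, OF t \<eta>] eventually_at_right_less[of 0]
  proof eventually_elim
    case (elim \<delta>)
    then have "ennreal \<bar>mollify e u (z - \<delta> *\<^sub>R v) - mollify e u z\<bar> \<le> ennreal \<delta> * (ennreal (mollify e h z) + ennreal \<eta>)"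
      unfolding eq eqh by simp
    also have "\<dots> = ennreal (\<delta> * (mollify e h z + \<eta>))"
      using elim(2) mh \<eta> by (simp add: ennreal_mult)
    finally show ?case using elim(2) mh \<eta> by (simp add: ennreal_le_iff)
  qed
qed

subsection \<open>From infinitesimal to global estimates\<close>

text \<open>The points up to which the estimate holds with an additional slope \<open>\<eta>\<close> form a closed set that
  can be extended to the right of each of its points.\<close>

lemma increment_bound:
  fixes f F :: "real \<Rightarrow> real"
  assumes ab: "a \<le> b" and f: "continuous_on {a..b} f" and F: "continuous_on {a..b} F"
    and loc: "\<And>t \<eta>. a \<le> t \<Longrightarrow> t < b \<Longrightarrow> 0 < \<eta> \<Longrightarrow>
        \<forall>\<^sub>F \<delta> in at_right 0. \<bar>f (t + \<delta>) - f t\<bar> \<le> F (t + \<delta>) - F t + \<eta> * \<delta>"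
  shows "\<bar>f b - f a\<bar> \<le> F b - F a"
proof -
  have main: "\<bar>f b - f a\<bar> \<le> F b - F a + \<eta> * (b - a)" if \<eta>: "0 < \<eta>" for \<eta>
  proof -
    define S where "S = {t \<in> {a..b}. \<bar>f t - f a\<bar> \<le> F t - F a + \<eta> * (t - a)}"
    have cS: "closed S" unfolding S_def
      by (intro continuous_on_closed_Collect_le continuous_intros f F)
    have "b \<in> S"
    proof (rule ccontr)
      assume bS: "b \<notin> S"
      define N where "N = {t \<in> {a..b}. t \<notin> S}"
      have N: "N \<noteq> {}" "bdd_below N" using bS ab by (auto simp: N_def intro!: bdd_belowI[of _ a])
      (* The first point at which the estimate fails to persist: it belongs to S because S is closed,
         and the local estimate carries S beyond it. *)
      define c where "c = Inf N"
      have ac: "a \<le> c" unfolding c_def using N(1) by (rule cInf_greatest) (auto simp: N_def)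
      have "b \<in> N" using bS ab by (simp add: N_def)
      then have cb: "c \<le> b" unfolding c_def using N(2) by (rule cInf_lower)
      have below: "t \<in> S" if "a \<le> t" "t < c" for t
      proof (rule ccontr)
        assume "t \<notin> S"
        then have "t \<in> N" using that cb by (simp add: N_def)
        then have "c \<le> t" unfolding c_def using N(2) by (rule cInf_lower)
        with that show False by simp
      qed
      have cinS: "c \<in> S"
      proof (cases "a = c")
        case True
        then show ?thesis using ab \<eta> by (simp add: S_def)
      next
        case False
        with ac have "a < c" by simp
        have "closure {a..<c} \<subseteq> S" using below cS by (intro closure_minimal) auto
        then show ?thesis using \<open>a < c\<close> by auto
      qed
      with bS cb have "c < b" by (metis order_le_less)
      from loc[OF ac this \<eta>] obtain d where d: "0 < d"
         "\<And>\<delta>. 0 < \<delta> \<Longrightarrow> \<delta> < d \<Longrightarrow> \<bar>f (c + \<delta>) - f c\<bar> \<le> F (c + \<delta>) - F c + \<eta> * \<delta>"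
        unfolding eventually_at_right_field by auto
      have "Inf N < c + d" using d(1) by (simp add: c_def)
      then obtain t where t: "t \<in> N" "t < c + d" using cInf_lessD[OF N(1)] by blast
      have "c \<le> t" unfolding c_def using t(1) N(2) by (rule cInf_lower)
      moreover have "t \<noteq> c" using t(1) cinS by (auto simp: N_def)
      ultimately have ct: "c < t" by simp
      have "\<bar>f (c + (t - c)) - f c\<bar> \<le> F (c + (t - c)) - F c + \<eta> * (t - c)"
        using ct t(2) by (intro d(2)) auto
      then have "\<bar>f t - f c\<bar> \<le> F t - F c + \<eta> * (t - c)" by simp
      moreover have "\<bar>f c - f a\<bar> \<le> F c - F a + \<eta> * (c - a)" using cinS by (simp add: S_def)
      ultimately have "\<bar>f t - f a\<bar> \<le> F t - F a + \<eta> * (t - a)" by (simp add: right_diff_distrib)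
      then have "t \<in> S" using t(1) by (simp add: S_def N_def)
      then show False using t(1) by (simp add: N_def)
    qed
    then show ?thesis by (simp add: S_def)
  qed
  show ?thesis
  proof (rule field_le_epsilon)
    fix e :: real assume e: "0 < e"
    have "\<bar>f b - f a\<bar> \<le> F b - F a + (e / (b - a + 1)) * (b - a)" using e ab by (intro main) auto
    also have "(e / (b - a + 1)) * (b - a) \<le> e" using e ab by (simp add: divide_le_eq mult_left_mono)
    finally show "\<bar>f b - f a\<bar> \<le> F b - F a + e" by simp
  qed
qed

lemma mollify_nonneg: "0 < e \<Longrightarrow> (\<And>z. 0 \<le> h z) \<Longrightarrow> 0 \<le> mollify e h z"
  unfolding mollify_def using mollifier_nonneg[of e] by (intro Bochner_Integration.integral_nonneg) auto

text \<open>Slope bounds in a dense set of directions bound the slope of the continuous function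
  \<open>mollify e u\<close> in all directions.\<close>

lemma mollify_lipschitz_ball:
  assumes u: "locally_integrable u" and h: "locally_integrable h" "\<And>z. 0 \<le> h z"
    and sb: "\<And>v. v \<in> good_directions \<Longrightarrow> slope_bound U u (\<lambda>z. ennreal (h z)) v" and e: "0 < e"
    and B: "\<And>z. z \<in> ball z0 r \<Longrightarrow> cball z e \<subseteq> U \<and> mollify e h z \<le> M"
    and z: "z \<in> ball z0 r" "z' \<in> ball z0 r"
  shows "\<bar>mollify e u z' - mollify e u z\<bar> \<le> M * dist z z'"
proof (cases "z = z'")
  case False
  define T where "T = norm (z' - z)"
  define w where "w = (1 / T) *\<^sub>R (z' - z)"
  have T: "0 < T" using False by (simp add: T_def)
  have w: "norm w = 1" "z + T *\<^sub>R w = z'" using T by (auto simp: w_def T_def)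
  have c: "continuous_on UNIV (mollify e u)" by (rule continuous_mollify[OF u e])
  have "\<bar>mollify e u z' - mollify e u z\<bar> \<le> M * T + \<eta>" if \<eta>: "0 < \<eta>" for \<eta>
  proof -
    obtain d1 where d1: "0 < d1" "\<And>y. dist y z' < d1 \<Longrightarrow> dist (mollify e u y) (mollify e u z') < \<eta>"
      using c \<eta> unfolding continuous_on_iff by blast
    obtain d2 where d2: "0 < d2" "ball z' d2 \<subseteq> ball z0 r"
      using z(2) open_ball openE by blast
    have "0 < min d1 d2 / T" using d1 d2 T by simp
    then obtain v where v: "v \<in> good_directions" "dist v w < min d1 d2 / T"
      using good_directions_dense[OF w(1)] by blast
    define y where "y = z + T *\<^sub>R v"
    have "dist y z' = T * dist v w"
    proof -
      have "y - z' = T *\<^sub>R (v - w)" using w(2) by (simp add: y_def algebra_simps flip: w(2))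
      then show ?thesis using T by (simp add: dist_norm)
    qed
    then have yz: "dist y z' < min d1 d2" using v(2) T by (simp add: pos_less_divide_eq mult.commute)
    then have "y \<in> ball z' d2" by (simp add: dist_commute)
    then have yB: "y \<in> ball z0 r" using d2(2) by blast
    (* The segment from z to z' is replaced by one in a nearby good direction v. It stays in the
       ball by convexity, and its end point y is close to z'. *)
    have "\<bar>mollify e u (z + T *\<^sub>R v) - mollify e u (z + 0 *\<^sub>R v)\<bar> \<le> M * T - M * 0"
    proof (rule increment_bound[of 0 T "\<lambda>t. mollify e u (z + t *\<^sub>R v)" "\<lambda>t. M * t"])
      show "continuous_on {0..T} (\<lambda>t. mollify e u (z + t *\<^sub>R v))"
        by (rule continuous_on_compose2[OF c]) (auto intro!: continuous_intros)
      fix t \<zeta> :: real assume t: "0 \<le> t" "t < T" and \<zeta>: "0 < \<zeta>"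
      have "z + t *\<^sub>R v = (1 - t / T) *\<^sub>R z + (t / T) *\<^sub>R y"
        using T by (simp add: y_def algebra_simps)
      also have "\<dots> \<in> ball z0 r"
        using t T by (intro convexD[OF convex_ball z(1) yB]) auto
      finally have p: "cball (z + t *\<^sub>R v) e \<subseteq> U" "mollify e h (z + t *\<^sub>R v) \<le> M" using B by auto
      have "\<forall>\<^sub>F \<delta> in at_right 0. \<bar>mollify e u (z + t *\<^sub>R v - \<delta> *\<^sub>R (- v)) - mollify e u (z + t *\<^sub>R v)\<bar> \<le> \<delta> * (mollify e h (z + t *\<^sub>R v) + \<zeta>)"
        by (rule mollify_slope[OF u h sb[OF good_directions_uminus[OF v(1)]] e p(1) \<zeta>])
      then show "\<forall>\<^sub>F \<delta> in at_right 0. \<bar>mollify e u (z + (t + \<delta>) *\<^sub>R v) - mollify e u (z + t *\<^sub>R v)\<bar> \<le> M * (t + \<delta>) - M * t + \<zeta> * \<delta>"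
        using eventually_at_right_less[of 0]
      proof eventually_elim
        case (elim \<delta>)
        have "\<delta> * (mollify e h (z + t *\<^sub>R v) + \<zeta>) \<le> \<delta> * (M + \<zeta>)"
          using p(2) elim(2) by (intro mult_left_mono) auto
        moreover have "z + t *\<^sub>R v - \<delta> *\<^sub>R (- v) = z + (t + \<delta>) *\<^sub>R v" by (simp add: algebra_simps)
        ultimately show ?case using elim(1) by (simp add: algebra_simps)
      qed
    qed (use T in \<open>auto intro!: continuous_intros\<close>)
    then have "\<bar>mollify e u y - mollify e u z\<bar> \<le> M * T" by (simp add: y_def)
    moreover have "\<bar>mollify e u y - mollify e u z'\<bar> < \<eta>" using d1(2)[of y] yz by (simp add: dist_real_def)
    ultimately show ?thesis by linarith
  qed
  then have "\<bar>mollify e u z' - mollify e u z\<bar> \<le> M * T" by (rule field_le_epsilon)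
  then show ?thesis by (simp add: T_def dist_norm norm_minus_commute)
qed simp

text \<open>Mollifications are continuous, so near each parameter \<open>t\<close> the local Lipschitz constant is
  nearly \<open>mollify e h (\<gamma> t)\<close>. A curve parameterized by arc length is \<open>1\<close>-Lipschitz, and the
  infinitesimal estimate along it integrates.\<close>

lemma mollify_along_curve:
  assumes u: "locally_integrable u" and h: "locally_integrable h" "\<And>z. 0 \<le> h z" and U: "open U"
    and sb: "\<And>v. v \<in> good_directions \<Longrightarrow> slope_bound U u (\<lambda>z. ennreal (h z)) v" and e: "0 < e"
    and \<gamma>: "(l, \<gamma>) \<in> curves Z" "0 \<le> a" "a \<le> b" "b \<le> l"
    and in_U: "\<And>t. a \<le> t \<Longrightarrow> t \<le> b \<Longrightarrow> cball (\<gamma> t) e \<subseteq> U"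
  shows "ennreal \<bar>mollify e u (\<gamma> a) - mollify e u (\<gamma> b)\<bar> \<le> (\<integral>\<^sup>+t\<in>{a..b}. ennreal (mollify e h (\<gamma> t)) \<partial>lebesgue)"
proof -
  have cu: "continuous_on UNIV (mollify e u)" by (rule continuous_mollify[OF u e])
  have ch: "continuous_on UNIV (mollify e h)" by (rule continuous_mollify[OF h(1) e])
  have c\<gamma>: "continuous_on {a..b} \<gamma>" using \<gamma> by (auto simp: curves_def intro: continuous_on_subset)
  define G where "G = (\<lambda>t. mollify e h (\<gamma> t))"
  have cG: "continuous_on {a..b} G" unfolding G_def
    by (rule continuous_on_compose2[OF ch c\<gamma>]) auto
  have Gi: "G integrable_on {s..t}" if "a \<le> s" "t \<le> b" for s t
    using that by (intro integrable_continuous_real continuous_on_subset[OF cG]) auto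
  define F where "F = (\<lambda>t. integral {a..t} G)"
  have "\<bar>mollify e u (\<gamma> b) - mollify e u (\<gamma> a)\<bar> \<le> F b - F a"
  proof (rule increment_bound[OF \<gamma>(3)])
    show "continuous_on {a..b} (\<lambda>t. mollify e u (\<gamma> t))"
      by (rule continuous_on_compose2[OF cu c\<gamma>]) auto
    show "continuous_on {a..b} F" unfolding F_def
      by (rule indefinite_integral_continuous_1[OF Gi]) auto
    fix t \<eta> :: real assume t: "a \<le> t" "t < b" and \<eta>: "0 < \<eta>"
    have e2: "0 < \<eta> / 2" using \<eta> by simp
    obtain r1 where r1: "0 < r1" "(\<Union>x\<in>cball (\<gamma> t) e. cball x r1) \<subseteq> U"
      using compact_subset_open_imp_cball_epsilon_subset[OF compact_cball U, of "\<gamma> t" e] in_U[of t] t by auto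
    obtain r2 where r2: "0 < r2" "\<And>y. dist y (\<gamma> t) < r2 \<Longrightarrow> dist (mollify e h y) (G t) < \<eta> / 2"
      using ch e2 unfolding continuous_on_iff G_def by blast
    define r where "r = min r1 r2"
    have r: "0 < r" using r1 r2 by (simp add: r_def)
    have near: "cball y e \<subseteq> U \<and> mollify e h y \<le> G t + \<eta> / 2" if "y \<in> ball (\<gamma> t) r" for y
    proof
      have d: "dist (\<gamma> t) y < r1" "dist y (\<gamma> t) < r2" using that by (auto simp: r_def dist_commute)
      show "cball y e \<subseteq> U"
      proof
        fix x assume x: "x \<in> cball y e"
        have "x - (y - \<gamma> t) \<in> cball (\<gamma> t) e" using x by (simp add: dist_norm algebra_simps)
        moreover have "x \<in> cball (x - (y - \<gamma> t)) r1" using d(1) by (simp add: dist_norm norm_minus_commute)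
        ultimately show "x \<in> U" using r1(2) by blast
      qed
      show "mollify e h y \<le> G t + \<eta> / 2" using r2(2)[OF d(2)] unfolding dist_real_def by linarith
    qed
    define d where "d = min r (b - t)"
    have d: "0 < d" using r t by (simp add: d_def)
    have "\<bar>mollify e u (\<gamma> (t + \<delta>)) - mollify e u (\<gamma> t)\<bar> \<le> F (t + \<delta>) - F t + \<eta> * \<delta>" if \<delta>: "0 < \<delta>" "\<delta> < d" for \<delta>
    proof -
      have tb: "t + \<delta> \<le> b" using \<delta> by (simp add: d_def)
      have lip: "dist (\<gamma> t) (\<gamma> s) \<le> s - t" if "t \<le> s" "s \<le> b" for s
        using curve_lipschitz[OF \<gamma>(1), of t s] that \<gamma> t by auto
      have inb: "\<gamma> s \<in> ball (\<gamma> t) r" if "t \<le> s" "s \<le> t + \<delta>" for s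
        using lip[of s] that \<delta> tb by (simp add: d_def)
      have G_low: "G t - \<eta> / 2 \<le> G s" if "t \<le> s" "s \<le> t + \<delta>" for s
      proof -
        have "dist (\<gamma> s) (\<gamma> t) < r2" using inb[OF that] by (simp add: r_def dist_commute)
        from r2(2)[OF this] show ?thesis unfolding G_def dist_real_def by linarith
      qed
      have "\<bar>mollify e u (\<gamma> (t + \<delta>)) - mollify e u (\<gamma> t)\<bar> \<le> (G t + \<eta> / 2) * dist (\<gamma> t) (\<gamma> (t + \<delta>))"
        using inb \<delta> r by (intro mollify_lipschitz_ball[OF u h sb e near]) auto
      also have "\<dots> \<le> (G t + \<eta> / 2) * \<delta>"
        using lip[of "t + \<delta>"] \<delta> tb \<eta> mollify_nonneg[OF e h(2)] by (intro mult_left_mono) (auto simp: G_def add_nonneg_nonneg)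
      finally have 1: "\<bar>mollify e u (\<gamma> (t + \<delta>)) - mollify e u (\<gamma> t)\<bar> \<le> (G t + \<eta> / 2) * \<delta>" .
      have "integral {t..t + \<delta>} (\<lambda>_. G t - \<eta> / 2) \<le> integral {t..t + \<delta>} G"
        using G_low t tb by (intro integral_le Gi) auto
      then have "(G t - \<eta> / 2) * \<delta> \<le> integral {t..t + \<delta>} G" using \<delta>(1) by (simp add: mult.commute)
      also have "\<dots> = F (t + \<delta>) - F t"
      proof -
        have "integral {a..t} G + integral {t..t + \<delta>} G = integral {a..t + \<delta>} G"
          using t \<delta> tb by (intro Henstock_Kurzweil_Integration.integral_combine Gi) auto
        then show ?thesis by (simp add: F_def)
      qed
      finally show ?thesis using 1 by (simp add: algebra_simps)
    qed
    then show "\<forall>\<^sub>F \<delta> in at_right 0. \<bar>mollify e u (\<gamma> (t + \<delta>)) - mollify e u (\<gamma> t)\<bar> \<le> F (t + \<delta>) - F t + \<eta> * \<delta>"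
      unfolding eventually_at_right_field using d by auto
  qed
  also have "\<dots> = integral {a..b} G" by (simp add: F_def)
  finally have "ennreal \<bar>mollify e u (\<gamma> a) - mollify e u (\<gamma> b)\<bar> \<le> ennreal (integral {a..b} G)"
    by (simp add: abs_minus_commute ennreal_leI)
  also have "\<dots> = (\<integral>\<^sup>+t. ennreal (indicator {a..b} t * G t) \<partial>lborel)"
    by (subst nn_integral_has_integral_lebesgue[where f=G, OF _ integrable_integral[OF Gi]])
       (auto simp: G_def mollify_nonneg[OF e h(2)])
  also have "\<dots> = (\<integral>\<^sup>+t\<in>{a..b}. ennreal (mollify e h (\<gamma> t)) \<partial>lebesgue)"
    unfolding nn_integral_completion by (intro nn_integral_cong) (auto simp: indicator_def G_def)
  finally show ?thesis .
qed

subsection \<open>Convergence of mollifications\<close>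

text \<open>Superadditivity of \<open>x powr p\<close>. It reduces convergence in \<open>L\<^sup>p\<close> to convergence of the powers in
  \<open>L\<^sup>1\<close>.\<close>

lemma powr_diff_le:
  fixes a b :: real
  assumes p: "1 \<le> p" and a: "0 \<le> a" and b: "0 \<le> b"
  shows "\<bar>a - b\<bar> powr p \<le> \<bar>a powr p - b powr p\<bar>"
proof -
  have sup: "x powr p + y powr p \<le> (x + y) powr p" if "0 \<le> x" "0 \<le> y" for x y :: real
  proof -
    have "x powr p = x * x powr (p - 1)" "y powr p = y * y powr (p - 1)"
      using that by (simp_all add: powr_mult_base)
    moreover have "x * x powr (p - 1) \<le> x * (x + y) powr (p - 1)" "y * y powr (p - 1) \<le> y * (x + y) powr (p - 1)"
      using that p by (auto intro!: mult_left_mono powr_mono2)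
    moreover have "(x + y) powr p = (x + y) * (x + y) powr (p - 1)" using that by (simp add: powr_mult_base)
    ultimately show ?thesis by (simp add: distrib_right)
  qed
  show ?thesis
  proof (cases "b \<le> a")
    case True
    then have "(a - b) powr p + b powr p \<le> a powr p" using sup[of "a - b" b] b by simp
    then show ?thesis using True by (simp add: abs_if)
  next
    case False
    then have "(b - a) powr p + a powr p \<le> b powr p" using sup[of "b - a" a] a by simp
    then show ?thesis using False by (simp add: abs_if)
  qed
qed

text \<open>Jensen's inequality for the powers, from Young's inequality
  \<open>p * t powr (p - 1) * a \<le> a powr p + (p - 1) * t powr p\<close> with \<open>t\<close> the mean.\<close>

lemma powr_mean_le:
  fixes \<kappa> f :: "plane \<Rightarrow> real"
  assumes p: "1 \<le> p" and \<kappa>: "\<kappa> \<in> borel_measurable borel" "\<And>w. 0 \<le> \<kappa> w" "(\<integral>\<^sup>+w. ennreal (\<kappa> w) \<partial>lborel) = 1"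
    and f: "f \<in> borel_measurable borel" "\<And>w. 0 \<le> f w" and i: "integrable lborel (\<lambda>w. f w * \<kappa> w)"
  shows "ennreal ((\<integral>w. f w * \<kappa> w \<partial>lborel) powr p) \<le> (\<integral>\<^sup>+w. ennreal (\<kappa> w * f w powr p) \<partial>lborel)"
proof -
  note [measurable] = \<kappa>(1) f(1)
  define t where "t = (\<integral>w. f w * \<kappa> w \<partial>lborel)"
  have t0: "0 \<le> t" unfolding t_def using \<kappa> f by (intro Bochner_Integration.integral_nonneg) auto
  have tn: "(\<integral>\<^sup>+w. ennreal (f w * \<kappa> w) \<partial>lborel) = ennreal t"
    unfolding t_def using \<kappa> f by (intro nn_integral_eq_integral i) auto
  show ?thesis
  proof (cases "t = 0")
    case True
    then show ?thesis unfolding t_def[symmetric] by simp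
  next
    case False
    with t0 have t: "0 < t" by simp
    have young: "p * t powr (p - 1) * a \<le> a powr p + (p - 1) * t powr p" if "0 \<le> a" for a
    proof (cases "a = 0")
      case True
      then show ?thesis using p by simp
    next
      case False
      with that have a: "0 < a" by simp
      have "(a powr p) powr (1 / p) * (t powr p) powr (1 - 1 / p) \<le> (1 / p) * a powr p + (1 - 1 / p) * t powr p"
        using p a t by (intro Youngs_inequality_0) auto
      moreover have "(a powr p) powr (1 / p) = a" using a p by (simp add: powr_powr)
      moreover have "(t powr p) powr (1 - 1 / p) = t powr (p - 1)"
        using p by (simp add: powr_powr right_diff_distrib)
      ultimately have "a * t powr (p - 1) \<le> (1 / p) * a powr p + (1 - 1 / p) * t powr p" by simp
      then have "p * (a * t powr (p - 1)) \<le> p * ((1 / p) * a powr p + (1 - 1 / p) * t powr p)"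
        using p by (intro mult_left_mono) auto
      then show ?thesis using p by (simp add: algebra_simps)
    qed
    have tp: "t powr (p - 1) * t = t powr p" using powr_mult_base[of t "p - 1"] t by (simp add: mult.commute)
    have "ennreal (t powr p) + ennreal ((p - 1) * t powr p) = ennreal (p * t powr (p - 1)) * ennreal t"
    proof -
      have "t powr p + (p - 1) * t powr p = p * t powr (p - 1) * t"
        by (simp add: mult.assoc tp left_diff_distrib)
      moreover have "ennreal (t powr p) + ennreal ((p - 1) * t powr p) = ennreal (t powr p + (p - 1) * t powr p)"
        using p by (intro ennreal_plus[symmetric]) auto
      moreover have "ennreal (p * t powr (p - 1) * t) = ennreal (p * t powr (p - 1)) * ennreal t"
        using p t by (intro ennreal_mult) auto
      ultimately show ?thesis by simp
    qed
    also have "\<dots> = (\<integral>\<^sup>+w. ennreal (p * t powr (p - 1)) * ennreal (f w * \<kappa> w) \<partial>lborel)"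
      unfolding tn[symmetric] by (rule nn_integral_cmult[symmetric]) measurable
    also have "\<dots> \<le> (\<integral>\<^sup>+w. ennreal (\<kappa> w * f w powr p) + ennreal ((p - 1) * t powr p) * ennreal (\<kappa> w) \<partial>lborel)"
    proof (rule nn_integral_mono)
      fix w
      have "p * t powr (p - 1) * f w * \<kappa> w \<le> (f w powr p + (p - 1) * t powr p) * \<kappa> w"
        using young[OF f(2)] \<kappa>(2) by (rule mult_right_mono)
      then have "ennreal (p * t powr (p - 1) * f w * \<kappa> w) \<le> ennreal (\<kappa> w * f w powr p + (p - 1) * t powr p * \<kappa> w)"
        by (intro ennreal_leI) (simp add: algebra_simps)
      then show "ennreal (p * t powr (p - 1)) * ennreal (f w * \<kappa> w) \<le> ennreal (\<kappa> w * f w powr p) + ennreal ((p - 1) * t powr p) * ennreal (\<kappa> w)"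
        using p \<kappa>(2)[of w] f(2)[of w] by (simp add: ennreal_mult[symmetric] ennreal_plus[symmetric] mult.assoc del: ennreal_plus)
    qed
    also have "\<dots> = (\<integral>\<^sup>+w. ennreal (\<kappa> w * f w powr p) \<partial>lborel) + ennreal ((p - 1) * t powr p)"
      by (subst nn_integral_add) (auto simp: nn_integral_cmult \<kappa>(3))
    finally have "ennreal ((p - 1) * t powr p) + ennreal (t powr p) \<le>
        ennreal ((p - 1) * t powr p) + (\<integral>\<^sup>+w. ennreal (\<kappa> w * f w powr p) \<partial>lborel)"
      by (simp only: add.commute)
    then show ?thesis unfolding t_def[symmetric] ennreal_add_left_cancel_le by simp
  qed
qed

lemma mollify_shift:
  assumes [measurable]: "f \<in> borel_measurable borel"
  shows "mollify e f z = (\<integral>w. f (z + w) * mollifier e w \<partial>lborel)"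
proof -
  have "(\<integral>w. f (w + z) * mollifier e (w + z - z) \<partial>lborel) = mollify e f z"
    unfolding mollify_def by (rule integral_translate[of "\<lambda>w. f w * mollifier e (w - z)"]) measurable
  then show ?thesis by (simp add: add.commute)
qed

text \<open>Convergence in \<open>L\<^sup>p\<close>. Jensen's inequality and the inequality for powers of differences bound
  the error by an average of \<open>L\<^sup>1\<close> distances between \<open>f powr p\<close> and its small translates.\<close>

lemma mollify_converges:
  fixes f :: "plane \<Rightarrow> real"
  assumes p: "1 \<le> p" and f: "f \<in> borel_measurable borel" "\<And>z. 0 \<le> f z" "(\<integral>\<^sup>+z. ennreal (f z powr p) \<partial>lborel) < top"
    and li: "locally_integrable f" and \<eta>: "0 < \<eta>"
  shows "\<exists>d>0. \<forall>e. 0 < e \<and> e < d \<longrightarrow> (\<integral>\<^sup>+z. ennreal (\<bar>mollify e f z - f z\<bar> powr p) \<partial>lborel) \<le> ennreal \<eta>"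
proof -
  note [measurable] = f(1)
  define G where "G = (\<lambda>z. f z powr p)"
  have [measurable]: "G \<in> borel_measurable borel" unfolding G_def by measurable
  have "integrable lborel G" using f by (intro integrableI_bounded) (auto simp: G_def)
  then have "mean_continuous G" by (rule mean_continuous_integrable)
  then obtain d where d: "0 < d" "\<And>a. norm a < d \<Longrightarrow> (\<integral>\<^sup>+z. ennreal \<bar>G (z + a) - G z\<bar> \<partial>lborel) < ennreal \<eta>"
    using \<eta> unfolding mean_continuous_def by blast
  have "(\<integral>\<^sup>+z. ennreal (\<bar>mollify e f z - f z\<bar> powr p) \<partial>lborel) \<le> ennreal \<eta>" if e: "0 < e" "e < d" for e
  proof -
    have ki: "integrable lborel (mollifier e)"
      using mollifier_nn_integral[OF e(1)] mollifier_nonneg[OF e(1)] by (intro integrableI_bounded) auto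
    have k1: "(\<integral>w. mollifier e w \<partial>lborel) = 1"
      using mollifier_nn_integral[OF e(1)] mollifier_nonneg[OF e(1)] nn_integral_eq_integral[OF ki] by simp
    have fi: "integrable lborel (\<lambda>w. f (z + w) * mollifier e w)" for z
    proof -
      have "integrable (distr lborel borel ((+) z)) (\<lambda>w. f w * mollifier e (w - z))"
        unfolding lborel_distr_plus by (rule locally_integrable_mult_mollifier[OF li e(1)])
      then show ?thesis by (subst (asm) integrable_distr_eq) (auto simp: comp_def)
    qed
    have ptw: "ennreal (\<bar>mollify e f z - f z\<bar> powr p) \<le> (\<integral>\<^sup>+w. ennreal (mollifier e w) * ennreal \<bar>G (z + w) - G z\<bar> \<partial>lborel)" for z
    proof -
      have i1: "integrable lborel (\<lambda>w. (f (z + w) - f z) * mollifier e w)"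
        using Bochner_Integration.integrable_diff[OF fi[of z] integrable_mult_right[OF ki, of "f z"]]
        by (simp add: left_diff_distrib)
      have i2: "integrable lborel (\<lambda>w. \<bar>f (z + w) - f z\<bar> * mollifier e w)"
        using integrable_abs[OF i1] mollifier_nonneg[OF e(1)] by (simp add: abs_mult)
      have "mollify e f z - f z = (\<integral>w. f (z + w) * mollifier e w \<partial>lborel) - (\<integral>w. f z * mollifier e w \<partial>lborel)"
        by (simp add: mollify_shift k1)
      also have "\<dots> = (\<integral>w. (f (z + w) - f z) * mollifier e w \<partial>lborel)"
        using fi[of z] ki by (subst Bochner_Integration.integral_diff[symmetric]) (auto simp: left_diff_distrib)
      finally have "\<bar>mollify e f z - f z\<bar> \<le> (\<integral>w. \<bar>(f (z + w) - f z) * mollifier e w\<bar> \<partial>lborel)"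
        using integral_abs_bound by simp
      also have "\<dots> = (\<integral>w. \<bar>f (z + w) - f z\<bar> * mollifier e w \<partial>lborel)"
        using mollifier_nonneg[OF e(1)] by (simp add: abs_mult)
      finally have "ennreal (\<bar>mollify e f z - f z\<bar> powr p) \<le> ennreal ((\<integral>w. \<bar>f (z + w) - f z\<bar> * mollifier e w \<partial>lborel) powr p)"
        using p by (intro ennreal_leI powr_mono2) auto
      also have "\<dots> \<le> (\<integral>\<^sup>+w. ennreal (mollifier e w * \<bar>f (z + w) - f z\<bar> powr p) \<partial>lborel)"
        using i2 mollifier_nonneg[OF e(1)] mollifier_nn_integral[OF e(1)] by (intro powr_mean_le p) auto
      also have "\<dots> \<le> (\<integral>\<^sup>+w. ennreal (mollifier e w) * ennreal \<bar>G (z + w) - G z\<bar> \<partial>lborel)"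
      proof (rule nn_integral_mono)
        fix w
        show "ennreal (mollifier e w * \<bar>f (z + w) - f z\<bar> powr p) \<le> ennreal (mollifier e w) * ennreal \<bar>G (z + w) - G z\<bar>"
          using powr_diff_le[OF p f(2)[of "z + w"] f(2)[of z]] mollifier_nonneg[OF e(1), of w]
          by (simp add: ennreal_mult[symmetric] G_def ennreal_leI mult_left_mono)
      qed
      finally show ?thesis .
    qed
    have "(\<integral>\<^sup>+z. ennreal (\<bar>mollify e f z - f z\<bar> powr p) \<partial>lborel)
        \<le> (\<integral>\<^sup>+z. (\<integral>\<^sup>+w. ennreal (mollifier e w) * ennreal \<bar>G (z + w) - G z\<bar> \<partial>lborel) \<partial>lborel)"
      by (intro nn_integral_mono ptw)
    also have "\<dots> = (\<integral>\<^sup>+w. (\<integral>\<^sup>+z. ennreal (mollifier e w) * ennreal \<bar>G (z + w) - G z\<bar> \<partial>lborel) \<partial>lborel)"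
      by (intro lborel_pair.Fubini'[symmetric]) measurable
    also have "\<dots> \<le> (\<integral>\<^sup>+w. ennreal \<eta> * ennreal (mollifier e w) \<partial>lborel)"
    proof (rule nn_integral_mono)
      fix w
      have "(\<integral>\<^sup>+z. ennreal (mollifier e w) * ennreal \<bar>G (z + w) - G z\<bar> \<partial>lborel) = ennreal (mollifier e w) * (\<integral>\<^sup>+z. ennreal \<bar>G (z + w) - G z\<bar> \<partial>lborel)"
        by (intro nn_integral_cmult) measurable
      also have "\<dots> \<le> ennreal \<eta> * ennreal (mollifier e w)"
      proof (cases "norm w < e")
        case True
        then show ?thesis using d(2)[of w] e by (simp add: mult.commute[of "ennreal \<eta>"] mult_left_mono less_imp_le)
      next
        case False
        then show ?thesis by (simp add: mollifier_zero)
      qed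
      finally show "(\<integral>\<^sup>+z. ennreal (mollifier e w) * ennreal \<bar>G (z + w) - G z\<bar> \<partial>lborel) \<le> ennreal \<eta> * ennreal (mollifier e w)" .
    qed
    also have "\<dots> = ennreal \<eta>"
      using mollifier_nn_integral[OF e(1)] by (subst nn_integral_cmult) auto
    finally show ?thesis .
  qed
  then show ?thesis using d(1) by blast
qed

section \<open>Good representatives\<close>

lemma locally_integrable_of_energy:
  assumes p: "1 \<le> p" and u: "u \<in> borel_measurable borel" "(\<integral>\<^sup>+z. ennreal (\<bar>u z\<bar> powr p) \<partial>lborel) < top"
  shows "locally_integrable u"
proof -
  note [measurable] = u(1)
  have "integrable_on_compacts UNIV (\<lambda>z. ennreal \<bar>u z\<bar>)"
    by (rule integrable_on_compacts_of_energy[OF p]) (use u in \<open>auto simp: ennreal_powr_ennreal\<close>)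
  then show ?thesis using u(1) by (auto simp: locally_integrable_def integrable_on_compacts_def)
qed

text \<open>The energy of a sum is controlled by the energies of its terms with weights
  \<open>(2 ^ Suc n) powr p\<close>. Dividing by these leaves a geometric series.\<close>

definition fast_rate :: "real \<Rightarrow> nat \<Rightarrow> real" where
  "fast_rate p n = (1/2) ^ Suc n / (2 ^ Suc n) powr p"

lemma fast_rate_pos: "0 < fast_rate p n"
  by (simp add: fast_rate_def)

lemma fast_convergence_energy:
  fixes f :: "nat \<Rightarrow> plane \<Rightarrow> real"
  assumes p: "1 \<le> p" and f: "\<And>n. f n \<in> borel_measurable borel" "\<And>n z. 0 \<le> f n z"
    and fast: "\<And>n. (\<integral>\<^sup>+z. ennreal (f n z powr p) \<partial>lborel) \<le> ennreal (fast_rate p n)"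
  shows "(\<integral>\<^sup>+z. ennreal_powr (\<Sum>n. ennreal (f n z)) p \<partial>lborel) < top"
proof -
  note [measurable] = f(1)
  define c where "c n = (2 ^ Suc n :: real) powr p" for n :: nat
  have c: "0 < c n" for n by (simp add: c_def)
  have ce: "c n * fast_rate p n = (1/2) ^ Suc n" for n using c[of n] by (simp add: fast_rate_def c_def)
  have "(\<integral>\<^sup>+z. ennreal_powr (\<Sum>n. ennreal (f n z)) p \<partial>lborel)
      \<le> (\<integral>\<^sup>+z. (\<Sum>n. ennreal (c n) * ennreal_powr (ennreal (f n z)) p) \<partial>lborel)"
    unfolding c_def by (intro nn_integral_mono ennreal_powr_suminf_le p)
  also have "\<dots> = (\<Sum>n. \<integral>\<^sup>+z. ennreal (c n) * ennreal_powr (ennreal (f n z)) p \<partial>lborel)"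
    by (intro nn_integral_suminf) measurable
  also have "\<dots> = (\<Sum>n. ennreal (c n) * (\<integral>\<^sup>+z. ennreal (f n z powr p) \<partial>lborel))"
    using f(2) by (intro arg_cong[where f=suminf] ext) (simp add: nn_integral_cmult ennreal_powr_ennreal)
  also have "\<dots> \<le> (\<Sum>n. ennreal (c n) * ennreal (fast_rate p n))"
    by (intro suminf_le mult_left_mono fast) auto
  also have "\<dots> = (\<Sum>n. ennreal ((1/2) ^ Suc n))"
    by (subst ennreal_mult[symmetric]) (simp_all only: less_imp_le[OF c] less_imp_le[OF fast_rate_pos] ce)
  also have "\<dots> = ennreal 1" by (intro suminf_ennreal_eq power_half_series) auto
  also have "\<dots> < top" by simp
  finally show ?thesis .
qed

lemma ennreal_suminf_finite_tendsto_0: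
  fixes x :: "nat \<Rightarrow> ennreal"
  assumes "(\<Sum>n. x n) < top"
  shows "x \<longlonglongrightarrow> 0"
proof -
  have fin: "x n < top" for n
    using assms sum_le_suminf[of x "{n}"] by (auto intro: le_less_trans)
  define y where "y n = enn2real (x n)" for n
  have xy: "x n = ennreal (y n)" "0 \<le> y n" for n using fin[of n] by (simp_all add: y_def)
  have "summable y"
    using assms xy by (intro summable_suminf_not_top) (auto simp: less_top[symmetric])
  then have "(\<lambda>n. ennreal (y n)) \<longlonglongrightarrow> ennreal 0"
    by (intro tendsto_ennrealI summable_LIMSEQ_zero)
  moreover have "x = (\<lambda>n. ennreal (y n))" by (rule ext) (rule xy(1))
  ultimately show ?thesis by simp
qed

lemma fast_convergence_AE:
  fixes f :: "nat \<Rightarrow> plane \<Rightarrow> real"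
  assumes p: "1 \<le> p" and f: "\<And>n. f n \<in> borel_measurable borel" "\<And>n z. 0 \<le> f n z"
    and fast: "\<And>n. (\<integral>\<^sup>+z. ennreal (f n z powr p) \<partial>lborel) \<le> ennreal (fast_rate p n)"
  shows "AE z in lborel. (\<lambda>n. f n z) \<longlonglongrightarrow> 0"
proof -
  note [measurable] = f(1)
  have "AE z in lborel. ennreal_powr (\<Sum>n. ennreal (f n z)) p \<noteq> top"
    using fast_convergence_energy[OF p f fast]
    by (intro nn_integral_PInf_AE[unfolded infinity_ennreal_def]) auto
  then show ?thesis
  proof eventually_elim
    case (elim z)
    then have "(\<Sum>n. ennreal (f n z)) < top" using ennreal_powr_less_top_iff[of _ p] by (simp add: less_top)
    from ennreal_suminf_finite_tendsto_0[OF this]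
    have "(\<lambda>n. ennreal (f n z)) \<longlonglongrightarrow> ennreal 0" by simp
    then show ?case using f(2) by (subst (asm) tendsto_ennreal_iff) auto
  qed
qed

text \<open>Along a fast sequence the mollifications of \<open>u\<close> converge almost everywhere, and the integrals of
  the mollifications of \<open>m\<close> converge along almost every curve (Fuglede's lemma). Along such a
  curve the upper limit \<open>w\<close> of the former varies by no more than the integral of \<open>m\<close>. Since almost
  every curve meets the set in which \<open>w\<close> is finite, \<open>w\<close> is finite at all of its points.\<close>

lemma good_representative:
  fixes u m :: "plane \<Rightarrow> real"
  assumes p: "1 \<le> p" and V: "open V"
    and u: "u \<in> borel_measurable borel" "(\<integral>\<^sup>+z. ennreal (\<bar>u z\<bar> powr p) \<partial>lborel) < top"
    and m: "m \<in> borel_measurable borel" "\<And>z. 0 \<le> m z" "(\<integral>\<^sup>+z. ennreal (m z powr p) \<partial>lborel) < top"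
    and sb: "\<And>v. v \<in> good_directions \<Longrightarrow> slope_bound V u (\<lambda>z. ennreal (m z)) v"
  shows "\<exists>w\<in>borel_measurable borel. (AE z in lborel. w z = ereal (u z)) \<and>
      weak_upper_gradient p V w (\<lambda>z. ennreal (m z))"
proof -
  note [measurable] = u(1) m(1)
  have lu: "locally_integrable u" by (rule locally_integrable_of_energy[OF p u])
  have lm: "locally_integrable m" by (rule locally_integrable_of_energy[OF p m(1)]) (use m in simp)
  (* Convergence of mollifications has been shown for nonnegative functions; hence the two parts. *)
  define u1 where "u1 = (\<lambda>z. max 0 (u z))"
  define u2 where "u2 = (\<lambda>z. max 0 (- u z))"
  have [measurable]: "u1 \<in> borel_measurable borel" "u2 \<in> borel_measurable borel" unfolding u1_def u2_def by measurable
  have part: "u1 z \<le> \<bar>u z\<bar>" "u2 z \<le> \<bar>u z\<bar>" "0 \<le> u1 z" "0 \<le> u2 z" "u z = u1 z - u2 z" for z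
    by (auto simp: u1_def u2_def)
  have e12: "(\<integral>\<^sup>+z. ennreal (u1 z powr p) \<partial>lborel) < top" "(\<integral>\<^sup>+z. ennreal (u2 z powr p) \<partial>lborel) < top"
    using u(2) part p by (auto intro!: le_less_trans[OF nn_integral_mono u(2)] ennreal_leI powr_mono2)
  have l12: "locally_integrable u1" "locally_integrable u2"
  proof -
    have abs: "\<bar>u1 z\<bar> = u1 z" "\<bar>u2 z\<bar> = u2 z" for z by (simp_all add: u1_def u2_def)
    have "(\<integral>\<^sup>+z. ennreal (\<bar>u1 z\<bar> powr p) \<partial>lborel) < top" "(\<integral>\<^sup>+z. ennreal (\<bar>u2 z\<bar> powr p) \<partial>lborel) < top"
      unfolding abs by (rule e12)+
    then show "locally_integrable u1" "locally_integrable u2"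
      by (auto intro!: locally_integrable_of_energy[OF p])
  qed
  have "\<exists>e. 0 < e \<and> e < 1 / real (Suc k) \<and>
      (\<integral>\<^sup>+z. ennreal (\<bar>mollify e u1 z - u1 z\<bar> powr p) \<partial>lborel) \<le> ennreal (fast_rate p k) \<and>
      (\<integral>\<^sup>+z. ennreal (\<bar>mollify e u2 z - u2 z\<bar> powr p) \<partial>lborel) \<le> ennreal (fast_rate p k) \<and>
      (\<integral>\<^sup>+z. ennreal (\<bar>mollify e m z - m z\<bar> powr p) \<partial>lborel) \<le> ennreal (fast_rate p k)" for k
  proof -
    have "\<exists>d>0. \<forall>e. 0 < e \<and> e < d \<longrightarrow> (\<integral>\<^sup>+z. ennreal (\<bar>mollify e u1 z - u1 z\<bar> powr p) \<partial>lborel) \<le> ennreal (fast_rate p k)"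
      by (rule mollify_converges[OF p _ part(3) e12(1) l12(1) fast_rate_pos]) measurable
    then obtain d1 where d1: "0 < d1" "\<And>e. 0 < e \<and> e < d1 \<Longrightarrow> (\<integral>\<^sup>+z. ennreal (\<bar>mollify e u1 z - u1 z\<bar> powr p) \<partial>lborel) \<le> ennreal (fast_rate p k)"
      by blast
    have "\<exists>d>0. \<forall>e. 0 < e \<and> e < d \<longrightarrow> (\<integral>\<^sup>+z. ennreal (\<bar>mollify e u2 z - u2 z\<bar> powr p) \<partial>lborel) \<le> ennreal (fast_rate p k)"
      by (rule mollify_converges[OF p _ part(4) e12(2) l12(2) fast_rate_pos]) measurable
    then obtain d2 where d2: "0 < d2" "\<And>e. 0 < e \<and> e < d2 \<Longrightarrow> (\<integral>\<^sup>+z. ennreal (\<bar>mollify e u2 z - u2 z\<bar> powr p) \<partial>lborel) \<le> ennreal (fast_rate p k)"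
      by blast
    have "\<exists>d>0. \<forall>e. 0 < e \<and> e < d \<longrightarrow> (\<integral>\<^sup>+z. ennreal (\<bar>mollify e m z - m z\<bar> powr p) \<partial>lborel) \<le> ennreal (fast_rate p k)"
      by (rule mollify_converges[OF p m lm fast_rate_pos]) 
    then obtain d3 where d3: "0 < d3" "\<And>e. 0 < e \<and> e < d3 \<Longrightarrow> (\<integral>\<^sup>+z. ennreal (\<bar>mollify e m z - m z\<bar> powr p) \<partial>lborel) \<le> ennreal (fast_rate p k)"
      by blast
    define X where "X = min (min d1 d2) (min d3 (1 / real (Suc k)))"
    have "0 < X" using d1(1) d2(1) d3(1) by (simp add: X_def)
    then have X: "0 < X / 2" "X / 2 < X" by simp_all
    have "X \<le> d1" "X \<le> d2" "X \<le> d3" "X \<le> 1 / real (Suc k)" by (simp_all add: X_def)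
    then have "X / 2 < d1" "X / 2 < d2" "X / 2 < d3" "X / 2 < 1 / real (Suc k)"
      using X(2) by (auto intro: order_less_le_trans)
    then show ?thesis using d1(2) d2(2) d3(2) X(1) by blast
  qed
  then have "\<exists>e. \<forall>k. 0 < e k \<and> e k < 1 / real (Suc k) \<and>
      (\<integral>\<^sup>+z. ennreal (\<bar>mollify (e k) u1 z - u1 z\<bar> powr p) \<partial>lborel) \<le> ennreal (fast_rate p k) \<and>
      (\<integral>\<^sup>+z. ennreal (\<bar>mollify (e k) u2 z - u2 z\<bar> powr p) \<partial>lborel) \<le> ennreal (fast_rate p k) \<and>
      (\<integral>\<^sup>+z. ennreal (\<bar>mollify (e k) m z - m z\<bar> powr p) \<partial>lborel) \<le> ennreal (fast_rate p k)"
    by (intro choice allI)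
  then obtain e where e: "\<And>k. 0 < e k" "\<And>k. e k < 1 / real (Suc k)"
      "\<And>k. (\<integral>\<^sup>+z. ennreal (\<bar>mollify (e k) u1 z - u1 z\<bar> powr p) \<partial>lborel) \<le> ennreal (fast_rate p k)"
      "\<And>k. (\<integral>\<^sup>+z. ennreal (\<bar>mollify (e k) u2 z - u2 z\<bar> powr p) \<partial>lborel) \<le> ennreal (fast_rate p k)"
      "\<And>k. (\<integral>\<^sup>+z. ennreal (\<bar>mollify (e k) m z - m z\<bar> powr p) \<partial>lborel) \<le> ennreal (fast_rate p k)"
    by blast
  have mm: "mollify (e k) f \<in> borel_measurable borel" if "locally_integrable f" for k f
    by (rule borel_measurable_continuous_onI[OF continuous_mollify[OF that e(1)]])
  note [measurable] = mm[OF l12(1)] mm[OF l12(2)] mm[OF lm] mm[OF lu]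
  have mu: "mollify (e k) u z = mollify (e k) u1 z - mollify (e k) u2 z" for k z
    unfolding mollify_def part(5)
    by (subst Bochner_Integration.integral_diff[symmetric])
       (auto intro: locally_integrable_mult_mollifier[OF l12(1) e(1)] locally_integrable_mult_mollifier[OF l12(2) e(1)] simp: left_diff_distrib)
  define w where "w = (\<lambda>z. limsup (\<lambda>k. ereal (mollify (e k) u z)))"
  have w_meas [measurable]: "w \<in> borel_measurable borel" unfolding w_def by measurable
  have "AE z in lborel. (\<lambda>k. \<bar>mollify (e k) u1 z - u1 z\<bar>) \<longlonglongrightarrow> 0"
    by (rule fast_convergence_AE[OF p]) (use e(3) in auto)
  moreover have "AE z in lborel. (\<lambda>k. \<bar>mollify (e k) u2 z - u2 z\<bar>) \<longlonglongrightarrow> 0"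
    by (rule fast_convergence_AE[OF p]) (use e(4) in auto)
  ultimately have wu: "AE z in lborel. w z = ereal (u z)"
  proof eventually_elim
    case (elim z)
    have "(\<lambda>k. mollify (e k) u1 z) \<longlonglongrightarrow> u1 z" "(\<lambda>k. mollify (e k) u2 z) \<longlonglongrightarrow> u2 z"
      using elim by (simp_all add: tendsto_rabs_zero_iff LIM_zero_iff)
    then have "(\<lambda>k. mollify (e k) u z) \<longlonglongrightarrow> u z" unfolding mu part(5)[of z] by (rule tendsto_diff)
    then have "(\<lambda>k. ereal (mollify (e k) u z)) \<longlonglongrightarrow> ereal (u z)" by (rule tendsto_ereal)
    then show ?case unfolding w_def by (intro lim_imp_Limsup) auto
  qed
  have E: "{z. \<bar>w z\<bar> = \<infinity>} \<in> null_sets lebesgue"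
  proof -
    have "AE z in lebesgue. \<not> \<bar>w z\<bar> = \<infinity>"
      unfolding AE_completion_iff using wu by eventually_elim simp
    from null_sets_of_AE_lebesgue[OF this] show ?thesis by simp
  qed
  (* Where the integral of \<rho> is finite, the integrals of the single errors tend to 0. *)
  define \<rho> where "\<rho> = (\<lambda>z. \<Sum>k. ennreal \<bar>mollify (e k) m z - m z\<bar>)"
  have [measurable]: "\<rho> \<in> borel_measurable borel" unfolding \<rho>_def by measurable
  have V': "V \<in> sets lebesgue" using V by auto
  have bor: "g \<in> borel_measurable (restrict_space borel V)" if "g \<in> borel_measurable borel" for g :: "plane \<Rightarrow> ennreal"
    using that by (rule measurable_restrict_space1)
  have "(\<integral>\<^sup>+z. ennreal_powr (\<rho> z) p \<partial>lborel) < top"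
    unfolding \<rho>_def by (rule fast_convergence_energy[OF p]) (use e(5) in auto)
  moreover have "(\<integral>\<^sup>+z. ennreal_powr (\<rho> z) p \<partial>lebesgue_on V) \<le> (\<integral>\<^sup>+z. ennreal_powr (\<rho> z) p \<partial>lborel)"
    using V' by (subst nn_integral_restrict_space) (auto simp: nn_integral_completion indicator_def intro!: nn_integral_mono)
  ultimately have \<rho>V: "(\<integral>\<^sup>+z. ennreal_powr (\<rho> z) p \<partial>lebesgue_on V) < top" by (rule le_less_trans[rotated])
  have ae\<rho>: "almost_every_curve p V (\<lambda>l \<gamma>. curve_integral l \<gamma> \<rho> < top)"
    unfolding almost_every_curve_iff[OF p] using \<rho>V bor[of \<rho>] by (intro bexI[of _ \<rho>]) auto
  have "almost_every_curve p V (upper_gradient_ineq w (\<lambda>z. ennreal (m z)))"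
  proof (rule almost_every_curve_mono[OF p almost_every_curve_conj[OF p ae\<rho> almost_every_curve_avoids_null[OF p V' E]]])
    fix l \<gamma> assume \<gamma>: "(l, \<gamma>) \<in> curves V"
      and good: "curve_integral l \<gamma> \<rho> < top \<and> (AE t in lebesgue_on {0..l}. \<gamma> t \<notin> {z. \<bar>w z\<bar> = \<infinity>})"
    have l: "0 < l" and c\<gamma>: "continuous_on {0..l} \<gamma>" and im: "\<gamma> ` {0..l} \<subseteq> V" using \<gamma> by (auto simp: curves_def)
    show "upper_gradient_ineq w (\<lambda>z. ennreal (m z)) l \<gamma>"
    proof (cases "curve_integral l \<gamma> (\<lambda>z. ennreal (m z))" rule: ennreal_cases)
      case top
      then show ?thesis by (simp add: upper_gradient_ineq_def)
    next
      case (real c)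
      have cm: "(\<lambda>t. g (\<gamma> t)) \<in> borel_measurable (lebesgue_on {0..l})" if "g \<in> borel_measurable borel" for g :: "plane \<Rightarrow> ennreal"
        by (rule curve_measurable[OF \<gamma> bor[OF that]])
      have sm: "(\<lambda>t. ennreal \<bar>mollify (e k) m (\<gamma> t) - m (\<gamma> t)\<bar>) \<in> borel_measurable (lebesgue_on {0..l})" for k
        by (rule cm[of "\<lambda>z. ennreal \<bar>mollify (e k) m z - m z\<bar>"]) measurable
      define s where "s k = curve_integral l \<gamma> (\<lambda>z. ennreal \<bar>mollify (e k) m z - m z\<bar>)" for k
      have "(\<Sum>k. s k) = curve_integral l \<gamma> \<rho>"
        unfolding s_def \<rho>_def curve_integral_def by (rule nn_integral_suminf[symmetric]) (rule sm)
      then have ssum: "(\<Sum>k. s k) < top" using good by simp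
      have s0: "s \<longlonglongrightarrow> 0" by (rule ennreal_suminf_finite_tendsto_0[OF ssum])
      have sfin: "s k < top" for k using ssum sum_le_suminf[of s "{k}"] by (auto intro: le_less_trans)
      have mk: "(\<integral>\<^sup>+t\<in>{a..b}. ennreal (mollify (e k) m (\<gamma> t)) \<partial>lebesgue) \<le> ennreal c + s k"
        if "0 \<le> a" "b \<le> l" for a b k
      proof -
        have "(\<integral>\<^sup>+t\<in>{a..b}. ennreal (mollify (e k) m (\<gamma> t)) \<partial>lebesgue) \<le> (\<integral>\<^sup>+t\<in>{0..l}. ennreal (mollify (e k) m (\<gamma> t)) \<partial>lebesgue)"
          using that by (intro nn_integral_mono) (auto simp: indicator_def)
        also have "\<dots> = (\<integral>\<^sup>+t. ennreal (mollify (e k) m (\<gamma> t)) \<partial>lebesgue_on {0..l})"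
          by (rule nn_integral_restrict_space[symmetric]) auto
        also have "\<dots> \<le> (\<integral>\<^sup>+t. ennreal (m (\<gamma> t)) + ennreal \<bar>mollify (e k) m (\<gamma> t) - m (\<gamma> t)\<bar> \<partial>lebesgue_on {0..l})"
        proof (rule nn_integral_mono)
          fix t
          have "ennreal (mollify (e k) m (\<gamma> t)) \<le> ennreal (m (\<gamma> t) + \<bar>mollify (e k) m (\<gamma> t) - m (\<gamma> t)\<bar>)"
            by (intro ennreal_leI) linarith
          then show "ennreal (mollify (e k) m (\<gamma> t)) \<le> ennreal (m (\<gamma> t)) + ennreal \<bar>mollify (e k) m (\<gamma> t) - m (\<gamma> t)\<bar>"
            using m(2) by simp
        qed
        also have "\<dots> = ennreal c + s k"
          unfolding real(2)[symmetric] s_def curve_integral_def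
          by (rule nn_integral_add[OF cm[of "\<lambda>z. ennreal (m z)"] sm]) measurable
        finally show ?thesis .
      qed
      have "compact (\<gamma> ` {0..l})" by (intro compact_continuous_image c\<gamma> compact_Icc)
      from compact_subset_open_imp_cball_epsilon_subset[OF this V im]
      obtain r where r: "0 < r" "(\<Union>x\<in>\<gamma> ` {0..l}. cball x r) \<subseteq> V" by blast
      (* From k0 on, the mollifications near the curve depend on values in V only. *)
      obtain k0 where k0: "1 / real (Suc k0) < r" using nat_approx_posE[OF r(1)] by blast
      have diff: "\<bar>mollify (e k) u (\<gamma> a) - mollify (e k) u (\<gamma> b)\<bar> \<le> c + enn2real (s k)"
        if ab: "a \<in> {0..l}" "b \<in> {0..l}" and k: "k0 \<le> k" for a b k
      proof -
        have "1 / real (Suc k) \<le> 1 / real (Suc k0)" using k by (intro divide_left_mono) auto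
        then have ek: "e k < r" using e(2)[of k] k0 by linarith
        have in_V: "cball (\<gamma> t) (e k) \<subseteq> V" if "0 \<le> t" "t \<le> l" for t
        proof -
          have "cball (\<gamma> t) (e k) \<subseteq> cball (\<gamma> t) r" using ek by (intro subset_cball) simp
          moreover have "\<gamma> t \<in> \<gamma> ` {0..l}" using that by auto
          ultimately show ?thesis using r(2) by blast
        qed
        have ord: "\<bar>mollify (e k) u (\<gamma> a) - mollify (e k) u (\<gamma> b)\<bar> \<le> c + enn2real (s k)"
          if "0 \<le> a" "a \<le> b" "b \<le> l" for a b
        proof -
          have "ennreal \<bar>mollify (e k) u (\<gamma> a) - mollify (e k) u (\<gamma> b)\<bar> \<le> (\<integral>\<^sup>+t\<in>{a..b}. ennreal (mollify (e k) m (\<gamma> t)) \<partial>lebesgue)"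
            by (rule mollify_along_curve[OF lu lm m(2) V sb e(1) \<gamma> that]) (use that in_V in auto)
          also have "\<dots> \<le> ennreal c + s k" by (rule mk[OF that(1,3)])
          also have "\<dots> = ennreal (c + enn2real (s k))" using sfin[of k] real(1) by simp
          finally show ?thesis using real(1) by (subst (asm) ennreal_le_iff) auto
        qed
        show ?thesis
          using ord[of a b] ord[of b a] ab by (cases "a \<le> b") (auto simp: abs_minus_commute)
      qed
      have wle: "w (\<gamma> a) \<le> ereal c + w (\<gamma> b)" if ab: "a \<in> {0..l}" "b \<in> {0..l}" for a b
      proof -
        have "(\<lambda>k. enn2real (s k)) \<longlonglongrightarrow> enn2real 0" using s0 by (intro tendsto_enn2real) auto
        then have "(\<lambda>k. c + enn2real (s k)) \<longlonglongrightarrow> c + 0" by (intro tendsto_add tendsto_const) simp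
        then have lim: "(\<lambda>k. ereal (c + enn2real (s k))) \<longlonglongrightarrow> ereal c" by simp
        have "w (\<gamma> a) \<le> limsup (\<lambda>k. ereal (c + enn2real (s k)) + ereal (mollify (e k) u (\<gamma> b)))"
          unfolding w_def
        proof (rule Limsup_mono)
          show "\<forall>\<^sub>F k in sequentially. ereal (mollify (e k) u (\<gamma> a)) \<le> ereal (c + enn2real (s k)) + ereal (mollify (e k) u (\<gamma> b))"
            unfolding eventually_sequentially
          proof (intro exI[of _ k0] allI impI)
            fix k assume "k0 \<le> k"
            from diff[OF ab this] show "ereal (mollify (e k) u (\<gamma> a)) \<le> ereal (c + enn2real (s k)) + ereal (mollify (e k) u (\<gamma> b))"
              by simp
          qed
        qed
        also have "\<dots> = ereal c + w (\<gamma> b)" unfolding w_def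
          by (rule ereal_limsup_lim_add[OF lim]) simp
        finally show ?thesis .
      qed
      have "\<exists>t\<in>{0..l}. \<bar>w (\<gamma> t)\<bar> \<noteq> \<infinity>"
      proof (rule ccontr)
        assume n: "\<not> ?thesis"
        have "AE t in lebesgue_on {0..l}. \<gamma> t \<notin> {z. \<bar>w z\<bar> = \<infinity>}" using good by blast
        then have "AE t in lebesgue_on {0..l}. False"
          using AE_space by eventually_elim (use n in simp)
        then have "(\<integral>\<^sup>+t. 1 \<partial>lebesgue_on {0..l}) = (\<integral>\<^sup>+t. 0 \<partial>lebesgue_on {0..l})"
          by (intro nn_integral_cong_AE) (auto elim: eventually_mono)
        then have "emeasure lebesgue {0..l} = 0" by (simp add: emeasure_restrict_space)
        then show False using l by simp
      qed
      then obtain t where t: "t \<in> {0..l}" "\<bar>w (\<gamma> t)\<bar> \<noteq> \<infinity>" by (rule bexE)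
      from t(2) have "\<exists>y0. w (\<gamma> t) = ereal y0" by (simp only: not_infty_ereal)
      then obtain y0 where y0: "w (\<gamma> t) = ereal y0" by (rule exE)
      have fin: "\<exists>x. w (\<gamma> a) = ereal x" if a: "a \<in> {0..l}" for a
        using wle[OF a t(1)] wle[OF t(1) a] unfolding y0 by (cases "w (\<gamma> a)" rule: ereal_cases) auto
      have l0: "0 \<in> {0..l}" "l \<in> {0..l}" using l by auto
      obtain x where x: "w (\<gamma> 0) = ereal x" using fin[OF l0(1)] by (rule exE)
      obtain y where y: "w (\<gamma> l) = ereal y" using fin[OF l0(2)] by (rule exE)
      note xy = x y
      have "\<bar>x - y\<bar> \<le> c" using wle[OF l0] wle[OF l0(2,1)] unfolding xy by simp
      then have "e2ennreal (ereal \<bar>x - y\<bar>) \<le> ennreal c" by (simp add: e2ennreal_ereal ennreal_leI)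
      then show ?thesis unfolding upper_gradient_ineq_def xy real(2) by simp
    qed
  qed
  moreover have "(\<lambda>z. ennreal (m z)) \<in> borel_measurable (lebesgue_on V)"
    by (intro borel_on_imp_lebesgue_on bor) measurable
  ultimately show ?thesis using wu by (intro bexI[of _ w] conjI) (auto simp: weak_upper_gradient_def)
qed

section \<open>Lines missing the removed set\<close>

text \<open>Almost every segment in a good direction is a curve in the complement of a thin set. Good
  directions are dense and include those of the axes.\<close>

definition thin :: "plane set \<Rightarrow> bool" where
  "thin A \<longleftrightarrow> A \<in> sets borel \<and> (\<forall>v\<in>good_directions. AE z in lborel. \<forall>t. z + t *\<^sub>R v \<notin> A)"

lemma AE_linear_functional_avoids:
  fixes a b :: real
  assumes ab: "(a, b) \<noteq> (0, 0)" and N: "N \<in> null_sets (lborel :: real measure)"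
  shows "AE z in lborel. a * fst z + b * snd z \<notin> N"
proof -
  have [measurable]: "N \<in> sets borel" using N by auto
  have N0: "(\<integral>\<^sup>+x. indicator N x \<partial>lborel) = 0" using null_setsD1[OF N] by simp
  have m: "(\<lambda>z. indicator N (a * fst z + b * snd z) :: ennreal) \<in> borel_measurable (lborel \<Otimes>\<^sub>M lborel)"
    by measurable
  have sec: "(\<integral>\<^sup>+y. indicator N (s + c * y) \<partial>lborel) = (0 :: ennreal)" if "c \<noteq> 0" for s c :: real
  proof -
    have "(\<integral>\<^sup>+x. indicator N x \<partial>lborel) = ennreal \<bar>c\<bar> * (\<integral>\<^sup>+y. indicator N (s + c * y) \<partial>lborel)"
      by (rule nn_integral_real_affine[OF _ that]) measurable
    then show ?thesis using that unfolding N0 by auto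
  qed
  have "(\<integral>\<^sup>+z. indicator N (a * fst z + b * snd z) \<partial>(lborel \<Otimes>\<^sub>M lborel)) = (0 :: ennreal)"
  proof (cases "b = 0")
    case False
    have "(\<integral>\<^sup>+z. indicator N (a * fst z + b * snd z) \<partial>(lborel \<Otimes>\<^sub>M lborel)) =
        (\<integral>\<^sup>+x. (\<integral>\<^sup>+y. indicator N (a * x + b * y) \<partial>lborel) \<partial>lborel)"
      by (subst lborel.nn_integral_fst[OF m, symmetric]) simp
    then show ?thesis by (simp add: sec[OF False])
  next
    case True
    then have a: "a \<noteq> 0" using ab by auto
    have "(\<integral>\<^sup>+z. indicator N (a * fst z + b * snd z) \<partial>(lborel \<Otimes>\<^sub>M lborel)) =
        (\<integral>\<^sup>+y. (\<integral>\<^sup>+x. indicator N (b * y + a * x) \<partial>lborel) \<partial>lborel)"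
      by (subst lborel_pair.nn_integral_snd[OF m, symmetric]) (simp add: add.commute)
    then show ?thesis by (simp add: sec[OF a])
  qed
  then have "AE z in lborel \<Otimes>\<^sub>M lborel. indicator N (a * fst z + b * snd z) = (0 :: ennreal)"
    by (subst (asm) nn_integral_0_iff_AE[OF m])
  then have "AE z in lborel. indicator N (a * fst z + b * snd z) = (0 :: ennreal)"
    unfolding lborel_prod .
  then show ?thesis by eventually_elim (auto simp: indicator_def split: if_splits)
qed

text \<open>A line in direction \<open>v\<close> meets the translate of the Cantor set by \<open>q\<close> only if the value on it of
  the functional that vanishes on \<open>v\<close> lies in a translate of the null projection. Countably many
  null sets are avoided by almost every line.\<close>

lemma thin_translates:
  fixes q :: "nat \<Rightarrow> plane"
  shows "thin (\<Union>j\<in>{1..}. (\<lambda>x. q j + x) ` four_corners_cantor_set)"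
proof -
  define A where "A = (\<Union>j\<in>{1..}. (\<lambda>x. q j + x) ` four_corners_cantor_set)"
  have "(\<lambda>x. q j + x) ` four_corners_cantor_set \<in> sets borel" for j
    by (intro borel_closed compact_imp_closed compact_continuous_image compact_four_corners continuous_intros)
  then have "A \<in> sets borel" unfolding A_def by (intro sets.countable_UN') auto
  moreover have "AE z in lborel. \<forall>t. z + t *\<^sub>R v \<notin> A" if v: "v \<in> good_directions" for v
  proof -
    define L where "L = (\<lambda>z::plane. snd v * fst z + (- fst v) * snd z)"
    define T where "T = L ` four_corners_cantor_set"
    have "T = (\<lambda>(x, y). snd v * x - fst v * y) ` four_corners_cantor_set"
      unfolding T_def by (rule image_cong) (auto simp: L_def)
    then have T: "T \<in> null_sets lborel" using v by (simp add: good_directions_def)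
    have "v \<noteq> 0" using v by (auto simp: good_directions_def)
    then have vn: "(snd v, - fst v) \<noteq> (0, 0)" by (auto simp: prod_eq_iff)
    have "AE z in lborel. L (z + (- q j)) \<notin> T" for j
      using AE_translate[OF AE_linear_functional_avoids[OF vn T], of "- q j"] by (simp only: L_def)
    then have "AE z in lborel. \<forall>j. L (z + (- q j)) \<notin> T" by (subst AE_all_countable) blast
    then show ?thesis
    proof eventually_elim
      case (elim z)
      show ?case
      proof (intro allI notI)
        fix t assume "z + t *\<^sub>R v \<in> A"
        then obtain j x where x: "x \<in> four_corners_cantor_set" "z + t *\<^sub>R v = q j + x" unfolding A_def by blast
        have "z + (- q j) = x - t *\<^sub>R v" using x(2) by (simp add: algebra_simps)
        then have "L (z + (- q j)) = L (x - t *\<^sub>R v)" by (rule arg_cong)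
        also have "\<dots> = L x" by (simp add: L_def algebra_simps)
        finally have "L (z + (- q j)) = L x" .
        then show False using elim x(1) unfolding T_def by (metis imageI)
      qed
    qed
  qed
  ultimately show ?thesis by (simp add: thin_def A_def)
qed

lemma thin_null:
  assumes "thin A"
  shows "A \<in> null_sets lborel"
proof -
  have "AE z in lborel. \<forall>t. z + t *\<^sub>R (1, 0) \<notin> A" using assms axis_directions(1) by (auto simp: thin_def)
  then have "AE z in lborel. z \<notin> A"
  proof eventually_elim
    case (elim z)
    then have "z + 0 *\<^sub>R (1, 0) \<notin> A" by blast
    then show ?case by (simp only: scaleR_zero_left add_0_right simp_thms)
  qed
  then show ?thesis using assms by (subst AE_iff_null_sets) (auto simp: thin_def)
qed

subsection \<open>Fubini along parallel segments\<close>

lemma AE_segment_integral_finite: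
  fixes v :: plane
  assumes \<rho>: "integrable_on_compacts UNIV \<rho>" and v: "norm v = 1" and \<delta>: "0 < \<delta>"
  shows "AE z in lborel. (\<integral>\<^sup>+s\<in>{0..\<delta>}. \<rho> (z + s *\<^sub>R v) \<partial>lborel) < top"
proof -
  have [measurable]: "\<rho> \<in> borel_measurable borel" using \<rho> by (simp add: integrable_on_compacts_def)
  define B0 where "B0 R = ball (0::plane) (real R)" for R
  have [measurable]: "B0 R \<in> sets borel" for R by (simp add: B0_def)
  have "AE z in lborel. z \<in> B0 R \<longrightarrow> (\<integral>\<^sup>+s\<in>{0..\<delta>}. \<rho> (z + s *\<^sub>R v) \<partial>lborel) \<noteq> top" for R
  proof -
    define B where "B = cball (0::plane) (real R + \<delta>)"
    have [measurable]: "B \<in> sets borel" by (simp add: B_def)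
    have fin: "(\<integral>\<^sup>+z\<in>B. \<rho> z \<partial>lborel) < top" using \<rho> by (auto simp: integrable_on_compacts_def B_def)
    have "(\<integral>\<^sup>+z\<in>B0 R. (\<integral>\<^sup>+s\<in>{0..\<delta>}. \<rho> (z + s *\<^sub>R v) \<partial>lborel) \<partial>lborel)
       = (\<integral>\<^sup>+z. (\<integral>\<^sup>+s. \<rho> (z + s *\<^sub>R v) * indicator {0..\<delta>} s * indicator (B0 R) z \<partial>lborel) \<partial>lborel)"
      by (intro nn_integral_cong nn_integral_multc[symmetric]) measurable
    also have "\<dots> = (\<integral>\<^sup>+s. (\<integral>\<^sup>+z. \<rho> (z + s *\<^sub>R v) * indicator {0..\<delta>} s * indicator (B0 R) z \<partial>lborel) \<partial>lborel)"
      by (intro lborel_pair.Fubini'[symmetric]) measurable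
    also have "\<dots> \<le> (\<integral>\<^sup>+s. (\<integral>\<^sup>+z\<in>B. \<rho> z \<partial>lborel) * indicator {0..\<delta>} s \<partial>lborel)"
    proof (rule nn_integral_mono)
      fix s :: real
      show "(\<integral>\<^sup>+z. \<rho> (z + s *\<^sub>R v) * indicator {0..\<delta>} s * indicator (B0 R) z \<partial>lborel) \<le> (\<integral>\<^sup>+z\<in>B. \<rho> z \<partial>lborel) * indicator {0..\<delta>} s"
      proof (cases "s \<in> {0..\<delta>}")
        case True
        have "(\<integral>\<^sup>+z. \<rho> (z + s *\<^sub>R v) * indicator {0..\<delta>} s * indicator (B0 R) z \<partial>lborel)
          \<le> (\<integral>\<^sup>+z. \<rho> (z + s *\<^sub>R v) * indicator B (z + s *\<^sub>R v) \<partial>lborel)"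
        proof (rule nn_integral_mono)
          fix z :: plane
          have "z + s *\<^sub>R v \<in> B" if "z \<in> B0 R"
            using that True v norm_triangle_ineq[of z "s *\<^sub>R v"] by (simp add: B_def B0_def)
          then show "\<rho> (z + s *\<^sub>R v) * indicator {0..\<delta>} s * indicator (B0 R) z \<le> \<rho> (z + s *\<^sub>R v) * indicator B (z + s *\<^sub>R v)"
            using True by (cases "z \<in> B0 R") simp_all
        qed
        also have "\<dots> = (\<integral>\<^sup>+z\<in>B. \<rho> z \<partial>lborel)" by (rule nn_integral_translate[of "\<lambda>z. \<rho> z * indicator B z"]) measurable
        finally show ?thesis using True by simp
      qed simp
    qed
    also have "\<dots> = (\<integral>\<^sup>+z\<in>B. \<rho> z \<partial>lborel) * ennreal \<delta>" using \<delta> by (subst nn_integral_cmult_indicator) auto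
    also have "\<dots> < top" using fin by (simp add: ennreal_mult_less_top)
    finally have "AE z in lborel. (\<integral>\<^sup>+s\<in>{0..\<delta>}. \<rho> (z + s *\<^sub>R v) \<partial>lborel) * indicator (B0 R) z \<noteq> top"
      by (intro nn_integral_PInf_AE[unfolded infinity_ennreal_def]) auto
    then show ?thesis by eventually_elim (auto simp: indicator_def split: if_splits)
  qed
  then have "AE z in lborel. \<forall>R. z \<in> B0 R \<longrightarrow> (\<integral>\<^sup>+s\<in>{0..\<delta>}. \<rho> (z + s *\<^sub>R v) \<partial>lborel) \<noteq> top"
    by (subst AE_all_countable) blast
  then show ?thesis
  proof eventually_elim
    case (elim z)
    obtain R where "norm z < real R" using reals_Archimedean2 by blast
    then show ?case using elim by (auto simp: less_top B0_def)
  qed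
qed

lemma AE_segment_avoids_null:
  fixes v :: plane
  assumes N: "N \<in> null_sets lborel"
  shows "AE z in lborel. AE s in lborel. z + s *\<^sub>R v \<notin> N"
proof -
  have [measurable]: "N \<in> sets borel" using N by auto
  have "(\<integral>\<^sup>+z. (\<integral>\<^sup>+s. indicator N (z + s *\<^sub>R v) \<partial>lborel) \<partial>lborel) = (\<integral>\<^sup>+s. (\<integral>\<^sup>+z. indicator N (z + s *\<^sub>R v) \<partial>lborel) \<partial>lborel)"
    by (intro lborel_pair.Fubini'[symmetric]) measurable
  also have "\<dots> = (\<integral>\<^sup>+s. 0 \<partial>(lborel :: real measure))"
  proof (rule nn_integral_cong)
    fix s :: real
    have "(\<integral>\<^sup>+z. indicator N (z + s *\<^sub>R v) \<partial>lborel) = (\<integral>\<^sup>+z. indicator N z \<partial>lborel)"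
      by (rule nn_integral_translate) measurable
    then show "(\<integral>\<^sup>+z. indicator N (z + s *\<^sub>R v) \<partial>lborel) = (0::ennreal)" using null_setsD1[OF N] by simp
  qed
  finally have "(\<integral>\<^sup>+z. (\<integral>\<^sup>+s. indicator N (z + s *\<^sub>R v) \<partial>lborel) \<partial>lborel) = (0::ennreal)" by simp
  then have "AE z in lborel. (\<integral>\<^sup>+s. indicator N (z + s *\<^sub>R v) \<partial>lborel) = (0::ennreal)"
    by (subst (asm) nn_integral_0_iff_AE) measurable
  then show ?thesis
  proof eventually_elim
    case (elim z)
    then have "AE s in lborel. indicator N (z + s *\<^sub>R v) = (0::ennreal)"
      by (subst (asm) nn_integral_0_iff_AE) measurable
    then show ?case by eventually_elim (auto simp: indicator_def split: if_splits)
  qed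
qed

section \<open>Weak upper gradients give slope bounds\<close>

text \<open>In a good direction almost every segment in the open set \<open>U\<close> lies in \<open>Z\<close> and is not
  exceptional, so the upper gradient inequality holds on it.\<close>

lemma slope_bound_of_weak_upper_gradient:
  fixes u :: "plane \<Rightarrow> real"
  assumes p: "1 \<le> p" and A: "thin A" and Z: "Z \<in> sets borel" "U - A \<subseteq> Z"
    and U: "open U" and wh: "weak_upper_gradient p Z w h"
    and ioc: "integrable_on_compacts U h'" and h'h: "AE z in lborel. z \<in> Z \<longrightarrow> h' z = h z"
    and u: "locally_integrable u" "AE z in lborel. z \<in> Z \<longrightarrow> u z = real_of_ereal (w z)"
    and v: "v \<in> good_directions"
  shows "slope_bound U u h' v"
proof -
  note [measurable] = Z(1)
  have Zl: "Z \<in> sets lebesgue" using Z(1) by auto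
  obtain N where N: "N \<in> null_sets lborel" "{z. \<not> (z \<in> Z \<longrightarrow> h' z = h z)} \<subseteq> N"
    using h'h by (auto simp: eventually_ae_filter)
  obtain \<rho> where \<rho>: "\<rho> \<in> borel_measurable (restrict_space borel Z)"
     "(\<integral>\<^sup>+x. ennreal_powr (\<rho> x) p \<partial>lebesgue_on Z) < top"
     "\<And>l \<gamma>. (l, \<gamma>) \<in> curves Z \<Longrightarrow> curve_integral l \<gamma> \<rho> < top \<Longrightarrow> upper_gradient_ineq w h l \<gamma>"
    using wh unfolding weak_upper_gradient_def almost_every_curve_iff[OF p] by blast
  (* Finite energy makes \<rho> locally integrable, and so its integral is finite along almost every
     segment in a fixed direction. *)
  define \<rho>' where "\<rho>' = (\<lambda>z. \<rho> z * indicator Z z)"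
  have [measurable]: "\<rho>' \<in> borel_measurable borel" unfolding \<rho>'_def
    by (rule borel_measurable_restrict_space_iff_ennreal[THEN iffD1, OF _ \<rho>(1)]) (use Z(1) in auto)
  have "integrable_on_compacts UNIV \<rho>'"
  proof (rule integrable_on_compacts_of_energy[OF p])
    have "(\<integral>\<^sup>+z. ennreal_powr (\<rho>' z) p \<partial>lborel) = (\<integral>\<^sup>+x. ennreal_powr (\<rho> x) p \<partial>lebesgue_on Z)"
      using Zl by (subst nn_integral_restrict_space) (auto simp: nn_integral_completion \<rho>'_def indicator_def intro!: nn_integral_cong)
    then show "(\<integral>\<^sup>+z. ennreal_powr (\<rho>' z) p \<partial>lborel) < top" using \<rho>(2) by simp
  qed measurable
  note \<rho>'_ioc = this
    define d where "d = - v"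
    have dg: "d \<in> good_directions" unfolding d_def by (rule good_directions_uminus[OF v])
    then have dn: "norm d = 1" by (simp add: good_directions_def)
    have "slope_bound U u h' (- d)"
    proof (rule slope_bound_of_segments[OF u(1) U ioc dn])
      fix \<delta> :: real assume \<delta>: "0 < \<delta>"
      have "AE z in lborel. \<forall>t. z + t *\<^sub>R d \<notin> A" using A dg by (auto simp: thin_def)
      then show "AE z in lborel. (\<forall>s\<in>{0..\<delta>}. z + s *\<^sub>R d \<in> U) \<longrightarrow>
        ennreal \<bar>u (z + \<delta> *\<^sub>R d) - u z\<bar> \<le> (\<integral>\<^sup>+s\<in>{0..\<delta>}. h' (z + s *\<^sub>R d) \<partial>lborel)"
        using u(2) AE_translate[OF u(2), of "\<delta> *\<^sub>R d"] AE_segment_integral_finite[OF \<rho>'_ioc dn \<delta>] AE_segment_avoids_null[OF N(1), of d]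
      proof eventually_elim
        case (elim z)
        show ?case
        proof
          assume seg: "\<forall>s\<in>{0..\<delta>}. z + s *\<^sub>R d \<in> U"
          have inZ: "z + s *\<^sub>R d \<in> Z" if "0 \<le> s" "s \<le> \<delta>" for s
          proof -
            have "s \<in> {0..\<delta>}" using that by simp
            then have "z + s *\<^sub>R d \<in> U" using seg by blast
            moreover have "z + s *\<^sub>R d \<notin> A" using elim(1) by blast
            ultimately show ?thesis using Z(2) by blast
          qed
          define \<gamma> where "\<gamma> = (\<lambda>t. z + t *\<^sub>R d)"
          have c: "(\<delta>, \<gamma>) \<in> curves Z" unfolding \<gamma>_def by (rule segment_curve[OF dn \<delta> inZ])
          have "curve_integral \<delta> \<gamma> \<rho> = (\<integral>\<^sup>+s\<in>{0..\<delta>}. \<rho>' (z + s *\<^sub>R d) \<partial>lborel)"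
            unfolding curve_integral_eq nn_integral_completion
            using inZ by (intro nn_integral_cong) (auto simp: \<gamma>_def \<rho>'_def indicator_def)
          then have "upper_gradient_ineq w h \<delta> \<gamma>" using elim(4) by (intro \<rho>(3) c) simp
          moreover have "curve_integral \<delta> \<gamma> h = (\<integral>\<^sup>+s\<in>{0..\<delta>}. h' (z + s *\<^sub>R d) \<partial>lborel)"
            unfolding curve_integral_eq nn_integral_completion
          proof (rule nn_integral_cong_AE)
            show "AE s in lborel. h (\<gamma> s) * indicator {0..\<delta>} s = h' (z + s *\<^sub>R d) * indicator {0..\<delta>} s"
              using elim(5)
            proof eventually_elim
              case (elim s)
              show ?case
              proof (cases "s \<in> {0..\<delta>}")
                case True
                then have "z + s *\<^sub>R d \<in> Z" using inZ by auto
                then show ?thesis using elim N(2) unfolding \<gamma>_def by fastforce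
              qed simp
            qed
          qed
          ultimately have "upper_gradient_ineq w h \<delta> \<gamma>" "curve_integral \<delta> \<gamma> h = (\<integral>\<^sup>+s\<in>{0..\<delta>}. h' (z + s *\<^sub>R d) \<partial>lborel)" .
          then have ug: "(if \<bar>w z\<bar> = \<infinity> \<or> \<bar>w (z + \<delta> *\<^sub>R d)\<bar> = \<infinity> then \<infinity> else e2ennreal \<bar>w z - w (z + \<delta> *\<^sub>R d)\<bar>)
              \<le> (\<integral>\<^sup>+s\<in>{0..\<delta>}. h' (z + s *\<^sub>R d) \<partial>lborel)"
          proof -
            have "\<gamma> 0 = z" "\<gamma> \<delta> = z + \<delta> *\<^sub>R d" by (simp_all add: \<gamma>_def)
            with \<open>upper_gradient_ineq w h \<delta> \<gamma>\<close> \<open>curve_integral \<delta> \<gamma> h = _\<close> show ?thesis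
              unfolding upper_gradient_ineq_def by (simp only:)
          qed
          show "ennreal \<bar>u (z + \<delta> *\<^sub>R d) - u z\<bar> \<le> (\<integral>\<^sup>+s\<in>{0..\<delta>}. h' (z + s *\<^sub>R d) \<partial>lborel)"
          proof (cases "\<bar>w z\<bar> = \<infinity> \<or> \<bar>w (z + \<delta> *\<^sub>R d)\<bar> = \<infinity>")
            case True
            then show ?thesis using ug by (simp add: top_unique)
          next
            case False
            then obtain a b where ab: "w z = ereal a" "w (z + \<delta> *\<^sub>R d) = ereal b" by auto
            have "u z = a" "u (z + \<delta> *\<^sub>R d) = b" using elim(2,3) inZ[of 0] inZ[of \<delta>] \<delta> ab by auto
            then show ?thesis using ug by (simp add: ab e2ennreal_ereal abs_minus_commute)
          qed
        qed
      qed
    qed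
    then show ?thesis by (simp add: d_def)
qed

text \<open>An upper gradient that is locally integrable on \<open>Z\<close> may fail to be integrable near points of
  \<open>V - Z\<close>. The open set \<open>U\<close> consists of balls about the points of \<open>Z\<close> in which it is integrable.\<close>

lemma slope_bound_of_local_weak_upper_gradient:
  fixes u :: "plane \<Rightarrow> real"
  assumes p: "1 \<le> p" and V: "open V" and A: "thin A" and Z: "Z \<in> sets borel" "V - A \<subseteq> Z" "Z \<subseteq> V"
    and h: "h \<in> Lp_loc p Z" and wh: "weak_upper_gradient p Z w h"
    and u: "locally_integrable u" "AE z in lborel. z \<in> Z \<longrightarrow> u z = real_of_ereal (w z)"
  shows "\<exists>U h'. open U \<and> Z \<subseteq> U \<and> U \<subseteq> V \<and> integrable_on_compacts U h' \<and>
     (AE z in lborel. z \<in> Z \<longrightarrow> h' z = h z) \<and> (\<forall>v\<in>good_directions. slope_bound U u h' v)"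
proof -
  note [measurable] = Z(1)
  have Zl: "Z \<in> sets lebesgue" using Z(1) by auto
  have hm: "h \<in> borel_measurable (lebesgue_on Z)" using h by (simp add: Lp_loc_def)
  have "\<exists>h0. h0 \<in> borel_measurable borel \<and> {x \<in> Z. h x \<noteq> h0 x} \<in> null_sets lebesgue"
    by (rule lebesgue_on_borel_version[OF Zl hm]) blast
  then obtain h0 where h0: "h0 \<in> borel_measurable borel" "{x \<in> Z. h x \<noteq> h0 x} \<in> null_sets lebesgue"
    by blast
  obtain N where N: "N \<in> null_sets lborel" "{x \<in> Z. h x \<noteq> h0 x} \<subseteq> N"
    using h0(2) unfolding null_sets_completion_iff2 by blast
  define h' where "h' = (\<lambda>z. h0 z * indicator Z z)"
  have [measurable]: "h0 \<in> borel_measurable borel" by (rule h0(1))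
  have h'm [measurable]: "h' \<in> borel_measurable borel" unfolding h'_def by measurable
  have h'h: "AE z in lborel. z \<in> Z \<longrightarrow> h' z = h z"
    using AE_not_in[OF N(1)] by eventually_elim (use N(2) in \<open>auto simp: h'_def\<close>)
  have "\<forall>x\<in>Z. \<exists>r>0. (\<integral>\<^sup>+y. ennreal_powr (h y) p \<partial>lebesgue_on (Z \<inter> ball x r)) < \<infinity>"
    using h by (simp add: Lp_loc_def)
  from bchoice[OF this] obtain r where r: "\<And>x. x \<in> Z \<Longrightarrow> 0 < r x"
      "\<And>x. x \<in> Z \<Longrightarrow> (\<integral>\<^sup>+y. ennreal_powr (h y) p \<partial>lebesgue_on (Z \<inter> ball x (r x))) < \<infinity>"
    by blast
  have ball: "(\<integral>\<^sup>+z\<in>ball x (r x). h' z \<partial>lborel) < top" if x: "x \<in> Z" for x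
  proof -
    define B where "B = ball x (r x)"
    have [measurable]: "B \<in> sets borel" by (simp add: B_def)
    have sets: "Z \<inter> ball x (r x) \<in> sets lebesgue" using Zl by (intro sets.Int) auto
    have eq: "(\<integral>\<^sup>+y. ennreal_powr (h y) p \<partial>lebesgue_on (Z \<inter> ball x (r x))) = (\<integral>\<^sup>+y\<in>ball x (r x). ennreal_powr (h' y) p \<partial>lborel)"
    proof -
      have "(\<integral>\<^sup>+y. ennreal_powr (h y) p \<partial>lebesgue_on (Z \<inter> ball x (r x))) = (\<integral>\<^sup>+y\<in>Z \<inter> ball x (r x). ennreal_powr (h y) p \<partial>lborel)"
        using sets by (subst nn_integral_restrict_space) (auto simp: nn_integral_completion)
      also have "\<dots> = (\<integral>\<^sup>+y\<in>ball x (r x). ennreal_powr (h' y) p \<partial>lborel)"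
        using h'h by (intro nn_integral_cong_AE) (auto elim!: eventually_mono simp: h'_def indicator_def)
      finally show ?thesis .
    qed
    have "(\<integral>\<^sup>+z\<in>ball x (r x). h' z \<partial>lborel) \<le> (\<integral>\<^sup>+z. indicator (ball x (r x)) z + ennreal_powr (h' z) p * indicator (ball x (r x)) z \<partial>lborel)"
    proof (rule nn_integral_mono)
      fix z
      show "h' z * indicator (ball x (r x)) z \<le> indicator (ball x (r x)) z + ennreal_powr (h' z) p * indicator (ball x (r x)) z"
        using le_one_plus_ennreal_powr[OF p, of "h' z"] by (cases "z \<in> ball x (r x)") simp_all
    qed
    also have "\<dots> = emeasure lborel (ball x (r x)) + (\<integral>\<^sup>+y\<in>ball x (r x). ennreal_powr (h' y) p \<partial>lborel)"
      unfolding B_def[symmetric] by (subst nn_integral_add) auto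
    also have "\<dots> < top" using r(2)[OF x] emeasure_lborel_ball_finite[of x "r x"] unfolding eq by simp
    finally show ?thesis .
  qed
  define U where "U = V \<inter> (\<Union>x\<in>Z. ball x (r x))"
  have U: "open U" "Z \<subseteq> U" "U \<subseteq> V" using V Z(3) r(1) by (auto simp: U_def)
  have ioc: "integrable_on_compacts U h'"
    unfolding integrable_on_compacts_def
  proof (intro conjI allI impI h'm)
    fix K assume K: "compact K" "K \<subseteq> U"
    have [measurable]: "K \<in> sets borel" using K(1) by (simp add: borel_closed compact_imp_closed)
    have "K \<subseteq> (\<Union>x\<in>Z. ball x (r x))" using K(2) by (auto simp: U_def)
    then obtain F where F: "F \<subseteq> Z" "finite F" "K \<subseteq> (\<Union>x\<in>F. ball x (r x))"
      using compactE_image[OF K(1), of Z "\<lambda>x. ball x (r x)"] by auto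
    have "(\<integral>\<^sup>+z\<in>K. h' z \<partial>lborel) \<le> (\<integral>\<^sup>+z. (\<Sum>x\<in>F. h' z * indicator (ball x (r x)) z) \<partial>lborel)"
    proof (rule nn_integral_mono)
      fix z
      show "h' z * indicator K z \<le> (\<Sum>x\<in>F. h' z * indicator (ball x (r x)) z)"
      proof (cases "z \<in> K")
        case True
        then obtain x where x: "x \<in> F" "z \<in> ball x (r x)" using F(3) by blast
        then have "h' z * indicator K z = h' z * indicator (ball x (r x)) z" using True by simp
        also have "\<dots> \<le> (\<Sum>x\<in>F. h' z * indicator (ball x (r x)) z)"
          using x(1) F(2) by (intro member_le_sum) auto
        finally show ?thesis .
      qed simp
    qed
    also have "\<dots> = (\<Sum>x\<in>F. \<integral>\<^sup>+z\<in>ball x (r x). h' z \<partial>lborel)"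
      using h'm by (intro nn_integral_sum borel_measurable_times_ennreal borel_measurable_indicator) auto
    also have "\<dots> < top" 
    proof -
      have "\<forall>x\<in>F. (\<integral>\<^sup>+z\<in>ball x (r x). h' z \<partial>lborel) < top" using ball F(1) by blast
      then show ?thesis using F(2) by (simp add: ennreal_sum_less_top)
    qed
    finally show "(\<integral>\<^sup>+z\<in>K. h' z \<partial>lborel) < top" .
  qed
  have sb: "slope_bound U u h' v" if v: "v \<in> good_directions" for v
    by (rule slope_bound_of_weak_upper_gradient[OF p A Z(1) _ U(1) wh ioc h'h u v]) (use U(3) Z(2) in blast)
  show ?thesis using U ioc h'h sb by blast
qed

section \<open>The Poincare inequality\<close>

lemma upper_gradient_on_segment:
  fixes v :: plane
  assumes ug: "upper_gradient Z u g" and v: "norm v = 1" and l: "0 < l"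
    and Z: "\<And>t. 0 \<le> t \<Longrightarrow> t \<le> l \<Longrightarrow> z + t *\<^sub>R v \<in> Z"
  shows "ennreal \<bar>real_of_ereal (u z) - real_of_ereal (u (z + l *\<^sub>R v))\<bar> \<le> (\<integral>\<^sup>+t\<in>{0..l}. g (z + t *\<^sub>R v) * indicator Z (z + t *\<^sub>R v) \<partial>lborel)"
proof -
  define \<gamma> where "\<gamma> = (\<lambda>t. z + t *\<^sub>R v)"
  have "(l, \<gamma>) \<in> curves Z" unfolding \<gamma>_def by (rule segment_curve[OF v l Z])
  then have i: "upper_gradient_ineq u g l \<gamma>" using ug unfolding upper_gradient_def by blast
  have c: "curve_integral l \<gamma> g = (\<integral>\<^sup>+t\<in>{0..l}. g (z + t *\<^sub>R v) * indicator Z (z + t *\<^sub>R v) \<partial>lborel)"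
    unfolding curve_integral_eq nn_integral_completion
    using Z by (intro nn_integral_cong) (auto simp: \<gamma>_def indicator_def)
  have g: "\<gamma> 0 = z" "\<gamma> l = z + l *\<^sub>R v" by (simp_all add: \<gamma>_def)
  show ?thesis
  proof (cases "\<bar>u z\<bar> = \<infinity> \<or> \<bar>u (z + l *\<^sub>R v)\<bar> = \<infinity>")
    case True
    then show ?thesis using i unfolding upper_gradient_ineq_def g c by (auto simp: top_unique)
  next
    case False
    then obtain a b where ab: "u z = ereal a" "u (z + l *\<^sub>R v) = ereal b" by auto
    show ?thesis using i unfolding upper_gradient_ineq_def g c ab by (simp add: e2ennreal_ereal)
  qed
qed

text \<open>Two points of a square are joined by a horizontal and a vertical segment, which miss \<open>A\<close> for
  almost every choice of the points. Averaging over the points bounds the mean oscillation by the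
  integral of the upper gradient over the square. A ball lies in a square that lies in the ball
  of twice the radius.\<close>

lemma thin_supports_Poincare:
  assumes A: "thin A"
  shows "supports_global_1_Poincare (UNIV - A)"
proof -
  define X where "X = UNIV - A"
  have Ab: "A \<in> sets borel" using A by (simp add: thin_def)
  have A0: "A \<in> null_sets lborel" by (rule thin_null[OF A])
  have goodx: "AE z in (lborel :: plane measure). \<forall>a. (a, snd z) \<notin> A"
  proof -
    have "AE z in (lborel :: plane measure). \<forall>t. z + t *\<^sub>R (1, 0) \<notin> A" using A axis_directions(1) by (auto simp: thin_def)
    then show ?thesis
    proof eventually_elim
      case (elim z)
      show ?case
      proof
        fix a
        have "z + (a - fst z) *\<^sub>R (1, 0) = (a, snd z)" by (simp add: prod_eq_iff)
        then show "(a, snd z) \<notin> A" using elim by metis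
      qed
    qed
  qed
  have goody: "AE z in (lborel :: plane measure). \<forall>b. (fst z, b) \<notin> A"
  proof -
    have "AE z in (lborel :: plane measure). \<forall>t. z + t *\<^sub>R (0, 1) \<notin> A" using A axis_directions(2) by (auto simp: thin_def)
    then show ?thesis
    proof eventually_elim
      case (elim z)
      show ?case
      proof
        fix b
        have "z + (b - snd z) *\<^sub>R (0, 1) = (fst z, b)" by (simp add: prod_eq_iff)
        then show "(fst z, b) \<notin> A" using elim by metis
      qed
    qed
  qed
  have main: "(\<integral>\<^sup>+y. e2ennreal \<bar>u y - ereal (average B u)\<bar> \<partial>lebesgue_on B) / emeasure lebesgue B
          \<le> ennreal (64 * r) / emeasure lebesgue B' * (\<integral>\<^sup>+y. g y \<partial>lebesgue_on B')"
    if r: "0 < r" and B: "B = X \<inter> ball x r" and B': "B' = X \<inter> ball x (2 * r)"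
      and int: "integrable_ereal_on B' u" and ug: "upper_gradient B' u g"
    for x :: plane and r u g B B'
  proof -
    have Bb [measurable]: "B \<in> sets borel" "B' \<in> sets borel" using Ab by (auto simp: B B' X_def)
    have Bl: "B \<in> sets lebesgue" "B' \<in> sets lebesgue" using Bb by auto
    have BB': "B \<subseteq> B'" unfolding B B' using r by auto
    define g' where "g' = (\<lambda>z. g z * indicator B' z)"
    have [measurable]: "g' \<in> borel_measurable borel" unfolding g'_def
      by (rule borel_measurable_restrict_space_iff_ennreal[THEN iffD1]) (use Bb ug in \<open>auto simp: upper_gradient_def\<close>)
    define f where "f = (\<lambda>z. real_of_ereal (u z))"
    have areas: "emeasure lebesgue B = ennreal (pi * r\<^sup>2)" "emeasure lebesgue B' = ennreal (pi * (2 * r)\<^sup>2)"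
    proof -
      have "emeasure lebesgue (X \<inter> ball x s) = ennreal (pi * s\<^sup>2)" if "0 < s" for s
      proof -
        have "X \<inter> ball x s = ball x s - A" by (auto simp: X_def)
        then have "emeasure lebesgue (X \<inter> ball x s) = emeasure lborel (ball x s - A)" using Ab by simp
        also have "\<dots> = emeasure lborel (ball x s)" using A0 by (intro emeasure_Diff_null_set) auto
        also have "\<dots> = ennreal (pi * s\<^sup>2)" using that by (subst emeasure_ball) (auto simp: unit_ball_vol_2 power2_eq_square)
        finally show ?thesis .
      qed
      from this[of r] this[of "2 * r"] r show "emeasure lebesgue B = ennreal (pi * r\<^sup>2)" "emeasure lebesgue B' = ennreal (pi * (2 * r)\<^sup>2)"
        unfolding B B' by simp_all
    qed
    define \<beta> where "\<beta> = pi * r\<^sup>2"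
    have \<beta>: "0 < \<beta>" using r by (simp add: \<beta>_def)
    define I where "I = {fst x - r<..<fst x + r}"
    define J where "J = {snd x - r<..<snd x + r}"
    have [measurable]: "I \<in> sets borel" "J \<in> sets borel" by (simp_all add: I_def J_def)
    have lenI: "emeasure lborel I = ennreal (2 * r)" "emeasure lborel J = ennreal (2 * r)" using r by (simp_all add: I_def J_def)
    define Q where "Q = I \<times> J"
    have Qb [measurable]: "Q \<in> sets borel" unfolding Q_def by (intro borel_Times) auto
    have QB': "z \<in> B'" if "z \<in> Q" "z \<notin> A" for z
    proof -
      have d: "\<bar>fst x - fst z\<bar> < r" "\<bar>snd x - snd z\<bar> < r" using that(1) by (auto simp: Q_def I_def J_def mem_Times_iff)
      have "dist x z \<le> dist (fst x) (fst z) + dist (snd x) (snd z)"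
        unfolding dist_prod_def by (rule sqrt_sum_squares_le_sum) auto
      also have "\<dots> < 2 * r" using d by (simp add: dist_real_def)
      finally show ?thesis using that(2) by (simp add: B' X_def)
    qed
    have BQ: "z \<in> Q" if "z \<in> B" for z
    proof -
      have "dist x z < r" using that by (simp add: B)
      then have "dist (fst x) (fst z) < r" "dist (snd x) (snd z) < r"
        using dist_fst_le[of x z] dist_snd_le[of x z] by linarith+
      then show ?thesis by (auto simp: Q_def I_def J_def mem_Times_iff dist_real_def abs_less_iff)
    qed
    define P where "P b = (\<integral>\<^sup>+s\<in>I. g' (s, b) \<partial>lborel)" for b
    define R where "R a = (\<integral>\<^sup>+s\<in>J. g' (a, s) \<partial>lborel)" for a
    define G where "G = (\<integral>\<^sup>+z\<in>Q. g' z \<partial>lborel)"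
    have PR [measurable]: "P \<in> borel_measurable borel" "R \<in> borel_measurable borel" unfolding P_def R_def by measurable
    have coord: "(\<lambda>z::plane. P (snd z)) \<in> borel_measurable borel" "(\<lambda>z::plane. R (fst z)) \<in> borel_measurable borel"
      by (rule measurable_compose[OF _ PR(1)] measurable_compose[OF _ PR(2)],
          intro borel_measurable_continuous_onI continuous_intros)+
    have horizontal: "ennreal \<bar>f (a, b) - f (a', b)\<bar> \<le> P b"
      if b: "\<forall>s. (s, b) \<notin> A" "b \<in> J" and a: "a \<in> I" "a' \<in> I" for a a' b
    proof -
      have lt: "ennreal \<bar>f (a, b) - f (a', b)\<bar> \<le> P b" if a: "a \<in> I" "a' \<in> I" "a < a'" for a a'
      proof -
        have e: "(a, b) + t *\<^sub>R (1, 0) = (a + t, b)" for t by simp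
        have inI: "a + t \<in> I" if "0 \<le> t" "t \<le> a' - a" for t using a that by (auto simp: I_def)
        have "(a, b) + t *\<^sub>R (1, 0) \<in> B'" if "0 \<le> t" "t \<le> a' - a" for t
          unfolding e using inI[OF that] b by (intro QB') (auto simp: Q_def)
        from upper_gradient_on_segment[where l = "a' - a", OF ug _ _ this] a
        have "ennreal \<bar>f (a, b) - f (a', b)\<bar> \<le> (\<integral>\<^sup>+t\<in>{0..a' - a}. g' (a + t, b) \<partial>lborel)"
          by (simp add: f_def g'_def)
        also have "\<dots> \<le> (\<integral>\<^sup>+t. g' (t + a, b) * indicator I (t + a) \<partial>lborel)"
          using inI by (intro nn_integral_mono) (auto simp: indicator_def add.commute)
        also have "\<dots> = P b" unfolding P_def by (rule nn_integral_translate[of "\<lambda>t. g' (t, b) * indicator I t"]) measurable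
        finally show ?thesis .
      qed
      show ?thesis using lt[OF a] lt[OF a(2,1)] by (cases a a' rule: linorder_cases) (auto simp: abs_minus_commute)
    qed
    have vertical: "ennreal \<bar>f (a, b) - f (a, b')\<bar> \<le> R a"
      if a: "\<forall>s. (a, s) \<notin> A" "a \<in> I" and b: "b \<in> J" "b' \<in> J" for a b b'
    proof -
      have lt: "ennreal \<bar>f (a, b) - f (a, b')\<bar> \<le> R a" if b: "b \<in> J" "b' \<in> J" "b < b'" for b b'
      proof -
        have e: "(a, b) + t *\<^sub>R (0, 1) = (a, b + t)" for t by simp
        have inJ: "b + t \<in> J" if "0 \<le> t" "t \<le> b' - b" for t using b that by (auto simp: J_def)
        have "(a, b) + t *\<^sub>R (0, 1) \<in> B'" if "0 \<le> t" "t \<le> b' - b" for t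
          unfolding e using inJ[OF that] a by (intro QB') (auto simp: Q_def)
        from upper_gradient_on_segment[where l = "b' - b", OF ug _ _ this] b
        have "ennreal \<bar>f (a, b) - f (a, b')\<bar> \<le> (\<integral>\<^sup>+t\<in>{0..b' - b}. g' (a, b + t) \<partial>lborel)"
          by (simp add: f_def g'_def)
        also have "\<dots> \<le> (\<integral>\<^sup>+t. g' (a, t + b) * indicator J (t + b) \<partial>lborel)"
          using inJ by (intro nn_integral_mono) (auto simp: indicator_def add.commute)
        also have "\<dots> = R a" unfolding R_def by (rule nn_integral_translate[of "\<lambda>t. g' (a, t) * indicator J t"]) measurable
        finally show ?thesis .
      qed
      show ?thesis using lt[OF b] lt[OF b(2,1)] by (cases b b' rule: linorder_cases) (auto simp: abs_minus_commute)
    qed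
    have osc: "ennreal \<bar>f z - f z'\<bar> \<le> P (snd z) + R (fst z')"
      if z: "z \<in> Q" "z' \<in> Q" and g: "\<forall>a. (a, snd z) \<notin> A" "\<forall>b. (fst z', b) \<notin> A" for z z'
    proof -
      have m: "fst z \<in> I" "snd z \<in> J" "fst z' \<in> I" "snd z' \<in> J" using z by (auto simp: Q_def mem_Times_iff)
      have "ennreal \<bar>f z - f z'\<bar> \<le> ennreal (\<bar>f (fst z, snd z) - f (fst z', snd z)\<bar> + \<bar>f (fst z', snd z) - f (fst z', snd z')\<bar>)"
        by (intro ennreal_leI) (simp add: abs_if)
      also have "\<dots> = ennreal \<bar>f (fst z, snd z) - f (fst z', snd z)\<bar> + ennreal \<bar>f (fst z', snd z) - f (fst z', snd z')\<bar>"
        by simp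
      also have "\<dots> \<le> P (snd z) + R (fst z')"
        using m g by (intro add_mono horizontal vertical) auto
      finally show ?thesis .
    qed
    have PQm: "(\<lambda>z::plane. P (snd z) * indicator Q z) \<in> borel_measurable borel" "(\<lambda>z::plane. R (fst z) * indicator Q z) \<in> borel_measurable borel"
      by (intro borel_measurable_times_ennreal coord borel_measurable_indicator Qb)+
    note PQ_simps = PQm borel_measurable_times_ennreal borel_measurable_add borel_measurable_indicator Qb
    have prod: "(\<integral>\<^sup>+z. F z \<partial>lborel) = (\<integral>\<^sup>+a. (\<integral>\<^sup>+b. F (a, b) \<partial>lborel) \<partial>lborel)"
      if [measurable]: "F \<in> borel_measurable borel" for F :: "plane \<Rightarrow> ennreal"
      unfolding lborel_prod[symmetric] by (subst lborel.nn_integral_fst[symmetric]) (auto simp: lborel_prod)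
    have prod': "(\<integral>\<^sup>+z. F z \<partial>lborel) = (\<integral>\<^sup>+b. (\<integral>\<^sup>+a. F (a, b) \<partial>lborel) \<partial>lborel)"
      if [measurable]: "F \<in> borel_measurable borel" for F :: "plane \<Rightarrow> ennreal"
      unfolding prod[OF that] by (intro lborel_pair.Fubini'[symmetric]) (auto simp: lborel_prod)
    have GP: "(\<integral>\<^sup>+b\<in>J. P b \<partial>lborel) = G"
    proof -
      have "G = (\<integral>\<^sup>+b. (\<integral>\<^sup>+a. g' (a, b) * indicator Q (a, b) \<partial>lborel) \<partial>lborel)"
        unfolding G_def by (rule prod') measurable
      also have "\<dots> = (\<integral>\<^sup>+b. (\<integral>\<^sup>+a. g' (a, b) * indicator I a * indicator J b \<partial>lborel) \<partial>lborel)"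
        by (intro nn_integral_cong) (auto simp: Q_def indicator_def)
      also have "\<dots> = (\<integral>\<^sup>+b\<in>J. P b \<partial>lborel)"
        unfolding P_def by (intro nn_integral_cong nn_integral_multc) measurable
      finally show ?thesis by simp
    qed
    have GR: "(\<integral>\<^sup>+a\<in>I. R a \<partial>lborel) = G"
    proof -
      have "G = (\<integral>\<^sup>+a. (\<integral>\<^sup>+b. g' (a, b) * indicator Q (a, b) \<partial>lborel) \<partial>lborel)"
        unfolding G_def by (rule prod) measurable
      also have "\<dots> = (\<integral>\<^sup>+a. (\<integral>\<^sup>+b. g' (a, b) * indicator J b * indicator I a \<partial>lborel) \<partial>lborel)"
        by (intro nn_integral_cong) (auto simp: Q_def indicator_def)
      also have "\<dots> = (\<integral>\<^sup>+a\<in>I. R a \<partial>lborel)"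
        unfolding R_def by (intro nn_integral_cong nn_integral_multc) measurable
      finally show ?thesis by simp
    qed
    have QP: "(\<integral>\<^sup>+z\<in>Q. P (snd z) \<partial>lborel) = ennreal (2 * r) * G"
    proof -
      have "(\<integral>\<^sup>+z\<in>Q. P (snd z) \<partial>lborel) = (\<integral>\<^sup>+b. (\<integral>\<^sup>+a. P (snd (a, b)) * indicator Q (a, b) \<partial>lborel) \<partial>lborel)"
        by (intro prod' borel_measurable_times_ennreal coord borel_measurable_indicator Qb)
      also have "\<dots> = (\<integral>\<^sup>+b. (\<integral>\<^sup>+a. P b * indicator J b * indicator I a \<partial>lborel) \<partial>lborel)"
        by (intro nn_integral_cong) (auto simp: Q_def indicator_def)
      also have "\<dots> = (\<integral>\<^sup>+b. P b * indicator J b * ennreal (2 * r) \<partial>lborel)"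
        by (intro nn_integral_cong) (simp add: nn_integral_cmult_indicator lenI)
      also have "\<dots> = (\<integral>\<^sup>+b\<in>J. P b \<partial>lborel) * ennreal (2 * r)" by (intro nn_integral_multc) measurable
      finally show ?thesis unfolding GP by (simp add: mult.commute)
    qed
    have QR: "(\<integral>\<^sup>+z\<in>Q. R (fst z) \<partial>lborel) = ennreal (2 * r) * G"
    proof -
      have "(\<integral>\<^sup>+z\<in>Q. R (fst z) \<partial>lborel) = (\<integral>\<^sup>+a. (\<integral>\<^sup>+b. R (fst (a, b)) * indicator Q (a, b) \<partial>lborel) \<partial>lborel)"
        by (intro prod borel_measurable_times_ennreal coord borel_measurable_indicator Qb)
      also have "\<dots> = (\<integral>\<^sup>+a. (\<integral>\<^sup>+b. R a * indicator I a * indicator J b \<partial>lborel) \<partial>lborel)"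
        by (intro nn_integral_cong) (auto simp: Q_def indicator_def)
      also have "\<dots> = (\<integral>\<^sup>+a. R a * indicator I a * ennreal (2 * r) \<partial>lborel)"
        by (intro nn_integral_cong) (simp add: nn_integral_cmult_indicator lenI)
      also have "\<dots> = (\<integral>\<^sup>+a\<in>I. R a \<partial>lborel) * ennreal (2 * r)" by (intro nn_integral_multc) measurable
      finally show ?thesis unfolding GR by (simp add: mult.commute)
    qed
    have Q4: "emeasure lborel Q = ennreal (4 * r\<^sup>2)"
    proof -
      have "emeasure lborel Q = (\<integral>\<^sup>+a. (\<integral>\<^sup>+b. indicator Q (a, b) \<partial>lborel) \<partial>lborel)"
        by (subst prod[OF borel_measurable_indicator[OF Qb], symmetric]) (simp add: Qb)
      also have "\<dots> = (\<integral>\<^sup>+a. (\<integral>\<^sup>+b. indicator I a * indicator J b \<partial>lborel) \<partial>lborel)"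
        by (intro nn_integral_cong) (auto simp: Q_def indicator_def)
      also have "\<dots> = (\<integral>\<^sup>+a. ennreal (2 * r) * indicator I a \<partial>lborel)"
        by (intro nn_integral_cong) (simp add: nn_integral_cmult_indicator lenI mult.commute)
      also have "\<dots> = ennreal (2 * r) * ennreal (2 * r)" by (simp add: nn_integral_cmult_indicator lenI)
      also have "\<dots> = ennreal (4 * r\<^sup>2)" using r by (simp add: ennreal_mult[symmetric] power2_eq_square)
      finally show ?thesis .
    qed
    have um: "u \<in> borel_measurable (lebesgue_on B)"
      using int BB' unfolding integrable_ereal_on_def by (blast intro: measurable_restrict_mono)
    have ufin: "(\<integral>\<^sup>+y. e2ennreal \<bar>u y\<bar> \<partial>lebesgue_on B) < top"
    proof -
      have "(\<integral>\<^sup>+y. e2ennreal \<bar>u y\<bar> \<partial>lebesgue_on B) \<le> (\<integral>\<^sup>+y. e2ennreal \<bar>u y\<bar> \<partial>lebesgue_on B')"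
        using Bl BB' by (subst (1 2) nn_integral_restrict_space) (auto simp: indicator_def intro!: nn_integral_mono)
      then show ?thesis using int unfolding integrable_ereal_on_def by (auto intro: le_less_trans)
    qed
    have uf: "AE y in lebesgue_on B. \<bar>u y\<bar> \<noteq> \<infinity>"
    proof -
      have "AE y in lebesgue_on B. e2ennreal \<bar>u y\<bar> \<noteq> top"
        using ufin um by (intro nn_integral_PInf_AE[unfolded infinity_ennreal_def]) auto
      then show ?thesis by eventually_elim auto
    qed
    have fm: "f \<in> borel_measurable (lebesgue_on B)" unfolding f_def using um by measurable
    have fi: "integrable (lebesgue_on B) f"
    proof (rule integrableI_bounded[OF fm])
      have "(\<integral>\<^sup>+y. ennreal (norm (f y)) \<partial>lebesgue_on B) \<le> (\<integral>\<^sup>+y. e2ennreal \<bar>u y\<bar> \<partial>lebesgue_on B)"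
      proof (rule nn_integral_mono)
        fix y show "ennreal (norm (f y)) \<le> e2ennreal \<bar>u y\<bar>"
          unfolding f_def by (cases "u y") (auto simp: e2ennreal_ereal)
      qed
      then show "(\<integral>\<^sup>+y. ennreal (norm (f y)) \<partial>lebesgue_on B) < \<infinity>" using ufin by (auto intro: le_less_trans)
    qed
    have mB: "measure lebesgue B = \<beta>" using areas \<beta> by (simp add: measure_def \<beta>_def)
    have BLf: "B \<in> lmeasurable" using areas(1) Bl(1) by (simp add: fmeasurable_def)
    interpret finB: finite_measure "lebesgue_on B" by (rule finite_measure_lebesgue_on[OF BLf])
    define avg where "avg = average B u"
    have avg: "avg * \<beta> = (\<integral>y. f y \<partial>lebesgue_on B)" using \<beta> by (simp add: avg_def average_def mB f_def)
    have point: "ennreal \<bar>f y - avg\<bar> \<le> ennreal (1 / \<beta>) * (ennreal (4 * r\<^sup>2) * P (snd y) + ennreal (2 * r) * G)"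
      if y: "y \<in> B" "\<forall>a. (a, snd y) \<notin> A" for y
    proof -
      have i: "integrable (lebesgue_on B) (\<lambda>z. f y - f z)" using fi by (intro Bochner_Integration.integrable_diff) auto
      have mspace: "measure (lebesgue_on B) (space (lebesgue_on B)) = \<beta>"
        using mB Bl by (simp add: measure_restrict_space)
      have "(\<integral>z. f y - f z \<partial>lebesgue_on B) = f y * \<beta> - avg * \<beta>"
        unfolding avg using fi mspace by (subst Bochner_Integration.integral_diff) (auto simp: mult.commute)
      then have "ennreal \<bar>f y * \<beta> - avg * \<beta>\<bar> \<le> (\<integral>\<^sup>+z. ennreal \<bar>f y - f z\<bar> \<partial>lebesgue_on B)"
        using integral_norm_bound_ennreal[OF i] by simp
      also have "\<dots> = (\<integral>\<^sup>+z\<in>B. ennreal \<bar>f y - f z\<bar> \<partial>lborel)"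
        using Bl by (subst nn_integral_restrict_space) (auto simp: nn_integral_completion)
      also have "\<dots> \<le> (\<integral>\<^sup>+z. P (snd y) * indicator Q z + R (fst z) * indicator Q z \<partial>lborel)"
      proof (rule nn_integral_mono_AE)
        show "AE z in lborel. ennreal \<bar>f y - f z\<bar> * indicator B z \<le> P (snd y) * indicator Q z + R (fst z) * indicator Q z"
          using goody
        proof eventually_elim
          case (elim z)
          show ?case
          proof (cases "z \<in> B")
            case True
            then show ?thesis using osc[OF BQ[OF y(1)] BQ[OF True] y(2) elim] BQ[OF True] by simp
          qed simp
        qed
      qed
      also have "\<dots> = ennreal (4 * r\<^sup>2) * P (snd y) + ennreal (2 * r) * G"
        by (subst nn_integral_add) (simp_all add: PQ_simps nn_integral_cmult_indicator Q4 QR mult.commute[of "P (snd y)" "ennreal (4 * r\<^sup>2)"])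
      finally have le: "ennreal \<bar>f y * \<beta> - avg * \<beta>\<bar> \<le> ennreal (4 * r\<^sup>2) * P (snd y) + ennreal (2 * r) * G" .
      have "\<bar>f y - avg\<bar> = (1 / \<beta>) * \<bar>f y * \<beta> - avg * \<beta>\<bar>"
        using \<beta> by (simp add: left_diff_distrib[symmetric] abs_mult)
      then have "ennreal \<bar>f y - avg\<bar> = ennreal (1 / \<beta>) * ennreal \<bar>f y * \<beta> - avg * \<beta>\<bar>"
        using \<beta> by (simp add: ennreal_mult[symmetric])
      also have "\<dots> \<le> ennreal (1 / \<beta>) * (ennreal (4 * r\<^sup>2) * P (snd y) + ennreal (2 * r) * G)"
        using le by (rule mult_left_mono) simp
      finally show ?thesis .
    qed
    have "(\<integral>\<^sup>+y. e2ennreal \<bar>u y - ereal avg\<bar> \<partial>lebesgue_on B) = (\<integral>\<^sup>+y. ennreal \<bar>f y - avg\<bar> \<partial>lebesgue_on B)"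
    proof (rule nn_integral_cong_AE)
      show "AE y in lebesgue_on B. e2ennreal \<bar>u y - ereal avg\<bar> = ennreal \<bar>f y - avg\<bar>"
        using uf
      proof eventually_elim
        case (elim y)
        then obtain a where "u y = ereal a" by auto
        then show ?case by (simp add: f_def e2ennreal_ereal)
      qed
    qed
    also have "\<dots> = (\<integral>\<^sup>+y\<in>B. ennreal \<bar>f y - avg\<bar> \<partial>lborel)"
      using Bl by (subst nn_integral_restrict_space) (auto simp: nn_integral_completion)
    also have "\<dots> \<le> (\<integral>\<^sup>+y. ennreal (1 / \<beta>) * (ennreal (4 * r\<^sup>2) * (P (snd y) * indicator Q y) + ennreal (2 * r) * G * indicator Q y) \<partial>lborel)"
    proof (rule nn_integral_mono_AE)
      show "AE y in lborel. ennreal \<bar>f y - avg\<bar> * indicator B y \<le> ennreal (1 / \<beta>) * (ennreal (4 * r\<^sup>2) * (P (snd y) * indicator Q y) + ennreal (2 * r) * G * indicator Q y)"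
        using goodx
      proof eventually_elim
        case (elim y)
        show ?case
        proof (cases "y \<in> B")
          case True
          then show ?thesis using point[OF True elim] BQ[OF True] by simp
        qed simp
      qed
    qed
    also have "\<dots> = ennreal (1 / \<beta>) * (ennreal (4 * r\<^sup>2) * (ennreal (2 * r) * G) + ennreal (2 * r) * G * ennreal (4 * r\<^sup>2))"
    proof -
      have "(\<integral>\<^sup>+y. ennreal (1 / \<beta>) * (ennreal (4 * r\<^sup>2) * (P (snd y) * indicator Q y) + ennreal (2 * r) * G * indicator Q y) \<partial>lborel)
         = ennreal (1 / \<beta>) * (\<integral>\<^sup>+y. ennreal (4 * r\<^sup>2) * (P (snd y) * indicator Q y) + ennreal (2 * r) * G * indicator Q y \<partial>lborel)"
        by (intro nn_integral_cmult; simp add: PQ_simps)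
      also have "(\<integral>\<^sup>+y. ennreal (4 * r\<^sup>2) * (P (snd y) * indicator Q y) + ennreal (2 * r) * G * indicator Q y \<partial>lborel)
         = (\<integral>\<^sup>+y. ennreal (4 * r\<^sup>2) * (P (snd y) * indicator Q y) \<partial>lborel) + (\<integral>\<^sup>+y. ennreal (2 * r) * G * indicator Q y \<partial>lborel)"
        by (intro nn_integral_add; simp add: PQ_simps)
      also have "(\<integral>\<^sup>+y. ennreal (4 * r\<^sup>2) * (P (snd y) * indicator Q y) \<partial>lborel) = ennreal (4 * r\<^sup>2) * (ennreal (2 * r) * G)"
        unfolding QP[symmetric] by (intro nn_integral_cmult; simp add: PQ_simps)
      also have "(\<integral>\<^sup>+y. ennreal (2 * r) * G * indicator Q y \<partial>lborel) = ennreal (2 * r) * G * ennreal (4 * r\<^sup>2)"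
        by (simp add: nn_integral_cmult_indicator Q4)
      finally show ?thesis .
    qed
    finally have fin: "(\<integral>\<^sup>+y. e2ennreal \<bar>u y - ereal avg\<bar> \<partial>lebesgue_on B)
       \<le> ennreal (1 / \<beta>) * (ennreal (4 * r\<^sup>2) * (ennreal (2 * r) * G) + ennreal (2 * r) * G * ennreal (4 * r\<^sup>2))" .
    have GG: "G \<le> (\<integral>\<^sup>+y. g y \<partial>lebesgue_on B')"
    proof -
      have "G \<le> (\<integral>\<^sup>+z. g' z \<partial>lborel)" unfolding G_def by (intro nn_integral_mono) (auto simp: indicator_def)
      also have "\<dots> = (\<integral>\<^sup>+y. g y \<partial>lebesgue_on B')"
        using Bl by (subst nn_integral_restrict_space) (auto simp: nn_integral_completion g'_def)
      finally show ?thesis .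
    qed
    have \<beta>': "emeasure lebesgue B' = ennreal (4 * \<beta>)" unfolding areas(2) \<beta>_def by (simp add: power_mult_distrib mult.left_commute)
    have const: "ennreal (1 / \<beta>) * (ennreal (4 * r\<^sup>2) * (ennreal (2 * r) * G) + ennreal (2 * r) * G * ennreal (4 * r\<^sup>2)) / ennreal \<beta>
        \<le> ennreal (64 * r) / ennreal (4 * \<beta>) * G"
    proof (cases G rule: ennreal_cases)
      case (real \<gamma>)
      have "ennreal (1 / \<beta>) * (ennreal (4 * r\<^sup>2) * (ennreal (2 * r) * G) + ennreal (2 * r) * G * ennreal (4 * r\<^sup>2)) / ennreal \<beta>
         = ennreal ((1 / \<beta>) * (4 * r\<^sup>2 * (2 * r * \<gamma>) + 2 * r * \<gamma> * (4 * r\<^sup>2)) / \<beta>)"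
        unfolding real(2) using real(1) r \<beta> by (simp add: ennreal_mult[symmetric] divide_ennreal flip: ennreal_plus)
      also have "\<dots> \<le> ennreal (64 * r / (4 * \<beta>) * \<gamma>)"
      proof (rule ennreal_leI)
        have "r\<^sup>2 \<le> \<beta>" using pi_ge_two mult_right_mono[of 1 pi "r\<^sup>2"] by (simp add: \<beta>_def)
        have "(1 / \<beta>) * (4 * r\<^sup>2 * (2 * r * \<gamma>) + 2 * r * \<gamma> * (4 * r\<^sup>2)) / \<beta> = (16 * r * \<gamma> / (\<beta> * \<beta>)) * r\<^sup>2"
          using \<beta> by (simp add: field_simps)
        also have "\<dots> \<le> (16 * r * \<gamma> / (\<beta> * \<beta>)) * \<beta>"
          using \<open>r\<^sup>2 \<le> \<beta>\<close> r real(1) \<beta> by (intro mult_left_mono) auto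
        also have "\<dots> = 64 * r / (4 * \<beta>) * \<gamma>" using \<beta> by (simp add: field_simps)
        finally show "(1 / \<beta>) * (4 * r\<^sup>2 * (2 * r * \<gamma>) + 2 * r * \<gamma> * (4 * r\<^sup>2)) / \<beta> \<le> 64 * r / (4 * \<beta>) * \<gamma>" .
      qed
      also have "\<dots> = ennreal (64 * r) / ennreal (4 * \<beta>) * G"
        unfolding real(2) using real(1) r \<beta> by (simp add: ennreal_mult[symmetric] divide_ennreal)
      finally show ?thesis .
    next
      case top
      have "ennreal (64 * r) / ennreal (4 * \<beta>) * G = top"
        unfolding top using r \<beta> by (simp add: divide_ennreal ennreal_mult_top)
      then show ?thesis by simp
    qed
    have "(\<integral>\<^sup>+y. e2ennreal \<bar>u y - ereal (average B u)\<bar> \<partial>lebesgue_on B) / emeasure lebesgue B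
        \<le> ennreal (1 / \<beta>) * (ennreal (4 * r\<^sup>2) * (ennreal (2 * r) * G) + ennreal (2 * r) * G * ennreal (4 * r\<^sup>2)) / ennreal \<beta>"
      unfolding areas(1) \<beta>_def[symmetric] avg_def[symmetric] using fin by (rule divide_right_mono_ennreal)
    also have "\<dots> \<le> ennreal (64 * r) / ennreal (4 * \<beta>) * G" by (rule const)
    also have "\<dots> \<le> ennreal (64 * r) / emeasure lebesgue B' * (\<integral>\<^sup>+y. g y \<partial>lebesgue_on B')"
      unfolding \<beta>' using GG by (rule mult_left_mono) simp
    finally show ?thesis .
  qed
  show ?thesis
    unfolding supports_global_1_Poincare_def Let_def X_def[symmetric]
    by (rule exI[of _ 64], rule conjI, simp, rule exI[of _ 2]) (auto intro!: main)
qed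

section \<open>Lines on which the removed set is dense\<close>

text \<open>The functional \<open>x + 2 * y\<close> maps the four squares of the first stage onto intervals that tile
  \<open>[0, 3]\<close>, and so it maps the Cantor set onto \<open>[0, 3]\<close>.\<close>

lemma cantor_stage_projection:
  "0 \<le> t \<Longrightarrow> t \<le> 3 \<Longrightarrow> \<exists>x\<in>cantor_stage k. \<exists>y\<in>cantor_stage k. x + 2 * y = t"
proof (induction k arbitrary: t)
  case 0
  then show ?case by (intro bexI[of _ "t / 3"]) (auto simp: cantor_stage_0)
next
  case (Suc k)
  have "\<exists>a\<in>{0, 3}. \<exists>b\<in>{0, 3}. 0 \<le> 4 * t - a - 2 * b \<and> 4 * t - a - 2 * b \<le> (3::real)"
  proof -
    have "4 * t \<le> 3 \<or> (3 \<le> 4 * t \<and> 4 * t \<le> 6) \<or> (6 \<le> 4 * t \<and> 4 * t \<le> 9) \<or> 9 \<le> 4 * t" by linarith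
    then show ?thesis using Suc.prems by auto
  qed
  then obtain a b :: real where ab: "a \<in> {0, 3}" "b \<in> {0, 3}" "0 \<le> 4 * t - a - 2 * b" "4 * t - a - 2 * b \<le> 3" by blast
  from Suc.IH[OF ab(3,4)] obtain x y where xy: "x \<in> cantor_stage k" "y \<in> cantor_stage k" "x + 2 * y = 4 * t - a - 2 * b" by blast
  have digit: "(x + a) / 4 \<in> cantor_stage (Suc k)" if "x \<in> cantor_stage k" "a \<in> {0, 3}" for x a
  proof -
    have "4 * ((x + a) / 4) = x + a" by simp
    then have "(x + a) / 4 \<in> cantor_stage (Suc k) \<longleftrightarrow> x + a \<in> cantor_stage k \<or> x + a - 3 \<in> cantor_stage k"
      by (simp only: cantor_stage_Suc)
    then show ?thesis using that by auto
  qed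
  show ?case
    using digit[OF xy(1) ab(1)] digit[OF xy(2) ab(2)] xy(3)
    by (intro bexI[of _ "(x + a) / 4"] bexI[of _ "(y + b) / 4"]) (auto simp: field_simps)
qed

text \<open>The points of the stages with a given image form decreasing nonempty compact sets.\<close>

lemma four_corners_projection:
  assumes "0 \<le> t" "t \<le> 3"
  shows "\<exists>x y. (x, y) \<in> four_corners_cantor_set \<and> x + 2 * y = t"
proof -
  define F where "F k = (cantor_stage k \<times> cantor_stage k) \<inter> {z. fst z + 2 * snd z = t}" for k
  have "compact (F k)" for k unfolding F_def
    by (intro compact_Int_closed compact_Times compact_cantor_stage closed_Collect_eq continuous_intros)
  moreover have "F k \<noteq> {}" for k
    using cantor_stage_projection[OF assms, of k] by (auto simp: F_def)
  moreover have "F n \<subseteq> F m" if "m \<le> n" for m n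
  proof -
    have "cantor_stage n \<subseteq> cantor_stage m"
      by (rule lift_Suc_antimono_le[where f=cantor_stage, OF cantor_stage_decreasing that])
    then show ?thesis by (auto simp: F_def)
  qed
  ultimately have "\<Inter>(range F) \<noteq> {}" by (rule compact_nest)
  then obtain z where z: "\<And>k. z \<in> F k" by blast
  have zk: "fst z \<in> cantor_stage k \<and> snd z \<in> cantor_stage k \<and> fst z + 2 * snd z = t" for k
    using z[of k] unfolding F_def Int_iff mem_Times_iff mem_Collect_eq by blast
  have "(fst z, snd z) \<in> cantor_half \<times> cantor_half"
    by (rule SigmaI) (use zk in blast)+
  then have "(fst z, snd z) \<in> four_corners_cantor_set" unfolding four_corners_eq .
  then show ?thesis using zk by blast
qed

text \<open>The corner of size \<open>s\<close> of the Cantor set projects onto an interval of length \<open>3 * s\<close>. A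
  rational translation puts the projection of the point \<open>z\<close> into this interval with the corner
  close to \<open>z\<close>, so the line through \<open>z\<close> meets the corner near \<open>z\<close>.\<close>

lemma removed_set_dense_on_line:
  fixes q :: "nat \<Rightarrow> plane" and z :: plane
  assumes q: "bij_betw q {1..} (\<rat> \<times> \<rat>)" and \<eta>: "0 < \<eta>"
  shows "\<exists>t. \<bar>t\<bar> < \<eta> \<and> z + t *\<^sub>R (2 / sqrt 5, - 1 / sqrt 5) \<in> (\<Union>j\<in>{1..}. (\<lambda>x. q j + x) ` four_corners_cantor_set)"
proof -
  obtain k where k: "16 / \<eta> < 4 ^ k" using real_arch_pow[of 4 "16 / \<eta>"] by auto
  define s :: real where "s = 1 / 4 ^ k"
  have s: "0 < s" by (simp add: s_def)
  have s\<eta>: "16 * s < \<eta>" using k \<eta> by (simp add: s_def divide_less_eq mult.commute pos_divide_less_eq)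
  have approx: "\<exists>a\<in>\<rat>. \<bar>a - c\<bar> < s / 8" for c :: real
  proof -
    obtain a where "a \<in> \<rat>" "c - s / 8 < a" "a < c + s / 8" using Rats_dense_in_real[of "c - s / 8" "c + s / 8"] s by auto
    then have "\<bar>a - c\<bar> < s / 8" unfolding abs_less_iff by linarith
    then show ?thesis using \<open>a \<in> \<rat>\<close> by blast
  qed
  (* The centre of the square of side s at (a, b) is close to z, so the projection of z is close
     to the centre of the projection of the square. *)
  obtain a where a: "a \<in> \<rat>" "\<bar>a - (fst z - s / 2)\<bar> < s / 8" using approx by blast
  obtain b where b: "b \<in> \<rat>" "\<bar>b - (snd z - s / 2)\<bar> < s / 8" using approx by blast
  have "(a, b) \<in> q ` {1..}" unfolding bij_betw_imp_surj_on[OF q] using a(1) b(1) by blast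
  then obtain j where j: "j \<in> {1..}" "q j = (a, b)" by (metis imageE)
  define t where "t = ((fst z - a) + 2 * (snd z - b)) / s"
  have "0 \<le> t" "t \<le> 3"
  proof -
    have *: "a - (fst z - s / 2) < s / 8" "- (a - (fst z - s / 2)) < s / 8"
      "b - (snd z - s / 2) < s / 8" "- (b - (snd z - s / 2)) < s / 8"
      using a(2) b(2) unfolding abs_less_iff by blast+
    have "0 \<le> (fst z - a) + 2 * (snd z - b)" using * s by argo
    moreover have "(fst z - a) + 2 * (snd z - b) \<le> 3 * s" using * s by argo
    ultimately show "0 \<le> t" "t \<le> 3" using s by (simp_all add: t_def divide_le_eq)
  qed
  then obtain x y where xy: "(x, y) \<in> four_corners_cantor_set" "x + 2 * y = t" using four_corners_projection by blast
  have C: "(s * x, s * y) \<in> four_corners_cantor_set" using four_corners_scale_corner[OF xy(1), of k] by (simp add: s_def)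
  have xy01: "0 \<le> x" "x \<le> 1" "0 \<le> y" "y \<le> 1"
  proof -
    have "x \<in> cantor_stage 0" "y \<in> cantor_stage 0" using xy(1) unfolding four_corners_eq by blast+
    then show "0 \<le> x" "x \<le> 1" "0 \<le> y" "y \<le> 1" by (simp_all add: cantor_stage_0)
  qed
  have sx: "0 \<le> s * x" "s * x \<le> s" "0 \<le> s * y" "s * y \<le> s" using xy01 s by (simp_all add: mult_left_le)
  define \<beta> where "\<beta> = b + s * y - snd z"
  have st: "s * (x + 2 * y) = (fst z - a) + 2 * (snd z - b)" using s unfolding xy(2) t_def by simp
  then have \<alpha>: "a + s * x - fst z = - 2 * \<beta>" by (simp add: \<beta>_def algebra_simps)
  have "\<bar>\<beta>\<bar> \<le> 2 * s" using b(2) sx(3,4) unfolding \<beta>_def by linarith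
  have sq: "sqrt 5 * sqrt 5 = (5::real)" "0 < sqrt (5::real)" "sqrt 5 \<le> (3::real)" by (auto intro: real_le_lsqrt)
  define \<tau> where "\<tau> = - \<beta> * sqrt 5"
  have "\<bar>\<tau>\<bar> = \<bar>\<beta>\<bar> * sqrt 5" by (simp add: \<tau>_def abs_mult)
  also have "\<dots> \<le> 2 * s * 3" using \<open>\<bar>\<beta>\<bar> \<le> 2 * s\<close> sq by (intro mult_mono) auto
  finally have "\<bar>\<tau>\<bar> < \<eta>" using s\<eta> s by linarith
  moreover have "z + \<tau> *\<^sub>R (2 / sqrt 5, - 1 / sqrt 5) = q j + (s * x, s * y)"
  proof -
    have "\<tau> * (2 / sqrt 5) = - 2 * \<beta>" "\<tau> * (- 1 / sqrt 5) = \<beta>"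
      using sq(2) by (simp_all add: \<tau>_def)
    moreover define t1 t2 where "t1 = \<tau> * (2 / sqrt 5)" and "t2 = \<tau> * (- 1 / sqrt 5)"
    ultimately have t12: "t1 = - 2 * \<beta>" "t2 = \<beta>" by simp_all
    have "fst z + t1 = a + s * x" using \<alpha> unfolding t12 by argo
    moreover have "snd z + t2 = b + s * y" unfolding t12 \<beta>_def by argo
    moreover have "\<tau> *\<^sub>R (2 / sqrt 5, - 1 / sqrt 5) = (t1, t2)" unfolding t1_def t2_def by (simp only: scaleR_Pair real_scaleR_def)
    moreover have "z = (fst z, snd z)" by (simp only: prod.collapse)
    ultimately show ?thesis unfolding j(2) by (metis add_Pair)
  qed
  moreover have "q j + (s * x, s * y) \<in> (\<Union>j\<in>{1..}. (\<lambda>x. q j + x) ` four_corners_cantor_set)"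
    by (rule UN_I[OF j(1)], rule imageI, rule C)
  ultimately have "\<bar>\<tau>\<bar> < \<eta> \<and> z + \<tau> *\<^sub>R (2 / sqrt 5, - 1 / sqrt 5) \<in> (\<Union>j\<in>{1..}. (\<lambda>x. q j + x) ` four_corners_cantor_set)"
    by (simp only: simp_thms)
  then show ?thesis by (rule exI)
qed

text \<open>On almost every segment in direction \<open>v\<close> the set \<open>A\<close> is dense and has measure zero. Its complement
  has no interior there, and it has full measure.\<close>

lemma not_path_almost_open_of_dense_on_lines:
  fixes v :: plane
  assumes p: "1 \<le> p" and A: "A \<in> null_sets lborel" and V: "open V" "V \<noteq> {}" and v: "norm v = 1"
    and dense: "\<And>z \<eta>. 0 < \<eta> \<Longrightarrow> \<exists>t. \<bar>t\<bar> < \<eta> \<and> z + t *\<^sub>R v \<in> A"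
  shows "\<not> path_almost_open p UNIV (V - A)"
proof
  assume "path_almost_open p UNIV (V - A)"
  then have "\<exists>\<rho>\<in>borel_measurable (restrict_space borel UNIV).
     (\<integral>\<^sup>+x. ennreal_powr (\<rho> x) p \<partial>lebesgue_on UNIV) < top \<and>
     (\<forall>(l, \<gamma>)\<in>curves UNIV. curve_integral l \<gamma> \<rho> < top \<longrightarrow>
        (\<exists>G N. openin (top_of_set {0..l}) G \<and> N \<in> null_sets lebesgue \<and> {t \<in> {0..l}. \<gamma> t \<in> V - A} = G \<union> N))"
    unfolding path_almost_open_def almost_every_curve_iff[OF p] .
  then obtain \<rho> where \<rho>1: "\<rho> \<in> borel_measurable (restrict_space borel UNIV)"
    and \<rho>2: "(\<integral>\<^sup>+x. ennreal_powr (\<rho> x) p \<partial>lebesgue_on UNIV) < top"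
    and \<rho>3: "\<forall>(l, \<gamma>)\<in>curves UNIV. curve_integral l \<gamma> \<rho> < top \<longrightarrow>
        (\<exists>G N. openin (top_of_set {0..l}) G \<and> N \<in> null_sets lebesgue \<and> {t \<in> {0..l}. \<gamma> t \<in> V - A} = G \<union> N)"
    by (elim bexE conjE)
  have [measurable]: "\<rho> \<in> borel_measurable borel" 
    using borel_measurable_restrict_space_iff_ennreal[THEN iffD1, OF _ \<rho>1] by simp
  have ioc: "integrable_on_compacts UNIV \<rho>"
    using \<rho>2 by (intro integrable_on_compacts_of_energy[OF p]) (auto simp: lebesgue_on_UNIV_eq nn_integral_completion)
  obtain z0 r where r: "0 < r" "ball z0 r \<subseteq> V" using V openE by blast
  define \<delta> where "\<delta> = r / 2"
  have \<delta>: "0 < \<delta>" using r by (simp add: \<delta>_def)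
  have "\<exists>z\<in>ball z0 \<delta>. (\<integral>\<^sup>+s\<in>{0..\<delta>}. \<rho> (z + s *\<^sub>R v) \<partial>lborel) < top \<and> (AE s in lborel. z + s *\<^sub>R v \<notin> A)"
  proof (rule ccontr)
    assume n: "\<not> ?thesis"
    have "AE z in lborel. z \<notin> ball z0 \<delta>"
      using AE_segment_integral_finite[OF ioc v \<delta>] AE_segment_avoids_null[OF A, of v]
      by eventually_elim (use n in blast)
    then have "ball z0 \<delta> \<in> null_sets lborel" by (subst AE_iff_null_sets) auto
    then have "negligible (ball z0 \<delta>)" by (simp add: negligible_iff_null_sets null_sets_completionI)
    then show False using open_not_negligible[of "ball z0 \<delta>"] \<delta> by simp
  qed
  then obtain z where z: "z \<in> ball z0 \<delta>" "(\<integral>\<^sup>+s\<in>{0..\<delta>}. \<rho> (z + s *\<^sub>R v) \<partial>lborel) < top" "AE s in lborel. z + s *\<^sub>R v \<notin> A" by blast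
  define \<gamma> where "\<gamma> = (\<lambda>t. z + t *\<^sub>R v)"
  have inV: "\<gamma> t \<in> V" if "t \<in> {0..\<delta>}" for t
  proof -
    have "dist z0 (\<gamma> t) \<le> dist z0 z + dist z (\<gamma> t)" by (rule dist_triangle)
    also have "dist z (\<gamma> t) = \<bar>t\<bar>" using v by (simp add: \<gamma>_def dist_norm)
    finally have "dist z0 (\<gamma> t) < r" using z(1) that by (simp add: \<delta>_def)
    then show ?thesis using r(2) by auto
  qed
  have c: "(\<delta>, \<gamma>) \<in> curves UNIV" unfolding \<gamma>_def by (rule segment_curve[OF v \<delta>]) simp
  have "curve_integral \<delta> \<gamma> \<rho> < top"
    using z(2) unfolding curve_integral_eq nn_integral_completion \<gamma>_def .
  then have "\<exists>G N. openin (top_of_set {0..\<delta>}) G \<and> N \<in> null_sets lebesgue \<and> {t \<in> {0..\<delta>}. \<gamma> t \<in> V - A} = G \<union> N"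
    using bspec[OF \<rho>3 c] by (simp only: prod.case simp_thms)
  then obtain G N where G: "openin (top_of_set {0..\<delta>}) G" and N: "N \<in> null_sets lebesgue"
    and GN: "{t \<in> {0..\<delta>}. \<gamma> t \<in> V - A} = G \<union> N" by (elim exE conjE)
  have "G \<noteq> {}"
  proof
    assume "G = {}"
    then have "{t \<in> {0..\<delta>}. \<gamma> t \<in> V - A} \<in> null_sets lebesgue" using GN N by simp
    then have "AE t in lebesgue. t \<notin> {t \<in> {0..\<delta>}. \<gamma> t \<in> V - A}" by (rule AE_not_in)
    moreover have "AE t in lebesgue. \<gamma> t \<notin> A" unfolding AE_completion_iff \<gamma>_def by (rule z(3))
    ultimately have "AE t in lebesgue. t \<notin> {0..\<delta>}" by eventually_elim (use inV in auto)
    then have "{0..\<delta>} \<in> null_sets lebesgue" by (subst AE_iff_null_sets) auto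
    then show False using \<delta> by (simp add: null_sets_def)
  qed
  then obtain t0 where t0: "t0 \<in> G" by blast
  obtain T where T: "open T" "G = {0..\<delta>} \<inter> T" using G unfolding openin_open by blast
  have t0\<delta>: "0 \<le> t0" "t0 \<le> \<delta>" "t0 \<in> T" using t0 T by auto
  obtain \<epsilon> where \<epsilon>: "0 < \<epsilon>" "ball t0 \<epsilon> \<subseteq> T" using T(1) t0\<delta>(3) openE by blast
  define lo where "lo = max 0 (t0 - \<epsilon> / 2)"
  define hi where "hi = min \<delta> (t0 + \<epsilon> / 2)"
  have lohi: "lo < hi" using \<epsilon> \<delta> t0\<delta> unfolding lo_def hi_def by auto
  have sub: "t \<in> G" if "lo \<le> t" "t \<le> hi" for t
  proof -
    have "t \<in> ball t0 \<epsilon>" using that \<epsilon>(1) unfolding lo_def hi_def by (auto simp: dist_real_def)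
    moreover have "t \<in> {0..\<delta>}" using that unfolding lo_def hi_def by auto
    ultimately show ?thesis using T(2) \<epsilon>(2) by blast
  qed
  define mid where "mid = (lo + hi) / 2"
  have "0 < (hi - lo) / 2" using lohi by simp
  from dense[OF this, of "\<gamma> mid"] obtain t where t: "\<bar>t\<bar> < (hi - lo) / 2" "\<gamma> mid + t *\<^sub>R v \<in> A" by blast
  have "\<gamma> (mid + t) \<in> A" using t(2) by (simp add: \<gamma>_def algebra_simps)
  moreover have "lo \<le> mid + t" "mid + t \<le> hi" using t(1) unfolding mid_def by (simp_all add: abs_if field_simps split: if_splits)
  then have "mid + t \<in> G" by (rule sub)
  then have "\<gamma> (mid + t) \<notin> A" using GN by blast
  ultimately show False by blast
qed

section \<open>Newtonian functions on the two domains\<close>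

lemma curves_mono: "Z \<subseteq> Y \<Longrightarrow> curves Z \<subseteq> curves Y"
  unfolding curves_def by blast

lemma curve_endpoints: "(l, \<gamma>) \<in> curves Z \<Longrightarrow> \<gamma> 0 \<in> Z \<and> \<gamma> l \<in> Z"
  unfolding curves_def by (auto simp: image_subset_iff)

lemma upper_gradient_ineq_cong:
  assumes "(l, \<gamma>) \<in> curves Z" "\<And>x. x \<in> Z \<Longrightarrow> v x = w x"
  shows "upper_gradient_ineq v g l \<gamma> \<longleftrightarrow> upper_gradient_ineq w g l \<gamma>"
  using curve_endpoints[OF assms(1)] assms(2) by (simp add: upper_gradient_ineq_def)

lemma upper_gradient_ineq_mono:
  "upper_gradient_ineq v g l \<gamma> \<Longrightarrow> curve_integral l \<gamma> g \<le> curve_integral l \<gamma> h \<Longrightarrow> upper_gradient_ineq v h l \<gamma>"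
  unfolding upper_gradient_ineq_def by (rule order_trans)

lemma upper_gradient_imp_weak:
  assumes "1 \<le> p" "upper_gradient Z u g"
  shows "weak_upper_gradient p Z u g"
proof -
  have "almost_every_curve p Z (upper_gradient_ineq u g)"
    unfolding almost_every_curve_iff[OF assms(1)]
    using assms(2) by (intro bexI[of _ "\<lambda>_. 0"]) (auto simp: upper_gradient_def)
  then show ?thesis using assms(2) by (simp add: weak_upper_gradient_def upper_gradient_def borel_on_imp_lebesgue_on)
qed

lemma energy_mono_set:
  assumes "Z \<subseteq> Y" "Z \<in> sets lebesgue" "Y \<in> sets lebesgue"
  shows "(\<integral>\<^sup>+x. f x \<partial>lebesgue_on Z) \<le> (\<integral>\<^sup>+x. f x \<partial>lebesgue_on Y)"
  using assms by (subst (1 2) nn_integral_restrict_space) (auto simp: indicator_def intro!: nn_integral_mono)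

lemma energy_lebesgue_on:
  assumes "Z \<in> sets lebesgue"
  shows "(\<integral>\<^sup>+x. f x \<partial>lebesgue_on Z) = (\<integral>\<^sup>+x. f x * indicator Z x \<partial>lborel)"
  using assms by (subst nn_integral_restrict_space) (auto simp: nn_integral_completion)

lemma weak_upper_gradient_restrict:
  assumes p: "1 \<le> p" and ZY: "Z \<subseteq> Y" "Z \<in> sets lebesgue" "Y \<in> sets lebesgue"
    and w: "weak_upper_gradient p Y v m" and eq: "\<And>x. x \<in> Z \<Longrightarrow> w x = v x"
  shows "weak_upper_gradient p Z w m"
proof -
  obtain \<rho> where \<rho>: "\<rho> \<in> borel_measurable (restrict_space borel Y)"
     "(\<integral>\<^sup>+x. ennreal_powr (\<rho> x) p \<partial>lebesgue_on Y) < top"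
     "\<And>l \<gamma>. (l, \<gamma>) \<in> curves Y \<Longrightarrow> curve_integral l \<gamma> \<rho> < top \<Longrightarrow> upper_gradient_ineq v m l \<gamma>"
    using w unfolding weak_upper_gradient_def almost_every_curve_iff[OF p] by blast
  have "almost_every_curve p Z (upper_gradient_ineq w m)"
    unfolding almost_every_curve_iff[OF p]
  proof (intro bexI[of _ \<rho>] conjI)
    show "(\<integral>\<^sup>+x. ennreal_powr (\<rho> x) p \<partial>lebesgue_on Z) < top"
      using energy_mono_set[OF ZY] \<rho>(2) by (rule le_less_trans)
    show "\<forall>(l, \<gamma>)\<in>curves Z. curve_integral l \<gamma> \<rho> < top \<longrightarrow> upper_gradient_ineq w m l \<gamma>"
    proof clarify
      fix l \<gamma> assume c: "(l, \<gamma>) \<in> curves Z" and f: "curve_integral l \<gamma> \<rho> < top"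
      have "upper_gradient_ineq v m l \<gamma>" using c curves_mono[OF ZY(1)] by (intro \<rho>(3) f) blast
      moreover have "upper_gradient_ineq w m l \<gamma> \<longleftrightarrow> upper_gradient_ineq v m l \<gamma>"
        by (rule upper_gradient_ineq_cong[OF c]) (rule eq)
      ultimately show "upper_gradient_ineq w m l \<gamma>" by blast
    qed
    show "\<rho> \<in> borel_measurable (restrict_space borel Z)" by (rule measurable_restrict_mono[OF \<rho>(1) ZY(1)])
  qed
  moreover have "m \<in> borel_measurable (lebesgue_on Z)"
    using w ZY(1) unfolding weak_upper_gradient_def by (blast intro: measurable_restrict_mono)
  ultimately show ?thesis by (simp add: weak_upper_gradient_def)
qed

lemma newtonian_upper_gradient:
  assumes "w \<in> newtonian p Z"
  shows "\<exists>g. upper_gradient Z w g \<and> (\<integral>\<^sup>+x. ennreal_powr (g x) p \<partial>lebesgue_on Z) < top"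
proof -
  have "(INF g \<in> {g. upper_gradient Z w g}. \<integral>\<^sup>+x. ennreal_powr (g x) p \<partial>lebesgue_on Z) < top"
    using assms by (auto simp: newtonian_def)
  then show ?thesis unfolding INF_less_iff by blast
qed

lemma newtonian_restrict:
  assumes ZY: "Z \<subseteq> Y" "Z \<in> sets lebesgue" "Y \<in> sets lebesgue" and v: "v \<in> newtonian p Y"
  shows "restrict v Z \<in> newtonian p Z"
proof -
  obtain g where g: "upper_gradient Y v g" "(\<integral>\<^sup>+x. ennreal_powr (g x) p \<partial>lebesgue_on Y) < top"
    using newtonian_upper_gradient[OF v] by blast
  have "v \<in> borel_measurable (lebesgue_on Z)"
    using v ZY(1) unfolding newtonian_def by (blast intro: measurable_restrict_mono)
  then have m: "restrict v Z \<in> borel_measurable (lebesgue_on Z)"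
    by (subst measurable_cong[of _ _ v]) auto
  have "(\<integral>\<^sup>+x. ennreal_powr (e2ennreal \<bar>restrict v Z x\<bar>) p \<partial>lebesgue_on Z) = (\<integral>\<^sup>+x. ennreal_powr (e2ennreal \<bar>v x\<bar>) p \<partial>lebesgue_on Z)"
    by (intro nn_integral_cong) simp
  also have "\<dots> \<le> (\<integral>\<^sup>+x. ennreal_powr (e2ennreal \<bar>v x\<bar>) p \<partial>lebesgue_on Y)" by (rule energy_mono_set[OF ZY])
  also have "\<dots> < top" using v by (auto simp: newtonian_def)
  finally have e: "(\<integral>\<^sup>+x. ennreal_powr (e2ennreal \<bar>restrict v Z x\<bar>) p \<partial>lebesgue_on Z) < top" .
  have "upper_gradient Z (restrict v Z) g"
    unfolding upper_gradient_def
  proof (intro conjI)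
    show "g \<in> borel_measurable (restrict_space borel Z)"
      using g(1) ZY(1) unfolding upper_gradient_def by (blast intro: measurable_restrict_mono)
    show "\<forall>(l, \<gamma>)\<in>curves Z. upper_gradient_ineq (restrict v Z) g l \<gamma>"
    proof clarify
      fix l \<gamma> assume c: "(l, \<gamma>) \<in> curves Z"
      have "upper_gradient_ineq v g l \<gamma>" using g(1) c curves_mono[OF ZY(1)] unfolding upper_gradient_def by blast
      then show "upper_gradient_ineq (restrict v Z) g l \<gamma>"
        using upper_gradient_ineq_cong[OF c, of "restrict v Z" v g] by simp
    qed
  qed
  then have "(INF g \<in> {g. upper_gradient Z (restrict v Z) g}. \<integral>\<^sup>+x. ennreal_powr (g x) p \<partial>lebesgue_on Z) \<le> (\<integral>\<^sup>+x. ennreal_powr (g x) p \<partial>lebesgue_on Z)"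
    by (intro INF_lower) simp
  also have "\<dots> \<le> (\<integral>\<^sup>+x. ennreal_powr (g x) p \<partial>lebesgue_on Y)" by (rule energy_mono_set[OF ZY])
  also have "\<dots> < top" by (rule g(2))
  finally show ?thesis using m e unfolding newtonian_def by simp
qed

text \<open>Adding a function of finite energy whose integral is infinite along the exceptional curves
  turns a weak upper gradient into an upper gradient.\<close>

lemma newtonian_of_weak_upper_gradient:
  fixes w :: "plane \<Rightarrow> ereal" and m :: "plane \<Rightarrow> ennreal"
  assumes p: "1 \<le> p" and w: "w \<in> borel_measurable borel" "(\<integral>\<^sup>+x. ennreal_powr (e2ennreal \<bar>w x\<bar>) p \<partial>lebesgue_on Z) < top"
    and m: "m \<in> borel_measurable borel" "(\<integral>\<^sup>+x. ennreal_powr (m x) p \<partial>lebesgue_on Z) < top"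
    and wk: "weak_upper_gradient p Z w m"
  shows "restrict w Z \<in> newtonian p Z"
proof -
  obtain \<rho> where \<rho>: "\<rho> \<in> borel_measurable (restrict_space borel Z)"
     "(\<integral>\<^sup>+x. ennreal_powr (\<rho> x) p \<partial>lebesgue_on Z) < top"
     "\<And>l \<gamma>. (l, \<gamma>) \<in> curves Z \<Longrightarrow> curve_integral l \<gamma> \<rho> < top \<Longrightarrow> upper_gradient_ineq w m l \<gamma>"
    using wk unfolding weak_upper_gradient_def almost_every_curve_iff[OF p] by blast
  have mZ: "m \<in> borel_measurable (restrict_space borel Z)" by (rule measurable_restrict_space1[OF m(1)])
  define g where "g = (\<lambda>x. m x + \<rho> x)"
  have gm: "g \<in> borel_measurable (restrict_space borel Z)" unfolding g_def using mZ \<rho>(1) by measurable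
  have ge: "(\<integral>\<^sup>+x. ennreal_powr (g x) p \<partial>lebesgue_on Z) < top"
    unfolding g_def by (intro energy_add_finite p borel_on_imp_lebesgue_on mZ \<rho> m(2))
  have "upper_gradient_ineq (restrict w Z) g l \<gamma>" if c: "(l, \<gamma>) \<in> curves Z" for l \<gamma>
  proof (cases "curve_integral l \<gamma> \<rho> < top")
    case True
    have "curve_integral l \<gamma> m \<le> curve_integral l \<gamma> g"
      unfolding curve_integral_def g_def by (intro nn_integral_mono) auto
    with \<rho>(3)[OF c True] have "upper_gradient_ineq w g l \<gamma>" by (rule upper_gradient_ineq_mono)
    then show ?thesis using upper_gradient_ineq_cong[OF c, of "restrict w Z" w g] by simp
  next
    case False
    have "curve_integral l \<gamma> \<rho> \<le> curve_integral l \<gamma> g"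
      unfolding curve_integral_def g_def by (intro nn_integral_mono) auto
    then have "curve_integral l \<gamma> g = top" using False by (simp add: less_top[symmetric] top_unique)
    then show ?thesis by (simp add: upper_gradient_ineq_def)
  qed
  then have "upper_gradient Z (restrict w Z) g" using gm by (auto simp: upper_gradient_def)
  then have "(INF g \<in> {g. upper_gradient Z (restrict w Z) g}. \<integral>\<^sup>+x. ennreal_powr (g x) p \<partial>lebesgue_on Z) \<le> (\<integral>\<^sup>+x. ennreal_powr (g x) p \<partial>lebesgue_on Z)"
    by (intro INF_lower) simp
  also have "\<dots> < top" by (rule ge)
  finally have inf: "(INF g \<in> {g. upper_gradient Z (restrict w Z) g}. \<integral>\<^sup>+x. ennreal_powr (g x) p \<partial>lebesgue_on Z) < top" .
  have "w \<in> borel_measurable (lebesgue_on Z)"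
    using w(1) by (intro measurable_restrict_space1 measurable_completion) simp
  then have "restrict w Z \<in> borel_measurable (lebesgue_on Z)"
    by (subst measurable_cong[of _ _ w]) auto
  moreover have "(\<integral>\<^sup>+x. ennreal_powr (e2ennreal \<bar>restrict w Z x\<bar>) p \<partial>lebesgue_on Z) = (\<integral>\<^sup>+x. ennreal_powr (e2ennreal \<bar>w x\<bar>) p \<partial>lebesgue_on Z)"
    by (intro nn_integral_cong) simp
  ultimately show ?thesis using inf w(2) unfolding newtonian_def by simp
qed

lemma newtonian_real_version:
  assumes p: "1 \<le> p" and Z: "Z \<in> sets lebesgue" and w: "w \<in> newtonian p Z"
  shows "\<exists>u. u \<in> borel_measurable borel \<and> (\<integral>\<^sup>+z. ennreal (\<bar>u z\<bar> powr p) \<partial>lborel) < top \<and>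
     (AE z in lborel. z \<in> Z \<longrightarrow> w z = ereal (u z))"
proof -
  have wm: "w \<in> borel_measurable (lebesgue_on Z)" and we: "(\<integral>\<^sup>+x. ennreal_powr (e2ennreal \<bar>w x\<bar>) p \<partial>lebesgue_on Z) < top"
    using w by (auto simp: newtonian_def)
  have "(\<lambda>z. real_of_ereal (w z)) \<in> borel_measurable (lebesgue_on Z)" using wm by measurable
  then have "(\<lambda>z. indicator Z z *\<^sub>R real_of_ereal (w z)) \<in> borel_measurable lebesgue"
    using Z by (subst (asm) borel_measurable_restrict_space_iff) auto
  then obtain u where u: "u \<in> borel_measurable lborel" "AE z in lborel. indicator Z z *\<^sub>R real_of_ereal (w z) = u z"
    using completion_ex_borel_measurable_real by blast
  have "AE x in lebesgue_on Z. ennreal_powr (e2ennreal \<bar>w x\<bar>) p \<noteq> top"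
    using we wm by (intro nn_integral_PInf_AE[unfolded infinity_ennreal_def]) auto
  then have "AE x in lebesgue. x \<in> Z \<longrightarrow> ennreal_powr (e2ennreal \<bar>w x\<bar>) p \<noteq> top"
    using Z by (subst (asm) AE_restrict_space_iff) auto
  then have fin: "AE x in lborel. x \<in> Z \<longrightarrow> ennreal_powr (e2ennreal \<bar>w x\<bar>) p \<noteq> top"
    unfolding AE_completion_iff .
  have wu: "AE z in lborel. z \<in> Z \<longrightarrow> w z = ereal (u z)"
    using u(2) fin
  proof eventually_elim
    case (elim z)
    show ?case using elim by (cases "w z") auto
  qed
  have "(\<integral>\<^sup>+z. ennreal (\<bar>u z\<bar> powr p) \<partial>lborel) = (\<integral>\<^sup>+z. ennreal_powr (e2ennreal \<bar>w z\<bar>) p * indicator Z z \<partial>lborel)"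
  proof (rule nn_integral_cong_AE)
    show "AE z in lborel. ennreal (\<bar>u z\<bar> powr p) = ennreal_powr (e2ennreal \<bar>w z\<bar>) p * indicator Z z"
      using u(2) wu
    proof eventually_elim
      case (elim z)
      show ?case
      proof (cases "z \<in> Z")
        case True
        then show ?thesis using elim by (simp add: e2ennreal_ereal ennreal_powr_ennreal)
      next
        case False
        then show ?thesis using elim by simp
      qed
    qed
  qed
  also have "\<dots> < top" using we energy_lebesgue_on[OF Z] by simp
  finally show ?thesis using u(1) wu by (intro exI[of _ u]) simp
qed

text \<open>Along a curve on which both upper gradients are integrable the two functions are finite and
  continuous. Since they agree at almost all parameters, they agree at all.\<close>

lemma newtonian_agree_on_curve:
  assumes c: "(l, \<gamma>) \<in> curves Z" and f: "upper_gradient Z v f" and g: "upper_gradient Z w g"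
    and fin: "curve_integral l \<gamma> (\<lambda>z. f z + g z) < top"
    and ae: "AE t in lebesgue_on {0..l}. v (\<gamma> t) = w (\<gamma> t)" and x: "x \<in> {0..l}"
  shows "v (\<gamma> x) = w (\<gamma> x)"
proof -
  have l: "0 < l" using c by (simp add: curves_def)
  have fm: "f \<in> borel_measurable (restrict_space borel Z)" "g \<in> borel_measurable (restrict_space borel Z)"
    using f g by (simp_all add: upper_gradient_def)
  define h where "h t = (f (\<gamma> t) + g (\<gamma> t)) * indicator {0..l} t" for t
  have hm: "h \<in> borel_measurable lebesgue" unfolding h_def
    by (rule borel_measurable_restrict_space_iff_ennreal[THEN iffD1, OF _ curve_measurable[OF c, of "\<lambda>z. f z + g z"]])
       (use fm in \<open>auto intro: borel_measurable_add\<close>)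
  have hfin: "(\<integral>\<^sup>+t. h t \<partial>lebesgue) < top" using fin unfolding curve_integral_eq h_def .
  (* The functions vary by at most the integral of h between x and a nearby parameter at which they
     agree, and this integral is small. *)
  define J where "J n = {x - 1 / real (Suc n)..x + 1 / real (Suc n)}" for n
  have lim: "(\<lambda>n. \<integral>\<^sup>+t\<in>J n. h t \<partial>lebesgue) \<longlonglongrightarrow> (\<integral>\<^sup>+t. 0 \<partial>(lebesgue :: real measure))"
  proof (rule nn_integral_dominated_convergence[where w=h])
    show "AE t in lebesgue. (\<lambda>n. h t * indicator (J n) t) \<longlonglongrightarrow> 0"
    proof -
      have "AE t in lebesgue. t \<noteq> x" unfolding AE_completion_iff by (rule AE_lborel_singleton)
      then show ?thesis
      proof eventually_elim
        case (elim t)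
        then have "0 < \<bar>t - x\<bar>" by simp
        then obtain N where N: "1 / real (Suc N) < \<bar>t - x\<bar>" using nat_approx_posE by blast
        have "h t * indicator (J n) t = 0" if "N \<le> n" for n
        proof -
          have "1 / real (Suc n) \<le> 1 / real (Suc N)" using that by (intro divide_left_mono) auto
          then have "t \<notin> J n" using N unfolding J_def by (auto simp: abs_if split: if_splits)
          then show ?thesis by simp
        qed
        then have "\<forall>\<^sub>F n in sequentially. h t * indicator (J n) t = 0" unfolding eventually_sequentially by blast
        then show ?case by (rule tendsto_eventually)
      qed
    qed
    show "(\<lambda>t. h t * indicator (J n) t) \<in> borel_measurable lebesgue" for n
      using hm by (rule borel_measurable_times_ennreal[OF _ borel_measurable_indicator]) (simp add: J_def)
    show "AE t in lebesgue. h t * indicator (J n) t \<le> h t" for n by (rule AE_I2) (auto simp: indicator_def)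
  qed (use hm hfin in auto)
  have near: "\<exists>t\<in>{0..l}. t \<in> J n \<and> t \<noteq> x \<and> v (\<gamma> t) = w (\<gamma> t)" for n
  proof (rule ccontr)
    assume n: "\<not> ?thesis"
    define d where "d = 1 / real (Suc n)"
    define lo where "lo = max 0 (x - d)"
    define hi where "hi = min l (x + d)"
    have "0 < d" by (simp add: d_def)
    then have lohi: "lo < hi" using x l unfolding lo_def hi_def by auto
    have "AE t in lebesgue. t \<in> {0..l} \<longrightarrow> v (\<gamma> t) = w (\<gamma> t)"
      using ae by (subst (asm) AE_restrict_space_iff) auto
    moreover have "AE t in lebesgue. t \<noteq> x" unfolding AE_completion_iff by (rule AE_lborel_singleton)
    ultimately have "AE t in lebesgue. t \<notin> {lo..hi}"
    proof eventually_elim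
      case (elim t)
      show ?case
      proof
        assume t: "t \<in> {lo..hi}"
        then have "t \<in> {0..l}" "t \<in> J n" by (auto simp: lo_def hi_def J_def d_def)
        then show False using n elim by blast
      qed
    qed
    then have "{lo..hi} \<in> null_sets lebesgue" by (subst AE_iff_null_sets) auto
    then show False using lohi by (simp add: null_sets_def)
  qed
  have sub: "upper_gradient_ineq u k (b - a) (\<lambda>t. \<gamma> (a + t)) \<and>
      curve_integral (b - a) (\<lambda>t. \<gamma> (a + t)) k = (\<integral>\<^sup>+t\<in>{a..b}. k (\<gamma> t) \<partial>lebesgue)"
    if "upper_gradient Z u k" "0 \<le> a" "a < b" "b \<le> l" for u k a b
  proof -
    have km: "k \<in> borel_measurable (restrict_space borel Z)" using that(1) by (simp add: upper_gradient_def)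
    have "(b - a, \<lambda>t. \<gamma> (a + t)) \<in> curves Z" by (rule subcurve[OF c that(2-4)])
    then show ?thesis
      using that(1) curve_integral_subcurve[OF c that(2-4) km] unfolding upper_gradient_def by blast
  qed
  have step: "\<exists>p q. u (\<gamma> a) = ereal p \<and> u (\<gamma> b) = ereal q \<and> ennreal \<bar>p - q\<bar> \<le> (\<integral>\<^sup>+t\<in>J n. k (\<gamma> t) * indicator {0..l} t \<partial>lebesgue)"
    if u: "upper_gradient Z u k" "\<And>t. k (\<gamma> t) \<le> f (\<gamma> t) + g (\<gamma> t)" and ab: "0 \<le> a" "a < b" "b \<le> l" and J: "a \<in> J n" "b \<in> J n" for u k a b n
  proof -
    have s: "upper_gradient_ineq u k (b - a) (\<lambda>t. \<gamma> (a + t))"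
      "curve_integral (b - a) (\<lambda>t. \<gamma> (a + t)) k = (\<integral>\<^sup>+t\<in>{a..b}. k (\<gamma> t) \<partial>lebesgue)"
      using sub[OF u(1) ab] by blast+
    have e: "a + 0 = a" "a + (b - a) = b" by simp_all
    have leJ: "(\<integral>\<^sup>+t\<in>{a..b}. k (\<gamma> t) \<partial>lebesgue) \<le> (\<integral>\<^sup>+t\<in>J n. k (\<gamma> t) * indicator {0..l} t \<partial>lebesgue)"
      using ab J by (intro nn_integral_mono) (auto simp: indicator_def J_def)
    have "(\<integral>\<^sup>+t\<in>J n. k (\<gamma> t) * indicator {0..l} t \<partial>lebesgue) \<le> (\<integral>\<^sup>+t. h t \<partial>lebesgue)"
      using u(2) by (intro nn_integral_mono) (auto simp: indicator_def h_def)
    then have "(\<integral>\<^sup>+t\<in>{a..b}. k (\<gamma> t) \<partial>lebesgue) < top" using leJ hfin by (meson le_less_trans)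
    with s have nf: "\<not> (\<bar>u (\<gamma> a)\<bar> = \<infinity> \<or> \<bar>u (\<gamma> b)\<bar> = \<infinity>)"
      unfolding upper_gradient_ineq_def e by (auto simp: top_unique)
    then obtain p q where pq: "u (\<gamma> a) = ereal p" "u (\<gamma> b) = ereal q" unfolding not_infty_ereal de_Morgan_disj by blast
    have "e2ennreal \<bar>ereal p - ereal q\<bar> \<le> (\<integral>\<^sup>+t\<in>{a..b}. k (\<gamma> t) \<partial>lebesgue)"
      using s unfolding upper_gradient_ineq_def e pq by simp
    then have "ennreal \<bar>p - q\<bar> \<le> (\<integral>\<^sup>+t\<in>{a..b}. k (\<gamma> t) \<partial>lebesgue)" by (simp add: e2ennreal_ereal)
    with leJ pq show ?thesis by (meson order_trans)
  qed
  have both: "\<exists>p q. v (\<gamma> x) = ereal p \<and> w (\<gamma> x) = ereal q \<and> ennreal \<bar>p - q\<bar> \<le> (\<integral>\<^sup>+t\<in>J n. h t \<partial>lebesgue)" for n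
  proof -
    obtain t where t: "t \<in> {0..l}" "t \<in> J n" "t \<noteq> x" "v (\<gamma> t) = w (\<gamma> t)" using near by blast
    have xJ: "x \<in> J n" by (simp add: J_def)
    have V: "\<exists>p q. u (\<gamma> x) = ereal p \<and> u (\<gamma> t) = ereal q \<and> ennreal \<bar>p - q\<bar> \<le> (\<integral>\<^sup>+t\<in>J n. k (\<gamma> t) * indicator {0..l} t \<partial>lebesgue)"
      if u: "upper_gradient Z u k" "\<And>t. k (\<gamma> t) \<le> f (\<gamma> t) + g (\<gamma> t)" for u k
    proof (cases "x < t")
      case True
      show ?thesis by (rule step[OF u _ True _ xJ t(2)]) (use x t(1) in auto)
    next
      case False
      then have "t < x" using t(3) by simp
      have "\<exists>p q. u (\<gamma> t) = ereal p \<and> u (\<gamma> x) = ereal q \<and> ennreal \<bar>p - q\<bar> \<le> (\<integral>\<^sup>+t\<in>J n. k (\<gamma> t) * indicator {0..l} t \<partial>lebesgue)"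
        by (rule step[OF u _ \<open>t < x\<close> _ t(2) xJ]) (use x t(1) in auto)
      then show ?thesis by (metis abs_minus_commute)
    qed
    obtain p q where pq: "v (\<gamma> x) = ereal p" "v (\<gamma> t) = ereal q" "ennreal \<bar>p - q\<bar> \<le> (\<integral>\<^sup>+t\<in>J n. f (\<gamma> t) * indicator {0..l} t \<partial>lebesgue)"
      using V[OF f] by auto
    obtain p' q' where pq': "w (\<gamma> x) = ereal p'" "w (\<gamma> t) = ereal q'" "ennreal \<bar>p' - q'\<bar> \<le> (\<integral>\<^sup>+t\<in>J n. g (\<gamma> t) * indicator {0..l} t \<partial>lebesgue)"
      using V[OF g] by auto
    have qq: "q = q'" using t(4) pq(2) pq'(2) by simp
    have km: "(\<lambda>t. k (\<gamma> t) * indicator {0..l} t * indicator (J n) t) \<in> borel_measurable lebesgue"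
      if "k \<in> borel_measurable (restrict_space borel Z)" for k :: "plane \<Rightarrow> ennreal"
    proof -
      have "(\<lambda>t. k (\<gamma> t) * indicator {0..l} t) \<in> borel_measurable lebesgue"
        by (rule borel_measurable_restrict_space_iff_ennreal[THEN iffD1, OF _ curve_measurable[OF c that]]) auto
      then show ?thesis by (rule borel_measurable_times_ennreal[OF _ borel_measurable_indicator]) (simp add: J_def)
    qed
    have "ennreal \<bar>p - p'\<bar> \<le> ennreal (\<bar>p - q\<bar> + \<bar>p' - q'\<bar>)" unfolding qq by (intro ennreal_leI) (simp add: abs_if)
    also have "\<dots> = ennreal \<bar>p - q\<bar> + ennreal \<bar>p' - q'\<bar>" by simp
    also have "\<dots> \<le> (\<integral>\<^sup>+t\<in>J n. f (\<gamma> t) * indicator {0..l} t \<partial>lebesgue) + (\<integral>\<^sup>+t\<in>J n. g (\<gamma> t) * indicator {0..l} t \<partial>lebesgue)"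
      using pq(3) pq'(3) by (rule add_mono)
    also have "\<dots> = (\<integral>\<^sup>+t. f (\<gamma> t) * indicator {0..l} t * indicator (J n) t + g (\<gamma> t) * indicator {0..l} t * indicator (J n) t \<partial>lebesgue)"
      by (intro nn_integral_add[symmetric] km fm)
    also have "\<dots> = (\<integral>\<^sup>+t\<in>J n. h t \<partial>lebesgue)" by (intro nn_integral_cong) (simp add: h_def distrib_right)
    finally show ?thesis using pq(1) pq'(1) by blast
  qed
  obtain p q where pq: "v (\<gamma> x) = ereal p" "w (\<gamma> x) = ereal q" using both[of 0] by blast
  have "ennreal \<bar>p - q\<bar> \<le> (\<integral>\<^sup>+t\<in>J n. h t \<partial>lebesgue)" for n using both[of n] unfolding pq by auto
  then have "ennreal \<bar>p - q\<bar> \<le> 0" using lim by (intro LIMSEQ_le_const[OF lim[simplified]]) auto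
  then have "p = q" by simp
  then show ?thesis using pq by simp
qed

text \<open>By the preceding lemma, functions that agree almost everywhere agree at all points of almost every
  curve.\<close>

lemma weak_upper_gradient_transfer:
  assumes p: "1 \<le> p" and Z: "Z \<in> sets lebesgue" and v: "v \<in> newtonian p Z" and w: "w \<in> newtonian p Z"
    and eq: "AE x in lebesgue_on Z. v x = w x" and m: "weak_upper_gradient p Z v m"
  shows "weak_upper_gradient p Z w m"
proof -
  obtain f where f: "upper_gradient Z v f" "(\<integral>\<^sup>+x. ennreal_powr (f x) p \<partial>lebesgue_on Z) < top"
    using newtonian_upper_gradient[OF v] by blast
  obtain g where g: "upper_gradient Z w g" "(\<integral>\<^sup>+x. ennreal_powr (g x) p \<partial>lebesgue_on Z) < top"
    using newtonian_upper_gradient[OF w] by blast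
  have fm: "f \<in> borel_measurable (restrict_space borel Z)" "g \<in> borel_measurable (restrict_space borel Z)"
    using f g by (simp_all add: upper_gradient_def)
  have "AE x in lebesgue. x \<in> Z \<longrightarrow> v x = w x" using eq Z by (subst (asm) AE_restrict_space_iff) auto
  then have N: "{x. \<not> (x \<in> Z \<longrightarrow> v x = w x)} \<in> null_sets lebesgue" by (rule null_sets_of_AE_lebesgue)
  have fin: "almost_every_curve p Z (\<lambda>l \<gamma>. curve_integral l \<gamma> (\<lambda>z. f z + g z) < top)"
    unfolding almost_every_curve_iff[OF p]
  proof (intro bexI[of _ "\<lambda>z. f z + g z"] conjI)
    show "(\<integral>\<^sup>+x. ennreal_powr (f x + g x) p \<partial>lebesgue_on Z) < top"
      by (intro energy_add_finite p borel_on_imp_lebesgue_on fm f(2) g(2))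
  qed (use fm in auto)
  have "almost_every_curve p Z (upper_gradient_ineq v m)" using m by (simp add: weak_upper_gradient_def)
  from almost_every_curve_conj[OF p this almost_every_curve_conj[OF p fin almost_every_curve_avoids_null[OF p Z N]]]
  have "almost_every_curve p Z (upper_gradient_ineq w m)"
  proof (rule almost_every_curve_mono[OF p])
    fix l \<gamma> assume c: "(l, \<gamma>) \<in> curves Z"
    assume *: "upper_gradient_ineq v m l \<gamma> \<and> curve_integral l \<gamma> (\<lambda>z. f z + g z) < top \<and>
      (AE t in lebesgue_on {0..l}. \<gamma> t \<notin> {x. \<not> (x \<in> Z \<longrightarrow> v x = w x)})"
    then have "AE t in lebesgue_on {0..l}. \<gamma> t \<notin> {x. \<not> (x \<in> Z \<longrightarrow> v x = w x)}" by blast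
    then have "AE t in lebesgue_on {0..l}. v (\<gamma> t) = w (\<gamma> t)"
      using AE_space by eventually_elim (use c in \<open>auto simp: curves_def image_subset_iff\<close>)
    note agree = newtonian_agree_on_curve[OF c f(1) g(1) _ this]
    have l: "0 \<in> {0..l}" "l \<in> {0..l}" using c by (auto simp: curves_def)
    have ends: "v (\<gamma> 0) = w (\<gamma> 0)" "v (\<gamma> l) = w (\<gamma> l)" using agree l * by blast+
    have "upper_gradient_ineq v m l \<gamma>" using * by blast
    then show "upper_gradient_ineq w m l \<gamma>" unfolding upper_gradient_ineq_def ends .
  qed
  then show ?thesis using m by (simp add: weak_upper_gradient_def)
qed

section \<open>Removability\<close>

text \<open>The least slope bound \<open>m\<close> of \<open>u\<close> in \<open>V\<close> serves both domains. A weak upper gradient on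
  either of them gives a slope bound in an open set, which \<open>m\<close> does not exceed; conversely \<open>m\<close> is
  a weak upper gradient of the good representative in \<open>V\<close>, and so of every Newtonian function
  that agrees with \<open>u\<close> almost everywhere on \<open>V\<close> or on \<open>V - A\<close>.\<close>

lemma common_minimal_gradient:
  fixes u :: "plane \<Rightarrow> real"
  assumes p: "1 \<le> p" and V: "open V" and A: "thin A"
    and u: "u \<in> borel_measurable borel" "(\<integral>\<^sup>+z. ennreal (\<bar>u z\<bar> powr p) \<partial>lborel) < top"
    and W: "W \<in> newtonian p (V - A)" "AE z in lborel. z \<in> V - A \<longrightarrow> W z = ereal (u z)"
  shows "\<exists>m. \<exists>v\<in>newtonian p V. (AE z in lborel. z \<in> V \<longrightarrow> v z = ereal (u z)) \<and>
    (\<forall>Z\<in>{V, V - A}. \<forall>w. (AE z in lborel. z \<in> Z \<longrightarrow> w z = ereal (u z)) \<longrightarrow>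
       (AE z in lborel. z \<in> Z \<longrightarrow> minimal_weak_upper_gradient p Z w z = m z))"
proof -
  have lu: "locally_integrable u" by (rule locally_integrable_of_energy[OF p u])
  have Ab: "A \<in> sets borel" using A by (simp add: thin_def)
  have A0: "A \<in> null_sets lborel" by (rule thin_null[OF A])
  have Vb [measurable]: "V \<in> sets borel" "V - A \<in> sets borel" using V Ab by auto
  have Vl: "V \<in> sets lebesgue" "V - A \<in> sets lebesgue" using Vb by auto
  obtain h where h: "upper_gradient (V - A) W h" "(\<integral>\<^sup>+x. ennreal_powr (h x) p \<partial>lebesgue_on (V - A)) < top"
    using newtonian_upper_gradient[OF W(1)] by blast
  define h0 where "h0 = (\<lambda>z. h z * indicator (V - A) z)"
  have h0m: "h0 \<in> borel_measurable borel" unfolding h0_def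
    by (rule borel_measurable_restrict_space_iff_ennreal[THEN iffD1]) (use Vb h in \<open>auto simp: upper_gradient_def\<close>)
  have "(\<integral>\<^sup>+z. ennreal_powr (h0 z) p \<partial>lborel) = (\<integral>\<^sup>+x. ennreal_powr (h x) p \<partial>lebesgue_on (V - A))"
    unfolding energy_lebesgue_on[OF Vl(2)] by (intro nn_integral_cong) (auto simp: h0_def indicator_def)
  then have h0e: "(\<integral>\<^sup>+z. ennreal_powr (h0 z) p \<partial>lborel) < top" using h(2) by simp
  have sb0: "slope_bound V u h0 v" if v: "v \<in> good_directions" for v
  proof (rule slope_bound_of_weak_upper_gradient[OF p A Vb(2) order_refl V upper_gradient_imp_weak[OF p h(1)] _ _ lu _ v])
    show "integrable_on_compacts V h0" by (rule integrable_on_compacts_of_energy[OF p h0m h0e])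
    show "AE z in lborel. z \<in> V - A \<longrightarrow> h0 z = h z" by (rule AE_I2) (simp add: h0_def)
    show "AE z in lborel. z \<in> V - A \<longrightarrow> u z = real_of_ereal (W z)" using W(2) by eventually_elim auto
  qed
  obtain m0 where m0: "m0 \<in> borel_measurable borel" "(\<integral>\<^sup>+z. ennreal_powr (m0 z) p \<partial>lborel) < top"
      "\<forall>v\<in>good_directions. slope_bound V u m0 v"
    and m0_min: "\<forall>U h. open U \<longrightarrow> U \<subseteq> V \<longrightarrow> integrable_on_compacts U h \<longrightarrow> (\<forall>v\<in>good_directions. slope_bound U u h v) \<longrightarrow>
         (AE z in lborel. z \<in> U \<longrightarrow> m0 z \<le> h z)"
    using minimal_slope_bound[where D = good_directions, OF p V lu h0m h0e sb0] by simp (elim exE conjE)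
  define m where "m = (\<lambda>z. enn2real (m0 z))"
  note [measurable] = m0(1)
  have mm [measurable]: "m \<in> borel_measurable borel" unfolding m_def by measurable
  have "AE z in lborel. ennreal_powr (m0 z) p \<noteq> top"
    using m0(2) by (intro nn_integral_PInf_AE[unfolded infinity_ennreal_def]) auto
  then have mm0: "AE z in lborel. m0 z = ennreal (m z)"
  proof eventually_elim
    case (elim z)
    then have "m0 z < top" using ennreal_powr_less_top_iff[of "m0 z" p] by (simp add: less_top)
    then show ?case by (simp add: m_def)
  qed
  have me': "(\<integral>\<^sup>+z. ennreal_powr (ennreal (m z)) p \<partial>lborel) < top"
  proof -
    have "(\<integral>\<^sup>+z. ennreal_powr (ennreal (m z)) p \<partial>lborel) = (\<integral>\<^sup>+z. ennreal_powr (m0 z) p \<partial>lborel)"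
      using mm0 by (intro nn_integral_cong_AE) (auto elim!: eventually_mono)
    then show ?thesis using m0(2) by simp
  qed
  then have me: "(\<integral>\<^sup>+z. ennreal (m z powr p) \<partial>lborel) < top"
    by (simp add: ennreal_powr_ennreal m_def)
  have sbm: "slope_bound V u (\<lambda>z. ennreal (m z)) v" if "v \<in> good_directions" for v
    by (rule slope_bound_cong[of V u m0]) (use m0(3) that mm0 in \<open>auto elim!: eventually_mono\<close>)
  have mnn: "0 \<le> m z" for z by (simp add: m_def)
  obtain v0 where v0: "v0 \<in> borel_measurable borel" "AE z in lborel. v0 z = ereal (u z)"
      "weak_upper_gradient p V v0 (\<lambda>z. ennreal (m z))"
    using good_representative[OF p V u mm mnn me sbm] by simp (elim bexE conjE)
  define M where "M = (\<lambda>z. ennreal (m z))"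
  have Mb: "M \<in> borel_measurable borel" unfolding M_def by measurable
  have Me: "(\<integral>\<^sup>+x. ennreal_powr (M x) p \<partial>lebesgue_on Z) < top" if "Z \<in> sets lebesgue" for Z
  proof -
    have "(\<integral>\<^sup>+x. ennreal_powr (M x) p \<partial>lebesgue_on Z) \<le> (\<integral>\<^sup>+x. ennreal_powr (M x) p \<partial>lborel)"
      unfolding energy_lebesgue_on[OF that] by (intro nn_integral_mono) (auto simp: indicator_def)
    then show ?thesis using me' unfolding M_def by (rule le_less_trans)
  qed
  have on_Z: "Z \<subseteq> V \<and> V - A \<subseteq> Z \<and> Z \<in> sets borel \<and> Z \<in> sets lebesgue" if "Z \<in> {V, V - A}" for Z
    using that Vb Vl by auto
  have rep: "restrict v0 Z \<in> newtonian p Z \<and> weak_upper_gradient p Z (restrict v0 Z) M" if Z: "Z \<in> {V, V - A}" for Z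
  proof
    note Z' = on_Z[OF Z]
    have wk: "weak_upper_gradient p Z v0 M"
      by (rule weak_upper_gradient_restrict[OF p _ _ Vl(1), of _ v0]) (use Z' v0(3) in \<open>auto simp: M_def\<close>)
    then show "weak_upper_gradient p Z (restrict v0 Z) M"
      by (rule weak_upper_gradient_restrict[OF p order_refl, rotated 2]) (use Z' in auto)
    show "restrict v0 Z \<in> newtonian p Z"
    proof (rule newtonian_of_weak_upper_gradient[OF p v0(1) _ Mb Me wk])
      have "(\<integral>\<^sup>+x. ennreal_powr (e2ennreal \<bar>v0 x\<bar>) p \<partial>lebesgue_on Z) \<le> (\<integral>\<^sup>+x. ennreal_powr (e2ennreal \<bar>v0 x\<bar>) p \<partial>lborel)"
        using Z' by (subst energy_lebesgue_on) (auto simp: indicator_def intro!: nn_integral_mono)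
      also have "\<dots> = (\<integral>\<^sup>+z. ennreal (\<bar>u z\<bar> powr p) \<partial>lborel)"
        using v0(2) by (intro nn_integral_cong_AE) (auto elim!: eventually_mono simp: e2ennreal_ereal ennreal_powr_ennreal)
      finally show "(\<integral>\<^sup>+x. ennreal_powr (e2ennreal \<bar>v0 x\<bar>) p \<partial>lebesgue_on Z) < top" using u(2) by (rule le_less_trans)
    qed (use Z' in blast)
  qed
  have repu: "AE z in lborel. z \<in> Z \<longrightarrow> restrict v0 Z z = ereal (u z)" for Z
    using v0(2) by eventually_elim auto
  have MLp: "M \<in> Lp_loc p Z" if Z: "Z \<in> {V, V - A}" for Z
  proof -
    note Z' = on_Z[OF Z]
    have "(\<integral>\<^sup>+y. ennreal_powr (M y) p \<partial>lebesgue_on (Z \<inter> ball x 1)) < \<infinity>" for x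
      using Me[of "Z \<inter> ball x 1"] Z' by (simp add: sets.Int)
    moreover have "M \<in> borel_measurable (lebesgue_on Z)"
      by (intro borel_on_imp_lebesgue_on measurable_restrict_space1 Mb)
    ultimately show ?thesis unfolding Lp_loc_def by (auto intro: exI[of _ 1])
  qed
  (* M is minimal for every Newtonian function with the given values, on either domain. *)
  have minimal: "is_minimal_weak_upper_gradient p Z w M"
    if Z: "Z \<in> {V, V - A}" and w: "w \<in> newtonian p Z" "AE z in lborel. z \<in> Z \<longrightarrow> w z = ereal (u z)" for Z w
  proof -
    note Z' = on_Z[OF Z]
    have eq: "AE z in lebesgue_on Z. restrict v0 Z z = w z"
    proof -
      have "AE z in lebesgue. z \<in> Z \<longrightarrow> restrict v0 Z z = w z"
        unfolding AE_completion_iff using repu[of Z] w(2) by eventually_elim simp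
      then show ?thesis using Z' by (subst AE_restrict_space_iff) auto
    qed
    have wk: "weak_upper_gradient p Z w M"
      using weak_upper_gradient_transfer[OF p _ _ w(1) eq] rep[OF Z] Z' by blast
    have "AE z in lebesgue_on Z. M z \<le> k z" if k: "k \<in> Lp_loc p Z" "weak_upper_gradient p Z w k" for k
    proof -
      have uw: "AE z in lborel. z \<in> Z \<longrightarrow> u z = real_of_ereal (w z)" using w(2) by eventually_elim auto
      have "\<exists>U h'. open U \<and> Z \<subseteq> U \<and> U \<subseteq> V \<and> integrable_on_compacts U h' \<and>
          (AE z in lborel. z \<in> Z \<longrightarrow> h' z = k z) \<and> (\<forall>v\<in>good_directions. slope_bound U u h' v)"
        by (rule slope_bound_of_local_weak_upper_gradient[OF p V A _ _ _ k lu uw]) (use Z' in blast)+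
      then obtain U h' where U: "open U" "Z \<subseteq> U" "U \<subseteq> V" "integrable_on_compacts U h'"
          "AE z in lborel. z \<in> Z \<longrightarrow> h' z = k z" "\<forall>v\<in>good_directions. slope_bound U u h' v"
        by (elim exE conjE)
      have "AE z in lborel. z \<in> U \<longrightarrow> m0 z \<le> h' z" using m0_min U by blast
      then have "AE z in lborel. z \<in> Z \<longrightarrow> M z \<le> k z"
        using U(5) mm0 by eventually_elim (use U(2) in \<open>auto simp: M_def\<close>)
      then have "AE z in lebesgue. z \<in> Z \<longrightarrow> M z \<le> k z" unfolding AE_completion_iff .
      then show ?thesis using Z' by (subst AE_restrict_space_iff) auto
    qed
    then show ?thesis using MLp[OF Z] wk unfolding is_minimal_weak_upper_gradient_def by blast
  qed
  have chosen: "AE z in lborel. z \<in> Z \<longrightarrow> minimal_weak_upper_gradient p Z w z = M z"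
    if Z: "Z \<in> {V, V - A}" and w: "AE z in lborel. z \<in> Z \<longrightarrow> w z = ereal (u z)" for Z w
  proof -
    note Z' = on_Z[OF Z]
    have Zl: "Z \<inter> space lebesgue \<in> sets lebesgue" using Z' by simp
    (* The operator picks some minimal weak upper gradient of some representative. Two minimal ones
       of the same representative agree almost everywhere. *)
    define P where "P g \<longleftrightarrow> (\<exists>v \<in> newtonian p Z. (AE x in lebesgue_on Z. w x = v x) \<and> is_minimal_weak_upper_gradient p Z v g)" for g
    have "AE z in lebesgue. z \<in> Z \<longrightarrow> w z = restrict v0 Z z"
      unfolding AE_completion_iff using repu[of Z] w by eventually_elim simp
    then have "AE x in lebesgue_on Z. w x = restrict v0 Z x" unfolding AE_restrict_space_iff[OF Zl] .
    then have "P M" unfolding P_def using rep[OF Z] minimal[OF Z _ repu] by blast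
    then have "P (SOME g. P g)" by (rule someI[of P])
    then have "P (minimal_weak_upper_gradient p Z w)" unfolding minimal_weak_upper_gradient_def P_def .
    then obtain v where v: "v \<in> newtonian p Z" "AE x in lebesgue_on Z. w x = v x"
        "is_minimal_weak_upper_gradient p Z v (minimal_weak_upper_gradient p Z w)" unfolding P_def by (elim bexE conjE)
    have "AE x in lborel. x \<in> Z \<longrightarrow> w x = v x"
      using v(2) unfolding AE_restrict_space_iff[OF Zl] AE_completion_iff .
    then have vu: "AE x in lborel. x \<in> Z \<longrightarrow> v x = ereal (u x)" using w by eventually_elim simp
    have vM: "is_minimal_weak_upper_gradient p Z v M" by (rule minimal[OF Z v(1) vu])
    have "AE x in lebesgue_on Z. minimal_weak_upper_gradient p Z w x \<le> M x"
      using v(3) vM unfolding is_minimal_weak_upper_gradient_def by blast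
    moreover have "AE x in lebesgue_on Z. M x \<le> minimal_weak_upper_gradient p Z w x"
      using v(3) vM unfolding is_minimal_weak_upper_gradient_def by blast
    ultimately have "AE x in lebesgue_on Z. minimal_weak_upper_gradient p Z w x = M x"
      by eventually_elim simp
    then show ?thesis unfolding AE_restrict_space_iff[OF Zl] AE_completion_iff .
  qed
  show ?thesis
    using rep[of V] repu[of V] chosen by (intro exI[of _ M] bexI[of _ "restrict v0 V"]) auto
qed

text \<open>Functions on the smaller domain are extended by the good representative, and the values on the
  null set \<open>A\<close> are immaterial. The gradients agree because both are the common one.\<close>

lemma thin_removable:
  assumes p: "1 \<le> p" and V: "open V" and A: "thin A"
  shows "isometrically_removable p (A \<inter> V) (V - A)"
proof -
  have Ab: "A \<in> sets borel" using A by (simp add: thin_def)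
  have A0: "A \<in> null_sets lborel" by (rule thin_null[OF A])
  define W where "W = V - A"
  have Vl: "V \<in> sets lebesgue" "W \<in> sets lebesgue" "W \<subseteq> V" using V Ab by (auto simp: W_def)
  have sp: "V \<inter> space lebesgue \<in> sets lebesgue" "W \<inter> space lebesgue \<in> sets lebesgue" using Vl by simp_all
  have un: "W \<union> (A \<inter> V) = V" by (auto simp: W_def)
  have AE_on: "(AE x in lebesgue_on V. P x) \<longleftrightarrow> (AE x in lborel. x \<in> V \<longrightarrow> P x)"
     "(AE x in lebesgue_on W. P x) \<longleftrightarrow> (AE x in lborel. x \<in> W \<longrightarrow> P x)" for P
    unfolding AE_restrict_space_iff[OF sp(1)] AE_restrict_space_iff[OF sp(2)] AE_completion_iff by simp_all
  have restr: "restrict u W \<in> newtonian_hat p W" if u: "u \<in> newtonian_hat p V" for u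
  proof -
    obtain v where v: "v \<in> newtonian p V" "AE x in lebesgue_on V. u x = v x" using u by (auto simp: newtonian_hat_def)
    have "restrict v W \<in> newtonian p W" by (rule newtonian_restrict[OF Vl(3,2,1) v(1)])
    moreover have "AE x in lebesgue_on W. restrict u W x = restrict v W x"
      unfolding AE_on using v(2)[unfolded AE_on] by eventually_elim (use Vl(3) in auto)
    ultimately have "\<exists>w\<in>newtonian p W. AE x in lebesgue_on W. restrict u W x = w x" by blast
    then show ?thesis unfolding newtonian_hat_def using restrict_extensional by blast
  qed
  have ext: "\<exists>u'\<in>newtonian_hat p V. u = restrict u' W" if u: "u \<in> newtonian_hat p W" for u
  proof -
    obtain w where w: "w \<in> newtonian p W" "AE x in lebesgue_on W. u x = w x" and ue: "u \<in> extensional W"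
      using u by (auto simp: newtonian_hat_def)
    obtain f where f: "f \<in> borel_measurable borel" "(\<integral>\<^sup>+z. ennreal (\<bar>f z\<bar> powr p) \<partial>lborel) < top"
        "AE z in lborel. z \<in> W \<longrightarrow> w z = ereal (f z)"
      using newtonian_real_version[OF p Vl(2) w(1)] by (elim exE conjE)
    obtain v where v: "v \<in> newtonian p V" "AE z in lborel. z \<in> V \<longrightarrow> v z = ereal (f z)"
      using common_minimal_gradient[OF p V A f(1,2) w(1)[unfolded W_def] f(3)[unfolded W_def]] by (elim exE bexE conjE)
    define u' where "u' = restrict (\<lambda>x. if x \<in> W then u x else v x) V"
    have "AE x in lborel. x \<in> V \<longrightarrow> u' x = v x"
      using w(2)[unfolded AE_on] f(3) v(2) by eventually_elim (auto simp: u'_def)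
    then have "AE x in lebesgue_on V. u' x = v x" unfolding AE_on .
    moreover have "u' \<in> extensional V" unfolding u'_def by (rule restrict_extensional)
    ultimately have "u' \<in> newtonian_hat p V" using v(1) unfolding newtonian_hat_def by blast
    moreover have "u = restrict u' W"
    proof
      fix x show "u x = restrict u' W x"
      proof (cases "x \<in> W")
        case True
        then show ?thesis using Vl(3) by (auto simp: u'_def)
      next
        case False
        then show ?thesis using extensional_arb[OF ue False] by simp
      qed
    qed
    ultimately show ?thesis by blast
  qed
  have grad: "AE x in lebesgue_on W. minimal_weak_upper_gradient p W (restrict u W) x = minimal_weak_upper_gradient p V u x"
    if u: "u \<in> newtonian_hat p V" for u
  proof -
    obtain v where v: "v \<in> newtonian p V" "AE x in lebesgue_on V. u x = v x" using u by (auto simp: newtonian_hat_def)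
    have vW: "restrict v W \<in> newtonian p W" by (rule newtonian_restrict[OF Vl(3,2,1) v(1)])
    obtain f where f: "f \<in> borel_measurable borel" "(\<integral>\<^sup>+z. ennreal (\<bar>f z\<bar> powr p) \<partial>lborel) < top"
        "AE z in lborel. z \<in> V \<longrightarrow> v z = ereal (f z)"
      using newtonian_real_version[OF p Vl(1) v(1)] by (elim exE conjE)
    have vf: "AE z in lborel. z \<in> W \<longrightarrow> restrict v W z = ereal (f z)"
      using f(3) by eventually_elim (use Vl(3) in auto)
    obtain m where m: "\<forall>Z\<in>{V, W}. \<forall>w. (AE z in lborel. z \<in> Z \<longrightarrow> w z = ereal (f z)) \<longrightarrow>
       (AE z in lborel. z \<in> Z \<longrightarrow> minimal_weak_upper_gradient p Z w z = m z)"
      using common_minimal_gradient[OF p V A f(1,2) vW[unfolded W_def] vf[unfolded W_def]]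
      unfolding W_def[symmetric] by (elim exE bexE conjE)
    have uf: "AE z in lborel. z \<in> V \<longrightarrow> u z = ereal (f z)"
      using v(2)[unfolded AE_on] f(3) by eventually_elim auto
    have uW: "AE z in lborel. z \<in> W \<longrightarrow> restrict u W z = ereal (f z)"
      using uf by eventually_elim (use Vl(3) in auto)
    have "AE z in lborel. z \<in> V \<longrightarrow> minimal_weak_upper_gradient p V u z = m z" using m uf by blast
    moreover have "AE z in lborel. z \<in> W \<longrightarrow> minimal_weak_upper_gradient p W (restrict u W) z = m z" using m uW by blast
    ultimately show ?thesis unfolding AE_on by eventually_elim (use Vl(3) in auto)
  qed
  have "newtonian_hat p W = (\<lambda>u. restrict u W) ` newtonian_hat p V"
    using restr ext by blast
  then show ?thesis
    unfolding isometrically_removable_def W_def[symmetric] un using grad by (auto simp: W_def)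
qed

theorem theorem6p1:
  fixes p :: real and q :: "nat \<Rightarrow> real \<times> real"
    and A X \<Omega> \<Omega>' :: "(real \<times> real) set"
  assumes "1 \<le> p"
    and "bij_betw q {1..} (\<rat> \<times> \<rat>)"
    and "A = (\<Union>j\<in>{1..}. (\<lambda>x. q j + x) ` four_corners_cantor_set)"
    and "X = UNIV - A"
    and "open \<Omega>'" and "\<Omega>' \<noteq> {}"
    and "\<Omega> = \<Omega>' \<inter> X"
  shows "isometrically_removable p (A \<inter> \<Omega>') \<Omega> \<and>
    supports_global_1_Poincare X \<and>
    \<not> path_almost_open p UNIV \<Omega>"
proof -
  have A: "thin A" unfolding assms(3) by (rule thin_translates)
  have \<Omega>: "\<Omega> = \<Omega>' - A" using assms(4,7) by blast
  have "isometrically_removable p (A \<inter> \<Omega>') \<Omega>"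
    unfolding \<Omega> by (rule thin_removable[OF assms(1,5) A])
  moreover have "supports_global_1_Poincare X"
    unfolding assms(4) by (rule thin_supports_Poincare[OF A])
  moreover have "\<not> path_almost_open p UNIV \<Omega>"
    unfolding \<Omega>
  proof (rule not_path_almost_open_of_dense_on_lines[OF assms(1) thin_null[OF A] assms(5,6)])
    show "norm (2 / sqrt 5 :: real, - 1 / sqrt 5 :: real) = 1"
      by (simp add: norm_prod_def power_divide)
    show "\<exists>t. \<bar>t\<bar> < \<eta> \<and> z + t *\<^sub>R (2 / sqrt 5, - 1 / sqrt 5) \<in> A" if "0 < \<eta>" for z \<eta>
      unfolding assms(3) by (rule removed_set_dense_on_line[OF assms(2) that])
  qed
  ultimately show ?thesis by blast
qed

end
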